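(* For any SIRSN, each of the following properties is equivalent to the unique singly-infinite geodesics property ($G=1$ almost surely): (a) $\mathbb P(B_{1,2}=\mathbf 0)=0$; (b) $\mathbb P(B(1)=\mathbf 0)=0$; (c) $\mathbb P(B(1,r)=\mathbf 0)=0$ for each $0<r<\infty$; (d) $\mathbb P(B_1(\infty)=\mathbf 0)=0$; (e) $\lim_{B\uparrow\infty}\lim_{\lambda\to\infty}Q(\lambda,0,B)=0$.
   Context: $\mathbf 0$ is the origin of $\mathbb{R}^2$, $\mathbf 1=(1,0)$, $\mathrm{disc}(z,r)$ is the closed disc, $\mathrm{len}$ is length, $\sigma_c(z)=cz$. A (feasible) route $\mathsf r(z,z')$ is a non-self-intersecting path from $z$ to $z'$ made of straight line segments between successive points $(z_i)$, with finite, semi-infinite or doubly infinite index set (with $z_i\to z$ as $i\to-\infty$, $z_i\to z'$ as $i\to\infty$ in the infinite directions), of finite total length; $\mathsf r(z',z)$ is the reversal of $\mathsf r(z,z')$. Routes are pairwise compatible if whenever two routes meet at two points they coincide on the subroute between these points. A feasible subnetwork on a locally finite configuration $(z_i)$ is the union $\mathsf s$ of pairwise compatible routes $\mathsf r(z_i,z_j)$, one for each pair (with marks recording which edges are in which routes), with $\mathrm{len}(\mathsf s\cap \mathrm{disc}(\mathbf 0,r))<\infty$ for all $r<\infty$. A process of random routes $\mathcal R(z_1,z_2)$, $z_1,z_2\in\mathbb R^2$, is specified by its finite-dimensional distributions: for each finite set $z_1,\dots,z_k$, the distribution $\mu_{z_1,\dots,z_k}$ of the random feasible subnetwork $\mathrm{span}(z_1,\dots,z_k)$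 formed by the routes $\mathcal R(z_i,z_j)$. These are required to be consistent, invariant under translation and rotation, invariant under scaling (the image of $\mathrm{span}(z_1,\dots,z_k)$ under $\sigma_c$ is distributed as $\mathrm{span}(cz_1,\dots,cz_k)$, for all $c>0$), and with $(z_1,\dots,z_k)\mapsto\mu_{z_1,\dots,z_k}$ measurable. Let $(\Xi(\lambda),0<\lambda<\infty)$ be the positions of the points arriving during time $[0,\lambda]$ in a rate-one space-time Poisson point process on $\mathbb R^2\times[0,\infty)$, independent of the routes, and let $\mathcal S(\lambda)$ be the subnetwork on $\Xi(\lambda)$ consisting of the routes $\mathcal R(\xi,\xi')$, $\xi,\xi'\in\Xi(\lambda)$. The edge-intensity of a translation-invariant random edge process $\mathcal E$ is the $\iota\in[0,\infty]$ with $\mathbb E\,\mathrm{len}(\mathcal E\cap A)=\iota\cdot\mathrm{area}(A)$. Put $D_1=\mathrm{len}\,\mathcal R(\mathbf 0,\mathbf 1)$, $\mathcal E(\lambda,r)=\bigcup_{\xi,\xi'\in\Xi(\lambda)}\mathcal R(\xi,\xi')\setminus(\mathrm{disc}(\xi,r)\cup\mathrm{disc}(\xi',r))$, $p(\lambda,r)=$ edge-intensity of $\mathcal E(\lambda,r)$, $p(r)=\lim_{\lambda\to\infty}p(\lambda,r)$. The process is a SIRSN if its finite-dimensional distributions are distributions of random feasible subnetworks which are consistent, invariant under translation, rotation and scaling, and depend measurably on $(z_1,\dots,z_k)$, and moreover $1<\mathbb E D_1<\infty$ and $p(1)<\infty$ (this implies that the edge-intensity of $\mathcal S(1)$ is finite).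 Let $\mathcal S^*(\lambda)$ be the subnetwork obtained from $\mathcal S(\lambda)$ by adding the point $\mathbf 0$ and the routes $\mathcal R(\mathbf 0,\xi)$, $\xi\in\Xi(\lambda)$. A singly infinite geodesic in $\mathcal S^*(\lambda)$ from $\mathbf 0$ is an infinite path starting from $\mathbf 0$ such that any finite portion of it is a subroute of $\mathcal R(\mathbf 0,\xi)$ for some $\xi\in\Xi(\lambda)$. The number of singly infinite geodesics in $\mathcal S^*(\lambda)$ from $\mathbf 0$ is nondecreasing in $\lambda$; $G$ denotes its limit as $\lambda\to\infty$ (an almost surely finite random variable). By compatibility, the intersection of a family of routes from $\mathbf 0$ is a subroute from $\mathbf 0$ to some point, called the branchpoint of the family (equal to $\mathbf 0$ if the intersection is just $\{\mathbf 0\}$). - $B_{1,2}$ is the branchpoint of $\mathcal R(\mathbf 0,U_1)$ and $\mathcal R(\mathbf 0,U_2)$, where $U_1,U_2$ are independent uniform on $\mathrm{disc}(\mathbf 0,1)$, independent of the routes. - $B(1)$ is the branchpoint of all routes $\mathcal R(\mathbf 0,\xi)$, $\xi\in\Xi(1)$. - $B(1,r)$ is the branchpoint of the routes $\mathcal R(\mathbf 0,\xi)$, $\xi\in\Xi(1)\cap\mathrm{disc}(\mathbf 0,r)$ (the event $B(1,r)=\mathbf 0$ being considered only when this set of points is non-empty). - For $\lambda<\infty$ let $\tilde\pi(\lambda)$ be the intersection of all routes $\mathcal R(\mathbf 0,\xi)$, $\xi\in\Xi(\lambda)\setminus\mathrm{disc}(\mathbf 0,1)$; $\bigcap_{\lambda<\infty}\tilde\pi(\lambda)$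 is a subroute from $\mathbf 0$ to a point $B_1(\infty)$. - $Q(\lambda,0,B)$ is the probability that the routes $\mathcal R(\mathbf 0,\xi')$ to all points $\xi'\in\Xi(\lambda)$ outside $\mathrm{disc}(\mathbf 0,B)$ do not all first exit $\mathrm{disc}(\mathbf 0,1)$ at the same point. *)

theory Defs
  imports "HOL-Probability.Probability"
begin

text \<open>The plane is \<^typ>\<open>complex\<close>: rotations are multiplications by \<^term>\<open>cis \<theta>\<close>, area is
  \<^term>\<open>lborel :: complex measure\<close>, and the points (0,0), (1,0) are 0 and 1.\<close>

section \<open>Routes and feasible subnetworks\<close>

text \<open>A route is represented by its constant-speed parametrization on \<open>[0,1]\<close>, so that \<open>L\<close> is its
  total length and \<^const>\<open>reversepath\<close> its reversal. The successive vertices are \<open>\<gamma> (\<tau> i)\<close>; as \<open>\<tau>\<close> is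
  only weakly monotone it may be eventually constant in either direction, which gives the
  finite and the semi-infinite index sets.\<close>

definition route :: "(real \<Rightarrow> complex) \<Rightarrow> bool" where
  "route \<gamma> \<longleftrightarrow> arc \<gamma> \<and> \<gamma> \<in> extensional {0..1} \<and>
    (\<exists>(L::real) (\<tau>::int \<Rightarrow> real).
       mono \<tau> \<and> (\<tau> \<longlongrightarrow> 0) at_bot \<and> (\<tau> \<longlongrightarrow> 1) at_top \<and>
       (\<forall>i. \<exists>v. norm v = L \<and> (\<forall>t\<in>{\<tau> i..\<tau> (i + 1)}. \<gamma> t = \<gamma> (\<tau> i) + (t - \<tau> i) *\<^sub>R v)))"

definition compatible :: "(real \<Rightarrow> complex) \<Rightarrow> (real \<Rightarrow> complex) \<Rightarrow> bool" where
  "compatible \<gamma> \<eta> \<longleftrightarrow>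
    (\<forall>s\<in>{0..1}. \<forall>t\<in>{0..1}. \<forall>s'\<in>{0..1}. \<forall>t'\<in>{0..1}.
       \<gamma> s = \<eta> s' \<and> \<gamma> t = \<eta> t' \<longrightarrow>
       path_image (subpath s t \<gamma>) = path_image (subpath s' t' \<eta>))"

definition index_pairs :: "nat \<Rightarrow> (nat \<times> nat) set" where
  "index_pairs k = {(i, j). i < k \<and> j < k \<and> i \<noteq> j}"

text \<open>A subnetwork on \<open>z 0, \<dots>, z (k - 1)\<close> with its marks is the family of its routes
  \<open>r (i, j)\<close> from \<open>z i\<close> to \<open>z j\<close>.\<close>

definition feasible_subnetwork ::
    "nat \<Rightarrow> (nat \<Rightarrow> complex) \<Rightarrow> (nat \<times> nat \<Rightarrow> real \<Rightarrow> complex) \<Rightarrow> bool" where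
  "feasible_subnetwork k z r \<longleftrightarrow>
    (\<forall>(i, j)\<in>index_pairs k. route (r (i, j)) \<and>
        pathstart (r (i, j)) = z i \<and> pathfinish (r (i, j)) = z j \<and>
        r (j, i) = reversepath (r (i, j))) \<and>
    (\<forall>p\<in>index_pairs k. \<forall>q\<in>index_pairs k. compatible (r p) (r q))"

definition route_space :: "(real \<Rightarrow> complex) measure" where
  "route_space = restrict_space (PiM {0..1} (\<lambda>_. borel)) (Collect route)"

definition network_space :: "nat \<Rightarrow> (nat \<times> nat \<Rightarrow> real \<Rightarrow> complex) measure" where
  "network_space k = PiM (index_pairs k) (\<lambda>_. route_space)"

definition positions :: "nat \<Rightarrow> (nat \<Rightarrow> complex) measure" where
  "positions k = restrict_space (PiM {..<k} (\<lambda>_. borel)) {z. inj_on z {..<k}}"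

text \<open>One-dimensional Hausdorff measure.\<close>

definition len :: "complex set \<Rightarrow> ennreal" where
  "len S = (SUP \<delta>\<in>{0<..}. INF C\<in>{C :: nat \<Rightarrow> complex set.
      S \<subseteq> (\<Union>n. C n) \<and> (\<forall>n. bounded (C n) \<and> diameter (C n) \<le> \<delta>)}.
      (\<Sum>n. ennreal (diameter (C n))))"

section \<open>Finite-dimensional distributions\<close>

type_synonym fdds = "nat \<Rightarrow> (nat \<Rightarrow> complex) \<Rightarrow> (nat \<times> nat \<Rightarrow> real \<Rightarrow> complex) measure"

definition consistent_fdds :: "fdds \<Rightarrow> bool" where
  "consistent_fdds \<mu> \<longleftrightarrow>
    (\<forall>m k f. \<forall>z\<in>space (positions k). inj_on f {..<m} \<and> f ` {..<m} \<subseteq> {..<k} \<longrightarrow>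
       distr (\<mu> k z) (network_space m) (\<lambda>r. \<lambda>(i, j)\<in>index_pairs m. r (f i, f j)) =
       \<mu> m (\<lambda>i\<in>{..<m}. z (f i)))"

definition invariant_fdds :: "fdds \<Rightarrow> (complex \<Rightarrow> complex) \<Rightarrow> bool" where
  "invariant_fdds \<mu> g \<longleftrightarrow>
    (\<forall>k. \<forall>z\<in>space (positions k).
       distr (\<mu> k z) (network_space k) (\<lambda>r. \<lambda>p\<in>index_pairs k. \<lambda>t\<in>{0..1}. g (r p t)) =
       \<mu> k (\<lambda>i\<in>{..<k}. g (z i)))"

definition random_routes :: "fdds \<Rightarrow> bool" where
  "random_routes \<mu> \<longleftrightarrow>
    (\<forall>k. \<mu> k \<in> positions k \<rightarrow>\<^sub>M prob_algebra (network_space k)) \<and>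
    (\<forall>k. \<forall>z\<in>space (positions k). AE r in \<mu> k z. feasible_subnetwork k z r) \<and>
    consistent_fdds \<mu> \<and>
    (\<forall>a. invariant_fdds \<mu> (\<lambda>x. x + a)) \<and>
    (\<forall>\<theta>. invariant_fdds \<mu> (\<lambda>x. cis \<theta> * x)) \<and>
    (\<forall>c::real. c > 0 \<longrightarrow> invariant_fdds \<mu> (\<lambda>x. c *\<^sub>R x))"

definition mean_D1 :: "fdds \<Rightarrow> ennreal" where
  "mean_D1 \<mu> =
    (\<integral>\<^sup>+ r. len (path_image (r (0, 1))) \<partial>\<mu> 2 (\<lambda>i\<in>{..<2}. if i = 0 then 0 else 1))"

section \<open>The network sampled at Poisson points\<close>

text \<open>A point process is given by an enumeration \<open>Z \<omega> 0, Z \<omega> 1, \<dots>\<close> of its points.\<close>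

definition poisson_process :: "'w measure \<Rightarrow> 'b measure \<Rightarrow> ('w \<Rightarrow> nat \<Rightarrow> 'b) \<Rightarrow> bool" where
  "poisson_process M \<nu> Z \<longleftrightarrow>
    (\<forall>n. (\<lambda>\<omega>. Z \<omega> n) \<in> M \<rightarrow>\<^sub>M \<nu>) \<and>
    (\<forall>A\<in>sets \<nu>. emeasure \<nu> A < \<infinity> \<longrightarrow> (AE \<omega> in M. finite {n. Z \<omega> n \<in> A})) \<and>
    (\<forall>A\<in>sets \<nu>. 0 < emeasure \<nu> A \<and> emeasure \<nu> A < \<infinity> \<longrightarrow>
       distr M (count_space UNIV) (\<lambda>\<omega>. card {n. Z \<omega> n \<in> A}) =
       measure_pmf (poisson_pmf (measure \<nu> A))) \<and>
    (\<forall>A :: nat \<Rightarrow> 'b set. disjoint_family A \<and> (\<forall>i. A i \<in> sets \<nu> \<and> emeasure \<nu> (A i) < \<infinity>) \<longrightarrow>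
       prob_space.indep_vars M (\<lambda>_. count_space UNIV) (\<lambda>i \<omega>. card {n. Z \<omega> n \<in> A i}) UNIV)"

definition space_time :: "(complex \<times> real) measure" where
  "space_time = restrict_space lborel (UNIV \<times> {0..})"

definition unit_disc_uniform :: "complex measure" where
  "unit_disc_uniform = uniform_measure lborel (cball 0 1)"

definition sample_data_space :: "(complex \<times> complex \<times> (nat \<Rightarrow> complex \<times> real)) measure" where
  "sample_data_space = borel \<Otimes>\<^sub>M (borel \<Otimes>\<^sub>M PiM UNIV (\<lambda>_. space_time))"

text \<open>\<open>Z\<close> is the space-time Poisson process, \<open>U\<close> and \<open>V\<close> are the uniform points, and
  \<open>R \<omega> z z'\<close> is the route from \<open>z\<close> to \<open>z'\<close>, relevant only when \<open>z\<close> and \<open>z'\<close> are distinct sample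
  points, i.e. the origin, \<open>U\<close>, \<open>V\<close> or Poisson points. Since only finite-dimensional distributions
  of the routes are given, independence of the routes and the sample points means that
  conditionally on \<open>(U, V, Z)\<close> the routes between finitely many sample points \<open>X 0, \<dots>, X (k - 1)\<close>
  have distribution \<open>\<mu> k X\<close>; this is the last conjunct.\<close>

definition sampled_routes ::
    "fdds \<Rightarrow> 'w measure \<Rightarrow> ('w \<Rightarrow> complex) \<Rightarrow> ('w \<Rightarrow> complex) \<Rightarrow>
     ('w \<Rightarrow> nat \<Rightarrow> complex \<times> real) \<Rightarrow> ('w \<Rightarrow> complex \<Rightarrow> complex \<Rightarrow> real \<Rightarrow> complex) \<Rightarrow> bool" where
  "sampled_routes \<mu> M U V Z R \<longleftrightarrow>
    prob_space M \<and> U \<in> borel_measurable M \<and> V \<in> borel_measurable M \<and>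
    poisson_process M space_time Z \<and>
    distr M sample_data_space (\<lambda>\<omega>. (U \<omega>, V \<omega>, Z \<omega>)) =
      unit_disc_uniform \<Otimes>\<^sub>M (unit_disc_uniform \<Otimes>\<^sub>M distr M (PiM UNIV (\<lambda>_. space_time)) Z) \<and>
    (\<forall>k X. inj_on X {..<k} \<and>
        X ` {..<k} \<subseteq> {\<lambda>_. 0, U, V} \<union> range (\<lambda>n \<omega>. fst (Z \<omega> n)) \<longrightarrow>
      (let span = (\<lambda>\<omega>. \<lambda>(i, j)\<in>index_pairs k. R \<omega> (X i \<omega>) (X j \<omega>)) in
        span \<in> M \<rightarrow>\<^sub>M network_space k \<and>
        (\<forall>A\<in>sets sample_data_space. \<forall>C\<in>sets (network_space k).
          emeasure M {\<omega>\<in>space M. (U \<omega>, V \<omega>, Z \<omega>) \<in> A \<and> span \<omega> \<in> C} =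
          (\<integral>\<^sup>+ \<omega>. indicator A (U \<omega>, V \<omega>, Z \<omega>) * emeasure (\<mu> k (\<lambda>i\<in>{..<k}. X i \<omega>)) C \<partial>M))))"

text \<open>In the following, \<open>x\<close> is a realization of the space-time process and \<open>\<rho>\<close> one of the routes.\<close>

definition \<Xi> :: "(nat \<Rightarrow> complex \<times> real) \<Rightarrow> real \<Rightarrow> complex set" where
  "\<Xi> x l = {fst (x n) | n. snd (x n) \<le> l}"

definition far_edges ::
    "(nat \<Rightarrow> complex \<times> real) \<Rightarrow> (complex \<Rightarrow> complex \<Rightarrow> real \<Rightarrow> complex) \<Rightarrow> real \<Rightarrow> real \<Rightarrow> complex set"
    where
  "far_edges x \<rho> l r =
    (\<Union>\<xi>\<in>\<Xi> x l. \<Union>\<xi>'\<in>\<Xi> x l - {\<xi>}. path_image (\<rho> \<xi> \<xi>') - (cball \<xi> r \<union> cball \<xi>' r))"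

definition has_edge_intensity :: "'w measure \<Rightarrow> ('w \<Rightarrow> complex set) \<Rightarrow> ennreal \<Rightarrow> bool" where
  "has_edge_intensity M E \<iota> \<longleftrightarrow>
    (\<forall>A\<in>sets borel. (\<integral>\<^sup>+ \<omega>. len (E \<omega> \<inter> A) \<partial>M) = \<iota> * emeasure lborel A)"

text \<open>\<open>p(r) = v\<close>\<close>

definition limit_intensity ::
    "'w measure \<Rightarrow> ('w \<Rightarrow> nat \<Rightarrow> complex \<times> real) \<Rightarrow>
     ('w \<Rightarrow> complex \<Rightarrow> complex \<Rightarrow> real \<Rightarrow> complex) \<Rightarrow> real \<Rightarrow> ennreal \<Rightarrow> bool" where
  "limit_intensity M Z R r v \<longleftrightarrow>
    (\<exists>p. (\<forall>l>0. has_edge_intensity M (\<lambda>\<omega>. far_edges (Z \<omega>) (R \<omega>) l r) (p l)) \<and>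
         (p \<longlongrightarrow> v) at_top)"

text \<open>The distribution of \<open>(Z, R)\<close> on the sample points, and hence the condition \<open>p(1) < \<infinity>\<close>, is
  determined by \<open>\<mu>\<close>; being a SIRSN is thus a property of \<open>\<mu>\<close> alone.\<close>

definition SIRSN ::
    "fdds \<Rightarrow> 'w measure \<Rightarrow> ('w \<Rightarrow> nat \<Rightarrow> complex \<times> real) \<Rightarrow>
     ('w \<Rightarrow> complex \<Rightarrow> complex \<Rightarrow> real \<Rightarrow> complex) \<Rightarrow> bool" where
  "SIRSN \<mu> M Z R \<longleftrightarrow>
    random_routes \<mu> \<and> 1 < mean_D1 \<mu> \<and> mean_D1 \<mu> < \<infinity> \<and>
    (\<exists>v<\<infinity>. limit_intensity M Z R 1 v)"

section \<open>Geodesics, branchpoints and exit points\<close>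

text \<open>Geodesics are counted as subsets of the plane; an infinite path is one of infinite length.\<close>

definition geodesics ::
    "(nat \<Rightarrow> complex \<times> real) \<Rightarrow> (complex \<Rightarrow> complex \<Rightarrow> real \<Rightarrow> complex) \<Rightarrow> real \<Rightarrow> complex set set"
    where
  "geodesics x \<rho> l = {\<gamma> ` {0..} | \<gamma> :: real \<Rightarrow> complex.
     continuous_on {0..} \<gamma> \<and> inj_on \<gamma> {0..} \<and> \<gamma> 0 = 0 \<and> len (\<gamma> ` {0..}) = \<infinity> \<and>
     (\<forall>s t. 0 \<le> s \<and> s \<le> t \<longrightarrow>
        (\<exists>\<xi>\<in>\<Xi> x l. \<exists>u\<in>{0..1}. \<exists>v\<in>{0..1}. \<gamma> ` {s..t} = path_image (subpath u v (\<rho> 0 \<xi>))))}"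

definition G ::
    "(nat \<Rightarrow> complex \<times> real) \<Rightarrow> (complex \<Rightarrow> complex \<Rightarrow> real \<Rightarrow> complex) \<Rightarrow> ennreal" where
  "G x \<rho> = Lim at_top (\<lambda>l. emeasure (count_space UNIV) (geodesics x \<rho> l))"

text \<open>The point \<open>b\<close> such that \<open>S\<close> is a subroute from 0 to \<open>b\<close>.\<close>

definition subroute_end :: "complex set \<Rightarrow> complex" where
  "subroute_end S = (THE b. \<exists>\<gamma> t. route \<gamma> \<and> pathstart \<gamma> = 0 \<and> t \<in> {0..1} \<and>
     S = path_image (subpath 0 t \<gamma>) \<and> b = \<gamma> t)"

definition branchpoint :: "(real \<Rightarrow> complex) set \<Rightarrow> complex" where
  "branchpoint \<Gamma> = subroute_end (\<Inter>\<gamma>\<in>\<Gamma>. path_image \<gamma>)"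

definition B_infty ::
    "(nat \<Rightarrow> complex \<times> real) \<Rightarrow> (complex \<Rightarrow> complex \<Rightarrow> real \<Rightarrow> complex) \<Rightarrow> complex" where
  "B_infty x \<rho> = subroute_end (\<Inter>l\<in>{0<..}. \<Inter>\<xi>\<in>\<Xi> x l - cball 0 1. path_image (\<rho> 0 \<xi>))"

definition first_exit :: "(real \<Rightarrow> complex) \<Rightarrow> complex" where
  "first_exit \<gamma> = \<gamma> (Inf {t\<in>{0..1}. \<gamma> t \<notin> cball 0 1})"

definition Q ::
    "'w measure \<Rightarrow> ('w \<Rightarrow> nat \<Rightarrow> complex \<times> real) \<Rightarrow>
     ('w \<Rightarrow> complex \<Rightarrow> complex \<Rightarrow> real \<Rightarrow> complex) \<Rightarrow> real \<Rightarrow> real \<Rightarrow> real" where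
  "Q M Z R l B = measure M {\<omega>\<in>space M.
     \<not> (\<exists>e. \<forall>\<xi>\<in>\<Xi> (Z \<omega>) l - cball 0 B. first_exit (R \<omega> 0 \<xi>) = e)}"

end

theory Submission
  imports Defs
begin

text \<open>
  All properties are equivalent to \<open>generic_join\<close>: for almost every pair of points, the routes to
  them from the origin a.s. share a nontrivial initial segment.

  The routes from the origin form a tree. Routes that leave a disc around their starting point at
  \<open>j\<close> different points are disjoint from then on and so have total length of order \<open>j\<close> in an
  annulus outside the disc; as \<open>p(1) < \<infinity>\<close>, Fubini and scaling show that the routes from the origin
  to the points outside \<open>disc(0, 3 r)\<close> a.s. leave \<open>disc(0, r)\<close> at finitely many points only. If
  any two generic routes share an initial segment, then by this finiteness all routes to points
  outside the unit disc leave some small disc at the same point, which gives (b), (c) and (d); by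
  scaling, with probability tending to 1 as \<open>B\<close> grows, the routes to points outside \<open>disc(0, B)\<close>
  leave \<open>disc(0, r)\<close> at the same point, which gives (e) and the uniqueness of the geodesic.

  Conversely, the probability that the routes to \<open>c y\<^sub>1\<close> and \<open>c y\<^sub>2\<close> separate at the origin does not
  depend on \<open>c\<close>. If it were positive on a set of pairs \<open>(y\<^sub>1, y\<^sub>2)\<close> of positive measure, then, since for
  large \<open>c\<close> some pair of points of \<open>\<Xi>(1)\<close> falls into \<open>c\<close> times that set, routes to points of \<open>\<Xi>(1)\<close>
  outside arbitrarily large discs would separate at the origin with probability bounded below;
  each of the properties excludes this. For (a) the law of \<open>(U\<^sub>1, U\<^sub>2)\<close> has a constant density on
  a product of discs, and scaling does the rest.
\<close>

text \<open>Only the finite-dimensional laws \<open>\<mu>\<close> are given, so statements have to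
  pass between Lebesgue-almost all configurations of finitely many points and the random points of
  \<open>Z\<close>. A null set of configurations is a.s. missed by all tuples of Poisson points, by
  a first moment computation. Conversely, a set \<open>K\<close> of positive measure has to be hit
  by a tuple with probability near 1. Such a set may have empty interior, so independence of the
  points in boxes applies only after \<open>K\<close> has been approximated by finite unions of
  boxes. The hitting tuple is selected by looking at the points alone, and its routes therefore
  still follow \<open>\<mu>\<close>. Scaling invariance is a property of \<open>\<mu>\<close> and
  not of one realization on \<open>M\<close>; hence bounds are proved on \<open>M\<close>
  (\<open>fan\<close>, \<open>split\<close>), carried to \<open>\<mu>\<close> (\<open>ess\<close>,
  \<open>generic_join\<close>), rescaled there and carried back. Routes are compared through their
  exit points from discs: these are measurable points of the plane, whereas a shared segment is a
  relation between curves. Equality of exit points passes to smaller discs, so agreement at one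
  radius settles all smaller radii.\<close>

section \<open>Exit times and exit points of paths\<close>

definition exit_time :: "real \<Rightarrow> (real \<Rightarrow> complex) \<Rightarrow> real" where
  "exit_time r \<gamma> = Inf {t\<in>{0..1}. \<gamma> t \<notin> cball 0 r}"

definition exit_point :: "real \<Rightarrow> (real \<Rightarrow> complex) \<Rightarrow> complex" where
  "exit_point r \<gamma> = \<gamma> (exit_time r \<gamma>)"

lemma first_exit_eq: "first_exit = exit_point 1"
  by (simp add: fun_eq_iff first_exit_def exit_point_def exit_time_def)

text \<open>The infimum is not attained, because the times spent outside the closed disc form a
  relatively open set. It is therefore recognized by excursions arbitrarily soon after
  \<open>T\<close>.\<close>

lemma exit_time_eqI:
  assumes "0 \<le> T" "T < 1" "\<And>t. 0 \<le> t \<Longrightarrow> t \<le> T \<Longrightarrow> norm (\<gamma> t) \<le> r"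
    and "\<And>v. T < v \<Longrightarrow> v \<le> 1 \<Longrightarrow> \<exists>u. T < u \<and> u \<le> v \<and> r < norm (\<gamma> u)"
  shows "exit_time r \<gamma> = T"
  unfolding exit_time_def
proof (rule cInf_eq_non_empty)
  show "{t \<in> {0..1}. \<gamma> t \<notin> cball 0 r} \<noteq> {}"
    using assms(4)[of 1] assms(1,2) by force
  show "T \<le> x" if "x \<in> {t \<in> {0..1}. \<gamma> t \<notin> cball 0 r}" for x
    using assms(3)[of x] that by force
  show "y \<le> T" if *: "\<And>x. x \<in> {t \<in> {0..1}. \<gamma> t \<notin> cball 0 r} \<Longrightarrow> y \<le> x" for y
  proof (rule ccontr)
    assume "\<not> y \<le> T"
    then have v: "T < min 1 ((T + y) / 2)" "min 1 ((T + y) / 2) \<le> 1" using assms(2) by auto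
    obtain u where u: "T < u" "u \<le> min 1 ((T + y) / 2)" "r < norm (\<gamma> u)"
      using assms(4)[OF v] by blast
    have "y \<le> u" using u assms(1) by (intro *) auto
    then show False using u \<open>\<not> y \<le> T\<close> by auto
  qed
qed

text \<open>At its exit time the path is still on the circle, and it may return into the disc at
  once. For this reason the last clause promises only some time outside in each interval to the
  right of the exit time.\<close>

lemma exit_time_props:
  assumes cont: "continuous_on {0..1} \<gamma>" and 0: "norm (\<gamma> 0) \<le> r"
    and t0: "t0 \<in> {0..1}" "r < norm (\<gamma> t0)"
  shows "0 \<le> exit_time r \<gamma>" "exit_time r \<gamma> < t0"
    "\<And>t. 0 \<le> t \<Longrightarrow> t \<le> exit_time r \<gamma> \<Longrightarrow> norm (\<gamma> t) \<le> r"
    "norm (exit_point r \<gamma>) = r"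
    "\<And>v. exit_time r \<gamma> < v \<Longrightarrow> v \<le> 1 \<Longrightarrow> \<exists>u. exit_time r \<gamma> < u \<and> u \<le> v \<and> r < norm (\<gamma> u)"
proof -
  let ?S = "{t\<in>{0..1}. \<gamma> t \<notin> cball 0 r}"
  let ?T = "exit_time r \<gamma>"
  have ne: "?S \<noteq> {}" using t0 by auto
  have bdd: "bdd_below ?S" by (auto intro: bdd_belowI)
  show T0: "0 \<le> ?T" unfolding exit_time_def using ne by (intro cInf_greatest) auto
  have le: "?T \<le> t" if "t \<in> ?S" for t unfolding exit_time_def by (rule cInf_lower[OF that bdd])
  have T1: "?T \<le> t0" using le t0 by auto
  have below: "norm (\<gamma> t) \<le> r" if "0 \<le> t" "t < ?T" for t
    using le[of t] that T1 t0 by force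
  have *: "norm (\<gamma> ?T) \<le> r"
  proof (cases "?T = 0")
    case True then show ?thesis using 0 by simp
  next
    case False
    then have pos: "0 < ?T" using T0 by simp
    have "continuous_on {0..?T} (\<lambda>t. norm (\<gamma> t))"
      by (intro continuous_on_norm continuous_on_subset[OF cont]) (use T1 t0 in auto)
    moreover have cl: "closure {0..<?T} = {0..?T}" using pos by (simp add: closure_atLeastLessThan)
    ultimately have 1: "continuous_on (closure {0..<?T}) (\<lambda>t. norm (\<gamma> t))" by simp
    have 2: "?T \<in> closure {0..<?T}" unfolding cl using T0 by simp
    show ?thesis
      by (rule continuous_le_on_closure[OF 1 2]) (use below in simp)
  qed
  show all: "norm (\<gamma> t) \<le> r" if "0 \<le> t" "t \<le> ?T" for t
    using below[of t] * that by (cases "t = ?T") auto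
  show Tt: "?T < t0" using T1 * t0 by (cases "?T = t0") auto
  show ex: "\<exists>u. ?T < u \<and> u \<le> v \<and> r < norm (\<gamma> u)" if v: "?T < v" "v \<le> 1" for v
  proof -
    have "Inf ?S < v" using v(1) by (simp add: exit_time_def)
    then obtain u where u: "u \<in> ?S" "u < v" using cInf_lessD[OF ne] by blast
    then have "?T \<noteq> u" using * by auto
    then show ?thesis using le[OF u(1)] u by (intro exI[of _ u]) auto
  qed
  have "r \<le> norm (\<gamma> ?T)"
  proof (rule ccontr)
    assume "\<not> r \<le> norm (\<gamma> ?T)"
    then have lt: "0 < r - norm (\<gamma> ?T)" by simp
    have "continuous_on {0..1} (\<lambda>t. norm (\<gamma> t))" by (intro continuous_on_norm cont)
    moreover have Tin: "?T \<in> {0..1}" using T0 Tt t0 by auto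
    ultimately obtain d where d: "0 < d" "\<And>x. x \<in> {0..1} \<Longrightarrow> dist x ?T < d \<Longrightarrow> dist (norm (\<gamma> x)) (norm (\<gamma> ?T)) < r - norm (\<gamma> ?T)"
      using lt unfolding continuous_on_iff by blast
    have v: "?T < min 1 (?T + d/2)" "min 1 (?T + d/2) \<le> 1" using d(1) Tt t0 by auto
    obtain u where u: "?T < u" "u \<le> min 1 (?T + d/2)" "r < norm (\<gamma> u)" using ex[OF v] by blast
    have "dist (norm (\<gamma> u)) (norm (\<gamma> ?T)) < r - norm (\<gamma> ?T)"
      by (rule d(2)) (use u T0 d in \<open>auto simp: dist_real_def\<close>)
    then show False using u by (auto simp: dist_real_def)
  qed
  then show "norm (exit_point r \<gamma>) = r" using * by (simp add: exit_point_def)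
qed

section \<open>Trees of routes with common starting point\<close>

text \<open>What \<open>compatible\<close> yields for routes with a common start. It is kept
  one-sided because the failure of one inclusion can be tested at rational times;
  \<open>route_tree\<close> demands it in both orders, which makes the initial traces equal.\<close>

definition initially_compatible :: "(real \<Rightarrow> complex) \<Rightarrow> (real \<Rightarrow> complex) \<Rightarrow> bool" where
  "initially_compatible \<gamma> \<eta> \<longleftrightarrow>
    (\<forall>s\<in>{0..1}. \<forall>t\<in>{0..1}. \<gamma> s = \<eta> t \<longrightarrow> \<gamma> ` {0..s} \<subseteq> \<eta> ` {0..t})"

lemma compatible_imp_initially_compatible:
  assumes "compatible \<gamma> \<eta>" "\<gamma> 0 = \<eta> 0"
  shows "initially_compatible \<gamma> \<eta>"
  unfolding initially_compatible_def
proof (intro ballI impI)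
  fix s t :: real assume *: "s \<in> {0..1}" "t \<in> {0..1}" "\<gamma> s = \<eta> t"
  have "path_image (subpath 0 s \<gamma>) = path_image (subpath 0 t \<eta>)"
    using assms(1)[unfolded compatible_def, rule_format, of 0 s 0 t] assms(2) * by auto
  then show "\<gamma> ` {0..s} \<subseteq> \<eta> ` {0..t}" using * by (simp add: path_image_subpath)
qed

definition route_tree :: "(real \<Rightarrow> complex) set \<Rightarrow> bool" where
  "route_tree \<Gamma> \<longleftrightarrow> (\<forall>\<gamma>\<in>\<Gamma>. route \<gamma> \<and> \<gamma> 0 = 0) \<and> (\<forall>\<gamma>\<in>\<Gamma>. \<forall>\<eta>\<in>\<Gamma>. initially_compatible \<gamma> \<eta>)"

lemma route_treeD:
  assumes "route_tree \<Gamma>" "\<gamma> \<in> \<Gamma>"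
  shows "route \<gamma>" "\<gamma> 0 = 0" "continuous_on {0..1} \<gamma>" "inj_on \<gamma> {0..1}"
  using assms by (auto simp: route_tree_def route_def arc_def path_def)

lemma route_tree_initial:
  assumes "route_tree \<Gamma>" "\<gamma> \<in> \<Gamma>" "\<eta> \<in> \<Gamma>" "s \<in> {0..1}" "t \<in> {0..1}" "\<gamma> s = \<eta> t"
  shows "\<gamma> ` {0..s} = \<eta> ` {0..t}"
  using assms unfolding route_tree_def initially_compatible_def
  by (metis subset_antisym)

lemma route_tree_mono: "route_tree \<Gamma> \<Longrightarrow> \<Gamma>' \<subseteq> \<Gamma> \<Longrightarrow> route_tree \<Gamma>'"
  unfolding route_tree_def by blast

text \<open>Up to the meeting point the two routes have the same trace, and this trace has already
  left the disc. The parametrizations may differ, so the exit time of \<open>\<eta>\<close> is found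
  as the parameter \<open>T'\<close> at which it visits the exit point of \<open>\<gamma>\<close>,
  and the excursions after it are transported through equal initial traces.\<close>

lemma exit_point_eq_if_meet:
  assumes \<Gamma>: "route_tree \<Gamma>" "\<gamma> \<in> \<Gamma>" "\<eta> \<in> \<Gamma>"
    and st: "s \<in> {0..1}" "t \<in> {0..1}" "\<gamma> s = \<eta> t" and r: "0 \<le> r" "r < norm (\<gamma> s)"
  shows "exit_point r \<gamma> = exit_point r \<eta>"
proof -
  note \<gamma> = route_treeD[OF \<Gamma>(1,2)] and \<eta> = route_treeD[OF \<Gamma>(1,3)]
  let ?T = "exit_time r \<gamma>"
  have 0: "norm (\<gamma> 0) \<le> r" using \<gamma> r by simp
  note T = exit_time_props[OF \<gamma>(3) 0 st(1) r(2)]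
  have Ti: "?T \<in> {0..1}" "?T \<in> {0..s}" using T(1,2) st by auto
  have img: "\<gamma> ` {0..s} = \<eta> ` {0..t}" by (rule route_tree_initial[OF \<Gamma> st])
  then obtain T' where T': "T' \<in> {0..t}" "\<gamma> ?T = \<eta> T'" using Ti by blast
  have T'i: "T' \<in> {0..1}" using T' st by auto
  have img': "\<gamma> ` {0..?T} = \<eta> ` {0..T'}" by (rule route_tree_initial[OF \<Gamma> Ti(1) T'i T'(2)])
  have "T' \<noteq> t"
  proof
    assume "T' = t"
    then have "\<gamma> ?T = \<gamma> s" using T' st by simp
    then show False using inj_onD[OF \<gamma>(4) _ Ti(1) st(1)] T(2) by simp
  qed
  then have T't: "T' < t" using T' by simp
  have "exit_time r \<eta> = T'"
  proof (rule exit_time_eqI)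
    show "0 \<le> T'" "T' < 1" using T' T't st by auto
    show "norm (\<eta> u) \<le> r" if "0 \<le> u" "u \<le> T'" for u
    proof -
      have "\<eta> u \<in> \<gamma> ` {0..?T}" unfolding img' using that by auto
      then show ?thesis using T(3) by auto
    qed
    fix v assume v: "T' < v" "v \<le> 1"
    let ?v = "min v t"
    have v': "?v \<in> {0..t}" "T' < ?v" "?v \<in> {0..1}" using v T't T' st by auto
    obtain u where u: "u \<in> {0..s}" "\<eta> ?v = \<gamma> u" using img v'(1) by blast
    have ui: "u \<in> {0..1}" using u st by auto
    have uT: "?T < u"
    proof (rule ccontr)
      assume "\<not> ?T < u"
      then have "\<eta> ?v \<in> \<eta> ` {0..T'}" unfolding img'[symmetric] u(2) using u by auto
      then obtain x where "x \<in> {0..T'}" "\<eta> ?v = \<eta> x" by blast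
      then show False using inj_onD[OF \<eta>(4), of ?v x] v' T'i by auto
    qed
    obtain u' where u': "?T < u'" "u' \<le> u" "r < norm (\<gamma> u')" using T(5)[OF uT] ui by auto
    have "\<gamma> u' \<in> \<gamma> ` {0..u}" using u' T(1) by auto
    also have "\<gamma> ` {0..u} = \<eta> ` {0..?v}" by (rule route_tree_initial[OF \<Gamma> ui v'(3) u(2)[symmetric]])
    finally obtain x where x: "x \<in> {0..?v}" "\<gamma> u' = \<eta> x" by blast
    have "T' < x"
    proof (rule ccontr)
      assume "\<not> T' < x"
      then have "\<gamma> u' \<in> \<gamma> ` {0..?T}" unfolding img' x(2) using x by auto
      then show False using T(3) u' by force
    qed
    then show "\<exists>u. T' < u \<and> u \<le> v \<and> r < norm (\<eta> u)" using x u' by (intro exI[of _ x]) auto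
  qed
  then show ?thesis using T' by (simp add: exit_point_def)
qed

text \<open>The common exit point from the larger disc is itself a meeting point outside the smaller
  disc.\<close>

lemma exit_point_eq_smaller:
  assumes \<Gamma>: "route_tree \<Gamma>" "\<gamma> \<in> \<Gamma>" "\<eta> \<in> \<Gamma>"
    and "exit_point r \<gamma> = exit_point r \<eta>" "0 \<le> r'" "r' \<le> r" "r < norm (\<gamma> 1)" "r < norm (\<eta> 1)"
  shows "exit_point r' \<gamma> = exit_point r' \<eta>"
proof (cases "r' = r")
  case False
  note \<gamma> = route_treeD[OF \<Gamma>(1,2)] and \<eta> = route_treeD[OF \<Gamma>(1,3)]
  have 0: "norm (\<gamma> 0) \<le> r" "norm (\<eta> 0) \<le> r" using \<gamma>(2) \<eta>(2) assms(5,6) by simp_all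
  have one: "1 \<in> {0..1::real}" by simp
  note T = exit_time_props[OF \<gamma>(3) 0(1) one assms(7)] and T' = exit_time_props[OF \<eta>(3) 0(2) one assms(8)]
  show ?thesis
  proof (rule exit_point_eq_if_meet[OF \<Gamma>])
    show "exit_time r \<gamma> \<in> {0..1}" "exit_time r \<eta> \<in> {0..1}" using T(1,2) T'(1,2) by simp_all
    show "\<gamma> (exit_time r \<gamma>) = \<eta> (exit_time r \<eta>)" using assms(4) by (simp only: exit_point_def)
    show "0 \<le> r'" by fact
    show "r' < cmod (\<gamma> (exit_time r \<gamma>))"
      using T(4) assms(6) False by (simp add: exit_point_def)
  qed
qed (use assms(4) in simp)

lemma exit_point_in_image:
  assumes "continuous_on {0..1} \<gamma>" "norm (\<gamma> 0) \<le> r" "r < norm (\<gamma> 1)"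
  shows "exit_point r \<gamma> \<in> path_image \<gamma>"
  using exit_time_props(1,2)[OF assms(1,2) _ assms(3)] unfolding exit_point_def path_image_def by auto

subsection \<open>Branchpoints\<close>

text \<open>Makes the description in \<open>subroute_end\<close> unique. An end of an arc does not
  disconnect it: if the two ends differed, removing \<open>\<eta> u\<close> from the common trace
  would leave it connected when seen along \<open>\<eta>\<close>, but would cut the parameter
  interval of \<open>\<gamma>\<close> at an interior point \<open>v\<close>.\<close>

lemma initial_subarc_end_unique:
  fixes \<gamma> \<eta> :: "real \<Rightarrow> complex"
  assumes \<gamma>: "arc \<gamma>" "\<gamma> 0 = 0" "t \<in> {0..1}" and \<eta>: "arc \<eta>" "\<eta> 0 = 0" "u \<in> {0..1}"
    and eq: "\<gamma> ` {0..t} = \<eta> ` {0..u}"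
  shows "\<gamma> t = \<eta> u"
proof (rule ccontr)
  assume ne: "\<gamma> t \<noteq> \<eta> u"
  have inj: "inj_on \<gamma> {0..1}" "inj_on \<eta> {0..1}" and cont: "continuous_on {0..1} \<gamma>" "continuous_on {0..1} \<eta>"
    using \<gamma> \<eta> by (auto simp: arc_def path_def)
  have "\<eta> u \<in> \<gamma> ` {0..t}" unfolding eq using \<eta> by auto
  then obtain v where v: "v \<in> {0..t}" "\<eta> u = \<gamma> v" by blast
  then have vt: "v < t" using ne by (cases "v = t") auto
  have v0: "0 < v"
  proof (rule ccontr)
    assume "\<not> 0 < v"
    then have "\<eta> u = \<eta> 0" using v \<gamma> \<eta> by auto
    then have "u = 0" using inj_onD[OF inj(2), of u 0] \<eta> by auto
    then have "\<gamma> ` {0..t} = {0}" using eq \<eta> by auto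
    then have "\<gamma> t = 0" using \<gamma>(3) by auto
    then show False using ne \<open>u = 0\<close> \<eta> by simp
  qed
  let ?g = "the_inv_into {0..t} \<gamma>"
  have inj': "inj_on \<gamma> {0..t}" "inj_on \<eta> {0..u}" using inj \<gamma>(3) \<eta>(3) by (auto elim: inj_on_subset)
  have ct: "continuous_on {0..t} \<gamma>" by (rule continuous_on_subset[OF cont(1)]) (use \<gamma>(3) in auto)
  have cg: "continuous_on (\<gamma> ` {0..t}) ?g"
    using ct compact_Icc inj'(1) by (rule continuous_on_inv_into)
  have "connected (\<eta> ` {0..<u})"
    by (intro connected_continuous_image continuous_on_subset[OF cont(2)]) (use \<eta> in auto)
  moreover have eq2: "\<eta> ` {0..<u} = \<gamma> ` ({0..t} - {v})"
  proof -
    have "\<eta> ` {0..<u} = \<eta> ` ({0..u} - {u})" by (rule arg_cong[of _ _ "(`) \<eta>"]) auto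
    also have "\<dots> = \<eta> ` {0..u} - {\<eta> u}"
      using \<eta> by (subst inj_on_image_set_diff[OF inj'(2)]) auto
    also have "\<dots> = \<gamma> ` {0..t} - \<gamma> ` {v}" using eq v by simp
    also have "\<dots> = \<gamma> ` ({0..t} - {v})"
      using v \<gamma> by (subst inj_on_image_set_diff[OF inj'(1)]) auto
    finally show ?thesis .
  qed
  ultimately have 1: "connected (\<gamma> ` ({0..t} - {v}))" by simp
  have "continuous_on (\<gamma> ` ({0..t} - {v})) ?g" by (rule continuous_on_subset[OF cg]) auto
  from connected_continuous_image[OF this 1]
  have "connected (?g ` (\<gamma> ` ({0..t} - {v})))" .
  also have "?g ` (\<gamma> ` ({0..t} - {v})) = {0..t} - {v}"
    by (force simp: the_inv_into_f_f[OF inj'(1)] image_image image_iff)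
  finally have "connected ({0..t} - {v})" .
  from connectedD_interval[OF this, of 0 t v] show False using v0 vt by auto
qed

lemma subroute_end_eq:
  assumes "route \<gamma>" "\<gamma> 0 = 0" "t \<in> {0..1}"
  shows "subroute_end (\<gamma> ` {0..t}) = \<gamma> t"
  unfolding subroute_end_def
proof (rule the_equality)
  show "\<exists>\<gamma>' t'. route \<gamma>' \<and> pathstart \<gamma>' = 0 \<and> t' \<in> {0..1} \<and> \<gamma> ` {0..t} = path_image (subpath 0 t' \<gamma>') \<and> \<gamma> t = \<gamma>' t'"
    using assms by (intro exI[of _ \<gamma>] exI[of _ t]) (auto simp: pathstart_def path_image_subpath)
next
  fix b assume "\<exists>\<gamma>' t'. route \<gamma>' \<and> pathstart \<gamma>' = 0 \<and> t' \<in> {0..1} \<and> \<gamma> ` {0..t} = path_image (subpath 0 t' \<gamma>') \<and> b = \<gamma>' t'"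
  then obtain \<gamma>' t' where *: "route \<gamma>'" "\<gamma>' 0 = 0" "t' \<in> {0..1}" "\<gamma> ` {0..t} = \<gamma>' ` {0..t'}" "b = \<gamma>' t'"
    by (auto simp: pathstart_def path_image_subpath)
  show "b = \<gamma> t"
    unfolding *(5) by (rule initial_subarc_end_unique[symmetric, OF _ assms(2,3) _ *(2,3,4)])
      (use assms * in \<open>auto simp: route_def\<close>)
qed

text \<open>The times at which \<open>\<gamma>\<close> is on all routes form a closed set. By
  compatibility this set contains every time before one of its members, so it is an interval
  starting at 0.\<close>

lemma route_tree_Inter:
  assumes \<Gamma>: "route_tree \<Gamma>" "\<gamma> \<in> \<Gamma>"
  shows "\<exists>t\<in>{0..1}. (\<Inter>\<eta>\<in>\<Gamma>. path_image \<eta>) = \<gamma> ` {0..t}"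
proof -
  note \<gamma> = route_treeD[OF \<Gamma>]
  let ?I = "\<Inter>\<eta>\<in>\<Gamma>. path_image \<eta>"
  let ?T = "{0..1} \<inter> \<gamma> -` ?I"
  have "path \<eta>" if "\<eta> \<in> \<Gamma>" for \<eta> using route_treeD(3)[OF \<Gamma>(1) that] by (simp add: path_def)
  then have "closed ?I" by (auto intro!: closed_INT closed_path_image)
  then have cl: "closed ?T" using \<gamma>(3) by (intro continuous_closed_preimage) auto
  have zero: "0 \<in> ?T" using \<gamma>(2) route_treeD(2)[OF \<Gamma>(1)] by (force simp: path_image_def)
  have bdd: "bdd_above ?T" by (intro bdd_aboveI[of _ 1]) auto
  define t where "t = Sup ?T"
  have ne: "?T \<noteq> {}" using zero by blast
  have t: "t \<in> ?T" unfolding t_def by (rule closed_contains_Sup[OF ne bdd cl])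
  have "s \<in> ?T" if s: "0 \<le> s" "s \<le> t" for s
  proof -
    have "\<gamma> s \<in> path_image \<eta>" if \<eta>: "\<eta> \<in> \<Gamma>" for \<eta>
    proof -
      obtain u where u: "u \<in> {0..1}" "\<gamma> t = \<eta> u" using t \<eta> by (auto simp: path_image_def)
      have "\<gamma> s \<in> \<gamma> ` {0..t}" using s by auto
      also have "\<dots> = \<eta> ` {0..u}" using t u by (intro route_tree_initial[OF \<Gamma> \<eta>]) auto
      finally show ?thesis using u by (auto simp: path_image_def)
    qed
    then show ?thesis using s t by auto
  qed
  moreover have "s \<le> t" if "s \<in> ?T" for s unfolding t_def by (rule cSup_upper[OF that bdd])
  ultimately have "?T = {0..t}" by auto
  then have "\<gamma> ` {0..t} = \<gamma> ` ?T" by simp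
  also have "\<dots> = path_image \<gamma> \<inter> ?I" by (auto simp: path_image_def)
  also have "\<dots> = ?I" using \<Gamma>(2) by blast
  finally show ?thesis using t by (intro bexI[of _ t]) auto
qed

text \<open>Removes the definite description: from here on, every statement about a branchpoint is a
  statement about a common point other than the origin.\<close>

lemma subroute_end_Inter_neq_0_iff:
  assumes \<Gamma>: "route_tree \<Gamma>" "\<Gamma> \<noteq> {}"
  shows "subroute_end (\<Inter>\<gamma>\<in>\<Gamma>. path_image \<gamma>) \<noteq> 0 \<longleftrightarrow> (\<exists>w. w \<noteq> 0 \<and> (\<forall>\<gamma>\<in>\<Gamma>. w \<in> path_image \<gamma>))"
proof -
  obtain \<gamma> where \<gamma>': "\<gamma> \<in> \<Gamma>" using \<Gamma> by blast
  note \<gamma> = route_treeD[OF \<Gamma>(1) \<gamma>']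
  obtain t where t: "t \<in> {0..1}" "(\<Inter>\<eta>\<in>\<Gamma>. path_image \<eta>) = \<gamma> ` {0..t}"
    using route_tree_Inter[OF \<Gamma>(1) \<gamma>'] by blast
  have "subroute_end (\<Inter>\<gamma>\<in>\<Gamma>. path_image \<gamma>) = \<gamma> t"
    unfolding t(2) by (rule subroute_end_eq[OF \<gamma>(1,2) t(1)])
  moreover have "\<gamma> t \<noteq> 0 \<longleftrightarrow> (\<exists>w. w \<noteq> 0 \<and> w \<in> (\<Inter>\<eta>\<in>\<Gamma>. path_image \<eta>))"
  proof
    assume "\<gamma> t \<noteq> 0"
    then show "\<exists>w. w \<noteq> 0 \<and> w \<in> (\<Inter>\<eta>\<in>\<Gamma>. path_image \<eta>)" unfolding t(2) using t(1) by (intro exI[of _ "\<gamma> t"]) auto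
  next
    assume "\<exists>w. w \<noteq> 0 \<and> w \<in> (\<Inter>\<eta>\<in>\<Gamma>. path_image \<eta>)"
    then obtain s where s: "s \<in> {0..t}" "\<gamma> s \<noteq> 0" unfolding t(2) by auto
    then have "t \<noteq> 0" using \<gamma>(2) by auto
    then show "\<gamma> t \<noteq> 0" using inj_onD[OF \<gamma>(4), of t 0] t(1) \<gamma>(2) by auto
  qed
  ultimately show ?thesis by auto
qed

subsection \<open>Length\<close>

lemma route_times_in_unit:
  fixes \<tau> :: "int \<Rightarrow> real"
  assumes "mono \<tau>" "(\<tau> \<longlongrightarrow> 0) at_bot" "(\<tau> \<longlongrightarrow> 1) at_top"
  shows "\<tau> i \<in> {0..1}"
proof -
  have "eventually (\<lambda>j. \<tau> j \<le> \<tau> i) at_bot"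
    using eventually_le_at_bot[of i] by eventually_elim (use assms(1) in \<open>auto dest: monoD\<close>)
  then have "0 \<le> \<tau> i" by (intro tendsto_upperbound[OF assms(2)]) auto
  moreover have "eventually (\<lambda>j. \<tau> i \<le> \<tau> j) at_top"
    using eventually_ge_at_top[of i] by eventually_elim (use assms(1) in \<open>auto dest: monoD\<close>)
  then have "\<tau> i \<le> 1" by (intro tendsto_lowerbound[OF assms(3)]) auto
  ultimately show ?thesis by simp
qed

text \<open>All pieces have the same speed \<open>L\<close>, so the bound holds across finitely many
  vertices by adding up. Vertices may accumulate at the times 0 and 1; these are reached by
  continuity, one variable at a time.\<close>

lemma route_lipschitz:
  assumes "route \<gamma>"
  obtains L where "0 \<le> L" "\<And>s t. s \<in> {0..1} \<Longrightarrow> t \<in> {0..1} \<Longrightarrow> norm (\<gamma> s - \<gamma> t) \<le> L * \<bar>s - t\<bar>"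
proof -
  obtain L and \<tau> :: "int \<Rightarrow> real" where \<tau>: "mono \<tau>" "(\<tau> \<longlongrightarrow> 0) at_bot" "(\<tau> \<longlongrightarrow> 1) at_top"
    and piece: "\<And>i. \<exists>v. norm v = L \<and> (\<forall>t\<in>{\<tau> i..\<tau> (i + 1)}. \<gamma> t = \<gamma> (\<tau> i) + (t - \<tau> i) *\<^sub>R v)"
    using assms unfolding route_def by blast
  have cont: "continuous_on {0..1} \<gamma>" using assms by (auto simp: route_def arc_def path_def)
  have L: "0 \<le> L" using piece[of 0] norm_ge_zero by metis
  have one: "norm (\<gamma> y - \<gamma> x) \<le> L * (y - x)" if "\<tau> i \<le> x" "x \<le> y" "y \<le> \<tau> (i + 1)" for i x y
  proof -
    obtain v where v: "norm v = L" "\<forall>t\<in>{\<tau> i..\<tau> (i + 1)}. \<gamma> t = \<gamma> (\<tau> i) + (t - \<tau> i) *\<^sub>R v"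
      using piece[of i] by blast
    have x: "\<gamma> x = \<gamma> (\<tau> i) + (x - \<tau> i) *\<^sub>R v" by (rule bspec[OF v(2)]) (use that in simp)
    have y: "\<gamma> y = \<gamma> (\<tau> i) + (y - \<tau> i) *\<^sub>R v" by (rule bspec[OF v(2)]) (use that in simp)
    have "\<gamma> y - \<gamma> x = (y - x) *\<^sub>R v" unfolding x y by (simp add: algebra_simps)
    then show ?thesis using that v(1) by simp
  qed
  have many: "norm (\<gamma> y - \<gamma> x) \<le> L * (y - x)" if "\<tau> i \<le> x" "x \<le> y" "y \<le> \<tau> (i + int n)" for i x y n
    using that
  proof (induction n arbitrary: x y)
    case 0
    then have "x = y" by simp
    then show ?case by simp
  next
    case (Suc n)
    let ?m = "\<tau> (i + int n)"
    have one': "norm (\<gamma> y - \<gamma> x) \<le> L * (y - x)" if "?m \<le> x" "x \<le> y" "y \<le> \<tau> (i + int (Suc n))" for x y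
      using one[of "i + int n" x y] that by (simp add: ac_simps)
    consider "y \<le> ?m" | "?m \<le> x" | "x < ?m" "?m < y" by linarith
    then show ?case
    proof cases
      case 3
      have im: "\<tau> i \<le> ?m" using \<tau>(1) by (simp add: monoD)
      have "norm (\<gamma> y - \<gamma> x) \<le> norm (\<gamma> y - \<gamma> ?m) + norm (\<gamma> ?m - \<gamma> x)" by norm
      also have "\<dots> \<le> L * (y - ?m) + L * (?m - x)"
        by (intro add_mono one' Suc.IH) (use 3 Suc.prems im in auto)
      finally show ?thesis by (simp add: algebra_simps)
    qed (use Suc one' in auto)
  qed
  have inner: "norm (\<gamma> y - \<gamma> x) \<le> L * \<bar>y - x\<bar>" if xy: "x \<in> {0<..<1}" "y \<in> {0<..<1}" for x y
  proof -
    have *: "norm (\<gamma> y - \<gamma> x) \<le> L * (y - x)" if xy: "x \<in> {0<..<1}" "y \<in> {0<..<1}" "x \<le> y" for x y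
    proof -
      have "eventually (\<lambda>i. \<tau> i < x) at_bot" using order_tendstoD(2)[OF \<tau>(2)] xy by simp
      then obtain i where i: "\<tau> i < x" by (metis eventually_at_bot_linorder order.refl)
      have "eventually (\<lambda>i. y < \<tau> i) at_top" using order_tendstoD(1)[OF \<tau>(3)] xy by simp
      then obtain j where j: "y < \<tau> j" by (metis eventually_at_top_linorder order.refl)
      have "i \<le> j"
      proof (rule ccontr)
        assume "\<not> i \<le> j" then have "\<tau> j \<le> \<tau> i" using \<tau>(1) by (simp add: monoD)
        then show False using i j xy by simp
      qed
      then show ?thesis using many[of i x y "nat (j - i)"] i j xy by simp
    qed
    show ?thesis
    proof (cases "x \<le> y")
      case True then show ?thesis using *[OF xy True] by simp
    next
      case False
      then have "norm (\<gamma> x - \<gamma> y) \<le> L * (x - y)" using *[OF xy(2,1)] by simp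
      then show ?thesis using False by (simp add: norm_minus_commute)
    qed
  qed
  have cl: "closure {0<..<1::real} = {0..1}" by simp
  have half: "norm (\<gamma> y - \<gamma> x) \<le> L * \<bar>y - x\<bar>" if x: "x \<in> {0<..<1}" and y: "y \<in> {0..1}" for x y
  proof -
    have "continuous_on (closure {0<..<1}) (\<lambda>y. norm (\<gamma> y - \<gamma> x) - L * \<bar>y - x\<bar>)"
      unfolding cl by (intro continuous_intros cont)
    from continuous_le_on_closure[OF this, of y 0] have "norm (\<gamma> y - \<gamma> x) - L * \<bar>y - x\<bar> \<le> 0"
      unfolding cl using inner[OF x] y by simp
    then show ?thesis by simp
  qed
  have full: "norm (\<gamma> y - \<gamma> x) \<le> L * \<bar>y - x\<bar>" if x: "x \<in> {0..1}" and y: "y \<in> {0..1}" for x y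
  proof -
    have "continuous_on (closure {0<..<1}) (\<lambda>x. norm (\<gamma> y - \<gamma> x) - L * \<bar>y - x\<bar>)"
      unfolding cl by (intro continuous_intros cont)
    from continuous_le_on_closure[OF this, of x 0] have "norm (\<gamma> y - \<gamma> x) - L * \<bar>y - x\<bar> \<le> 0"
      unfolding cl using half[OF _ y] x by simp
    then show ?thesis by simp
  qed
  show thesis using that[OF L] full by blast
qed

lemma route_affine:
  assumes "route \<gamma>" "0 < c"
  shows "route (\<lambda>t\<in>{0..1}. c *\<^sub>R \<gamma> t + a)"
proof -
  obtain L and \<tau> :: "int \<Rightarrow> real" where \<tau>: "mono \<tau>" "(\<tau> \<longlongrightarrow> 0) at_bot" "(\<tau> \<longlongrightarrow> 1) at_top"
    and piece: "\<And>i. \<exists>v. norm v = L \<and> (\<forall>t\<in>{\<tau> i..\<tau> (i + 1)}. \<gamma> t = \<gamma> (\<tau> i) + (t - \<tau> i) *\<^sub>R v)"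
    using assms(1) unfolding route_def by blast
  have \<tau>01: "0 \<le> \<tau> i" "\<tau> i \<le> 1" for i using route_times_in_unit[OF \<tau>, of i] by auto
  have \<gamma>: "continuous_on {0..1} \<gamma>" "inj_on \<gamma> {0..1}"
    using assms(1) by (auto simp: route_def arc_def path_def)
  let ?\<eta> = "\<lambda>t\<in>{0..1}. c *\<^sub>R \<gamma> t + a"
  have "continuous_on {0..1} (\<lambda>t. c *\<^sub>R \<gamma> t + a)" by (intro continuous_intros \<gamma>)
  then have "continuous_on {0..1} ?\<eta>" by (simp cong: continuous_on_cong_simp)
  moreover have "inj_on ?\<eta> {0..1}" using \<gamma>(2) assms(2) by (auto simp: inj_on_def)
  moreover have "\<exists>v. norm v = c * L \<and> (\<forall>t\<in>{\<tau> i..\<tau> (i + 1)}. ?\<eta> t = ?\<eta> (\<tau> i) + (t - \<tau> i) *\<^sub>R v)" for i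
  proof -
    obtain v where v: "norm v = L" "\<forall>t\<in>{\<tau> i..\<tau> (i + 1)}. \<gamma> t = \<gamma> (\<tau> i) + (t - \<tau> i) *\<^sub>R v"
      using piece[of i] by blast
    have "?\<eta> t = ?\<eta> (\<tau> i) + (t - \<tau> i) *\<^sub>R (c *\<^sub>R v)" if t: "t \<in> {\<tau> i..\<tau> (i + 1)}" for t
    proof -
      have "t \<in> {0..1}" using t \<tau>01[of i] \<tau>01[of "i+1"] by auto
      then have "?\<eta> t = c *\<^sub>R \<gamma> t + a" by simp
      also have "\<gamma> t = \<gamma> (\<tau> i) + (t - \<tau> i) *\<^sub>R v" using v(2) t by blast
      finally have "?\<eta> t = c *\<^sub>R (\<gamma> (\<tau> i) + (t - \<tau> i) *\<^sub>R v) + a" .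
      then show ?thesis using \<tau>01[of i] by (simp add: algebra_simps)
    qed
    moreover have "norm (c *\<^sub>R v) = c * L" using v(1) assms(2) by simp
    ultimately show ?thesis by blast
  qed
  ultimately show ?thesis
    unfolding route_def arc_def path_def using \<tau> by blast
qed

lemma len_mono:
  assumes "S \<subseteq> T"
  shows "len S \<le> len T"
  unfolding len_def
proof (rule SUP_mono', rule INF_superset_mono)
  fix \<delta> :: real
  show "{C. T \<subseteq> (\<Union>n. C n) \<and> (\<forall>n. bounded (C n) \<and> diameter (C n) \<le> \<delta>)}
    \<subseteq> {C. S \<subseteq> (\<Union>n. C n) \<and> (\<forall>n. bounded (C n) \<and> diameter (C n) \<le> \<delta>)}"
    using assms by blast
qed simp

lemma len_lipschitz_image:
  fixes \<gamma> :: "real \<Rightarrow> complex"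
  assumes L: "0 \<le> L" and lip: "\<And>s t. s \<in> {0..1} \<Longrightarrow> t \<in> {0..1} \<Longrightarrow> norm (\<gamma> s - \<gamma> t) \<le> L * \<bar>s - t\<bar>"
  shows "len (\<gamma> ` {0..1}) \<le> ennreal L"
  unfolding len_def
proof (rule SUP_least)
  fix \<delta> :: real assume "\<delta> \<in> {0<..}"
  then have \<delta>: "0 < \<delta>" by simp
  \<comment> \<open>Enough equal pieces of the unit interval for each image to have diameter at most
    \<delta>; the bounds on the diameters add up to \<open>L\<close>.\<close>
  obtain N where N: "L / \<delta> < real N" using reals_Archimedean2 by blast
  then have N0: "0 < N" using L \<delta> by (metis divide_nonneg_pos not_gr0 not_less of_nat_0 order_less_irrefl order.strict_iff_order)
  have LN: "L / N \<le> \<delta>" using N N0 \<delta> by (simp add: field_simps)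
  define C where "C n = (if n < N then \<gamma> ` {real n / N..real (Suc n) / N} else {})" for n
  have d: "norm (x - y) \<le> L / N" if xy: "x \<in> C n" "y \<in> C n" for x y n
  proof -
    have n: "n < N" using xy by (auto simp: C_def split: if_splits)
    obtain s t where st: "x = \<gamma> s" "y = \<gamma> t" "s \<in> {real n / N..real (Suc n) / N}" "t \<in> {real n / N..real (Suc n) / N}"
      using xy by (auto simp: C_def split: if_splits)
    have b: "0 \<le> real n / N" "real (Suc n) / N \<le> 1" using n by (auto simp: field_simps)
    have "s \<in> {0..1}" "t \<in> {0..1}" using b st(3,4) by (meson atLeastAtMost_iff order.trans)+
    then have "norm (x - y) \<le> L * \<bar>s - t\<bar>" using lip st by simp
    also have "\<bar>s - t\<bar> \<le> real (Suc n) / N - real n / N" using st(3,4) by auto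
    also have "\<dots> = 1 / N" by (simp add: add_divide_distrib)
    finally show ?thesis using L by (simp add: mult_left_mono)
  qed
  have diam: "diameter (C n) \<le> L / N" for n
    by (rule diameter_le) (use d L in auto)
  have bdd: "bounded (C n)" for n
  proof (cases "C n = {}")
    case False
    then obtain x where "x \<in> C n" by blast
    then show ?thesis using d[of x n] unfolding bounded_def dist_norm by blast
  qed simp
  have cover: "\<gamma> ` {0..1} \<subseteq> (\<Union>n. C n)"
  proof
    fix z assume "z \<in> \<gamma> ` {0..1}"
    then obtain t where t: "0 \<le> t" "t \<le> 1" "z = \<gamma> t" by auto
    show "z \<in> (\<Union>n. C n)"
    proof (cases "t = 1")
      case True
      then have "z \<in> C (N - 1)" using t N0 by (auto simp: C_def of_nat_diff field_simps)
      then show ?thesis by blast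
    next
      case False
      define n where "n = nat \<lfloor>t * N\<rfloor>"
      have n: "real n \<le> t * N" "t * N < real n + 1" using t by (auto simp: n_def)
      have "real n < real N" using n(1) t False N0
        by (smt (verit) mult_less_cancel_right2 of_nat_0_less_iff)
      then have "n < N" by simp
      then have "z \<in> C n" using t n N0 by (auto simp: C_def field_simps)
      then show ?thesis by blast
    qed
  qed
  have "(INF C\<in>{C. \<gamma> ` {0..1} \<subseteq> (\<Union>n. C n) \<and> (\<forall>n. bounded (C n) \<and> diameter (C n) \<le> \<delta>)}.
      (\<Sum>n. ennreal (diameter (C n)))) \<le> (\<Sum>n. ennreal (diameter (C n)))"
    by (rule INF_lower) (use cover bdd order.trans[OF diam LN] in auto)
  also have "\<dots> = (\<Sum>n<N. ennreal (diameter (C n)))"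
    by (rule suminf_finite) (auto simp: C_def)
  also have "\<dots> \<le> (\<Sum>n<N. ennreal (L / N))" by (intro sum_mono ennreal_leI diam)
  also have "\<dots> = ennreal L" using L N0 by (simp add: ennreal_of_nat_eq_real_of_nat ennreal_mult''[symmetric])
  finally show "(INF C\<in>{C. \<gamma> ` {0..1} \<subseteq> (\<Union>n. C n) \<and> (\<forall>n. bounded (C n) \<and> diameter (C n) \<le> \<delta>)}.
      (\<Sum>n. ennreal (diameter (C n)))) \<le> ennreal L" .
qed

lemma len_route_finite: "route \<gamma> \<Longrightarrow> len (path_image \<gamma>) < \<infinity>"
  by (metis route_lipschitz len_lipschitz_image path_image_def ennreal_less_top infinity_ennreal_def order.strict_trans1)

text \<open>The distance from \<open>c\<close> is 1-Lipschitz, so the sets of a cover that meet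
  \<open>S i\<close> have diameters adding up to at least \<open>b - a\<close>. A set of diameter at
  most \<delta> cannot meet two of the separated sets, hence different \<open>i\<close> use
  different members of the cover and the bounds add.\<close>

lemma len_ge_separated:
  fixes c :: complex
  assumes I: "finite I" and \<delta>: "0 < \<delta>"
    and sep: "\<And>i j x y. i \<in> I \<Longrightarrow> j \<in> I \<Longrightarrow> i \<noteq> j \<Longrightarrow> x \<in> S i \<Longrightarrow> y \<in> S j \<Longrightarrow> \<delta> < dist x y"
    and cross: "\<And>i. i \<in> I \<Longrightarrow> {a..b} \<subseteq> (\<lambda>z. norm (z - c)) ` S i"
    and sub: "\<And>i. i \<in> I \<Longrightarrow> S i \<subseteq> E" and ab: "a \<le> b"
  shows "of_nat (card I) * ennreal (b - a) \<le> len E"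
proof -
  let ?f = "\<lambda>z. norm (z - c)"
  have "of_nat (card I) * ennreal (b - a) \<le> (INF C\<in>{C. E \<subseteq> (\<Union>n. C n) \<and> (\<forall>n. bounded (C n) \<and> diameter (C n) \<le> \<delta>)}.
      (\<Sum>n. ennreal (diameter (C n))))"
  proof (rule INF_greatest)
    fix C :: "nat \<Rightarrow> complex set"
    assume "C \<in> {C. E \<subseteq> (\<Union>n. C n) \<and> (\<forall>n. bounded (C n) \<and> diameter (C n) \<le> \<delta>)}"
    then have C: "E \<subseteq> (\<Union>n. C n)" "\<And>n. bounded (C n)" "\<And>n. diameter (C n) \<le> \<delta>" by auto
    define d where "d n = ennreal (diameter (C n))" for n
    define N where "N i = {n. C n \<inter> S i \<noteq> {}}" for i
    have single: "ennreal (b - a) \<le> (\<Sum>n. if n \<in> N i then d n else 0)" if i: "i \<in> I" for i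
    proof -
      define m where "m n = Inf (?f ` C n)" for n
      \<comment> \<open>The distance from \<open>c\<close> maps \<open>C n\<close> into an interval
        that starts at its infimum and is as long as the diameter.\<close>
      define J where "J n = (if n \<in> N i then {m n..m n + diameter (C n)} else {})" for n
      have "{a..b} \<subseteq> (\<Union>n. J n)"
      proof
        fix u assume "u \<in> {a..b}"
        then obtain z where z: "z \<in> S i" "u = ?f z" using cross[OF i] by blast
        then obtain n where n: "z \<in> C n" using C(1) sub[OF i] by blast
        then have nN: "n \<in> N i" using z by (auto simp: N_def)
        have "m n \<le> u" unfolding m_def
          by (rule cInf_lower) (use n z in \<open>auto intro!: bdd_belowI[of _ 0]\<close>)
        moreover have "u - diameter (C n) \<le> m n" unfolding m_def
        proof (rule cInf_greatest)
          show "?f ` C n \<noteq> {}" using n by auto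
          fix x assume "x \<in> ?f ` C n"
          then obtain w where w: "w \<in> C n" "x = ?f w" by blast
          have "norm (z - c) - norm (w - c) \<le> norm (z - w)"
            using norm_triangle_ineq2[of "z - c" "w - c"] by simp
          also have "\<dots> \<le> diameter (C n)"
            using diameter_bounded_bound[OF C(2) n w(1)] by (simp add: dist_norm)
          finally show "u - diameter (C n) \<le> x" using z w by simp
        qed
        ultimately show "u \<in> (\<Union>n. J n)" using nN by (intro UN_I[of n]) (auto simp: J_def)
      qed
      then have "emeasure lborel {a..b} \<le> emeasure lborel (\<Union>n. J n)"
        by (intro emeasure_mono) (auto simp: J_def)
      also have "\<dots> \<le> (\<Sum>n. emeasure lborel (J n))"
        by (rule emeasure_subadditive_countably) (auto simp: J_def)
      also have "\<dots> = (\<Sum>n. if n \<in> N i then d n else 0)"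
        by (intro suminf_cong) (auto simp: J_def d_def diameter_ge_0[OF C(2)])
      finally show ?thesis using ab by simp
    qed
    have "of_nat (card I) * ennreal (b - a) = (\<Sum>i\<in>I. ennreal (b - a))" by simp
    also have "\<dots> \<le> (\<Sum>i\<in>I. \<Sum>n. if n \<in> N i then d n else 0)" by (intro sum_mono single)
    also have "\<dots> = (\<Sum>n. \<Sum>i\<in>I. if n \<in> N i then d n else 0)"
      by (rule suminf_sum[symmetric]) simp
    also have "\<dots> \<le> (\<Sum>n. d n)"
    proof (intro suminf_le summableI)
      fix n
      show "(\<Sum>i\<in>I. if n \<in> N i then d n else 0) \<le> d n"
      proof (cases "\<exists>i\<in>I. n \<in> N i")
        case True
        then obtain i where i: "i \<in> I" "n \<in> N i" by blast
        have "j = i" if j: "j \<in> I" "n \<in> N j" for j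
        proof (rule ccontr)
          assume "j \<noteq> i"
          obtain x y where "x \<in> C n" "x \<in> S i" "y \<in> C n" "y \<in> S j" using i j by (auto simp: N_def)
          then show False using sep[OF i(1) j(1) \<open>j \<noteq> i\<close>[symmetric], of x y]
              diameter_bounded_bound[OF C(2), of x n y] C(3)[of n] by auto
        qed
        then have "(\<Sum>j\<in>I. if n \<in> N j then d n else 0) = (\<Sum>j\<in>I. if j = i then d n else 0)"
          using i(2) by (intro sum.cong refl) (metis (full_types))
        also have "\<dots> = d n" using i I by simp
        finally show ?thesis by simp
      qed auto
    qed
    finally show "of_nat (card I) * ennreal (b - a) \<le> (\<Sum>n. ennreal (diameter (C n)))"
      by (simp add: d_def)
  qed
  also have "\<dots> \<le> len E" unfolding len_def by (rule SUP_upper) (use \<delta> in simp)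
  finally show ?thesis .
qed

text \<open>Disjoint compact sets have positive distance, and finitely many of them have a common
  one.\<close>

lemma len_ge_disjoint:
  fixes c :: complex
  assumes I: "finite I"
    and disj: "disjoint_family_on S I" and cpt: "\<And>i. i \<in> I \<Longrightarrow> compact (S i)"
    and cross: "\<And>i. i \<in> I \<Longrightarrow> {a..b} \<subseteq> (\<lambda>z. norm (z - c)) ` S i"
    and sub: "\<And>i. i \<in> I \<Longrightarrow> S i \<subseteq> E" and ab: "a \<le> b"
  shows "of_nat (card I) * ennreal (b - a) \<le> len E"
proof -
  have "\<exists>d>0. i \<noteq> j \<longrightarrow> (\<forall>x\<in>S i. \<forall>y\<in>S j. d < dist x y)" if ij: "i \<in> I" "j \<in> I" for i j
  proof (cases "i = j")
    case False
    then have "S i \<inter> S j = {}" using disj ij by (auto simp: disjoint_family_on_def)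
    then obtain d where d: "d > 0" "\<forall>x\<in>S i. \<forall>y\<in>S j. d \<le> dist x y"
      using separate_compact_closed[OF cpt[OF ij(1)] compact_imp_closed[OF cpt[OF ij(2)]]] by blast
    then show ?thesis by (intro exI[of _ "d/2"]) force
  qed (auto intro: exI[of _ 1])
  then obtain d where d: "\<And>i j. i \<in> I \<Longrightarrow> j \<in> I \<Longrightarrow> d i j > 0 \<and> (i \<noteq> j \<longrightarrow> (\<forall>x\<in>S i. \<forall>y\<in>S j. d i j < dist x y))"
    by metis
  \<comment> \<open>The inserted 1 keeps the set non-empty when \<open>I\<close> is empty.\<close>
  define \<delta> where "\<delta> = Min (insert 1 ((\<lambda>(i, j). d i j) ` (I \<times> I)))"
  have "0 < \<delta>" using I d by (auto simp: \<delta>_def)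
  moreover have "\<delta> \<le> d i j" if "i \<in> I" "j \<in> I" for i j
    unfolding \<delta>_def using I that by (intro Min_le) auto
  ultimately show ?thesis using d
    by (intro len_ge_separated[OF I _ _ cross sub ab, of \<delta>]) force+
qed

text \<open>Such a set crosses every circle around one of its points, so the bound for a single
  crossing set applies with arbitrarily large radius. It serves to verify the infinite length
  demanded of geodesics.\<close>

lemma len_connected_unbounded:
  assumes "connected S" "\<not> bounded S"
  shows "len S = \<infinity>"
proof -
  have "S \<noteq> {}" using assms by auto
  then obtain c where c: "c \<in> S" by blast
  have "ennreal (real n) \<le> len S" for n
  proof -
    have "{0..real n} \<subseteq> (\<lambda>z. norm (z - c)) ` S"
    proof -
      have con: "connected ((\<lambda>z. norm (z - c)) ` S)"
        by (intro connected_continuous_image continuous_intros assms)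
      obtain z where z: "z \<in> S" "real n < norm (z - c)"
      proof (rule ccontr)
        assume "\<not> thesis"
        then have "\<forall>z\<in>S. norm (z - c) \<le> real n" using that by force
        then have "bounded S" unfolding bounded_def dist_norm by (metis norm_minus_commute)
        then show False using assms by simp
      qed
      have "{norm (c - c)..norm (z - c)} \<subseteq> (\<lambda>z. norm (z - c)) ` S"
        by (rule connected_contains_Icc[OF con]) (use c z in auto)
      then show ?thesis using z by auto
    qed
    from len_ge_separated[of "{()}" 1 "\<lambda>_. S" 0 "real n" c S, OF _ _ _ this]
    show ?thesis by simp
  qed
  note * = this
  show ?thesis
  proof (rule ccontr)
    assume "len S \<noteq> \<infinity>"
    then have "len S < top" by (simp add: less_top)
    then obtain n where "len S < of_nat n" using ennreal_Ex_less_of_nat by blast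
    then show False using *[of n] by (simp add: ennreal_of_nat_eq_real_of_nat leD)
  qed
qed

subsection \<open>Finite products of planar Lebesgue measure\<close>

abbreviation lborels :: "nat set \<Rightarrow> (nat \<Rightarrow> complex) measure" where
  "lborels J \<equiv> PiM J (\<lambda>_. lborel)"

interpretation lborels: product_sigma_finite "\<lambda>_::nat. lborel :: complex measure"
  by standard

lemma sets_lborels[measurable_cong]: "sets (lborels J) = sets (PiM J (\<lambda>_. borel))"
  by (intro sets_PiM_cong) auto

text \<open>Measures are determined by their values on boxes only if they are finite; the
  restriction to the bounded box \<open>A\<close> provides this. It identifies three measures: the
  mean number of tuples, the image of Lebesgue measure under a dilation, and the law of the uniform
  points.\<close>

lemma emeasure_unique_on_box:
  assumes J: "finite J" and sets_\<nu>: "sets \<nu> = sets (PiM J (\<lambda>_. borel))"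
    and A: "\<And>j. j \<in> J \<Longrightarrow> A j \<in> sets borel" "\<And>j. j \<in> J \<Longrightarrow> emeasure lborel (A j) < \<infinity>" and c: "c < \<infinity>"
    and box: "\<And>B. (\<And>j. j \<in> J \<Longrightarrow> B j \<in> sets borel) \<Longrightarrow>
      emeasure \<nu> (Pi\<^sub>E J B) = c * (\<Prod>j\<in>J. emeasure lborel (A j \<inter> B j))"
    and S: "S \<in> sets (PiM J (\<lambda>_. borel))"
  shows "emeasure \<nu> S = c * emeasure (lborels J) (Pi\<^sub>E J A \<inter> S)"
proof -
  have boxA: "Pi\<^sub>E J A \<in> sets (lborels J)" using A J by (intro sets_PiM_I_finite) auto
  define Q where "Q = density (lborels J) (\<lambda>x. c * indicator (Pi\<^sub>E J A) x)"
  have Q: "emeasure Q S = c * emeasure (lborels J) (Pi\<^sub>E J A \<inter> S)" if S: "S \<in> sets (PiM J (\<lambda>_. borel))" for S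
  proof -
    have S': "S \<in> sets (lborels J)" using S by (simp add: sets_lborels)
    have "emeasure Q S = (\<integral>\<^sup>+x. c * indicator (Pi\<^sub>E J A) x * indicator S x \<partial>lborels J)"
      unfolding Q_def by (rule emeasure_density[OF _ S']) (use boxA in measurable)
    also have "\<dots> = (\<integral>\<^sup>+x. c * indicator (Pi\<^sub>E J A \<inter> S) x \<partial>lborels J)"
      by (intro nn_integral_cong) (simp add: indicator_inter_arith mult.assoc)
    also have "\<dots> = c * emeasure (lborels J) (Pi\<^sub>E J A \<inter> S)"
      using boxA S' by (intro nn_integral_cmult_indicator) auto
    finally show ?thesis .
  qed
  have "\<nu> = Q"
  proof (rule measure_eqI_PiM_finite[where M = "\<lambda>_. borel", OF J])
    show "sets \<nu> = sets (PiM J (\<lambda>_. borel))" by (rule sets_\<nu>)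
    show "sets Q = sets (PiM J (\<lambda>_. borel))" by (simp add: Q_def sets_lborels)
    show "emeasure \<nu> (Pi\<^sub>E J B) = emeasure Q (Pi\<^sub>E J B)" if B: "\<And>i. i \<in> J \<Longrightarrow> B i \<in> sets borel" for B
    proof -
      have "emeasure Q (Pi\<^sub>E J B) = c * emeasure (lborels J) (Pi\<^sub>E J (\<lambda>j. A j \<inter> B j))"
        using B J by (subst Q) (auto intro!: sets_PiM_I_finite simp: PiE_Int)
      also have "\<dots> = c * (\<Prod>j\<in>J. emeasure lborel (A j \<inter> B j))"
        using A B J by (subst lborels.emeasure_PiM) auto
      finally show ?thesis using box[OF B] by simp
    qed
    show "range (\<lambda>_::nat. Pi\<^sub>E J (\<lambda>_. UNIV)) \<subseteq> prod_algebra J (\<lambda>_. borel)"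
      using J by (auto intro!: prod_algebraI_finite)
    show "(\<Union>i::nat. Pi\<^sub>E J (\<lambda>_. UNIV)) = space (PiM J (\<lambda>_. borel :: complex measure))" by (simp add: space_PiM)
    have "(\<Prod>j\<in>J. emeasure lborel (A j)) < \<infinity>" using A(2) by (simp add: less_top[symmetric] ennreal_prod_eq_top)
    then show "emeasure \<nu> (Pi\<^sub>E J (\<lambda>_. UNIV)) \<noteq> \<infinity>"
      using c by (subst box) (auto simp: ennreal_mult_eq_top_iff)
  qed
  then show ?thesis using Q[OF S] by simp
qed

text \<open>The sets with arbitrarily good approximations form a sigma-algebra. For a countable
  union half of the error is spent on cutting it to a finite union and half on approximating that
  one.\<close>

lemma (in finite_measure) approximate_by_algebra:
  assumes gen: "sets M = sigma_sets (space M) E" "E \<subseteq> \<G>" and sub: "\<G> \<subseteq> sets M" and empty: "{} \<in> \<G>"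
    and compl: "\<And>S. S \<in> \<G> \<Longrightarrow> space M - S \<in> \<G>" and un: "\<And>S T. S \<in> \<G> \<Longrightarrow> T \<in> \<G> \<Longrightarrow> S \<union> T \<in> \<G>"
    and S: "S \<in> sets M" and e: "0 < (e::real)"
  shows "\<exists>H\<in>\<G>. measure M (S - H \<union> (H - S)) < e"
proof -
  have "S \<in> sigma_sets (space M) E" using S gen by simp
  then show ?thesis using e
  proof (induction arbitrary: e rule: sigma_sets.induct)
    case (Basic a)
    then show ?case using gen(2) by (intro bexI[of _ a]) auto
  next
    case Empty
    then show ?case using empty by (intro bexI[of _ "{}"]) auto
  next
    case (Compl a)
    have a: "a \<in> sets M" using Compl.hyps gen(1) by simp
    obtain H where H: "H \<in> \<G>" "measure M (a - H \<union> (H - a)) < e" using Compl by blast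
    have "H \<subseteq> space M" "a \<subseteq> space M" using H sub a sets.sets_into_space by blast+
    then have "(space M - a) - (space M - H) \<union> ((space M - H) - (space M - a)) = a - H \<union> (H - a)" by auto
    then show ?case using H compl by (intro bexI[of _ "space M - H"]) auto
  next
    case (Union a)
    have a: "a i \<in> sets M" for i using Union.hyps gen(1) by simp
    have fin: "\<exists>H\<in>\<G>. measure M ((\<Union>i<n. a i) - H \<union> (H - (\<Union>i<n. a i))) < d" if "0 < d" for n and d :: real
      using that
    proof (induction n arbitrary: d)
      case 0
      then show ?case using empty by (intro bexI[of _ "{}"]) auto
    next
      case (Suc n)
      obtain H where H: "H \<in> \<G>" "measure M ((\<Union>i<n. a i) - H \<union> (H - (\<Union>i<n. a i))) < d / 2"
        using Suc.IH[of "d / 2"] Suc.prems by auto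
      obtain H' where H': "H' \<in> \<G>" "measure M (a n - H' \<union> (H' - a n)) < d / 2"
        using Union.IH[of "d / 2" n] Suc.prems by auto
      have m: "H \<in> sets M" "H' \<in> sets M" "(\<Union>i<n. a i) \<in> sets M" using H H' sub a by auto
      have "measure M ((\<Union>i<Suc n. a i) - (H \<union> H') \<union> (H \<union> H' - (\<Union>i<Suc n. a i)))
        \<le> measure M (((\<Union>i<n. a i) - H \<union> (H - (\<Union>i<n. a i))) \<union> (a n - H' \<union> (H' - a n)))"
        by (rule finite_measure_mono) (use m a in \<open>auto simp: less_Suc_eq\<close>)
      also have "\<dots> \<le> measure M ((\<Union>i<n. a i) - H \<union> (H - (\<Union>i<n. a i))) + measure M (a n - H' \<union> (H' - a n))"
        by (rule measure_Un_le) (use m a in auto)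
      also have "\<dots> < d" using H H' by simp
      finally show ?case using un[OF H(1) H'(1)] by blast
    qed
    have "(\<lambda>n. measure M (\<Union>i<n. a i)) \<longlonglongrightarrow> measure M (\<Union>n. \<Union>i<n. a i)"
      by (rule finite_Lim_measure_incseq) (use a in \<open>auto simp: incseq_def intro: less_le_trans\<close>)
    also have U: "(\<Union>n. \<Union>i<n. a i) = (\<Union>i. a i)" by auto
    finally have "eventually (\<lambda>n. measure M (\<Union>i. a i) - e / 2 < measure M (\<Union>i<n. a i)) sequentially"
      by (rule order_tendstoD) (use Union.prems in simp)
    then obtain n where n: "measure M (\<Union>i. a i) - e / 2 < measure M (\<Union>i<n. a i)"
      by (meson eventually_happens' sequentially_bot)
    obtain H where H: "H \<in> \<G>" "measure M ((\<Union>i<n. a i) - H \<union> (H - (\<Union>i<n. a i))) < e / 2"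
      using fin[of "e / 2" n] Union.prems by auto
    have m: "H \<in> sets M" "(\<Union>i<n. a i) \<in> sets M" "(\<Union>i. a i) \<in> sets M" using H sub a by auto
    have "measure M ((\<Union>i. a i) - H \<union> (H - (\<Union>i. a i)))
        \<le> measure M (((\<Union>i. a i) - (\<Union>i<n. a i)) \<union> ((\<Union>i<n. a i) - H \<union> (H - (\<Union>i<n. a i))))"
      by (rule finite_measure_mono) (use m in auto)
    also have "\<dots> \<le> measure M ((\<Union>i. a i) - (\<Union>i<n. a i)) + measure M ((\<Union>i<n. a i) - H \<union> (H - (\<Union>i<n. a i)))"
      by (rule measure_Un_le) (use m in auto)
    also have "measure M ((\<Union>i. a i) - (\<Union>i<n. a i)) = measure M (\<Union>i. a i) - measure M (\<Union>i<n. a i)"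
      by (rule finite_measure_Diff) (use m in auto)
    finally show ?case using H n by (intro bexI[of _ H]) auto
  qed
qed

lemma exists_cball_box:
  assumes "finite J" "x \<in> extensional J"
  shows "\<exists>n. x \<in> (\<Pi>\<^sub>E j\<in>J. cball (0::complex) (real n))"
proof -
  obtain n where n: "(\<Sum>j\<in>J. norm (x j)) \<le> real n" using real_arch_simple by blast
  have "x j \<in> cball 0 (real n)" if "j \<in> J" for j
    using member_le_sum[of j J "\<lambda>j. norm (x j)"] assms(1) that n by auto
  then have "x \<in> (\<Pi>\<^sub>E j\<in>J. cball (0::complex) (real n))" using assms(2) by (intro PiE_I) (auto simp: extensional_def)
  then show ?thesis ..
qed

lemma grid_cells:
  "{x \<in> J \<rightarrow>\<^sub>E UNIV. (\<lambda>j\<in>J. f (x j)) \<in> P} = (\<Union>p \<in> P \<inter> (J \<rightarrow>\<^sub>E range f). \<Pi>\<^sub>E j\<in>J. f -` {p j})"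
proof (intro subset_antisym subsetI)
  fix x assume x: "x \<in> {x \<in> J \<rightarrow>\<^sub>E UNIV. (\<lambda>j\<in>J. f (x j)) \<in> P}"
  then have "(\<lambda>j\<in>J. f (x j)) \<in> P \<inter> (J \<rightarrow>\<^sub>E range f)" by auto
  moreover have "x \<in> (\<Pi>\<^sub>E j\<in>J. f -` {(\<lambda>j\<in>J. f (x j)) j})" using x by (intro PiE_I) auto
  ultimately show "x \<in> (\<Union>p \<in> P \<inter> (J \<rightarrow>\<^sub>E range f). \<Pi>\<^sub>E j\<in>J. f -` {p j})" by blast
next
  fix x assume "x \<in> (\<Union>p \<in> P \<inter> (J \<rightarrow>\<^sub>E range f). \<Pi>\<^sub>E j\<in>J. f -` {p j})"
  then obtain p where p: "p \<in> P" "p \<in> J \<rightarrow>\<^sub>E range f" and x: "x \<in> (\<Pi>\<^sub>E j\<in>J. f -` {p j})" by blast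
  have "(\<lambda>j\<in>J. f (x j)) = p"
  proof
    fix j show "(\<lambda>j\<in>J. f (x j)) j = p j"
      using PiE_mem[OF x, of j] PiE_arb[OF p(2), of j] by (cases "j \<in> J") auto
  qed
  moreover have "x \<in> J \<rightarrow>\<^sub>E UNIV" using x by (auto simp: PiE_def)
  ultimately show "x \<in> {x \<in> J \<rightarrow>\<^sub>E UNIV. (\<lambda>j\<in>J. f (x j)) \<in> P}" using p by auto
qed

text \<open>Sets that are unions of boxes of a finite grid form an algebra, so a set of positive measure
  almost fills some box of a sufficiently fine measurable grid.\<close>

definition grid_sets :: "nat set \<Rightarrow> (nat \<Rightarrow> complex) set set" where
  "grid_sets J = {{x \<in> space (PiM J (\<lambda>_. borel)). (\<lambda>j\<in>J. f (x j)) \<in> P} |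
     (f :: complex \<Rightarrow> nat) P. f \<in> borel \<rightarrow>\<^sub>M count_space UNIV \<and> finite (range f)}"

lemma grid_setsI:
  "f \<in> borel \<rightarrow>\<^sub>M count_space UNIV \<Longrightarrow> finite (range (f :: complex \<Rightarrow> nat)) \<Longrightarrow>
    {x \<in> space (PiM J (\<lambda>_. borel)). (\<lambda>j\<in>J. f (x j)) \<in> P} \<in> grid_sets J"
  unfolding grid_sets_def by blast

lemma grid_sets_compl: "S \<in> grid_sets J \<Longrightarrow> space (PiM J (\<lambda>_. borel)) - S \<in> grid_sets J"
proof -
  assume "S \<in> grid_sets J"
  then obtain f :: "complex \<Rightarrow> nat" and P where f: "f \<in> borel \<rightarrow>\<^sub>M count_space UNIV" "finite (range f)"
    and S: "S = {x \<in> space (PiM J (\<lambda>_. borel)). (\<lambda>j\<in>J. f (x j)) \<in> P}" unfolding grid_sets_def by blast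
  have "space (PiM J (\<lambda>_. borel)) - S = {x \<in> space (PiM J (\<lambda>_. borel)). (\<lambda>j\<in>J. f (x j)) \<in> - P}"
    unfolding S by auto
  then show ?thesis using f unfolding grid_sets_def by blast
qed

lemma grid_sets_Un:
  assumes "S \<in> grid_sets J" "T \<in> grid_sets J"
  shows "S \<union> T \<in> grid_sets J"
proof -
  obtain f :: "complex \<Rightarrow> nat" and P where f: "f \<in> borel \<rightarrow>\<^sub>M count_space UNIV" "finite (range f)"
    and S: "S = {x \<in> space (PiM J (\<lambda>_. borel)). (\<lambda>j\<in>J. f (x j)) \<in> P}" using assms(1) unfolding grid_sets_def by blast
  obtain g :: "complex \<Rightarrow> nat" and P' where g: "g \<in> borel \<rightarrow>\<^sub>M count_space UNIV" "finite (range g)"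
    and T: "T = {x \<in> space (PiM J (\<lambda>_. borel)). (\<lambda>j\<in>J. g (x j)) \<in> P'}" using assms(2) unfolding grid_sets_def by blast
  \<comment> \<open>The common refinement of both grids; a pair of cell numbers is coded by one
    number to stay within the same type.\<close>
  define h where "h z = prod_encode (f z, g z)" for z
  have "h \<in> borel \<rightarrow>\<^sub>M count_space UNIV" unfolding h_def using f g by measurable
  moreover have "finite (range h)"
    by (rule finite_subset[of _ "prod_encode ` (range f \<times> range g)"]) (use f g in \<open>auto simp: h_def\<close>)
  moreover have "S \<union> T = {x \<in> space (PiM J (\<lambda>_. borel)). (\<lambda>j\<in>J. h (x j)) \<in>
      {p. (\<lambda>j\<in>J. fst (prod_decode (p j))) \<in> P \<or> (\<lambda>j\<in>J. snd (prod_decode (p j))) \<in> P'}}"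
  proof -
    have "(\<lambda>j\<in>J. fst (prod_decode ((\<lambda>j\<in>J. h (x j)) j))) = (\<lambda>j\<in>J. f (x j))"
      "(\<lambda>j\<in>J. snd (prod_decode ((\<lambda>j\<in>J. h (x j)) j))) = (\<lambda>j\<in>J. g (x j))" for x
      by (auto simp: h_def)
    then show ?thesis unfolding S T mem_Collect_eq by auto
  qed
  ultimately show ?thesis unfolding grid_sets_def by blast
qed

lemma grid_sets_measurable:
  assumes "finite J" shows "grid_sets J \<subseteq> sets (PiM J (\<lambda>_. borel))"
proof
  fix S assume "S \<in> grid_sets J"
  then obtain f :: "complex \<Rightarrow> nat" and P where f: "f \<in> borel \<rightarrow>\<^sub>M count_space UNIV" "finite (range f)"
    and S: "S = {x \<in> space (PiM J (\<lambda>_. borel)). (\<lambda>j\<in>J. f (x j)) \<in> P}" unfolding grid_sets_def by blast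
  have "S = (\<Union>p \<in> P \<inter> (J \<rightarrow>\<^sub>E range f). \<Pi>\<^sub>E j\<in>J. f -` {p j})"
    unfolding S space_PiM by (simp only: space_borel grid_cells)
  also have "\<dots> \<in> sets (PiM J (\<lambda>_. borel))"
  proof (intro sets.finite_UN)
    show "finite (P \<inter> (J \<rightarrow>\<^sub>E range f))" using assms f by (intro finite_Int disjI2 finite_PiE) auto
    show "(\<Pi>\<^sub>E j\<in>J. f -` {p j}) \<in> sets (PiM J (\<lambda>_. borel))" for p
      using assms measurable_sets[OF f(1), of "{p _}"] by (intro sets_PiM_I_finite) auto
  qed
  finally show "S \<in> sets (PiM J (\<lambda>_. borel))" .
qed

text \<open>A substitute for a density point, with arbitrary measurable sides in place of cubes.
  \<open>K\<close> is approximated by a union \<open>H\<close> of disjoint grid cells; if every cell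
  missed \<open>K\<close> by a fraction above \<eta>, then \<open>H - K\<close> would exceed the
  error of the approximation.\<close>

lemma dense_box:
  assumes J: "finite J" and K: "K \<in> sets (PiM J (\<lambda>_. borel))" "0 < emeasure (lborels J) K" and \<eta>: "0 < \<eta>"
  obtains A where "\<And>j. j \<in> J \<Longrightarrow> A j \<in> sets borel" "\<And>j. j \<in> J \<Longrightarrow> 0 < emeasure lborel (A j)"
    "\<And>j. j \<in> J \<Longrightarrow> emeasure lborel (A j) < \<infinity>"
    "emeasure (lborels J) (Pi\<^sub>E J A - K) \<le> ennreal \<eta> * emeasure (lborels J) (Pi\<^sub>E J A)"
proof -
  \<comment> \<open>Capped at 1, so that the error is at most a quarter of the measure of
    \<open>K\<close> and \<open>H\<close> cannot be small itself.\<close>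
  define \<eta>' where "\<eta>' = min \<eta> 1"
  have \<eta>': "0 < \<eta>'" "\<eta>' \<le> 1" "\<eta>' \<le> \<eta>" using \<eta> by (auto simp: \<eta>'_def)
  let ?D = "\<lambda>n::nat. \<Pi>\<^sub>E j\<in>J. cball (0::complex) (real n)"
  have D: "?D n \<in> sets (PiM J (\<lambda>_. borel))" for n using J by (intro sets_PiM_I_finite) auto
  \<comment> \<open>The approximation requires a finite measure, hence a bounded part of
    \<open>K\<close> that still has positive measure.\<close>
  have "\<exists>n. emeasure (lborels J) (K \<inter> ?D n) \<noteq> 0"
  proof (rule ccontr)
    assume "\<not> ?thesis"
    then have "emeasure (lborels J) (\<Union>n. K \<inter> ?D n) = 0"
      using K D by (intro emeasure_UN_eq_0) (auto simp: sets_lborels)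
    also have "(\<Union>n. K \<inter> ?D n) = K"
    proof -
      have "K \<subseteq> extensional J" using sets.sets_into_space[OF K(1)] by (auto simp: space_PiM PiE_def)
      then have "K \<subseteq> (\<Union>n. ?D n)" using exists_cball_box[OF J] by blast
      then show ?thesis by blast
    qed
    finally show False using K(2) by simp
  qed
  then obtain n where n: "emeasure (lborels J) (K \<inter> ?D n) \<noteq> 0" by blast
  define M where "M = density (lborels J) (indicator (?D n))"
  have emM: "emeasure M S = emeasure (lborels J) (?D n \<inter> S)" if "S \<in> sets (PiM J (\<lambda>_. borel))" for S
    unfolding M_def by (rule emeasure_restricted) (use D[of n] that in \<open>simp_all add: sets_lborels\<close>)
  have setsM: "sets M = sets (PiM J (\<lambda>_. borel))" by (simp add: M_def sets_lborels)
  have spaceM: "space M = space (PiM J (\<lambda>_. borel))" by (simp add: M_def space_PiM)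
  have "emeasure (lborels J) (?D n) = (\<Prod>j\<in>J. emeasure lborel (cball (0::complex) (real n)))"
    using J by (subst lborels.emeasure_PiM) auto
  also have "\<dots> < \<infinity>" using emeasure_lborel_cball_finite[of "0::complex" "real n"] by (simp add: less_top[symmetric] ennreal_prod_eq_top del: prod_constant)
  finally have Dfin: "emeasure (lborels J) (?D n) < \<infinity>" .
  interpret M: finite_measure M
  proof
    have "space M \<in> sets (PiM J (\<lambda>_. borel))" by (simp add: spaceM)
    then have "emeasure M (space M) \<le> emeasure (lborels J) (?D n)"
      using D[of n] by (subst emM) (auto intro!: emeasure_mono simp: sets_lborels)
    then show "emeasure M (space M) \<noteq> \<infinity>" using Dfin by (auto simp: top_unique)
  qed
  have Kpos: "0 < measure M K"
  proof -
    have "emeasure M K \<noteq> 0" using n emM[OF K(1)] by (simp add: Int_commute)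
    then have "measure M K \<noteq> 0" by (auto simp: M.emeasure_eq_measure)
    then show ?thesis using measure_nonneg[of M K] by linarith
  qed
  obtain H where H: "H \<in> grid_sets J" "measure M (K - H \<union> (H - K)) < \<eta>' / 4 * measure M K"
  proof -
    have "\<exists>H\<in>grid_sets J. measure M (K - H \<union> (H - K)) < \<eta>' / 4 * measure M K"
    proof (rule M.approximate_by_algebra)
      show "sets M = sigma_sets (space M) {{f \<in> J \<rightarrow>\<^sub>E UNIV. f i \<in> A} | i A. i \<in> J \<and> A \<in> sets borel}"
        unfolding setsM spaceM by (simp add: sets_PiM_single space_PiM)
      show "{{f \<in> J \<rightarrow>\<^sub>E UNIV. f i \<in> A} | i A. i \<in> J \<and> A \<in> sets (borel::complex measure)} \<subseteq> grid_sets J"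
      proof safe
        fix i and A :: "complex set" assume i: "i \<in> J" and A: "A \<in> sets borel"
        let ?f = "\<lambda>z. if z \<in> A then 1 else (0::nat)"
        have f: "?f \<in> borel \<rightarrow>\<^sub>M count_space UNIV" using A by measurable
        have fin: "finite (range ?f)" by (rule finite_subset[of _ "{0, 1}"]) auto
        have eq: "{f \<in> J \<rightarrow>\<^sub>E UNIV. f i \<in> A} = {x \<in> space (PiM J (\<lambda>_. borel)). (\<lambda>j\<in>J. ?f (x j)) \<in> {p. p i = 1}}"
          using i by (auto simp: space_PiM split: if_splits)
        show "{f \<in> J \<rightarrow>\<^sub>E UNIV. f i \<in> A} \<in> grid_sets J" unfolding eq by (rule grid_setsI[OF f fin])
      qed
      show "grid_sets J \<subseteq> sets M" using grid_sets_measurable[OF J] by (simp add: setsM)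
      have "{x \<in> space (PiM J (\<lambda>_. borel)). (\<lambda>j\<in>J. (\<lambda>_. 0::nat) (x j)) \<in> {}} \<in> grid_sets J"
        by (rule grid_setsI) auto
      then show "{} \<in> grid_sets J" by simp
      show "space M - S \<in> grid_sets J" if "S \<in> grid_sets J" for S
        using grid_sets_compl[OF that] by (simp add: spaceM)
      show "K \<in> sets M" using K by (simp add: setsM)
      show "0 < \<eta>' / 4 * measure M K" using Kpos \<eta>' by simp
    qed (rule grid_sets_Un)
    then show thesis using that by blast
  qed
  obtain f :: "complex \<Rightarrow> nat" and P where f: "f \<in> borel \<rightarrow>\<^sub>M count_space UNIV" "finite (range f)"
    and Hf: "H = {x \<in> space (PiM J (\<lambda>_. borel)). (\<lambda>j\<in>J. f (x j)) \<in> P}" using H(1) unfolding grid_sets_def by blast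
  let ?P = "P \<inter> (J \<rightarrow>\<^sub>E range f)"
  let ?cell = "\<lambda>p. \<Pi>\<^sub>E j\<in>J. f -` {p j}"
  have finP: "finite ?P" using J f by (intro finite_Int disjI2 finite_PiE) auto
  have fset: "f -` {i} \<in> sets borel" for i using measurable_sets[OF f(1), of "{i}"] by simp
  have cell: "?cell p \<in> sets M" for p unfolding setsM using J fset by (intro sets_PiM_I_finite) auto
  have Hcell: "H = (\<Union>p\<in>?P. ?cell p)"
    unfolding Hf space_PiM by (simp only: space_borel grid_cells)
  have disj: "disjoint_family_on ?cell ?P"
    unfolding disjoint_family_on_def
  proof safe
    fix p p' x assume p: "p \<in> J \<rightarrow>\<^sub>E range f" "p' \<in> J \<rightarrow>\<^sub>E range f" "p \<noteq> p'" and x: "x \<in> ?cell p" "x \<in> ?cell p'"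
    have "p j = p' j" if "j \<in> J" for j using x that by (auto simp: PiE_def Pi_def)
    then have "p = p'" using p(1,2) by (intro PiE_ext[of p J]) auto
    then show "x \<in> {}" using p by simp
  qed
  have HM: "H \<in> sets M" "K \<in> sets M" using Hcell cell finP K by (auto simp: setsM)
  have "\<exists>p\<in>?P. 0 < measure M (?cell p) \<and> measure M (?cell p - K) \<le> \<eta>' * measure M (?cell p)"
  proof (rule ccontr)
    assume nt: "\<not> (\<exists>p\<in>?P. 0 < measure M (?cell p) \<and> measure M (?cell p - K) \<le> \<eta>' * measure M (?cell p))"
    have bad: "\<eta>' * measure M (?cell p) \<le> measure M (?cell p - K)" if "p \<in> ?P" for p
    proof (cases "0 < measure M (?cell p)")
      case True
      then have "\<not> measure M (?cell p - K) \<le> \<eta>' * measure M (?cell p)"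
        using nt that by blast
      then show ?thesis by simp
    next
      case False
      then have "measure M (?cell p) = 0" using measure_nonneg[of M "?cell p"] by linarith
      then show ?thesis by simp
    qed
    have "\<eta>' * measure M H = (\<Sum>p\<in>?P. \<eta>' * measure M (?cell p))"
      unfolding Hcell by (subst M.finite_measure_finite_Union[OF finP _ disj]) (use cell in \<open>auto simp: sum_distrib_left\<close>)
    also have "\<dots> \<le> (\<Sum>p\<in>?P. measure M (?cell p - K))" by (intro sum_mono bad)
    also have "\<dots> = measure M (\<Union>p\<in>?P. ?cell p - K)"
      by (rule M.finite_measure_finite_Union[OF finP, symmetric]) (use cell HM disj in \<open>auto simp: disjoint_family_on_def\<close>)
    also have "(\<Union>p\<in>?P. ?cell p - K) = H - K" unfolding Hcell by blast
    also have "measure M (H - K) \<le> measure M (K - H \<union> (H - K))" using HM by (intro M.finite_measure_mono) auto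
    finally have 1: "\<eta>' * measure M H < \<eta>' / 4 * measure M K" using H(2) by simp
    have "measure M K \<le> measure M (H \<union> (K - H \<union> (H - K)))" using HM by (intro M.finite_measure_mono) auto
    also have "\<dots> \<le> measure M H + measure M (K - H \<union> (H - K))" using HM by (intro measure_Un_le) auto
    also have "\<dots> \<le> measure M H + measure M K / 4"
    proof -
      have "\<eta>' / 4 * measure M K \<le> measure M K / 4"
        using mult_right_mono[OF \<eta>'(2), of "measure M K / 4"] Kpos by simp
      then show ?thesis using H(2) by linarith
    qed
    finally have "measure M K / 4 \<le> measure M H" using Kpos by linarith
    then have "\<eta>' * (measure M K / 4) \<le> \<eta>' * measure M H" using \<eta>'(1) by (intro mult_left_mono) auto
    then show False using 1 by linarith
  qed
  then obtain p where p: "0 < measure M (?cell p)" "measure M (?cell p - K) \<le> \<eta>' * measure M (?cell p)" by blast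
  define A where "A j = cball 0 (real n) \<inter> f -` {p j}" for j
  have Abox: "?D n \<inter> ?cell p = Pi\<^sub>E J A" by (auto simp: A_def PiE_Int)
  have A1: "A j \<in> sets borel" for j using fset by (auto simp: A_def)
  have A2: "emeasure lborel (A j) < \<infinity>" for j
    using emeasure_mono[of "A j" "cball 0 (real n)" lborel] emeasure_lborel_cball_finite[of "0::complex" "real n"]
    by (auto simp: A_def intro: le_less_trans)
  have e1: "emeasure M (?cell p) = emeasure (lborels J) (Pi\<^sub>E J A)" using emM[of "?cell p"] cell by (simp add: setsM Abox)
  have e2: "emeasure M (?cell p - K) = emeasure (lborels J) (Pi\<^sub>E J A - K)"
    using emM[of "?cell p - K"] cell[of p] HM by (simp add: setsM Abox[symmetric] Int_Diff)
  have "0 < emeasure (lborels J) (Pi\<^sub>E J A)" using p(1) unfolding e1[symmetric] by (simp add: M.emeasure_eq_measure)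
  moreover have "emeasure (lborels J) (Pi\<^sub>E J A) = (\<Prod>j\<in>J. emeasure lborel (A j))"
    by (rule lborels.emeasure_PiM[OF J]) (use A1 in simp)
  ultimately have pos: "(\<Prod>j\<in>J. emeasure lborel (A j)) \<noteq> 0" by (metis less_irrefl)
  have A3: "0 < emeasure lborel (A j)" if "j \<in> J" for j
  proof (rule ccontr)
    assume "\<not> 0 < emeasure lborel (A j)"
    then have "emeasure lborel (A j) = 0" by simp
    then have "(\<Prod>j\<in>J. emeasure lborel (A j)) = 0" using J that by (intro prod_zero) auto
    then show False using pos by simp
  qed
  have "emeasure M (?cell p - K) \<le> ennreal \<eta>' * emeasure M (?cell p)"
    using p(2) \<eta>' by (simp add: M.emeasure_eq_measure ennreal_mult[symmetric])
  also have "\<dots> \<le> ennreal \<eta> * emeasure M (?cell p)" using \<eta>' by (intro mult_right_mono ennreal_leI) auto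
  finally have le: "emeasure (lborels J) (Pi\<^sub>E J A - K) \<le> ennreal \<eta> * emeasure (lborels J) (Pi\<^sub>E J A)"
    unfolding e1 e2 .
  show thesis by (rule that[of A]) (use A1 A3 A2 le in blast)+
qed

section \<open>Lebesgue null sets under dilations, translations and sections\<close>

lemma emeasure_lborel_affine_vimage:
  fixes a :: complex
  assumes "0 < c" "B \<in> sets borel"
  shows "emeasure lborel ((\<lambda>z. c *\<^sub>R z + a) -` B) = ennreal (1 / c\<^sup>2) * emeasure lborel B"
proof -
  have m: "(\<lambda>z. c *\<^sub>R z + a) \<in> borel_measurable borel" by measurable
  have "lborel = density (distr lborel borel (\<lambda>x::complex. a + c *\<^sub>R x)) (\<lambda>_. ennreal (\<bar>c\<bar> ^ DIM(complex)))"
    by (rule lborel_affine) (use assms in auto)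
  then have "emeasure lborel B = emeasure (density (distr lborel borel (\<lambda>x::complex. c *\<^sub>R x + a)) (\<lambda>_. ennreal (c\<^sup>2))) B"
    using assms by (simp add: add.commute)
  also have "\<dots> = ennreal (c\<^sup>2) * emeasure lborel ((\<lambda>z. c *\<^sub>R z + a) -` B)"
    using assms m by (simp add: emeasure_density nn_integral_cmult_indicator emeasure_distr)
  finally have "ennreal (1 / c\<^sup>2) * emeasure lborel B = (ennreal (1 / c\<^sup>2) * ennreal (c\<^sup>2)) * emeasure lborel ((\<lambda>z. c *\<^sub>R z + a) -` B)"
    by (simp add: mult.assoc)
  also have "ennreal (1 / c\<^sup>2) * ennreal (c\<^sup>2) = 1" using assms by (simp add: ennreal_mult[symmetric])
  finally show ?thesis by simp
qed

text \<open>The image of Lebesgue measure is a multiple of Lebesgue measure. This is checked on the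
  bounded boxes \<open>?D n\<close>, where both measures are finite, and is enough for null sets to
  pull back to null sets.\<close>

lemma AE_lborels_affine:
  assumes J: "finite J" and c: "0 < c" and AE: "AE y in lborels J. P y"
  shows "AE y in lborels J. P (\<lambda>j\<in>J. c *\<^sub>R y j + a)"
proof -
  let ?T = "\<lambda>y. \<lambda>j\<in>J. c *\<^sub>R y j + a :: complex"
  have T[measurable]: "?T \<in> lborels J \<rightarrow>\<^sub>M PiM J (\<lambda>_. borel)" by measurable
  obtain N where N: "{y \<in> space (lborels J). \<not> P y} \<subseteq> N" "N \<in> sets (lborels J)" "emeasure (lborels J) N = 0"
    using AE by (auto elim!: AE_E)
  have N': "N \<in> sets (PiM J (\<lambda>_. borel))" using N by (simp add: sets_lborels)
  define \<nu> where "\<nu> = distr (lborels J) (PiM J (\<lambda>_. borel)) ?T"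
  let ?D = "\<lambda>n::nat. \<Pi>\<^sub>E j\<in>J. cball (0::complex) (real n)"
  have D: "?D n \<in> sets (PiM J (\<lambda>_. borel))" for n using J by (intro sets_PiM_I_finite) auto
  have rect: "emeasure \<nu> (Pi\<^sub>E J B) = (\<Prod>j\<in>J. ennreal (1 / c\<^sup>2) * emeasure lborel (B j))"
    if B: "\<And>j. j \<in> J \<Longrightarrow> B j \<in> sets borel" for B
  proof -
    have "?T -` Pi\<^sub>E J B \<inter> space (lborels J) = (\<Pi>\<^sub>E j\<in>J. (\<lambda>z. c *\<^sub>R z + a) -` B j)"
      by (auto simp: space_PiM PiE_def Pi_def)
    then have "emeasure \<nu> (Pi\<^sub>E J B) = emeasure (lborels J) (\<Pi>\<^sub>E j\<in>J. (\<lambda>z. c *\<^sub>R z + a) -` B j)"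
      unfolding \<nu>_def using B J by (subst emeasure_distr) (auto intro!: sets_PiM_I_finite)
    also have "\<dots> = (\<Prod>j\<in>J. emeasure lborel ((\<lambda>z. c *\<^sub>R z + a) -` B j))"
    proof (rule lborels.emeasure_PiM[OF J])
      fix j assume "j \<in> J"
      then have "(\<lambda>z. c *\<^sub>R z + a) -` B j \<inter> space borel \<in> sets borel" by (intro measurable_sets[OF _ B]) auto
      then show "(\<lambda>z. c *\<^sub>R z + a) -` B j \<in> sets lborel" by simp
    qed
    also have "\<dots> = (\<Prod>j\<in>J. ennreal (1 / c\<^sup>2) * emeasure lborel (B j))"
      using emeasure_lborel_affine_vimage[OF c B] by (intro prod.cong) auto
    finally show ?thesis .
  qed
  have zero: "emeasure \<nu> (?D n \<inter> N) = 0" for n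
  proof -
    define \<nu>' where "\<nu>' = density \<nu> (indicator (?D n))"
    have sets\<nu>: "sets \<nu> = sets (PiM J (\<lambda>_. borel))" by (simp add: \<nu>_def)
    have em: "emeasure \<nu>' S = emeasure \<nu> (?D n \<inter> S)" if "S \<in> sets (PiM J (\<lambda>_. borel))" for S
      unfolding \<nu>'_def by (rule emeasure_restricted) (use D[of n] that in \<open>simp_all add: sets\<nu>\<close>)
    have "emeasure \<nu>' N = (\<Prod>j\<in>J. ennreal (1 / c\<^sup>2)) * emeasure (lborels J) (?D n \<inter> N)"
    proof (rule emeasure_unique_on_box[OF J _ _ _ _ _ N'])
      show "sets \<nu>' = sets (PiM J (\<lambda>_. borel))" by (simp add: \<nu>'_def sets\<nu>)
      show "emeasure lborel (cball (0::complex) (real n)) < \<infinity>" using emeasure_lborel_cball_finite by (simp add: less_top)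
      show "(\<Prod>j\<in>J. ennreal (1 / c\<^sup>2)) < \<infinity>" by (simp add: power_less_top_ennreal)
      fix B assume B: "\<And>j. j \<in> J \<Longrightarrow> B j \<in> sets (borel :: complex measure)"
      have "emeasure \<nu>' (Pi\<^sub>E J B) = emeasure \<nu> (\<Pi>\<^sub>E j\<in>J. cball 0 (real n) \<inter> B j)"
        using B J by (subst em) (auto intro!: sets_PiM_I_finite simp: PiE_Int)
      also have "\<dots> = (\<Prod>j\<in>J. ennreal (1 / c\<^sup>2) * emeasure lborel (cball 0 (real n) \<inter> B j))"
        by (rule rect) (use B in auto)
      finally show "emeasure \<nu>' (Pi\<^sub>E J B) = (\<Prod>j\<in>J. ennreal (1 / c\<^sup>2)) * (\<Prod>j\<in>J. emeasure lborel (cball 0 (real n) \<inter> B j))"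
        by (simp only: prod.distrib)
    qed simp
    also have "emeasure (lborels J) (?D n \<inter> N) = 0"
      using N(2,3) D[of n] emeasure_mono[of "?D n \<inter> N" N "lborels J"] by auto
    finally show ?thesis using em[OF N'] by simp
  qed
  have "N \<subseteq> extensional J" using sets.sets_into_space[OF N(2)] by (auto simp: space_PiM PiE_def)
  then have "N \<subseteq> (\<Union>n. ?D n)" using exists_cball_box[OF J] by blast
  then have "N = (\<Union>n. ?D n \<inter> N)" by blast
  moreover have "emeasure \<nu> (\<Union>n. ?D n \<inter> N) = 0"
    by (rule emeasure_UN_eq_0) (use zero D N' in \<open>auto simp: \<nu>_def\<close>)
  ultimately have "emeasure \<nu> N = 0" by simp
  then have "N \<in> null_sets \<nu>" using N' by (auto simp: \<nu>_def)
  then have "AE y in \<nu>. y \<notin> N" by (rule AE_not_in)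
  then have "AE y in lborels J. ?T y \<notin> N" unfolding \<nu>_def using N' by (subst (asm) AE_distr_iff) auto
  then show ?thesis
  proof (eventually_elim)
    case (elim y)
    have "?T y \<in> space (lborels J)" by (simp add: space_PiM)
    then show ?case using elim N(1) by blast
  qed
qed

text \<open>Fubini: almost every value of the coordinate \<open>i\<close> is good, and a set
  \<open>B\<close> of positive measure contains a good one. It will fix the base point of a network
  near the origin.\<close>

lemma AE_lborels_section:
  assumes J: "finite J" "i \<notin> J" and AE: "AE z in lborels (insert i J). P z"
    and B: "B \<in> sets borel" "0 < emeasure lborel B"
  obtains w where "w \<in> B" "AE y in lborels J. P (y(i := w))"
proof -
  obtain N where N: "{z \<in> space (lborels (insert i J)). \<not> P z} \<subseteq> N" "N \<in> sets (lborels (insert i J))" "emeasure (lborels (insert i J)) N = 0"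
    using AE by (auto elim!: AE_E)
  note [measurable] = N(2)
  have m[measurable]: "(\<lambda>(y, w). indicator N (y(i := w)) :: ennreal) \<in> borel_measurable (lborels J \<Otimes>\<^sub>M lborel)"
    by measurable
  have "(\<integral>\<^sup>+ w. (\<integral>\<^sup>+ y. indicator N (y(i := w)) \<partial>lborels J) \<partial>lborel) = (\<integral>\<^sup>+ z. indicator N z \<partial>lborels (insert i J))"
    using J by (subst lborels.product_nn_integral_insert_rev) auto
  also have "\<dots> = 0" using N by simp
  finally have 0: "(\<integral>\<^sup>+ w. (\<integral>\<^sup>+ y. indicator N (y(i := w)) \<partial>lborels J) \<partial>lborel) = 0" .
  interpret sigma_finite_measure "lborels J" by (rule lborels.sigma_finite[OF J(1)])
  have "(\<lambda>w. \<integral>\<^sup>+ y. indicator N (y(i := w)) \<partial>lborels J) \<in> borel_measurable lborel"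
    by (rule borel_measurable_nn_integral) measurable
  then have AEw: "AE w in lborel. (\<integral>\<^sup>+ y. indicator N (y(i := w)) \<partial>lborels J) = 0"
    using 0 by (subst (asm) nn_integral_0_iff_AE) auto
  have "\<exists>w\<in>B. (\<integral>\<^sup>+ y. indicator N (y(i := w)) \<partial>lborels J) = 0"
  proof (rule ccontr)
    assume "\<not> ?thesis"
    then have "AE w in lborel. w \<notin> B" using AEw by (intro AE_mp[OF AEw AE_I2]) blast
    then have "emeasure lborel B = 0" using B(1) by (subst (asm) AE_iff_measurable[of B]) auto
    then show False using B(2) by simp
  qed
  then obtain w where w: "w \<in> B" "(\<integral>\<^sup>+ y. indicator N (y(i := w)) \<partial>lborels J) = 0" by blast
  have "AE y in lborels J. indicator N (y(i := w)) = (0::ennreal)"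
    using w(2) by (subst (asm) nn_integral_0_iff_AE) auto
  then have "AE y in lborels J. P (y(i := w))"
  proof (rule AE_mp[OF _ AE_I2[OF impI]])
    fix y assume "y \<in> space (lborels J)" "indicator N (y(i := w)) = (0::ennreal)"
    then have "y(i := w) \<in> space (lborels (insert i J))" "y(i := w) \<notin> N"
      by (auto simp: space_PiM PiE_def extensional_def indicator_def split: if_splits)
    then show "P (y(i := w))" using N(1) by blast
  qed
  then show thesis using that w by blast
qed

subsection \<open>Poisson processes\<close>

lemma exp_sums: "(\<lambda>k. x ^ k / fact k) sums exp (x::real)"
  using exp_converges[of x] by (simp add: divide_inverse mult.commute)

lemma poisson_mean:
  assumes m: "0 < m"
  shows "(\<integral>\<^sup>+ k. of_nat k \<partial>measure_pmf (poisson_pmf m)) = ennreal m"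
proof -
  let ?p = "\<lambda>k. m ^ k / fact k * exp (- m)"
  from exp_sums[of m] have "(\<lambda>k. m ^ k / fact k * (m * exp (- m))) sums (exp m * (m * exp (- m)))" by (rule sums_mult2)
  moreover have "exp m * (m * exp (- m)) = m" by (simp add: exp_minus field_simps)
  moreover have "m ^ k / fact k * (m * exp (- m)) = ?p (Suc k) * real (Suc k)" for k
    by (simp add: field_simps del: of_nat_Suc)
  ultimately have "(\<lambda>k. ?p (Suc k) * real (Suc k)) sums m" by (simp only:)
  then have "(\<lambda>k. ?p k * real k) sums (m + ?p 0 * real 0)" by (rule sums_Suc)
  then have s: "(\<lambda>k. ?p k * real k) sums m" by simp
  have "(\<integral>\<^sup>+ k. of_nat k \<partial>measure_pmf (poisson_pmf m)) = (\<Sum>k. ennreal (?p k) * of_nat k)"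
    using m by (simp add: nn_integral_measure_pmf nn_integral_count_space_nat)
  also have "\<dots> = (\<Sum>k. ennreal (?p k * real k))"
    using m by (intro suminf_cong) (simp add: ennreal_mult[symmetric] ennreal_of_nat_eq_real_of_nat)
  also have "\<dots> = ennreal (\<Sum>k. ?p k * real k)"
    using m by (intro suminf_ennreal2 sums_summable[OF s]) simp
  also have "\<dots> = ennreal m" by (simp only: sums_unique[OF s, symmetric])
  finally show ?thesis .
qed

text \<open>Markov's inequality for \<open>2^(-k)\<close>.\<close>

lemma poisson_lower_tail:
  assumes m: "0 < m"
  shows "measure (measure_pmf (poisson_pmf m)) {k. real k \<le> m / 4} \<le> exp (- m / 4)"
proof -
  let ?p = "\<lambda>k. m ^ k / fact k * exp (- m)"
  from exp_sums[of "m / 2"] have "(\<lambda>k. (m / 2) ^ k / fact k * exp (- m)) sums (exp (m / 2) * exp (- m))" by (rule sums_mult2)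
  moreover have "exp (m / 2) * exp (- m) = exp (- m / 2)" by (simp add: mult_exp_exp)
  moreover have "(m / 2) ^ k / fact k * exp (- m) = ?p k * (1 / 2) ^ k" for k
    by (simp add: power_divide field_simps)
  ultimately have s: "(\<lambda>k. ?p k * (1 / 2) ^ k) sums exp (- m / 2)" by (simp only:)
  have "(\<integral>\<^sup>+ k. ennreal ((1 / 2) ^ k) \<partial>measure_pmf (poisson_pmf m)) = (\<Sum>k. ennreal (?p k) * ennreal ((1 / 2) ^ k))"
    using m by (simp add: nn_integral_measure_pmf nn_integral_count_space_nat)
  also have "\<dots> = (\<Sum>k. ennreal (?p k * (1 / 2) ^ k))"
    using m by (intro suminf_cong) (simp add: ennreal_mult[symmetric])
  also have "\<dots> = ennreal (\<Sum>k. ?p k * (1 / 2) ^ k)"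
    using m by (intro suminf_ennreal2 sums_summable[OF s]) simp
  also have "\<dots> = ennreal (exp (- m / 2))" by (simp only: sums_unique[OF s, symmetric])
  finally have int: "(\<integral>\<^sup>+ k. ennreal ((1 / 2) ^ k) \<partial>measure_pmf (poisson_pmf m)) = ennreal (exp (- m / 2))" .
  have ge: "1 \<le> exp (m / 4) * (1 / 2) ^ k" if k: "real k \<le> m / 4" for k :: nat
  proof -
    have "(2::real) ^ k \<le> exp 1 ^ k" using exp_ge_add_one_self[of 1] by (intro power_mono) auto
    also have "\<dots> = exp (real k)" by (simp add: exp_of_nat_mult[symmetric])
    also have "\<dots> \<le> exp (m / 4)" using k by simp
    finally show ?thesis by (simp add: power_one_over field_simps)
  qed
  have "emeasure (measure_pmf (poisson_pmf m)) {k. real k \<le> m / 4}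
      = (\<integral>\<^sup>+ k. indicator {k. real k \<le> m / 4} k \<partial>measure_pmf (poisson_pmf m))" by simp
  also have "\<dots> \<le> (\<integral>\<^sup>+ k. ennreal (exp (m / 4)) * ennreal ((1 / 2) ^ k) \<partial>measure_pmf (poisson_pmf m))"
  proof (rule nn_integral_mono)
    fix k :: nat
    show "indicator {k. real k \<le> m / 4} k \<le> ennreal (exp (m / 4)) * ennreal ((1 / 2) ^ k)"
      using ge[of k] by (auto simp: indicator_def ennreal_mult[symmetric] simp del: ennreal_1 simp flip: ennreal_1 intro!: ennreal_leI)
  qed
  also have "\<dots> = ennreal (exp (m / 4) * exp (- m / 2))"
    using int by (simp add: nn_integral_cmult ennreal_mult)
  also have "exp (m / 4) * exp (- m / 2) = exp (- m / 4)" by (simp add: mult_exp_exp)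
  finally show ?thesis by (simp add: measure_pmf.emeasure_eq_measure)
qed

lemma poisson_two_or_more:
  assumes m: "0 < m"
  shows "measure (measure_pmf (poisson_pmf m)) {k. 2 \<le> k} \<le> m\<^sup>2"
proof -
  have "{k::nat. 2 \<le> k} = UNIV - {0, 1}" by auto
  then have "measure (measure_pmf (poisson_pmf m)) {k. 2 \<le> k} = 1 - measure (measure_pmf (poisson_pmf m)) {0, 1}"
    using measure_pmf.prob_compl[of "{0, 1}" "poisson_pmf m"] by simp
  also have "measure (measure_pmf (poisson_pmf m)) {0, 1} = exp (- m) + m * exp (- m)"
    using m by (subst measure_measure_pmf_finite) auto
  also have "1 - (exp (- m) + m * exp (- m)) = 1 - exp (- m) * (1 + m)" by (simp add: algebra_simps)
  also have "\<dots> \<le> 1 - (1 - m) * (1 + m)"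
    using exp_ge_add_one_self[of "- m"] m by (intro diff_left_mono mult_right_mono) auto
  also have "\<dots> = m\<^sup>2" by (simp add: algebra_simps power2_eq_square)
  finally show ?thesis .
qed

lemma sets_space_time_Times:
  assumes "A \<in> sets borel" "I \<in> sets borel" "I \<subseteq> {0..}"
  shows "A \<times> I \<in> sets space_time" "emeasure space_time (A \<times> I) = emeasure lborel A * emeasure lborel I"
proof -
  have m: "A \<times> I \<in> sets (lborel :: (complex \<times> real) measure)"
    unfolding lborel_prod[symmetric] using assms by (intro pair_measureI) auto
  have S: "UNIV \<times> {0..} \<inter> space lborel \<in> sets (lborel :: (complex \<times> real) measure)"
  proof -
    have "UNIV \<times> {0..} \<in> sets (lborel \<Otimes>\<^sub>M lborel :: (complex \<times> real) measure)" by (intro pair_measureI) auto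
    then show ?thesis unfolding lborel_prod by (simp only: space_lborel space_borel Int_UNIV_right)
  qed
  have sub: "A \<times> I \<subseteq> UNIV \<times> {0..}" using assms by auto
  show "A \<times> I \<in> sets space_time"
    unfolding space_time_def using m sub S by (subst sets_restrict_space_iff) auto
  have "emeasure space_time (A \<times> I) = emeasure lborel (A \<times> I)"
    unfolding space_time_def by (rule emeasure_restrict_space[OF S sub])
  also have "\<dots> = emeasure lborel A * emeasure lborel I"
    unfolding lborel_prod[symmetric] using assms by (intro lborel.emeasure_pair_measure_Times) auto
  finally show "emeasure space_time (A \<times> I) = emeasure lborel A * emeasure lborel I" .
qed

section \<open>Tuples of Poisson points and their mean number\<close>

text \<open>Dividing by \<open>c\<close> lets one fixed set \<open>K\<close> be sought at every
  scale. The density of the rescaled points is \<open>l * c\<^sup>2\<close>, so a large scale can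
  replace a late time.\<close>

definition hit_tuple :: "nat set \<Rightarrow> (nat \<Rightarrow> complex) set \<Rightarrow> real \<Rightarrow> real \<Rightarrow> (nat \<Rightarrow> complex \<times> real) \<Rightarrow> (nat \<Rightarrow> nat) \<Rightarrow> bool" where
  "hit_tuple J K l c x i \<longleftrightarrow> inj_on i J \<and> (\<forall>j\<in>J. snd (x (i j)) \<le> l) \<and> (\<lambda>j\<in>J. (1 / c) *\<^sub>R fst (x (i j))) \<in> K"

locale poisson_points = prob_space M for M :: "'w measure" +
  fixes Z :: "'w \<Rightarrow> nat \<Rightarrow> complex \<times> real"
  assumes poisson: "poisson_process M space_time Z"
begin

lemma measurable_Z: "(\<lambda>\<omega>. Z \<omega> n) \<in> M \<rightarrow>\<^sub>M space_time"
  using poisson by (simp add: poisson_process_def)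

lemma measurable_Z_borel[measurable]: "(\<lambda>\<omega>. Z \<omega> n) \<in> M \<rightarrow>\<^sub>M borel \<Otimes>\<^sub>M borel"
  using measurable_Z[of n] unfolding space_time_def
  by (simp add: measurable_restrict_space2_iff borel_prod measurable_lborel1)

lemma Z_time_nonneg: "\<omega> \<in> space M \<Longrightarrow> 0 \<le> snd (Z \<omega> n)"
  using measurable_space[OF measurable_Z, of \<omega> n] by (auto simp: space_time_def space_restrict_space)

abbreviation "hits A \<omega> \<equiv> card {n. Z \<omega> n \<in> A}"

lemma AE_finite_count:
  assumes "A \<in> sets space_time" "emeasure space_time A < \<infinity>"
  shows "AE \<omega> in M. finite {n. Z \<omega> n \<in> A}"
  using poisson assms unfolding poisson_process_def by blast

lemma indep_counts:
  assumes J: "finite (J :: nat set)" and disj: "disjoint_family_on A J"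
    and A: "\<And>j. j \<in> J \<Longrightarrow> A j \<in> sets space_time" "\<And>j. j \<in> J \<Longrightarrow> emeasure space_time (A j) < \<infinity>"
  shows "indep_vars (\<lambda>_. count_space UNIV) (\<lambda>j. hits (A j)) J"
proof -
  let ?A = "\<lambda>j. if j \<in> J then A j else {}"
  have "disjoint_family ?A" using disj by (auto simp: disjoint_family_on_def)
  moreover have "\<forall>i. ?A i \<in> sets space_time \<and> emeasure space_time (?A i) < \<infinity>" using A by simp
  ultimately have "indep_vars (\<lambda>_. count_space UNIV) (\<lambda>j. hits (?A j)) UNIV"
    using poisson unfolding poisson_process_def by blast
  then have "indep_vars (\<lambda>_. count_space UNIV) (\<lambda>j. hits (?A j)) J" by (rule indep_vars_subset) simp
  then show ?thesis by (rule indep_vars_cong[THEN iffD1, rotated -1]) auto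
qed

lemma measurable_count:
  assumes "A \<in> sets space_time" "emeasure space_time A < \<infinity>"
  shows "hits A \<in> M \<rightarrow>\<^sub>M count_space UNIV"
proof -
  have "indep_vars (\<lambda>_. count_space UNIV) (\<lambda>j. hits ((\<lambda>_. A) j)) {0::nat}"
    by (rule indep_counts) (use assms in \<open>auto simp: disjoint_family_on_def\<close>)
  then show ?thesis by (simp add: indep_vars_def)
qed

lemma distr_count:
  assumes "A \<in> sets space_time" "0 < emeasure space_time A" "emeasure space_time A < \<infinity>"
  shows "distr M (count_space UNIV) (hits A) = measure_pmf (poisson_pmf (measure space_time A))"
  using poisson assms unfolding poisson_process_def by blast

lemma measure_pos: "0 < emeasure N A \<Longrightarrow> emeasure N A < \<infinity> \<Longrightarrow> 0 < measure N A"
  by (simp add: measure_def enn2real_positive_iff)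

lemma mean_count:
  assumes A: "A \<in> sets space_time" "emeasure space_time A < \<infinity>"
  shows "(\<integral>\<^sup>+\<omega>. of_nat (hits A \<omega>) \<partial>M) = emeasure space_time A"
proof -
  have pos: "(\<integral>\<^sup>+\<omega>. of_nat (hits A \<omega>) \<partial>M) = emeasure space_time A"
    if A: "A \<in> sets space_time" "0 < emeasure space_time A" "emeasure space_time A < \<infinity>" for A
  proof -
    have "(\<integral>\<^sup>+\<omega>. of_nat (hits A \<omega>) \<partial>M) = (\<integral>\<^sup>+k. of_nat k \<partial>distr M (count_space UNIV) (hits A))"
      by (rule nn_integral_distr[symmetric]) (use measurable_count[OF A(1,3)] in auto)
    also have "\<dots> = ennreal (measure space_time A)"
      unfolding distr_count[OF A] by (rule poisson_mean) (use measure_pos A in blast)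
    also have "\<dots> = emeasure space_time A" using A(3) by (simp add: emeasure_eq_ennreal_measure less_top)
    finally show ?thesis .
  qed
  show ?thesis
  proof (cases "emeasure space_time A = 0")
    case True
    \<comment> \<open>For a null set \<open>poisson_process\<close> prescribes no law. Its mean
      count is obtained by subtraction: the unit cube without \<open>A\<close> and the same set
      together with \<open>A\<close> both have measure 1, hence mean count 1.\<close>
    let ?C = "(cbox 0 (Complex 1 1)) \<times> {0..1::real}"
    have "emeasure lborel (cbox 0 (Complex 1 1)) = 1"
      by (subst emeasure_lborel_cbox) (auto simp: Basis_complex_def)
    then have C: "?C \<in> sets space_time" "emeasure space_time ?C = 1"
      using sets_space_time_Times[of "cbox 0 (Complex 1 1)" "{0..1}"] by auto
    let ?D = "?C - A"
    have D: "?D \<in> sets space_time" "emeasure space_time ?D = 1" "A \<union> ?D \<in> sets space_time" "emeasure space_time (A \<union> ?D) = 1"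
    proof -
      show "?D \<in> sets space_time" "A \<union> ?D \<in> sets space_time" using A C by auto
      have "emeasure space_time ?C \<le> emeasure space_time ?D + emeasure space_time A"
        using A C by (intro order.trans[OF emeasure_mono emeasure_subadditive]) auto
      moreover have "emeasure space_time ?D \<le> emeasure space_time ?C" using A C by (intro emeasure_mono) auto
      ultimately show 1: "emeasure space_time ?D = 1" using C True by simp
      have "emeasure space_time (A \<union> ?D) = emeasure space_time A + emeasure space_time ?D"
        using A C by (intro plus_emeasure[symmetric]) auto
      then show "emeasure space_time (A \<union> ?D) = 1" using 1 True by simp
    qed
    have Dfin: "emeasure space_time ?D < \<infinity>" using D(2) by simp
    have "(\<integral>\<^sup>+\<omega>. of_nat (hits (A \<union> ?D) \<omega>) \<partial>M) = (\<integral>\<^sup>+\<omega>. of_nat (hits A \<omega>) + of_nat (hits ?D \<omega>) \<partial>M)"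
    proof (rule nn_integral_cong_AE)
      show "AE \<omega> in M. (of_nat (hits (A \<union> ?D) \<omega>) :: ennreal) = of_nat (hits A \<omega>) + of_nat (hits ?D \<omega>)"
        using AE_finite_count[OF A] AE_finite_count[OF D(1) Dfin]
      proof eventually_elim
        case (elim \<omega>)
        { assume "finite {n. Z \<omega> n \<in> A}" and "finite {n. Z \<omega> n \<in> ?D}"
          then have "card ({n. Z \<omega> n \<in> A} \<union> {n. Z \<omega> n \<in> ?D}) = hits A \<omega> + hits ?D \<omega>"
            by (rule card_Un_disjoint) auto
          also have "{n. Z \<omega> n \<in> A} \<union> {n. Z \<omega> n \<in> ?D} = {n. Z \<omega> n \<in> A \<union> ?D}" by auto
          finally have "(of_nat (hits (A \<union> ?D) \<omega>) :: ennreal) = of_nat (hits A \<omega>) + of_nat (hits ?D \<omega>)"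
            by (simp only: of_nat_add) }
        with elim show ?case using D by auto
      qed
    qed
    also have "\<dots> = (\<integral>\<^sup>+\<omega>. of_nat (hits A \<omega>) \<partial>M) + (\<integral>\<^sup>+\<omega>. of_nat (hits ?D \<omega>) \<partial>M)"
    proof (rule nn_integral_add)
      show "(\<lambda>\<omega>. of_nat (hits A \<omega>) :: ennreal) \<in> borel_measurable M"
        using measurable_count[OF A] by measurable
      show "(\<lambda>\<omega>. of_nat (hits ?D \<omega>) :: ennreal) \<in> borel_measurable M"
        using measurable_count[OF D(1) Dfin] by measurable
    qed
    finally have "1 = (\<integral>\<^sup>+\<omega>. of_nat (hits A \<omega>) \<partial>M) + 1"
      using pos[OF D(1)] pos[OF D(3)] D by simp
    then have "1 + 0 = 1 + (\<integral>\<^sup>+\<omega>. of_nat (hits A \<omega>) \<partial>M)"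
      unfolding add_0_right by (subst add.commute)
    then have "0 = (\<integral>\<^sup>+\<omega>. of_nat (hits A \<omega>) \<partial>M)"
      unfolding ennreal_add_left_cancel infinity_ennreal_def using ennreal_one_neq_top by metis
    then show ?thesis unfolding True by (rule sym)
  next
    case False
    then show ?thesis using pos[OF A(1)] A(2) by (simp add: zero_less_iff_neq_zero)
  qed
qed

lemma mean_prod_count:
  assumes J: "finite (J :: nat set)" and disj: "disjoint_family_on A J"
    and A: "\<And>j. j \<in> J \<Longrightarrow> A j \<in> sets space_time" "\<And>j. j \<in> J \<Longrightarrow> emeasure space_time (A j) < \<infinity>"
  shows "(\<integral>\<^sup>+\<omega>. (\<Prod>j\<in>J. of_nat (hits (A j) \<omega>)) \<partial>M) = (\<Prod>j\<in>J. emeasure space_time (A j))"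
proof -
  have "indep_vars (\<lambda>_. borel) (\<lambda>j \<omega>. of_nat (hits (A j) \<omega>) :: ennreal) J"
    by (rule indep_vars_compose2[OF indep_counts[OF assms], of "\<lambda>_. of_nat"]) auto
  then have "(\<integral>\<^sup>+\<omega>. (\<Prod>j\<in>J. of_nat (hits (A j) \<omega>)) \<partial>M) = (\<Prod>j\<in>J. \<integral>\<^sup>+\<omega>. of_nat (hits (A j) \<omega>) \<partial>M)"
    by (intro indep_vars_nn_integral J) auto
  also have "\<dots> = (\<Prod>j\<in>J. emeasure space_time (A j))" by (intro prod.cong mean_count A refl)
  finally show ?thesis .
qed

definition tuples :: "nat set \<Rightarrow> (nat \<Rightarrow> complex set) \<Rightarrow> (nat \<Rightarrow> real set) \<Rightarrow> real \<Rightarrow> (nat \<Rightarrow> complex) set \<Rightarrow> 'w \<Rightarrow> (nat \<Rightarrow> nat) set"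
  where "tuples J A I c S \<omega> = {i \<in> J \<rightarrow>\<^sub>E UNIV. (\<forall>j\<in>J. (1 / c) *\<^sub>R fst (Z \<omega> (i j)) \<in> A j \<and> snd (Z \<omega> (i j)) \<in> I j) \<and>
     (\<lambda>j\<in>J. (1 / c) *\<^sub>R fst (Z \<omega> (i j))) \<in> S}"

abbreviation "slab A I c j \<equiv> {p. (1 / c) *\<^sub>R fst p \<in> A j \<and> snd p \<in> (I j :: real set)}"

lemma slab_props:
  assumes "A j \<in> sets borel" "I j \<in> sets borel" "I j \<subseteq> {0..}" "0 < c"
  shows "slab A I c j \<in> sets space_time" "emeasure space_time (slab A I c j) = ennreal (c\<^sup>2) * emeasure lborel (A j) * emeasure lborel (I j)"
proof -
  have eq: "slab A I c j = ((\<lambda>z. (1 / c) *\<^sub>R z + 0) -` A j) \<times> I j" by auto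
  have m: "(\<lambda>z. (1 / c) *\<^sub>R z + 0) -` A j \<in> sets borel"
    using measurable_sets[of "\<lambda>z::complex. (1 / c) *\<^sub>R z + 0" borel borel "A j"] assms by auto
  show "slab A I c j \<in> sets space_time" unfolding eq by (rule sets_space_time_Times) (use assms m in auto)
  have "emeasure lborel ((\<lambda>z. (1 / c) *\<^sub>R z + 0) -` A j) = ennreal (1 / (1 / c)\<^sup>2) * emeasure lborel (A j)"
    by (rule emeasure_lborel_affine_vimage) (use assms in auto)
  also have "1 / (1 / c)\<^sup>2 = c\<^sup>2" using assms by (simp add: power_divide)
  finally show "emeasure space_time (slab A I c j) = ennreal (c\<^sup>2) * emeasure lborel (A j) * emeasure lborel (I j)"
    unfolding eq using sets_space_time_Times[OF m assms(2,3)] by simp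
qed

lemma countable_tuples: "finite J \<Longrightarrow> countable (J \<rightarrow>\<^sub>E (UNIV :: nat set))"
  by (rule countable_PiE) auto

text \<open>Campbell's formula for tuples. The slabs are disjoint, so on boxes the number of tuples
  is a product of independent Poisson counts and its mean is the product of the means; uniqueness of
  measures extends the formula from boxes to all \<open>S\<close>.\<close>

lemma mean_tuples:
  assumes J: "finite J" and disj: "disjoint_family_on (slab A I c) J" and c: "0 < c"
    and A: "\<And>j. j \<in> J \<Longrightarrow> A j \<in> sets borel" "\<And>j. j \<in> J \<Longrightarrow> emeasure lborel (A j) < \<infinity>"
    and I: "\<And>j. j \<in> J \<Longrightarrow> I j \<in> sets borel" "\<And>j. j \<in> J \<Longrightarrow> emeasure lborel (I j) < \<infinity>" "\<And>j. j \<in> J \<Longrightarrow> I j \<subseteq> {0..}"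
    and S: "S \<in> sets (PiM J (\<lambda>_. borel))"
  shows "(\<integral>\<^sup>+\<omega>. emeasure (count_space UNIV) (tuples J A I c S \<omega>) \<partial>M) =
     (\<Prod>j\<in>J. ennreal (c\<^sup>2) * emeasure lborel (I j)) * emeasure (lborels J) (Pi\<^sub>E J A \<inter> S)"
    (is "?lhs S = _")
proof -
  let ?T = "J \<rightarrow>\<^sub>E (UNIV :: nat set)"
  let ?N = "count_space ?T"
  interpret N: sigma_finite_measure ?N by (rule sigma_finite_measure_count_space_countable[OF countable_tuples[OF J]])
  interpret P: pair_sigma_finite ?N M ..
  define pos where "pos = (\<lambda>(i, \<omega>). \<lambda>j\<in>J. (1 / c) *\<^sub>R fst (Z \<omega> (i j)))"
  define inside where "inside = {p \<in> space (?N \<Otimes>\<^sub>M M). \<forall>j\<in>J. (1 / c) *\<^sub>R fst (Z (snd p) (fst p j)) \<in> A j \<and> snd (Z (snd p) (fst p j)) \<in> I j}"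
  have pos[measurable]: "pos \<in> ?N \<Otimes>\<^sub>M M \<rightarrow>\<^sub>M PiM J (\<lambda>_. borel)"
    by (rule measurable_pair_measure_countable1[OF countable_tuples[OF J]]) (simp add: pos_def)
  have inside: "inside \<in> sets (?N \<Otimes>\<^sub>M M)"
  proof -
    have "(\<lambda>p. \<forall>j\<in>J. (1 / c) *\<^sub>R fst (Z (snd p) (fst p j)) \<in> A j \<and> snd (Z (snd p) (fst p j)) \<in> I j) \<in> ?N \<Otimes>\<^sub>M M \<rightarrow>\<^sub>M count_space UNIV"
    proof (rule measurable_pair_measure_countable1[OF countable_tuples[OF J]])
      fix i :: "nat \<Rightarrow> nat"
      have [measurable]: "A j \<in> sets borel" "I j \<in> sets borel" if "j \<in> J" for j using A I that by auto
      show "(\<lambda>\<omega>. \<forall>j\<in>J. (1 / c) *\<^sub>R fst (Z (snd (i, \<omega>)) (fst (i, \<omega>) j)) \<in> A j \<and> snd (Z (snd (i, \<omega>)) (fst (i, \<omega>) j)) \<in> I j) \<in> M \<rightarrow>\<^sub>M count_space UNIV"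
        unfolding fst_conv snd_conv using J by measurable
    qed
    then show ?thesis unfolding inside_def by measurable
  qed
  \<comment> \<open>The mean number of tuples as a measure in \<open>S\<close>: counting measure on
    index tuples times \<open>M\<close>, restricted to the slabs and pushed forward to the rescaled
    positions.\<close>
  define \<nu> where "\<nu> = distr (density (?N \<Otimes>\<^sub>M M) (indicator inside)) (PiM J (\<lambda>_. borel)) pos"
  have \<nu>: "emeasure \<nu> S = ?lhs S" if S: "S \<in> sets (PiM J (\<lambda>_. borel))" for S
  proof -
    have V: "pos -` S \<inter> space (?N \<Otimes>\<^sub>M M) \<in> sets (?N \<Otimes>\<^sub>M M)" by (rule measurable_sets[OF pos S])
    have "emeasure \<nu> S = emeasure (density (?N \<Otimes>\<^sub>M M) (indicator inside)) (pos -` S \<inter> space (?N \<Otimes>\<^sub>M M))"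
      unfolding \<nu>_def using S by (subst emeasure_distr) auto
    also have "\<dots> = emeasure (?N \<Otimes>\<^sub>M M) (inside \<inter> (pos -` S \<inter> space (?N \<Otimes>\<^sub>M M)))"
      by (rule emeasure_restricted[OF inside V])
    also have "\<dots> = (\<integral>\<^sup>+p. indicator (inside \<inter> (pos -` S \<inter> space (?N \<Otimes>\<^sub>M M))) p \<partial>(?N \<Otimes>\<^sub>M M))"
      using inside V by simp
    also have "\<dots> = (\<integral>\<^sup>+\<omega>. (\<integral>\<^sup>+i. indicator (inside \<inter> (pos -` S \<inter> space (?N \<Otimes>\<^sub>M M))) (i, \<omega>) \<partial>?N) \<partial>M)"
      by (rule P.nn_integral_snd[symmetric]) (use inside V in measurable)
    also have "\<dots> = ?lhs S"
    proof (rule nn_integral_cong)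
      fix \<omega> assume \<omega>: "\<omega> \<in> space M"
      have "(\<integral>\<^sup>+i. indicator (inside \<inter> (pos -` S \<inter> space (?N \<Otimes>\<^sub>M M))) (i, \<omega>) \<partial>?N) = (\<integral>\<^sup>+i. indicator (tuples J A I c S \<omega>) i \<partial>?N)"
        using \<omega> by (intro nn_integral_cong) (auto simp: indicator_def inside_def pos_def tuples_def space_pair_measure)
      also have "\<dots> = emeasure ?N (tuples J A I c S \<omega>)" by (rule nn_integral_indicator) (auto simp: tuples_def)
      also have "\<dots> = emeasure (count_space UNIV) (tuples J A I c S \<omega>)"
        by (cases "finite (tuples J A I c S \<omega>)") (auto simp: tuples_def emeasure_count_space)
      finally show "(\<integral>\<^sup>+i. indicator (inside \<inter> (pos -` S \<inter> space (?N \<Otimes>\<^sub>M M))) (i, \<omega>) \<partial>?N) = emeasure (count_space UNIV) (tuples J A I c S \<omega>)" .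
    qed
    finally show ?thesis .
  qed
  have "emeasure \<nu> S = (\<Prod>j\<in>J. ennreal (c\<^sup>2) * emeasure lborel (I j)) * emeasure (lborels J) (Pi\<^sub>E J A \<inter> S)"
  proof (rule emeasure_unique_on_box[OF J _ A _ _ S])
    show "sets \<nu> = sets (PiM J (\<lambda>_. borel))" by (simp add: \<nu>_def)
    show "(\<Prod>j\<in>J. ennreal (c\<^sup>2) * emeasure lborel (I j)) < \<infinity>"
      using I(2) by (auto simp: less_top[symmetric] ennreal_prod_eq_top ennreal_mult_eq_top_iff)
    fix B assume B: "\<And>j. j \<in> J \<Longrightarrow> B j \<in> sets (borel :: complex measure)"
    let ?D = "slab (\<lambda>j. A j \<inter> B j) I c"
    have D: "?D j \<in> sets space_time" "emeasure space_time (?D j) = ennreal (c\<^sup>2) * emeasure lborel (A j \<inter> B j) * emeasure lborel (I j)" if "j \<in> J" for j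
      using slab_props[of "\<lambda>j. A j \<inter> B j" j I c] A B I c that by auto
    have Dfin: "emeasure space_time (?D j) < \<infinity>" if "j \<in> J" for j
    proof -
      have "emeasure lborel (A j \<inter> B j) \<le> emeasure lborel (A j)" using A that by (intro emeasure_mono) auto
      then have "emeasure lborel (A j \<inter> B j) < \<infinity>" using A(2)[OF that] by (rule le_less_trans)
      then show ?thesis unfolding D(2)[OF that] using I(2)[OF that] by (simp add: ennreal_mult_less_top)
    qed
    have "emeasure \<nu> (Pi\<^sub>E J B) = ?lhs (Pi\<^sub>E J B)" using B J by (intro \<nu> sets_PiM_I_finite) auto
    also have "\<dots> = (\<integral>\<^sup>+\<omega>. (\<Prod>j\<in>J. of_nat (hits (?D j) \<omega>)) \<partial>M)"
    proof (rule nn_integral_cong_AE)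
      have "AE \<omega> in M. \<forall>j\<in>J. finite {n. Z \<omega> n \<in> ?D j}"
        using J by (intro AE_finite_allI AE_finite_count D Dfin)
      then show "AE \<omega> in M. emeasure (count_space UNIV) (tuples J A I c (Pi\<^sub>E J B) \<omega>) = (\<Prod>j\<in>J. of_nat (hits (?D j) \<omega>))"
      proof eventually_elim
        case (elim \<omega>)
        have eq: "tuples J A I c (Pi\<^sub>E J B) \<omega> = (\<Pi>\<^sub>E j\<in>J. {n. Z \<omega> n \<in> ?D j})"
          unfolding tuples_def PiE_def Pi_def by (auto simp: extensional_def)
        have "finite (\<Pi>\<^sub>E j\<in>J. {n. Z \<omega> n \<in> ?D j})" using elim J by (intro finite_PiE) auto
        then show ?case unfolding eq using J by (simp add: card_PiE)
      qed
    qed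
    also have "\<dots> = (\<Prod>j\<in>J. emeasure space_time (?D j))"
      by (rule mean_prod_count[OF J _ D(1) Dfin]) (use disj in \<open>auto simp: disjoint_family_on_def\<close>)
    also have "\<dots> = (\<Prod>j\<in>J. (ennreal (c\<^sup>2) * emeasure lborel (I j)) * emeasure lborel (A j \<inter> B j))"
      by (intro prod.cong refl) (simp only: D(2) mult_ac)
    finally show "emeasure \<nu> (Pi\<^sub>E J B) = (\<Prod>j\<in>J. ennreal (c\<^sup>2) * emeasure lborel (I j)) * (\<Prod>j\<in>J. emeasure lborel (A j \<inter> B j))"
      by (simp add: prod.distrib)
  qed
  then show ?thesis using \<nu>[OF S] by simp
qed

end

context poisson_points
begin

lemma prob_hits_ge_2:
  assumes A: "A \<in> sets space_time" "emeasure space_time A \<le> ennreal m"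
  shows "prob {\<omega> \<in> space M. 2 \<le> hits A \<omega>} \<le> m\<^sup>2"
proof -
  have fin: "emeasure space_time A < \<infinity>" using A(2) by (auto intro: le_less_trans)
  note [measurable] = measurable_count[OF A(1) fin]
  show ?thesis
  proof (cases "emeasure space_time A = 0")
    case True
    then have "(\<integral>\<^sup>+\<omega>. of_nat (hits A \<omega>) \<partial>M) = 0" using mean_count[OF A(1) fin] by simp
    then have "AE \<omega> in M. (of_nat (hits A \<omega>) :: ennreal) = 0" by (subst (asm) nn_integral_0_iff_AE) auto
    then have "AE \<omega> in M. \<not> 2 \<le> hits A \<omega>" by eventually_elim (metis of_nat_eq_0_iff not_numeral_le_zero)
    then have "prob {\<omega> \<in> space M. 2 \<le> hits A \<omega>} = 0" by (subst prob_eq_0) auto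
    then show ?thesis by simp
  next
    case False
    then have pos: "0 < emeasure space_time A" by (simp add: zero_less_iff_neq_zero)
    have "prob {\<omega> \<in> space M. 2 \<le> hits A \<omega>} = measure (distr M (count_space UNIV) (hits A)) {k. 2 \<le> k}"
      by (subst measure_distr) (auto intro!: arg_cong[of _ _ prob])
    also have "\<dots> \<le> (measure space_time A)\<^sup>2"
      unfolding distr_count[OF A(1) pos fin] by (rule poisson_two_or_more[OF measure_pos[OF pos fin]])
    also have "\<dots> \<le> m\<^sup>2"
    proof (rule power_mono)
      have "ennreal (measure space_time A) \<le> ennreal m"
        using A(2) fin by (simp add: emeasure_eq_ennreal_measure less_top)
      then show "measure space_time A \<le> m" using measure_pos[OF pos fin] by (metis ennreal_le_iff2 not_le)
    qed simp
    finally show ?thesis .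
  qed
qed

lemma prob_hits_small:
  assumes A: "A \<in> sets space_time" "emeasure space_time A = ennreal m" and m: "0 < m"
  shows "prob {\<omega> \<in> space M. real (hits A \<omega>) \<le> m / 4} \<le> 4 / m"
proof -
  have fin: "0 < emeasure space_time A" "emeasure space_time A < \<infinity>" using A(2) m by auto
  have mm: "measure space_time A = m" using A(2) m by (simp add: measure_def)
  note [measurable] = measurable_count[OF A(1) fin(2)]
  have "prob {\<omega> \<in> space M. real (hits A \<omega>) \<le> m / 4} = measure (distr M (count_space UNIV) (hits A)) {k. real k \<le> m / 4}"
    by (subst measure_distr) (auto intro!: arg_cong[of _ _ prob])
  also have "\<dots> \<le> exp (- m / 4)"
    unfolding distr_count[OF A(1) fin] mm by (rule poisson_lower_tail[OF m])
  also have "\<dots> \<le> 4 / m"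
  proof -
    have "m / 4 \<le> exp (m / 4)" using exp_ge_add_one_self[of "m / 4"] by linarith
    then have "1 / exp (m / 4) \<le> 1 / (m / 4)" using m by (intro divide_left_mono) auto
    then show ?thesis by (simp add: exp_minus inverse_eq_divide)
  qed
  finally show ?thesis .
qed

section \<open>Almost sure position of the points\<close>

text \<open>A bounded window meets about \<open>2 * N * T\<close> vertical strips of width
  \<open>1 / N\<close>. Two points fall into the same given strip with probability of order
  \<open>1 / N\<^sup>2\<close>, so some strip holds two points with probability of order
  \<open>1 / N\<close>. Real parts are compared, and not positions, because strips are what
  separates the points afterwards.\<close>

lemma AE_distinct_Re: "AE \<omega> in M. \<forall>n m. n \<noteq> m \<longrightarrow> Re (fst (Z \<omega> n)) \<noteq> Re (fst (Z \<omega> m))"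
proof -
  define B where "B T = {z. \<bar>Re z\<bar> \<le> real T \<and> \<bar>Im z\<bar> \<le> real T} \<times> {0..real T}" for T :: nat
  define E where "E T = {\<omega> \<in> space M. \<exists>n m. n \<noteq> m \<and> \<bar>Re (fst (Z \<omega> n))\<bar> \<le> real T \<and> \<bar>Im (fst (Z \<omega> n))\<bar> \<le> real T \<and> snd (Z \<omega> n) \<le> real T \<and>
      \<bar>Re (fst (Z \<omega> m))\<bar> \<le> real T \<and> \<bar>Im (fst (Z \<omega> m))\<bar> \<le> real T \<and> snd (Z \<omega> m) \<le> real T \<and> Re (fst (Z \<omega> n)) = Re (fst (Z \<omega> m))}" for T
  have E[measurable]: "E T \<in> sets M" for T unfolding E_def by measurable
  have "prob (E T) = 0" for T
  proof -
    have bound: "prob (E T) \<le> (2 * real T + 1) * (2 * (real T)\<^sup>2)\<^sup>2 / real N" if N: "0 < N" for N :: nat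
    proof -
      define R where "R k = {z. \<lfloor>real N * Re z\<rfloor> = k \<and> \<bar>Re z\<bar> \<le> real T \<and> \<bar>Im z\<bar> \<le> real T}" for k
      define D where "D k = R k \<times> {0..real T}" for k
      have R: "R k \<in> sets borel" for k unfolding R_def by measurable
      have D: "D k \<in> sets space_time" "emeasure space_time (D k) \<le> ennreal (2 * (real T)\<^sup>2 / real N)" for k
      proof -
        let ?Q = "cbox (Complex (real_of_int k / N) (- real T)) (Complex ((real_of_int k + 1) / N) (real T))"
        have "R k \<subseteq> ?Q"
        proof
          fix z assume z: "z \<in> R k"
          then have "real_of_int k \<le> real N * Re z" "real N * Re z < real_of_int k + 1"
            by (auto simp: R_def floor_eq_iff)
          then have "real_of_int k / N \<le> Re z" "Re z \<le> (real_of_int k + 1) / N"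
            using N by (simp_all add: divide_le_eq le_divide_eq mult.commute)
          then show "z \<in> ?Q" using z by (auto simp: in_cbox_complex_iff R_def)
        qed
        then have "emeasure lborel (R k) \<le> emeasure lborel ?Q" by (intro emeasure_mono) auto
        also have "\<dots> = ennreal (2 * real T / real N)"
        proof -
          have "(real_of_int k + 1) / N - real_of_int k / N = 1 / N" by (simp add: diff_divide_distrib[symmetric])
          then show ?thesis using N
            by (subst emeasure_lborel_cbox) (auto simp: Basis_complex_def divide_right_mono algebra_simps)
        qed
        finally have le: "emeasure lborel (R k) \<le> ennreal (2 * real T / real N)" .
        note S = sets_space_time_Times[OF R[of k], of "{0..real T}"]
        show "D k \<in> sets space_time" unfolding D_def by (rule S) auto
        have "emeasure space_time (D k) = emeasure lborel (R k) * ennreal (real T)"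
          unfolding D_def using S(2) by simp
        also have "\<dots> \<le> ennreal (2 * real T / real N) * ennreal (real T)" by (intro mult_right_mono le) simp
        also have "\<dots> = ennreal (2 * (real T)\<^sup>2 / real N)" by (simp add: ennreal_mult[symmetric] power2_eq_square)
        finally show "emeasure space_time (D k) \<le> ennreal (2 * (real T)\<^sup>2 / real N)" .
      qed
      have Dfin: "emeasure space_time (D k) < \<infinity>" for k using D(2)[of k] by (auto intro: le_less_trans)
      let ?K = "{- int (N * T)..int (N * T)}"
      have "AE \<omega> in M. \<forall>k\<in>?K. finite {n. Z \<omega> n \<in> D k}"
        by (intro AE_finite_allI AE_finite_count D Dfin) simp
      then have "AE \<omega> in M. \<omega> \<in> E T \<longrightarrow> \<omega> \<in> (\<Union>k\<in>?K. {\<omega> \<in> space M. 2 \<le> hits (D k) \<omega>})"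
      proof (rule AE_mp[OF _ AE_I2], intro impI)
        fix \<omega> assume \<omega>: "\<omega> \<in> space M" and fin: "\<forall>k\<in>?K. finite {n. Z \<omega> n \<in> D k}" and "\<omega> \<in> E T"
        then obtain n m where nm: "n \<noteq> m" "\<bar>Re (fst (Z \<omega> n))\<bar> \<le> real T" "\<bar>Im (fst (Z \<omega> n))\<bar> \<le> real T" "snd (Z \<omega> n) \<le> real T"
          "\<bar>Re (fst (Z \<omega> m))\<bar> \<le> real T" "\<bar>Im (fst (Z \<omega> m))\<bar> \<le> real T" "snd (Z \<omega> m) \<le> real T" "Re (fst (Z \<omega> n)) = Re (fst (Z \<omega> m))"
          unfolding E_def by blast
        define k where "k = \<lfloor>real N * Re (fst (Z \<omega> n))\<rfloor>"
        have "Z \<omega> n \<in> D k" "Z \<omega> m \<in> D k"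
          using nm Z_time_nonneg[OF \<omega>] by (auto simp: D_def R_def k_def mem_Times_iff)
        then have sub: "{n, m} \<subseteq> {n. Z \<omega> n \<in> D k}" by simp
        have "\<bar>real N * Re (fst (Z \<omega> n))\<bar> \<le> real N * real T"
          using nm(2) by (simp add: abs_mult mult_left_mono)
        then have kK: "k \<in> ?K" unfolding k_def by (auto simp: le_floor_iff floor_le_iff)
        have "card {n, m} \<le> hits (D k) \<omega>" by (rule card_mono[OF _ sub]) (use fin kK in blast)
        then have "2 \<le> hits (D k) \<omega>" using nm(1) by simp
        then show "\<omega> \<in> (\<Union>k\<in>?K. {\<omega> \<in> space M. 2 \<le> hits (D k) \<omega>})" using kK \<omega> by blast
      qed
      then have "prob (E T) \<le> prob (\<Union>k\<in>?K. {\<omega> \<in> space M. 2 \<le> hits (D k) \<omega>})"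
      proof (rule finite_measure_mono_AE)
        have [measurable]: "hits (D k) \<in> M \<rightarrow>\<^sub>M count_space UNIV" for k by (rule measurable_count[OF D(1) Dfin])
        show "(\<Union>k\<in>?K. {\<omega> \<in> space M. 2 \<le> hits (D k) \<omega>}) \<in> events" by measurable
      qed
      also have "\<dots> \<le> (\<Sum>k\<in>?K. prob {\<omega> \<in> space M. 2 \<le> hits (D k) \<omega>})"
      proof (rule finite_measure_subadditive_finite)
        have [measurable]: "hits (D k) \<in> M \<rightarrow>\<^sub>M count_space UNIV" for k by (rule measurable_count[OF D(1) Dfin])
        show "(\<lambda>k. {\<omega> \<in> space M. 2 \<le> hits (D k) \<omega>}) ` ?K \<subseteq> events" by (auto intro: measurable_sets)
      qed simp
      also have "\<dots> \<le> (\<Sum>k\<in>?K. (2 * (real T)\<^sup>2 / real N)\<^sup>2)" by (intro sum_mono prob_hits_ge_2 D)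
      also have "\<dots> = (2 * real N * real T + 1) * ((2 * (real T)\<^sup>2)\<^sup>2 / (real N)\<^sup>2)"
        by (simp add: power_divide)
      also have "\<dots> \<le> ((2 * real T + 1) * real N) * ((2 * (real T)\<^sup>2)\<^sup>2 / (real N)\<^sup>2)"
        using N by (intro mult_right_mono) (auto simp: algebra_simps)
      also have "\<dots> = (2 * real T + 1) * (2 * (real T)\<^sup>2)\<^sup>2 / real N" using N by (simp add: power2_eq_square)
      finally show ?thesis .
    qed
    show "prob (E T) = 0"
    proof (rule ccontr)
      assume "prob (E T) \<noteq> 0"
      then have pos: "0 < prob (E T)" using measure_nonneg[of M "E T"] by linarith
      let ?c = "(2 * real T + 1) * (2 * (real T)\<^sup>2)\<^sup>2"
      obtain N :: nat where N: "?c / prob (E T) < real N" using reals_Archimedean2 by blast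
      have "0 \<le> ?c / prob (E T)" using pos by (intro divide_nonneg_pos mult_nonneg_nonneg) auto
      then have N0: "0 < N" using N by (metis of_nat_0 not_gr0 not_le)
      have "prob (E T) * real N \<le> ?c" using bound[OF N0] N0 by (simp add: le_divide_eq)
      moreover have "?c < real N * prob (E T)" using N pos by (simp add: divide_less_eq)
      ultimately show False by (simp add: mult.commute)
    qed
  qed
  then have "AE \<omega> in M. \<omega> \<notin> E T" for T using prob_eq_0[OF E] by simp
  then have "AE \<omega> in M. \<forall>T. \<omega> \<notin> E T" by (simp add: AE_all_countable)
  then show ?thesis
  proof (rule AE_mp[OF _ AE_I2], intro impI allI notI)
    fix \<omega> n m assume \<omega>: "\<omega> \<in> space M" and nE: "\<forall>T. \<omega> \<notin> E T" and nm: "n \<noteq> m" "Re (fst (Z \<omega> n)) = Re (fst (Z \<omega> m))"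
    obtain T :: nat where T: "\<bar>Re (fst (Z \<omega> n))\<bar> + \<bar>Im (fst (Z \<omega> n))\<bar> + \<bar>snd (Z \<omega> n)\<bar> + \<bar>Im (fst (Z \<omega> m))\<bar> + \<bar>snd (Z \<omega> m)\<bar> \<le> real T"
      using real_arch_simple by blast
    have "\<omega> \<in> E T" unfolding E_def mem_Collect_eq using \<omega> nm T
      by (intro conjI exI[of _ n] exI[of _ m]) auto
    then show False using nE by blast
  qed
qed

text \<open>The mean number of tuples is known only for coordinates in disjoint slabs. Since the
  real parts differ a.s., sufficiently thin vertical strips put the points of the tuple into
  different slabs, and there a null set of positions has mean count 0.\<close>

lemma AE_positions:
  assumes J: "finite J" and i: "inj_on i J" and AE: "AE y in lborels J. P y"
  shows "AE \<omega> in M. P (\<lambda>j\<in>J. fst (Z \<omega> (i j)))"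
proof -
  obtain N where N: "{y \<in> space (lborels J). \<not> P y} \<subseteq> N" "N \<in> sets (lborels J)" "emeasure (lborels J) N = 0"
    using AE by (auto elim!: AE_E)
  have N': "N \<in> sets (PiM J (\<lambda>_. borel))" using N by (simp add: sets_lborels)
  \<comment> \<open>\<open>tuples\<close> consists of extensional index functions.\<close>
  define i' where "i' = restrict i J"
  define A where "A k m T = (\<lambda>j. {z. \<lfloor>real k * Re z\<rfloor> = m j \<and> norm z \<le> real T})" for k T :: nat and m :: "nat \<Rightarrow> int"
  define I where "I T = (\<lambda>j::nat. {0..real T})" for T :: nat
  have A[measurable]: "A k m T j \<in> sets borel" for k m T j unfolding A_def by measurable
  have "AE \<omega> in M. i' \<notin> tuples J (A k m T) (I T) 1 N \<omega>" if m: "inj_on m J" for k m T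
  proof -
    have Afin: "emeasure lborel (A k m T j) < \<infinity>" for j
    proof (rule le_less_trans)
      show "emeasure lborel (A k m T j) \<le> emeasure lborel (cball (0::complex) (real T))"
        by (rule emeasure_mono) (auto simp: A_def)
      show "emeasure lborel (cball (0::complex) (real T)) < \<infinity>" using emeasure_lborel_cball_finite by (simp add: less_top)
    qed
    have "disjoint_family_on (slab (A k m T) (I T) 1) J"
      using m by (auto simp: disjoint_family_on_def A_def inj_on_def)
    then have "(\<integral>\<^sup>+\<omega>. emeasure (count_space UNIV) (tuples J (A k m T) (I T) 1 N \<omega>) \<partial>M) =
       (\<Prod>j\<in>J. ennreal (1\<^sup>2) * emeasure lborel (I T j)) * emeasure (lborels J) (Pi\<^sub>E J (A k m T) \<inter> N)"
      by (intro mean_tuples J A Afin N') (auto simp: I_def)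
    moreover have "emeasure (lborels J) (Pi\<^sub>E J (A k m T) \<inter> N) = 0"
      using N(2,3) emeasure_mono[of "Pi\<^sub>E J (A k m T) \<inter> N" N "lborels J"] by auto
    ultimately have 0: "(\<integral>\<^sup>+\<omega>. emeasure (count_space UNIV) (tuples J (A k m T) (I T) 1 N \<omega>) \<partial>M) = 0" by simp
    let ?E = "{\<omega> \<in> space M. i' \<in> tuples J (A k m T) (I T) 1 N \<omega>}"
    have [measurable]: "I T j \<in> sets borel" for j by (simp add: I_def)
    have [measurable]: "N \<in> sets (PiM J (\<lambda>_. borel))" by (rule N')
    have E: "?E \<in> events" unfolding tuples_def using J by measurable
    have "emeasure M ?E = (\<integral>\<^sup>+\<omega>. indicator ?E \<omega> \<partial>M)" using E by simp
    also have "\<dots> \<le> (\<integral>\<^sup>+\<omega>. emeasure (count_space UNIV) (tuples J (A k m T) (I T) 1 N \<omega>) \<partial>M)"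
    proof (rule nn_integral_mono)
      fix \<omega>
      show "indicator ?E \<omega> \<le> emeasure (count_space UNIV) (tuples J (A k m T) (I T) 1 N \<omega>)"
      proof (cases "\<omega> \<in> ?E")
        case True
        then have "{i'} \<subseteq> tuples J (A k m T) (I T) 1 N \<omega>" by simp
        then have "emeasure (count_space UNIV) {i'} \<le> emeasure (count_space UNIV) (tuples J (A k m T) (I T) 1 N \<omega>)"
          by (intro emeasure_mono) auto
        then show ?thesis using True by simp
      qed simp
    qed
    finally have "emeasure M ?E = 0" using 0 by simp
    then have "?E \<in> null_sets M" using E by auto
    then show ?thesis by (rule AE_I') auto
  qed
  \<comment> \<open>The width, the strips and the window range over countable sets, so one
    exceptional event serves for all choices made later from the realization.\<close>
  then have "AE \<omega> in M. \<forall>k T. \<forall>m\<in>{m \<in> J \<rightarrow>\<^sub>E UNIV. inj_on m J}. i' \<notin> tuples J (A k m T) (I T) 1 N \<omega>"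
    unfolding AE_all_countable using countable_PiE[OF J, of "\<lambda>_. UNIV :: int set"]
    by (intro allI) (subst AE_ball_countable, auto intro: countable_subset[rotated])
  then show ?thesis using AE_distinct_Re
  proof (rule AE_mp[OF _ AE_mp[OF _ AE_I2]], intro impI)
    fix \<omega> assume \<omega>: "\<omega> \<in> space M" and dist: "\<forall>n m. n \<noteq> m \<longrightarrow> Re (fst (Z \<omega> n)) \<noteq> Re (fst (Z \<omega> m))"
      and nt: "\<forall>k T. \<forall>m\<in>{m \<in> J \<rightarrow>\<^sub>E UNIV. inj_on m J}. i' \<notin> tuples J (A k m T) (I T) 1 N \<omega>"
    define x where "x j = Re (fst (Z \<omega> (i j)))" for j
    have xinj: "x j \<noteq> x j'" if "j \<in> J" "j' \<in> J" "j \<noteq> j'" for j j'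
      using dist i that by (auto simp: x_def inj_on_def)
    define d where "d = Min (insert 1 ((\<lambda>(j, j'). if j = j' then 1 else \<bar>x j - x j'\<bar>) ` (J \<times> J)))"
    have d: "0 < d" using J xinj by (auto simp: d_def)
    have dle: "d \<le> \<bar>x j - x j'\<bar>" if "j \<in> J" "j' \<in> J" "j \<noteq> j'" for j j'
      unfolding d_def using J that by (intro Min_le) (auto intro!: image_eqI[of _ _ "(j, j')"])
    obtain k :: nat where k: "1 / d < real k" using reals_Archimedean2 by blast
    define m where "m = (\<lambda>j\<in>J. \<lfloor>real k * x j\<rfloor>)"
    have minj: "inj_on m J"
    proof (rule inj_onI, rule ccontr)
      fix j j' assume *: "j \<in> J" "j' \<in> J" "m j = m j'" "j \<noteq> j'"
      then have "\<bar>real k * x j - real k * x j'\<bar> < 1" by (simp add: m_def) linarith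
      moreover have "real k * d \<le> real k * \<bar>x j - x j'\<bar>" using dle[OF *(1,2,4)] by (intro mult_left_mono) auto
      moreover have "1 < real k * d" using k d by (simp add: divide_less_eq)
      ultimately show False by (simp add: abs_mult right_diff_distrib[symmetric])
    qed
    obtain T :: nat where T: "(\<Sum>j\<in>J. norm (fst (Z \<omega> (i j))) + snd (Z \<omega> (i j))) \<le> real T" using real_arch_simple by blast
    have Tj: "norm (fst (Z \<omega> (i j))) \<le> real T" "snd (Z \<omega> (i j)) \<le> real T" if "j \<in> J" for j
    proof -
      have "norm (fst (Z \<omega> (i j))) + snd (Z \<omega> (i j)) \<le> (\<Sum>j\<in>J. norm (fst (Z \<omega> (i j))) + snd (Z \<omega> (i j)))"
        using J that Z_time_nonneg[OF \<omega>] by (intro member_le_sum) auto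
      then show "norm (fst (Z \<omega> (i j))) \<le> real T" "snd (Z \<omega> (i j)) \<le> real T"
        using T Z_time_nonneg[OF \<omega>, of "i j"] norm_ge_zero[of "fst (Z \<omega> (i j))"] by linarith+
    qed
    have "i' \<notin> tuples J (A k m T) (I T) 1 N \<omega>" using nt minj by (auto simp: m_def)
    moreover have "\<forall>j\<in>J. (1 / 1) *\<^sub>R fst (Z \<omega> (i' j)) \<in> A k m T j \<and> snd (Z \<omega> (i' j)) \<in> I T j"
      using Tj Z_time_nonneg[OF \<omega>] by (auto simp: A_def I_def i'_def m_def x_def)
    moreover have "i' \<in> J \<rightarrow>\<^sub>E UNIV" by (simp add: i'_def)
    ultimately have "(\<lambda>j\<in>J. (1 / 1) *\<^sub>R fst (Z \<omega> (i' j))) \<notin> N" unfolding tuples_def by blast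
    moreover have "(\<lambda>j\<in>J. (1 / 1) *\<^sub>R fst (Z \<omega> (i' j))) = (\<lambda>j\<in>J. fst (Z \<omega> (i j)))"
      by (auto simp: i'_def restrict_def)
    moreover have "(\<lambda>j\<in>J. fst (Z \<omega> (i j))) \<in> space (lborels J)" by (simp add: space_PiM)
    ultimately show "P (\<lambda>j\<in>J. fst (Z \<omega> (i j)))" using N(1) by auto
  qed
qed


section \<open>Sets of positive measure are hit\<close>

abbreviation hit :: "nat set \<Rightarrow> (nat \<Rightarrow> complex) set \<Rightarrow> real \<Rightarrow> real \<Rightarrow> 'w set" where
  "hit J K l c \<equiv> {\<omega> \<in> space M. \<exists>i \<in> J \<rightarrow>\<^sub>E UNIV. hit_tuple J K l c (Z \<omega>) i}"

lemma hit_tuple_measurable: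
  assumes "finite J" "K \<in> sets (PiM J (\<lambda>_. borel))"
  shows "{\<omega> \<in> space M. hit_tuple J K l c (Z \<omega>) i} \<in> events"
proof -
  note [measurable] = assms(2)
  show ?thesis unfolding hit_tuple_def using assms(1) by measurable
qed

lemma hit_event_measurable:
  assumes "finite J" "K \<in> sets (PiM J (\<lambda>_. borel))"
  shows "hit J K l c \<in> events"
proof -
  have "hit J K l c = (\<Union>i\<in>J \<rightarrow>\<^sub>E UNIV. {\<omega> \<in> space M. hit_tuple J K l c (Z \<omega>) i})"
    by blast
  also have "\<dots> \<in> events"
    by (intro sets.countable_UN'' countable_tuples assms hit_tuple_measurable)
  finally show ?thesis .
qed

text \<open>In a box \<open>A\<close> that \<open>K\<close> almost fills, the mean number of tuples that miss \<open>K\<close> is a small fraction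
  \<open>\<eta>\<close> of the mean number of all tuples. As each coordinate likely finds at least a quarter of the
  mean number of points in its own time slab, not all tuples can miss \<open>K\<close>.\<close>

lemma hit_probability:
  assumes J: "finite J" and K: "K \<in> sets (PiM J (\<lambda>_. borel))" "0 < emeasure (lborels J) K" and \<epsilon>: "0 < (\<epsilon>::real)"
  obtains m0 where "0 < m0" "\<And>l c. 0 < l \<Longrightarrow> 0 < c \<Longrightarrow> m0 \<le> l * c\<^sup>2 \<Longrightarrow>
    1 - \<epsilon> \<le> prob (hit J K l c)"
proof -
  \<comment> \<open>Each coordinate is only guaranteed a quarter of its mean number of points; the
    power of 4 pays for this in the final Markov bound.\<close>
  define \<eta> where "\<eta> = \<epsilon> / 2 / 4 ^ card J"
  have \<eta>: "0 < \<eta>" using \<epsilon> by (simp add: \<eta>_def)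
  obtain A where A: "\<And>j. j \<in> J \<Longrightarrow> A j \<in> sets borel" "\<And>j. j \<in> J \<Longrightarrow> 0 < emeasure lborel (A j)"
    "\<And>j. j \<in> J \<Longrightarrow> emeasure lborel (A j) < \<infinity>"
    "emeasure (lborels J) (Pi\<^sub>E J A - K) \<le> ennreal \<eta> * emeasure (lborels J) (Pi\<^sub>E J A)"
    using dense_box[OF J K \<eta>] by blast
  define a where "a j = measure lborel (A j)" for j
  have a: "0 < a j" "emeasure lborel (A j) = ennreal (a j)" if "j \<in> J" for j
    using A(2,3)[OF that] measure_pos[of lborel "A j"] by (auto simp: a_def emeasure_eq_ennreal_measure less_top)
  obtain k where k: "J \<subseteq> {..<k}" "0 < k"
    using finite_nat_iff_bounded[of J] J by (metis lessThan_subset_iff max.cobounded1 max.cobounded2 order.trans zero_less_one less_le_trans)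
  define b where "b = Min (insert 1 (a ` J))"
  have b: "0 < b" "\<And>j. j \<in> J \<Longrightarrow> b \<le> a j" using J a by (auto simp: b_def)
  \<comment> \<open>Makes every mean \<open>m j\<close> at least
    \<open>8 * (card J + 1) / \<epsilon>\<close>. The probability \<open>4 / m j\<close> of too few
    points then adds up to at most half of \<epsilon> over the coordinates; the factor
    \<open>k\<close> is lost because each coordinate gets one \<open>k\<close>-th of the
    time.\<close>
  define m0 where "m0 = real k * (8 * (real (card J) + 1) / (b * \<epsilon>))"
  have m0: "0 < m0" using k b \<epsilon> by (simp add: m0_def)
  have "1 - \<epsilon> \<le> prob (hit J K l c)"
    if l: "0 < l" and c: "0 < c" and lc: "m0 \<le> l * c\<^sup>2" for l c
  proof -
    let ?H = "hit J K l c"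
    have H[measurable]: "?H \<in> events" by (rule hit_event_measurable[OF J K(1)])
    define h where "h = l / real k"
    have h: "0 < h" "h * real k = l" using l k by (auto simp: h_def)
    \<comment> \<open>One time interval per coordinate: points of different coordinates then have
      different indices, and their counts are independent even if the sides \<open>A j\<close>
      overlap.\<close>
    define I where "I j = {h * real j..<h * (real j + 1)}" for j :: nat
    have I: "I j \<in> sets borel" "emeasure lborel (I j) = ennreal h" "I j \<subseteq> {0..}" for j
      using h by (auto simp: I_def algebra_simps intro: order.trans[rotated])
    have Idisj: "I j \<inter> I j' = {}" if "j < j'" for j j'
    proof -
      have "h * (real j + 1) \<le> h * real j'" using that h by (intro mult_left_mono) auto
      then show ?thesis by (auto simp: I_def)
    qed
    then have Idisj': "I j \<inter> I j' = {}" if "j \<noteq> j'" for j j'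
      using that by (metis Int_commute linorder_neqE_nat)
    have Il: "t \<le> l" if "t \<in> I j" "j \<in> J" for t j
    proof -
      have "real j + 1 \<le> real k" using k that by auto
      then have "h * (real j + 1) \<le> h * real k" using h by (intro mult_left_mono) auto
      then show ?thesis using that h by (auto simp: I_def)
    qed
    let ?D = "slab A I c"
    define m where "m j = c\<^sup>2 * a j * h" for j
    have m: "0 < m j" if "j \<in> J" for j using a[OF that] c h by (simp add: m_def)
    have D: "?D j \<in> sets space_time" "emeasure space_time (?D j) = ennreal (m j)" if "j \<in> J" for j
    proof -
      note s = slab_props[of A j I c, OF A(1)[OF that] I(1) I(3) c]
      show "?D j \<in> sets space_time" by (rule s)
      show "emeasure space_time (?D j) = ennreal (m j)"
        unfolding s(2) a(2)[OF that] I(2) m_def using a(1)[OF that] h by (simp add: ennreal_mult)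
    qed
    have Dfin: "emeasure space_time (?D j) < \<infinity>" if "j \<in> J" for j using D[OF that] by simp
    have disj: "disjoint_family_on ?D J" using Idisj' by (auto simp: disjoint_family_on_def)
    have sum_small: "(\<Sum>j\<in>J. prob {\<omega> \<in> space M. real (hits (?D j) \<omega>) \<le> m j / 4}) \<le> \<epsilon> / 2"
    proof -
      have hc: "8 * (real (card J) + 1) / (b * \<epsilon>) \<le> h * c\<^sup>2"
        using lc k by (simp add: m0_def h_def field_simps)
      have "(\<Sum>j\<in>J. prob {\<omega> \<in> space M. real (hits (?D j) \<omega>) \<le> m j / 4}) \<le> (\<Sum>j\<in>J. 4 / m j)"
        by (intro sum_mono prob_hits_small D m)
      also have "\<dots> \<le> (\<Sum>j\<in>J. \<epsilon> / (2 * (real (card J) + 1)))"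
      proof (rule sum_mono)
        fix j assume j: "j \<in> J"
        have "8 * (real (card J) + 1) / \<epsilon> = 8 * (real (card J) + 1) / (b * \<epsilon>) * b" using b by simp
        also have "\<dots> \<le> h * c\<^sup>2 * a j" using hc b(2)[OF j] b(1) h c \<epsilon> by (intro mult_mono) auto
        finally have "8 * (real (card J) + 1) / \<epsilon> \<le> m j" by (simp add: m_def mult_ac)
        then have "4 / m j \<le> 4 / (8 * (real (card J) + 1) / \<epsilon>)"
          using \<epsilon> by (intro divide_left_mono mult_pos_pos m j) auto
        also have "4 / (8 * (real (card J) + 1) / \<epsilon>) = \<epsilon> / (2 * (real (card J) + 1))" using \<epsilon> by (simp add: field_simps)
        finally show "4 / m j \<le> \<epsilon> / (2 * (real (card J) + 1))" .
      qed
      also have "\<dots> = \<epsilon> / 2 * (real (card J) / (real (card J) + 1))" by (simp add: mult.commute)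
      also have "\<dots> \<le> \<epsilon> / 2 * 1" using \<epsilon> by (intro mult_left_mono) auto
      also have "\<dots> = \<epsilon> / 2" by simp
      finally show ?thesis .
    qed
    let ?F = "{\<omega> \<in> space M. \<omega> \<notin> ?H \<and> (\<forall>j\<in>J. m j / 4 < real (hits (?D j) \<omega>))}"
    have hitsm: "{\<omega> \<in> space M. real (hits (?D j) \<omega>) \<le> m j / 4} \<in> events" if "j \<in> J" for j
    proof -
      note [measurable] = measurable_count[OF D(1)[OF that] Dfin[OF that]]
      show ?thesis by measurable
    qed
    have "?F = (space M - ?H) - (\<Union>j\<in>J. {\<omega> \<in> space M. real (hits (?D j) \<omega>) \<le> m j / 4})"
      by (auto simp: not_le)
    also have "\<dots> \<in> events" using J H hitsm by (intro sets.Diff sets.finite_UN) auto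
    finally have F: "?F \<in> events" .
    let ?S = "space (PiM J (\<lambda>_. borel)) - K"
    have "(\<integral>\<^sup>+\<omega>. emeasure (count_space UNIV) (tuples J A I c ?S \<omega>) \<partial>M)
        = (\<Prod>j\<in>J. ennreal (c\<^sup>2) * emeasure lborel (I j)) * emeasure (lborels J) (Pi\<^sub>E J A \<inter> ?S)"
      by (rule mean_tuples[OF J disj c]) (use A I K in auto)
    also have "Pi\<^sub>E J A \<inter> ?S = Pi\<^sub>E J A - K" by (auto simp: space_PiM)
    also have "(\<Prod>j\<in>J. ennreal (c\<^sup>2) * emeasure lborel (I j)) * emeasure (lborels J) (Pi\<^sub>E J A - K)
        \<le> (\<Prod>j\<in>J. ennreal (c\<^sup>2) * emeasure lborel (I j)) * (ennreal \<eta> * emeasure (lborels J) (Pi\<^sub>E J A))"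
      by (intro mult_left_mono A(4)) simp
    also have "emeasure (lborels J) (Pi\<^sub>E J A) = (\<Prod>j\<in>J. ennreal (a j))"
      using A(1) a(2) J by (subst lborels.emeasure_PiM) auto
    also have "(\<Prod>j\<in>J. ennreal (c\<^sup>2) * emeasure lborel (I j)) * (ennreal \<eta> * (\<Prod>j\<in>J. ennreal (a j))) = ennreal \<eta> * (\<Prod>j\<in>J. ennreal (m j))"
    proof -
      have "(\<Prod>j\<in>J. ennreal (m j)) = (\<Prod>j\<in>J. (ennreal (c\<^sup>2) * emeasure lborel (I j)) * ennreal (a j))"
        using a(1) h by (intro prod.cong refl) (auto simp: m_def I(2) ennreal_mult less_imp_le mult_ac)
      then show ?thesis by (simp only: prod.distrib mult_ac)
    qed
    also have "\<dots> = ennreal (\<eta> * (\<Prod>j\<in>J. m j))"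
      using m \<eta> by (subst prod_ennreal) (auto simp: ennreal_mult less_imp_le prod_nonneg)
    finally have mean: "(\<integral>\<^sup>+\<omega>. emeasure (count_space UNIV) (tuples J A I c ?S \<omega>) \<partial>M) \<le> ennreal (\<eta> * (\<Prod>j\<in>J. m j))" .
    define q where "q = (\<Prod>j\<in>J. m j / 4)"
    have q: "0 < q" "(\<Prod>j\<in>J. m j) = 4 ^ card J * q" using m by (auto simp: q_def prod_pos prod_dividef)
    \<comment> \<open>On \<open>?F\<close> there are at least \<open>q\<close> tuples in the slabs
      and all of them miss \<open>K\<close>, so the mean number of missing tuples bounds the
      probability of \<open>?F\<close>.\<close>
    have "ennreal q * emeasure M ?F = (\<integral>\<^sup>+\<omega>. ennreal q * indicator ?F \<omega> \<partial>M)"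
      using F by (simp add: nn_integral_cmult_indicator)
    also have "\<dots> \<le> (\<integral>\<^sup>+\<omega>. emeasure (count_space UNIV) (tuples J A I c ?S \<omega>) \<partial>M)"
    proof (rule nn_integral_mono_AE)
      have "AE \<omega> in M. \<forall>j\<in>J. finite {n. Z \<omega> n \<in> ?D j}"
        using J by (intro AE_finite_allI AE_finite_count D Dfin)
      then show "AE \<omega> in M. ennreal q * indicator ?F \<omega> \<le> emeasure (count_space UNIV) (tuples J A I c ?S \<omega>)"
      proof eventually_elim
        case (elim \<omega>)
        show ?case
        proof (cases "\<omega> \<in> ?F")
          case True
          let ?P = "\<Pi>\<^sub>E j\<in>J. {n. Z \<omega> n \<in> ?D j}"
          have finP: "finite ?P" using elim J by (intro finite_PiE) auto
          have "q \<le> (\<Prod>j\<in>J. real (hits (?D j) \<omega>))"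
            unfolding q_def using True m by (intro prod_mono) (auto simp: less_imp_le)
          also have "\<dots> = real (card ?P)" using J by (simp add: card_PiE)
          finally have "ennreal q \<le> of_nat (card ?P)" by (simp add: ennreal_of_nat_eq_real_of_nat ennreal_leI)
          also have "\<dots> = emeasure (count_space UNIV) ?P" using finP by simp
          also have "\<dots> \<le> emeasure (count_space UNIV) (tuples J A I c ?S \<omega>)"
          proof (rule emeasure_mono)
            show "?P \<subseteq> tuples J A I c ?S \<omega>"
            proof
              fix i assume i: "i \<in> ?P"
              then have i1: "i \<in> J \<rightarrow>\<^sub>E UNIV" "\<forall>j\<in>J. Z \<omega> (i j) \<in> ?D j" by (auto simp: PiE_def)
              have inj: "inj_on i J"
              proof (rule inj_onI, rule ccontr)
                fix j j' assume "j \<in> J" "j' \<in> J" "i j = i j'" "j \<noteq> j'"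
                then have "snd (Z \<omega> (i j)) \<in> I j \<inter> I j'" using i1(2) by auto
                then show False using Idisj'[OF \<open>j \<noteq> j'\<close>] by simp
              qed
              have "\<not> hit_tuple J K l c (Z \<omega>) i" using True i1 by auto
              then have "(\<lambda>j\<in>J. (1 / c) *\<^sub>R fst (Z \<omega> (i j))) \<notin> K"
                unfolding hit_tuple_def using inj i1 Il by auto
              then show "i \<in> tuples J A I c ?S \<omega>" unfolding tuples_def using i1 by (auto simp: space_PiM)
            qed
          qed simp
          finally show ?thesis using True by simp
        qed simp
      qed
    qed
    also note mean
    finally have "ennreal (q * prob ?F) \<le> ennreal (\<eta> * (4 ^ card J * q))"
      using q by (simp add: emeasure_eq_measure ennreal_mult)
    then have "q * prob ?F \<le> \<eta> * (4 ^ card J * q)" using q \<eta> by (simp add: ennreal_le_iff)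
    also have "\<dots> = q * (\<epsilon> / 2)" by (simp add: \<eta>_def)
    finally have PF: "prob ?F \<le> \<epsilon> / 2" using q(1) by simp
    have UB: "(\<Union>j\<in>J. {\<omega> \<in> space M. real (hits (?D j) \<omega>) \<le> m j / 4}) \<in> events"
      using hitsm by (rule sets.finite_UN[OF J])
    have "1 - prob ?H = prob (space M - ?H)" using prob_compl[OF H] by simp
    also have "\<dots> \<le> prob (?F \<union> (\<Union>j\<in>J. {\<omega> \<in> space M. real (hits (?D j) \<omega>) \<le> m j / 4}))"
      by (rule finite_measure_mono[OF _ sets.Un[OF F UB]]) (auto simp: not_le)
    also have "\<dots> \<le> prob ?F + prob (\<Union>j\<in>J. {\<omega> \<in> space M. real (hits (?D j) \<omega>) \<le> m j / 4})"
      by (rule measure_Un_le[OF F UB])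
    also have "prob (\<Union>j\<in>J. {\<omega> \<in> space M. real (hits (?D j) \<omega>) \<le> m j / 4}) \<le> (\<Sum>j\<in>J. prob {\<omega> \<in> space M. real (hits (?D j) \<omega>) \<le> m j / 4})"
      using J hitsm by (intro finite_measure_subadditive_finite) auto
    finally show ?thesis using PF sum_small by linarith
  qed
  then show thesis using that m0 by blast
qed

text \<open>For \<open>K\<close> the whole space the event \<open>hit\<close> does not depend on
  \<open>c\<close>. A large \<open>c\<close> can therefore be inserted at time bound 1, and the
  probability exceeds every number below 1.\<close>

lemma AE_infinitely_many_points: "AE \<omega> in M. infinite {n. snd (Z \<omega> n) \<le> 1}"
proof -
  have "AE \<omega> in M. \<exists>i. inj_on i {..<q} \<and> (\<forall>j<q. snd (Z \<omega> (i j)) \<le> 1)" for q :: nat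
  proof -
    let ?K = "space (PiM {..<q} (\<lambda>_. borel)) :: (nat \<Rightarrow> complex) set"
    let ?E = "\<lambda>c. hit {..<q} ?K 1 c"
    have Ec: "?E c = ?E 1" for c by (auto simp: hit_tuple_def space_PiM)
    have "emeasure (lborels {..<q}) ?K = (\<Prod>j<q. emeasure lborel (UNIV :: complex set))"
      unfolding space_PiM space_borel by (rule lborels.emeasure_PiM) auto
    also have "\<dots> \<noteq> 0" by simp
    finally have pos: "0 < emeasure (lborels {..<q}) ?K" by (simp add: zero_less_iff_neq_zero)
    have le: "1 - \<epsilon> \<le> prob (?E 1)" if \<epsilon>: "0 < \<epsilon>" for \<epsilon>
    proof -
      obtain m0 where m0: "0 < m0" "\<And>l c. 0 < l \<Longrightarrow> 0 < c \<Longrightarrow> m0 \<le> l * c\<^sup>2 \<Longrightarrow>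
        1 - \<epsilon> \<le> prob (hit {..<q} ?K l c)"
        using hit_probability[OF _ _ pos \<epsilon>] by auto
      have "1 - \<epsilon> \<le> prob (?E (sqrt m0))" by (rule m0(2)) (use m0(1) in auto)
      then show ?thesis unfolding Ec[of "sqrt m0"] .
    qed
    have "1 \<le> prob (?E 1)"
    proof (rule field_le_epsilon)
      fix e :: real assume "0 < e"
      then show "1 \<le> prob (?E 1) + e" using le[of e] by linarith
    qed
    then have "prob (?E 1) = 1" by (simp add: order_antisym)
    moreover have "?E 1 \<in> events" by (rule hit_event_measurable) auto
    ultimately have "AE \<omega> in M. \<omega> \<in> ?E 1" using prob_eq_1 by blast
    then show ?thesis by eventually_elim (auto simp: hit_tuple_def)
  qed
  then have "AE \<omega> in M. \<forall>q::nat. \<exists>i. inj_on i {..<q} \<and> (\<forall>j<q. snd (Z \<omega> (i j)) \<le> 1)"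
    unfolding AE_all_countable by (rule allI)
  then show ?thesis
  proof eventually_elim
    case (elim \<omega>)
    show ?case
    proof
      assume fin: "finite {n. snd (Z \<omega> n) \<le> 1}"
      define q where "q = Suc (card {n. snd (Z \<omega> n) \<le> 1})"
      obtain i where i: "inj_on i {..<q}" "\<forall>j<q. snd (Z \<omega> (i j)) \<le> 1" using elim by blast
      have "card (i ` {..<q}) \<le> card {n. snd (Z \<omega> n) \<le> 1}" by (rule card_mono[OF fin]) (use i in auto)
      then show False using i by (simp add: card_image q_def)
    qed
  qed
qed

lemma AE_locally_finite: "AE \<omega> in M. \<forall>l B. finite {n. snd (Z \<omega> n) \<le> l \<and> norm (fst (Z \<omega> n)) \<le> B}"
proof -
  have "AE \<omega> in M. finite {n. Z \<omega> n \<in> cball 0 (real k) \<times> {0..real k}}" for k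
  proof (rule AE_finite_count)
    show "cball 0 (real k) \<times> {0..real k} \<in> sets space_time" by (rule sets_space_time_Times) auto
    have "emeasure space_time (cball 0 (real k) \<times> {0..real k}) = emeasure lborel (cball (0::complex) (real k)) * emeasure lborel {0..real k}"
      by (rule sets_space_time_Times) auto
    then show "emeasure space_time (cball 0 (real k) \<times> {0..real k}) < \<infinity>"
      using emeasure_lborel_cball_finite[of "0::complex" "real k"] by (simp add: ennreal_mult_less_top less_top)
  qed
  then have "AE \<omega> in M. \<forall>k. finite {n. Z \<omega> n \<in> cball 0 (real k) \<times> {0..real k}}"
    by (simp add: AE_all_countable)
  then show ?thesis
  proof (rule AE_mp[OF _ AE_I2], intro impI allI)
    fix \<omega> l B assume \<omega>: "\<omega> \<in> space M" and fin: "\<forall>k. finite {n. Z \<omega> n \<in> cball 0 (real k) \<times> {0..real k}}"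
    obtain k :: nat where k: "max l B \<le> real k" using real_arch_simple by blast
    have "{n. snd (Z \<omega> n) \<le> l \<and> norm (fst (Z \<omega> n)) \<le> B} \<subseteq> {n. Z \<omega> n \<in> cball 0 (real k) \<times> {0..real k}}"
      using k Z_time_nonneg[OF \<omega>] by (auto simp: mem_Times_iff)
    then show "finite {n. snd (Z \<omega> n) \<le> l \<and> norm (fst (Z \<omega> n)) \<le> B}" using fin finite_subset by blast
  qed
qed

end

subsection \<open>Measurability\<close>

lemma space_route_space: "space route_space = Collect route"
  unfolding route_space_def space_restrict_space space_PiM by (auto simp: route_def PiE_def)

lemma measurable_route_spaceI:
  assumes "\<And>\<omega>. \<omega> \<in> space N \<Longrightarrow> route (f \<omega>)"
    and "\<And>t. t \<in> {0..1} \<Longrightarrow> (\<lambda>\<omega>. f \<omega> t) \<in> borel_measurable N"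
  shows "f \<in> N \<rightarrow>\<^sub>M route_space"
  unfolding route_space_def
proof (rule measurable_restrict_space2)
  show "f \<in> space N \<rightarrow> Collect route" using assms(1) by auto
  show "f \<in> N \<rightarrow>\<^sub>M PiM {0..1} (\<lambda>_. borel)"
    by (rule measurable_PiM_single') (use assms in \<open>auto simp: route_def PiE_def\<close>)
qed

lemma measurable_route_eval:
  assumes "f \<in> N \<rightarrow>\<^sub>M route_space" "t \<in> {0..1}"
  shows "(\<lambda>\<omega>. f \<omega> t) \<in> borel_measurable N"
proof -
  have "f \<in> N \<rightarrow>\<^sub>M PiM {0..1} (\<lambda>_. borel)"
    using assms(1) unfolding route_space_def by (simp add: measurable_restrict_space2_iff)
  from measurable_component_singleton[OF assms(2), THEN measurable_compose[OF this]]
  show ?thesis .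
qed

lemma route_space_route:
  assumes "f \<in> N \<rightarrow>\<^sub>M route_space" "\<omega> \<in> space N"
  shows "route (f \<omega>)" "continuous_on {0..1} (f \<omega>)"
proof -
  show "route (f \<omega>)" using measurable_space[OF assms] by (simp add: space_route_space)
  then show "continuous_on {0..1} (f \<omega>)" by (auto simp: route_def arc_def path_def)
qed

text \<open>Rational times below a given time suffice, because the paths are continuous.\<close>

lemma rational_time_below:
  fixes \<gamma> :: "real \<Rightarrow> 'a::topological_space"
  assumes "continuous_on {0..1} \<gamma>" "t \<in> {0..1}" "open U" "\<gamma> t \<in> U" "l < t \<or> l = 0"
  shows "\<exists>q \<in> \<rat> \<inter> {0..1}. q \<le> t \<and> l \<le> q \<and> \<gamma> q \<in> U \<or> t < l"
proof (cases "t = 0 \<or> t < l")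
  case True
  then show ?thesis using assms by (auto intro!: bexI[of _ 0])
next
  case False
  then have t: "0 < t" "t \<le> 1" "max 0 l < t" using assms by auto
  obtain A where A: "open A" "A \<inter> {0..1} = \<gamma> -` U \<inter> {0..1}"
    using assms(1,3) unfolding continuous_on_open_invariant by blast
  then have "t \<in> A" using assms t by auto
  then obtain e where e: "0 < e" "ball t e \<subseteq> A" using A(1) open_contains_ball by blast
  have "max (max 0 l) (t - e) < t" using t e by auto
  then obtain q where q: "q \<in> \<rat>" "max (max 0 l) (t - e) < q" "q < t" using Rats_dense_in_real by blast
  then have "q \<in> A \<inter> {0..1}" using e t by (auto simp: subset_iff dist_real_def)
  then have "\<gamma> q \<in> U" using A by blast
  then show ?thesis using q t by (intro bexI[of _ q]) auto
qed

lemma rational_times: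
  obtains q :: "nat \<Rightarrow> real" where "range q = \<rat> \<inter> {0..1}"
proof -
  have "countable (\<rat> \<inter> {0..1::real})" by (intro countable_Int1 countable_rat)
  moreover have "(0::real) \<in> \<rat> \<inter> {0..1}" by simp
  ultimately have "range (from_nat_into (\<rat> \<inter> {0..1::real})) = \<rat> \<inter> {0..1}"
    by (intro range_from_nat_into) blast+
  then show thesis by (rule that)
qed

text \<open>The exit time is the infimum of a relatively open set of times and is determined by
  rational times. The value at a random time is the limit of the values at grid times, each of which
  is taken on a countable partition.\<close>

lemma measurable_exit_point:
  assumes f: "f \<in> N \<rightarrow>\<^sub>M route_space"
  shows "(\<lambda>\<omega>. exit_point r (f \<omega>)) \<in> borel_measurable N"
proof -
  obtain q :: "nat \<Rightarrow> real" where q: "range q = \<rat> \<inter> {0..1}" by (rule rational_times)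
  have qi: "q n \<in> {0..1}" for n using q by (metis IntD2 rangeI)
  have fq[measurable]: "(\<lambda>\<omega>. f \<omega> (q n)) \<in> borel_measurable N" for n
    by (rule measurable_route_eval[OF f qi])
  let ?S = "\<lambda>\<omega>. {t\<in>{0..1}. f \<omega> t \<notin> cball 0 r}"
  let ?T = "\<lambda>\<omega>. exit_time r (f \<omega>)"
  define E where "E \<omega> \<longleftrightarrow> (\<exists>n. r < norm (f \<omega> (q n)))" for \<omega>
  have [measurable]: "Measurable.pred N E" unfolding E_def by measurable
  have rat: "(\<exists>t\<in>?S \<omega>. t < a) \<longleftrightarrow> (\<exists>n. q n < a \<and> r < norm (f \<omega> (q n)))" if \<omega>: "\<omega> \<in> space N" for \<omega> a
  proof
    assume "\<exists>t\<in>?S \<omega>. t < a"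
    then obtain t where t: "t \<in> {0..1}" "f \<omega> t \<in> {z. r < norm z}" "t < a" by auto
    have "open {z::complex. r < norm z}" by (intro open_Collect_less continuous_intros)
    from rational_time_below[OF route_space_route(2)[OF f \<omega>] t(1) this t(2), of 0] t(1)
    obtain p where p: "p \<in> \<rat> \<inter> {0..1}" "p \<le> t" "f \<omega> p \<in> {z. r < norm z}" by auto
    then obtain n where "p = q n" using q by (metis imageE)
    then show "\<exists>n. q n < a \<and> r < norm (f \<omega> (q n))" using p(2,3) t(3) by (intro exI[of _ n]) auto
  next
    assume "\<exists>n. q n < a \<and> r < norm (f \<omega> (q n))"
    then show "\<exists>t\<in>?S \<omega>. t < a" using qi by force
  qed
  have ne: "?S \<omega> \<noteq> {} \<longleftrightarrow> E \<omega>" if \<omega>: "\<omega> \<in> space N" for \<omega>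
  proof -
    have "?S \<omega> \<noteq> {} \<longleftrightarrow> (\<exists>t\<in>?S \<omega>. t < 2)" by auto
    also have "\<dots> \<longleftrightarrow> E \<omega>" unfolding rat[OF \<omega>] E_def
    proof (intro iffI; elim exE conjE)
      fix n assume "r < norm (f \<omega> (q n))"
      then show "\<exists>n. q n < 2 \<and> r < norm (f \<omega> (q n))" using qi[of n] by (intro exI[of _ n]) auto
    qed blast
    finally show ?thesis .
  qed
  \<comment> \<open>A time inside the unit interval in all cases; without an exit,
    \<open>exit_time\<close> would be the unspecified real number \<open>Inf {}\<close>.\<close>
  define T' where "T' \<omega> = (if E \<omega> then ?T \<omega> else 0)" for \<omega>
  have T'_in: "T' \<omega> \<in> {0..1}" if \<omega>: "\<omega> \<in> space N" for \<omega>
  proof (cases "E \<omega>")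
    case True
    then have n: "?S \<omega> \<noteq> {}" using ne[OF \<omega>] by simp
    then obtain t where t: "t \<in> ?S \<omega>" by blast
    have "bdd_below (?S \<omega>)" by (auto intro: bdd_belowI)
    then have "?T \<omega> \<le> t" unfolding exit_time_def by (intro cInf_lower t)
    moreover have "0 \<le> ?T \<omega>" unfolding exit_time_def by (intro cInf_greatest n) auto
    ultimately show ?thesis using t True by (auto simp: T'_def)
  qed (simp add: T'_def)
  have [measurable]: "T' \<in> borel_measurable N"
  proof (rule borel_measurableI_less)
    fix a
    have "{\<omega> \<in> space N. T' \<omega> < a} =
        {\<omega> \<in> space N. if E \<omega> then \<exists>n. q n < a \<and> r < norm (f \<omega> (q n)) else 0 < a}"
    proof (intro Collect_cong conj_cong refl)
      fix \<omega> assume \<omega>: "\<omega> \<in> space N"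
      show "T' \<omega> < a \<longleftrightarrow> (if E \<omega> then \<exists>n. q n < a \<and> r < norm (f \<omega> (q n)) else 0 < a)"
      proof (cases "E \<omega>")
        case True
        then have n: "?S \<omega> \<noteq> {}" using ne[OF \<omega>] by simp
        have "bdd_below (?S \<omega>)" by (auto intro: bdd_belowI)
        then have "?T \<omega> < a \<longleftrightarrow> (\<exists>t\<in>?S \<omega>. t < a)" unfolding exit_time_def by (intro cInf_less_iff n)
        then show ?thesis using True rat[OF \<omega>, of a] by (simp add: T'_def)
      qed (simp add: T'_def)
    qed
    also have "\<dots> \<in> sets N" by measurable
    finally show "{\<omega> \<in> space N. T' \<omega> < a} \<in> sets N" .
  qed
  have lim: "(\<lambda>\<omega>. f \<omega> (T' \<omega>)) \<in> borel_measurable N"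
  proof (rule borel_measurable_LIMSEQ_metric)
    fix n :: nat
    \<comment> \<open>The index computed from \<open>T'\<close> never exceeds \<open>Suc n\<close>;
      the default 0 makes every \<open>F k\<close> measurable.\<close>
    define F where "F k \<omega> = (if k \<le> Suc n then f \<omega> (real k / real (Suc n)) else 0)" for k \<omega>
    have "(\<lambda>\<omega>. F k \<omega>) \<in> borel_measurable N" for k
      unfolding F_def by (cases "k \<le> Suc n") (auto intro!: measurable_route_eval[OF f])
    then show "(\<lambda>\<omega>. F (nat \<lfloor>real (Suc n) * T' \<omega>\<rfloor>) \<omega>) \<in> borel_measurable N"
      by (rule measurable_compose_countable) measurable
  next
    fix \<omega> assume \<omega>: "\<omega> \<in> space N"
    note T = T'_in[OF \<omega>]
    let ?s = "\<lambda>n. real (nat \<lfloor>real (Suc n) * T' \<omega>\<rfloor>) / real (Suc n)"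
    have le: "real (nat \<lfloor>real (Suc n) * T' \<omega>\<rfloor>) \<le> real (Suc n) * T' \<omega>" for n
      using T by (simp add: of_nat_nat)
    have s1: "?s n \<le> T' \<omega>" for n using le[of n] by (simp add: field_simps del: of_nat_Suc)
    have s2: "T' \<omega> - 1 / real (Suc n) \<le> ?s n" for n
    proof -
      have "real (Suc n) * T' \<omega> - 1 \<le> real (nat \<lfloor>real (Suc n) * T' \<omega>\<rfloor>)" using T by linarith
      then have "(real (Suc n) * T' \<omega> - 1) / real (Suc n) \<le> ?s n" by (intro divide_right_mono) auto
      then show ?thesis by (simp add: diff_divide_distrib del: of_nat_Suc)
    qed
    have "?s \<longlonglongrightarrow> T' \<omega>"
    proof (rule real_tendsto_sandwich)
      show "(\<lambda>n. T' \<omega> - 1 / real (Suc n)) \<longlonglongrightarrow> T' \<omega>"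
        using tendsto_diff[OF tendsto_const LIMSEQ_inverse_real_of_nat, of "T' \<omega>"] by (simp add: inverse_eq_divide)
      show "eventually (\<lambda>n. T' \<omega> - 1 / real (Suc n) \<le> ?s n) sequentially" by (intro always_eventually allI s2)
      show "eventually (\<lambda>n. ?s n \<le> T' \<omega>) sequentially" by (intro always_eventually allI s1)
    qed (rule tendsto_const)
    then have "(\<lambda>n. f \<omega> (?s n)) \<longlonglongrightarrow> f \<omega> (T' \<omega>)"
    proof (rule continuous_on_tendsto_compose[OF route_space_route(2)[OF f \<omega>] _ T])
      show "eventually (\<lambda>n. ?s n \<in> {0..1}) sequentially"
      proof (intro always_eventually allI)
        fix n
        have "?s n \<le> 1" by (rule order.trans[OF s1]) (use T in simp)
        moreover have "0 \<le> ?s n" by simp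
        ultimately show "?s n \<in> {0..1}" by (simp only: atLeastAtMost_iff)
      qed
    qed
    moreover have "nat \<lfloor>real (Suc n) * T' \<omega>\<rfloor> \<le> Suc n" for n
    proof -
      have "real (Suc n) * T' \<omega> \<le> real (Suc n) * 1" using T by (intro mult_left_mono) auto
      then have "real (nat \<lfloor>real (Suc n) * T' \<omega>\<rfloor>) \<le> real (Suc n)"
        using order.trans[OF le[of n]] by (simp only: mult_1_right)
      then show ?thesis by simp
    qed
    ultimately show "(\<lambda>n. if nat \<lfloor>real (Suc n) * T' \<omega>\<rfloor> \<le> Suc n
        then f \<omega> (real (nat \<lfloor>real (Suc n) * T' \<omega>\<rfloor>) / real (Suc n)) else 0) \<longlonglongrightarrow> f \<omega> (T' \<omega>)"
      by simp
  qed
  \<comment> \<open>Nothing is known about \<open>Inf {}\<close>. If it lies in the unit interval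
    this is an evaluation, and otherwise all routes have the value \<open>undefined\<close> there,
    being extensional.\<close>
  have const: "(\<lambda>\<omega>. f \<omega> (Inf {})) \<in> borel_measurable N"
  proof (cases "(Inf {} :: real) \<in> {0..1}")
    case True
    then show ?thesis by (rule measurable_route_eval[OF f])
  next
    case False
    then have "f \<omega> (Inf {}) = undefined" if "\<omega> \<in> space N" for \<omega>
      using route_space_route(1)[OF f that] by (auto simp: route_def extensional_def)
    then show ?thesis by (simp cong: measurable_cong)
  qed
  have "(\<lambda>\<omega>. if E \<omega> then f \<omega> (T' \<omega>) else f \<omega> (Inf {})) \<in> borel_measurable N"
    using lim const by measurable
  moreover have "exit_point r (f \<omega>) = (if E \<omega> then f \<omega> (T' \<omega>) else f \<omega> (Inf {}))" if "\<omega> \<in> space N" for \<omega>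
  proof (cases "E \<omega>")
    case False
    then have "?S \<omega> = {}" using ne[OF that] by blast
    then show ?thesis using False unfolding exit_point_def exit_time_def by (simp only: if_False)
  qed (simp add: exit_point_def T'_def)
  ultimately show ?thesis by (simp cong: measurable_cong)
qed

text \<open>Failure means that \<open>\<gamma>\<close> visits, before some meeting, a point at
  positive distance from the part of \<open>\<eta>\<close> before the meeting. In the criterion
  \<open>q a\<close> is the time of the stray point, \<open>m\<close> bounds its distance from
  below, and \<open>q b\<close>, \<open>q c\<close> are times of near-meetings with error tending to
  0; compactness turns the near-meetings into a meeting.\<close>

lemma initially_compatible_rational_iff:
  fixes \<gamma> \<eta> :: "real \<Rightarrow> complex"
  assumes \<gamma>: "continuous_on {0..1} \<gamma>" and \<eta>: "continuous_on {0..1} \<eta>" and q: "range q = \<rat> \<inter> {0..1::real}"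
  shows "\<not> initially_compatible \<gamma> \<eta> \<longleftrightarrow>
    (\<exists>a m. \<forall>n. \<exists>b c. q a \<le> q b \<and> norm (\<gamma> (q b) - \<eta> (q c)) < 1 / real (Suc n) \<and>
      (\<forall>d. q d \<le> q c \<longrightarrow> 1 / real (Suc m) \<le> norm (\<gamma> (q a) - \<eta> (q d))))"
  (is "_ \<longleftrightarrow> ?R")
proof
  assume "\<not> initially_compatible \<gamma> \<eta>"
  then obtain s t u0 where st: "s \<in> {0..1}" "t \<in> {0..1}" "\<gamma> s = \<eta> t" and u0: "u0 \<in> {0..s}" "\<gamma> u0 \<notin> \<eta> ` {0..t}"
    unfolding initially_compatible_def by blast
  have cl: "compact (\<eta> ` {0..t})"
    by (intro compact_continuous_image continuous_on_subset[OF \<eta>]) (use st in auto)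
  have op: "open (- (\<eta> ` {0..t}))" by (rule open_Compl[OF compact_imp_closed[OF cl]])
  have u01: "u0 \<in> {0..1}" using u0 st by auto
  obtain p where p: "p \<in> \<rat> \<inter> {0..1}" "p \<le> u0" "\<gamma> p \<notin> \<eta> ` {0..t}"
    using rational_time_below[OF \<gamma> u01 op, of 0] u0 u01 by auto
  then obtain a where a: "q a = p" using q by (metis imageE)
  obtain e where e: "0 < e" "\<And>y. y \<in> \<eta> ` {0..t} \<Longrightarrow> e \<le> dist (\<gamma> p) y"
    using separate_point_closed[OF compact_imp_closed[OF cl] p(3)] by blast
  obtain m where m: "1 / real (Suc m) < e" using nat_approx_posE[OF e(1)] .
  have ps: "p \<le> s" using p u0 by auto
  show ?R
  proof (rule exI[of _ a], rule exI[of _ m], rule allI)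
    fix n
    let ?e = "1 / real (Suc n)"
    have e2: "0 < ?e / 2" by simp
    obtain b where b: "p \<le> q b" "dist (\<gamma> (q b)) (\<gamma> s) < ?e / 2"
    proof (cases "p < s \<or> p = 0")
      case True
      have "open (ball (\<gamma> s) (?e/2))" "\<gamma> s \<in> ball (\<gamma> s) (?e/2)" using e2 by (auto simp del: of_nat_Suc)
      from rational_time_below[OF \<gamma> st(1) this True] ps
      obtain b where "b \<in> \<rat> \<inter> {0..1}" "p \<le> b" "\<gamma> b \<in> ball (\<gamma> s) (?e/2)" by auto
      then show thesis using q that by (metis imageE dist_commute mem_ball)
    next
      case False
      then show thesis using that[of a] a ps e2 by (auto simp del: of_nat_Suc)
    qed
    have "open (ball (\<eta> t) (?e/2))" "\<eta> t \<in> ball (\<eta> t) (?e/2)" using e2 by (auto simp del: of_nat_Suc)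
    from rational_time_below[OF \<eta> st(2) this, of 0] st(2)
    obtain c where "c \<in> \<rat> \<inter> {0..1}" "c \<le> t" "\<eta> c \<in> ball (\<eta> t) (?e/2)" by auto
    then obtain c where c: "q c \<le> t" "dist (\<eta> (q c)) (\<eta> t) < ?e / 2"
      using q by (metis imageE dist_commute mem_ball)
    have "norm (\<gamma> (q b) - \<eta> (q c)) < ?e"
      using dist_triangle_half_l[OF b(2), of "\<eta> (q c)"] c st(3) by (simp add: dist_norm del: of_nat_Suc)
    moreover have "1 / real (Suc m) \<le> norm (\<gamma> (q a) - \<eta> (q d))" if "q d \<le> q c" for d
    proof -
      have "q d \<in> {0..1}" using q by (metis IntD2 rangeI)
      then have "\<eta> (q d) \<in> \<eta> ` {0..t}" using that c by auto
      from e(2)[OF this] show ?thesis using m a by (simp add: dist_norm del: of_nat_Suc)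
    qed
    ultimately show "\<exists>b c. q a \<le> q b \<and> norm (\<gamma> (q b) - \<eta> (q c)) < ?e \<and>
      (\<forall>d. q d \<le> q c \<longrightarrow> 1 / real (Suc m) \<le> norm (\<gamma> (q a) - \<eta> (q d)))"
      using b a by blast
  qed
next
  assume ?R
  then obtain a m where "\<forall>n. \<exists>b c. q a \<le> q b \<and> norm (\<gamma> (q b) - \<eta> (q c)) < 1 / real (Suc n) \<and>
      (\<forall>d. q d \<le> q c \<longrightarrow> 1 / real (Suc m) \<le> norm (\<gamma> (q a) - \<eta> (q d)))" by blast
  then obtain b c where bc: "\<And>n. q a \<le> q (b n)" "\<And>n. norm (\<gamma> (q (b n)) - \<eta> (q (c n))) < 1 / real (Suc n)"
      "\<And>n d. q d \<le> q (c n) \<Longrightarrow> 1 / real (Suc m) \<le> norm (\<gamma> (q a) - \<eta> (q d))" by metis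
  have qi: "q n \<in> {0..1}" for n using q by (metis IntD2 rangeI)
  have "compact ({0..1::real} \<times> {0..1::real})" by (intro compact_Times) auto
  then have "seq_compact ({0..1::real} \<times> {0..1::real})" by (rule compact_imp_seq_compact)
  moreover have "\<forall>n. (q (b n), q (c n)) \<in> {0..1} \<times> {0..1}" using qi by blast
  ultimately obtain l h where l: "l \<in> {0..1} \<times> {0..1}" and h: "strict_mono (h :: nat \<Rightarrow> nat)"
    and lim: "((\<lambda>n. (q (b n), q (c n))) \<circ> h) \<longlonglongrightarrow> l"
    by (rule seq_compactE)
  obtain s t where lst: "l = (s, t)" by force
  have st: "s \<in> {0..1}" "t \<in> {0..1}" using l lst by auto
  have lims: "(\<lambda>n. q (b (h n))) \<longlonglongrightarrow> s" using tendsto_fst[OF lim] by (simp add: lst o_def)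
  have limt: "(\<lambda>n. q (c (h n))) \<longlonglongrightarrow> t" using tendsto_snd[OF lim] by (simp add: lst o_def)
  have g: "(\<lambda>n. \<gamma> (q (b (h n)))) \<longlonglongrightarrow> \<gamma> s"
    by (rule continuous_on_tendsto_compose[OF \<gamma> lims st(1)]) (use qi in auto)
  have e: "(\<lambda>n. \<eta> (q (c (h n)))) \<longlonglongrightarrow> \<eta> t"
    by (rule continuous_on_tendsto_compose[OF \<eta> limt st(2)]) (use qi in auto)
  have "(\<lambda>n. \<gamma> (q (b (h n))) - \<eta> (q (c (h n)))) \<longlonglongrightarrow> 0"
  proof (rule Lim_null_comparison)
    show "eventually (\<lambda>n. norm (\<gamma> (q (b (h n))) - \<eta> (q (c (h n)))) \<le> 1 / real (Suc n)) sequentially"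
    proof (intro always_eventually allI)
      fix n
      have "norm (\<gamma> (q (b (h n))) - \<eta> (q (c (h n)))) \<le> 1 / real (Suc (h n))" using bc(2)[of "h n"] by simp
      also have "\<dots> \<le> 1 / real (Suc n)" using seq_suble[OF h, of n] by (simp add: frac_le)
      finally show "norm (\<gamma> (q (b (h n))) - \<eta> (q (c (h n)))) \<le> 1 / real (Suc n)" .
    qed
    show "(\<lambda>n. 1 / real (Suc n)) \<longlonglongrightarrow> 0" using LIMSEQ_inverse_real_of_nat by (simp add: inverse_eq_divide)
  qed
  moreover have "(\<lambda>n. \<gamma> (q (b (h n))) - \<eta> (q (c (h n)))) \<longlonglongrightarrow> \<gamma> s - \<eta> t" by (intro tendsto_diff g e)
  ultimately have meet: "\<gamma> s = \<eta> t" using LIMSEQ_unique by fastforce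
  have as: "q a \<le> s" by (rule LIMSEQ_le_const[OF lims]) (use bc(1) in auto)
  have "\<gamma> (q a) \<notin> \<eta> ` {0..t}"
  proof
    assume "\<gamma> (q a) \<in> \<eta> ` {0..t}"
    then obtain w where w: "w \<in> {0..t}" "\<gamma> (q a) = \<eta> w" by blast
    have w1: "w \<in> {0..1}" using w st by auto
    let ?U = "ball (\<eta> w) (1 / real (Suc m))"
    have U: "open ?U" "\<eta> w \<in> ?U" by (auto simp del: of_nat_Suc)
    \<comment> \<open>The time \<open>q d\<close> is strictly before \<open>t\<close>, or 0, so it
      precedes some \<open>q (c n)\<close> even when these converge to \<open>t\<close> from
      below.\<close>
    obtain d where d: "q d < t \<or> q d = 0" "\<eta> (q d) \<in> ?U"
    proof (cases "w = 0")
      case True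
      have "0 \<in> \<rat> \<inter> {0..1::real}" by simp
      then obtain d where "q d = 0" using q by (metis imageE)
      then show thesis using that[of d] U True by simp
    next
      case False
      \<comment> \<open>a slightly smaller time is still mapped into the ball\<close>
      obtain A where A: "open A" "A \<inter> {0..1} = \<eta> -` ?U \<inter> {0..1}"
        using \<eta> U(1) unfolding continuous_on_open_invariant by blast
      then have "w \<in> A" using U w1 by auto
      then obtain r where r: "0 < r" "ball w r \<subseteq> A" using A(1) open_contains_ball by blast
      have "max 0 (w - r) < w" using False w1 r by auto
      then obtain p where p: "p \<in> \<rat>" "max 0 (w - r) < p" "p < w" using Rats_dense_in_real by blast
      then have "p \<in> A \<inter> {0..1}" using r w1 by (auto simp: subset_iff dist_real_def)
      then have "\<eta> p \<in> ?U" "p \<in> \<rat> \<inter> {0..1}" using A p by blast+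
      then show thesis using q that p w by (metis atLeastAtMost_iff imageE order.strict_trans2)
    qed
    have "\<exists>n. q d \<le> q (c n)"
    proof (cases "q d = 0")
      case True then show ?thesis using qi by auto
    next
      case False
      then have "eventually (\<lambda>n. q d < q (c (h n))) sequentially" using order_tendstoD(1)[OF limt] d by simp
      then show ?thesis by (meson eventually_happens' less_imp_le sequentially_bot)
    qed
    then obtain n where "q d \<le> q (c n)" by blast
    from bc(3)[OF this] d(2) w(2) show False by (simp add: dist_norm del: of_nat_Suc)
  qed
  moreover have "q a \<in> {0..s}" using as qi by auto
  ultimately show "\<not> initially_compatible \<gamma> \<eta>"
    unfolding initially_compatible_def using st meet by blast
qed

lemma measurable_initially_compatible:
  assumes f: "f \<in> N \<rightarrow>\<^sub>M route_space" and g: "g \<in> N \<rightarrow>\<^sub>M route_space"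
  shows "Measurable.pred N (\<lambda>\<omega>. initially_compatible (f \<omega>) (g \<omega>))"
proof -
  obtain q :: "nat \<Rightarrow> real" where q: "range q = \<rat> \<inter> {0..1}" by (rule rational_times)
  have qi: "q n \<in> {0..1}" for n using q by (metis IntD2 rangeI)
  have [measurable]: "(\<lambda>\<omega>. f \<omega> (q n)) \<in> borel_measurable N" "(\<lambda>\<omega>. g \<omega> (q n)) \<in> borel_measurable N" for n
    by (rule measurable_route_eval[OF f qi] measurable_route_eval[OF g qi])+
  have "Measurable.pred N (\<lambda>\<omega>. \<not> (\<exists>a m. \<forall>n. \<exists>b c. q a \<le> q b \<and> norm (f \<omega> (q b) - g \<omega> (q c)) < 1 / real (Suc n) \<and>
      (\<forall>d. q d \<le> q c \<longrightarrow> 1 / real (Suc m) \<le> norm (f \<omega> (q a) - g \<omega> (q d)))))"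
    by measurable
  moreover have "initially_compatible (f \<omega>) (g \<omega>) \<longleftrightarrow> \<not> (\<exists>a m. \<forall>n. \<exists>b c. q a \<le> q b \<and> norm (f \<omega> (q b) - g \<omega> (q c)) < 1 / real (Suc n) \<and>
      (\<forall>d. q d \<le> q c \<longrightarrow> 1 / real (Suc m) \<le> norm (f \<omega> (q a) - g \<omega> (q d))))" if "\<omega> \<in> space N" for \<omega>
    using initially_compatible_rational_iff[OF route_space_route(2)[OF f that] route_space_route(2)[OF g that] q] by blast
  ultimately show ?thesis by (simp cong: measurable_cong)
qed

lemma measurable_route_affine:
  fixes f :: "'a \<Rightarrow> real \<Rightarrow> complex"
  assumes f: "f \<in> N \<rightarrow>\<^sub>M route_space" and a: "a \<in> borel_measurable N" and c: "0 < c"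
  shows "(\<lambda>\<omega>. \<lambda>t\<in>{0..1}. c *\<^sub>R f \<omega> t + a \<omega>) \<in> N \<rightarrow>\<^sub>M route_space"
proof (rule measurable_route_spaceI)
  show "route (\<lambda>t\<in>{0..1}. c *\<^sub>R f \<omega> t + a \<omega>)" if "\<omega> \<in> space N" for \<omega>
    by (rule route_affine[OF route_space_route(1)[OF f that] c])
  fix t :: real assume t: "t \<in> {0..1}"
  have [measurable]: "(\<lambda>\<omega>. f \<omega> t) \<in> borel_measurable N" by (rule measurable_route_eval[OF f t])
  note [measurable] = a
  have "(\<lambda>\<omega>. c *\<^sub>R f \<omega> t + a \<omega>) \<in> borel_measurable N" by measurable
  then show "(\<lambda>\<omega>. (\<lambda>t\<in>{0..1}. c *\<^sub>R f \<omega> t + a \<omega>) t) \<in> borel_measurable N" using t by simp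
qed

subsection \<open>Geodesics\<close>

text \<open>Both routes run injectively through the same trace. Initial traces up to corresponding
  points agree, which forces the change of parameter to be increasing.\<close>

lemma route_tree_reparametrize:
  assumes \<Gamma>: "route_tree \<Gamma>" "\<gamma> \<in> \<Gamma>" "\<eta> \<in> \<Gamma>" and st: "s \<in> {0..1}" "t \<in> {0..1}" "\<gamma> s = \<eta> t"
  obtains h where "\<And>u. u \<in> {0..s} \<Longrightarrow> \<gamma> u = \<eta> (h u)" "strict_mono_on {0..s} h" "h ` {0..s} = {0..t}"
proof -
  note \<gamma> = route_treeD[OF \<Gamma>(1,2)] and \<eta> = route_treeD[OF \<Gamma>(1,3)]
  have img: "\<gamma> ` {0..s} = \<eta> ` {0..t}" by (rule route_tree_initial[OF \<Gamma> st])
  have "\<forall>u\<in>{0..s}. \<exists>v. v \<in> {0..t} \<and> \<gamma> u = \<eta> v" using img by blast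
  then obtain h where h: "\<And>u. u \<in> {0..s} \<Longrightarrow> h u \<in> {0..t}" "\<And>u. u \<in> {0..s} \<Longrightarrow> \<gamma> u = \<eta> (h u)"
    by metis
  have unit: "u \<in> {0..1}" if "u \<in> {0..s}" for u using that st by auto
  have unit': "u \<in> {0..1}" if "u \<in> {0..t}" for u using that st by auto
  have "h u < h v" if uv: "u \<in> {0..s}" "v \<in> {0..s}" "u < v" for u v
  proof -
    have 1: "\<gamma> ` {0..v} = \<eta> ` {0..h v}"
      by (rule route_tree_initial[OF \<Gamma> unit unit' h(2)]) (use uv h in auto)
    have "\<eta> (h u) \<in> \<gamma> ` {0..v}" using h(2)[OF uv(1)] uv by (intro image_eqI[of _ _ u]) auto
    then obtain w where w: "w \<in> {0..h v}" "\<eta> (h u) = \<eta> w" unfolding 1 by blast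
    have "w \<in> {0..t}" using w(1) h(1)[OF uv(2)] by auto
    then have "h u = w" using inj_onD[OF \<eta>(4) w(2)] unit' h(1)[OF uv(1)] by blast
    moreover have "h u \<noteq> h v"
    proof
      assume "h u = h v"
      then have "\<gamma> u = \<gamma> v" using h(2) uv by simp
      then show False using inj_onD[OF \<gamma>(4)] unit uv by blast
    qed
    ultimately show ?thesis using w by simp
  qed
  then have "strict_mono_on {0..s} h" by (rule strict_mono_onI)
  moreover have "h ` {0..s} = {0..t}"
  proof (intro subset_antisym subsetI)
    fix v assume v: "v \<in> {0..t}"
    then obtain u where u: "u \<in> {0..s}" "\<eta> v = \<gamma> u" using img by blast
    then have "\<eta> v = \<eta> (h u)" using h(2) by simp
    then have "v = h u" using inj_onD[OF \<eta>(4)] unit' v h(1)[OF u(1)] by blast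
    then show "v \<in> h ` {0..s}" using u by blast
  qed (use h in blast)
  ultimately show thesis using that h by blast
qed

text \<open>The almost sure properties of a realization from which the geometry follows without
  probability. Points are handled through their indices, since only countably many routes can be
  controlled simultaneously.\<close>

locale sampled_tree =
  fixes x :: "nat \<Rightarrow> complex \<times> real" and \<rho> :: "complex \<Rightarrow> complex \<Rightarrow> real \<Rightarrow> complex"
  assumes tree: "route_tree (range (\<lambda>n. \<rho> 0 (fst (x n))))"
    and ends: "\<And>n. \<rho> 0 (fst (x n)) 1 = fst (x n)"
    and locally_finite: "\<And>l B. finite {n. snd (x n) \<le> l \<and> norm (fst (x n)) \<le> B}"
    and infinite: "infinite {n. snd (x n) \<le> 1}"
begin

abbreviation "br n \<equiv> \<rho> 0 (fst (x n))"
abbreviation "pos n \<equiv> fst (x n)"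
abbreviation "exit n r \<equiv> exit_point r (br n)"
abbreviation "initial n r \<equiv> br n ` {0..exit_time r (br n)}"

lemma br: "route (br n)" "br n 0 = 0" "continuous_on {0..1} (br n)" "inj_on (br n) {0..1}"
  by (rule route_treeD[OF tree rangeI])+

lemma br_exit:
  assumes "0 \<le> r" "r < norm (pos n)"
  shows "0 \<le> exit_time r (br n)" "exit_time r (br n) < 1"
    "\<And>t. 0 \<le> t \<Longrightarrow> t \<le> exit_time r (br n) \<Longrightarrow> norm (br n t) \<le> r" "norm (exit n r) = r"
proof -
  have 0: "norm (br n 0) \<le> r" using assms br by simp
  have 1: "1 \<in> {0..1::real}" "r < norm (br n 1)" using assms ends by simp_all
  note * = exit_time_props[OF br(3) 0 1]
  show "0 \<le> exit_time r (br n)" "exit_time r (br n) < 1" by (rule *)+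
  show "\<And>t. 0 \<le> t \<Longrightarrow> t \<le> exit_time r (br n) \<Longrightarrow> norm (br n t) \<le> r" by (rule *(3))
  show "norm (exit n r) = r" by (rule *(4))
qed

lemma initial_eq:
  assumes "0 \<le> r" "r < norm (pos n)" "r < norm (pos m)" "exit n r = exit m r"
  shows "initial n r = initial m r"
proof (rule route_tree_initial[OF tree rangeI rangeI])
  show "exit_time r (br n) \<in> {0..1}" using br_exit(1,2)[of r n] assms(1,2) by simp
  show "exit_time r (br m) \<in> {0..1}" using br_exit(1,2)[of r m] assms(1,3) by simp
  show "br n (exit_time r (br n)) = br m (exit_time r (br m))" using assms(4) by (simp only: exit_point_def)
qed

lemma exit_in_initial:
  assumes "0 \<le> r" "r < norm (pos n)"
  shows "exit n r \<in> initial n r"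
  using br_exit(1)[OF assms] by (auto simp: exit_point_def)

definition follows_routes :: "real \<Rightarrow> (real \<Rightarrow> complex) \<Rightarrow> bool" where
  "follows_routes l \<gamma> \<longleftrightarrow> (\<forall>s t. 0 \<le> s \<and> s \<le> t \<longrightarrow>
     (\<exists>\<xi>\<in>\<Xi> x l. \<exists>u\<in>{0..1}. \<exists>v\<in>{0..1}. \<gamma> ` {s..t} = path_image (subpath u v (\<rho> 0 \<xi>))))"

lemma geodesics_iff:
  "S \<in> geodesics x \<rho> l \<longleftrightarrow> (\<exists>\<gamma>. S = \<gamma> ` {0..} \<and> continuous_on {0..} \<gamma> \<and> inj_on \<gamma> {0..} \<and>
    \<gamma> 0 = 0 \<and> len (\<gamma> ` {0..}) = \<infinity> \<and> follows_routes l \<gamma>)"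
  unfolding geodesics_def follows_routes_def mem_Collect_eq ..

text \<open>Successive routes agree up to the exit from the disc on which the next piece begins, so
  the pieces between consecutive circles fit together to one path. It is unbounded, hence of
  infinite length.\<close>

lemma chain_geodesic:
  assumes kl: "\<And>i. snd (x (k i)) \<le> l" and far: "\<And>i. real (Suc i) < norm (pos (k i))"
    and chain: "\<And>i. exit (k (Suc i)) (Suc i) = exit (k i) (Suc i)"
  shows "(\<Union>i. initial (k i) (Suc i)) \<in> geodesics x \<rho> l"
proof -
  \<comment> \<open>On the time interval from \<open>n\<close> to \<open>n + 1\<close> the path
    follows the route \<open>k n\<close> from its exit out of the disc of radius \<open>n\<close>,
    or from its start if \<open>n = 0\<close>, to its exit out of the next disc.\<close>
  define a where "a i = exit_time (Suc i) (br (k i))" for i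
  define c where "c i = (if i = 0 then 0 else exit_time (real i) (br (k i)))" for i :: nat
  have a: "0 \<le> a i" "a i < 1" "norm (br (k i) (a i)) = real (Suc i)" for i
    using br_exit(1,2,4)[OF _ far, of i] by (auto simp: a_def exit_point_def)
  have far': "real i < norm (pos (k i))" for i :: nat using far[of i] by simp
  have c: "0 \<le> c i" "c i < 1" "norm (br (k i) (c i)) = real i" for i :: nat
    using br_exit(1,2,4)[OF _ far', of i] br(2) by (auto simp: c_def exit_point_def)
  have ca: "br (k (Suc i)) (c (Suc i)) = br (k i) (a i)" for i
    using chain[of i] by (simp add: c_def a_def exit_point_def)
  have below_a: "norm (br (k i) t) \<le> real (Suc i)" if "0 \<le> t" "t \<le> a i" for i :: nat and t
    using br_exit(3)[OF _ far, of i t] that by (simp add: a_def)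
  have below_c: "norm (br (k i) t) \<le> real i" if "0 \<le> t" "t \<le> c i" for i :: nat and t
    using br_exit(3)[OF _ far', of i t] that br(2) by (cases "i = 0") (auto simp: c_def)
  have c_less_a: "c i < a i" for i :: nat
  proof (rule ccontr)
    assume "\<not> c i < a i"
    then have "norm (br (k i) (a i)) \<le> real i" using a by (intro below_c) auto
    then show False using a(3)[of i] by simp
  qed
  define g where "g i t = c i + (t - real i) * (a i - c i)" for i and t :: real
  define \<gamma> where "\<gamma> t = br (k (nat \<lfloor>t\<rfloor>)) (g (nat \<lfloor>t\<rfloor>) t)" for t :: real
  \<comment> \<open>At the right end the floor already selects the next route; by \<open>ca\<close>
    both descriptions give the same point.\<close>
  have piece: "\<gamma> t = br (k n) (g n t)" if t: "t \<in> {real n..real n + 1}" for t n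
  proof (cases "t = real n + 1")
    case True
    have "\<lfloor>t\<rfloor> = int (Suc n)" using True by linarith
    then have "nat \<lfloor>t\<rfloor> = Suc n" by (simp only: nat_int)
    then have "\<gamma> t = br (k (Suc n)) (c (Suc n))" using True by (simp add: \<gamma>_def g_def)
    also have "\<dots> = br (k n) (a n)" by (rule ca)
    finally show ?thesis using True by (simp add: g_def)
  next
    case False
    then have "\<lfloor>t\<rfloor> = int n" using t by (simp add: floor_eq_iff)
    then show ?thesis by (simp add: \<gamma>_def)
  qed
  have g_img: "g n ` {real n..real n + 1} = {c n..a n}" for n
  proof (intro subset_antisym subsetI)
    fix u assume "u \<in> {c n..a n}"
    then have "u = g n (real n + (u - c n) / (a n - c n))" "real n + (u - c n) / (a n - c n) \<in> {real n..real n + 1}"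
      using c_less_a[of n] by (auto simp: g_def field_simps)
    then show "u \<in> g n ` {real n..real n + 1}" by blast
  next
    fix u assume "u \<in> g n ` {real n..real n + 1}"
    then obtain t where t: "t \<in> {real n..real n + 1}" "u = g n t" by blast
    have "(t - real n) * (a n - c n) \<le> 1 * (a n - c n)"
      using t c_less_a[of n] by (intro mult_right_mono) auto
    moreover have "0 \<le> (t - real n) * (a n - c n)"
      using t c_less_a[of n] by (intro mult_nonneg_nonneg) auto
    ultimately show "u \<in> {c n..a n}" unfolding t(2) g_def by simp
  qed
  have g_mono: "g n s < g n t" if "s < t" for n s t
    using that c_less_a[of n] by (simp add: g_def)
  have cont_piece: "continuous_on {real n..real n + 1} \<gamma>" for n
  proof -
    have "continuous_on (g n ` {real n..real n + 1}) (br (k n))"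
      unfolding g_img by (rule continuous_on_subset[OF br(3)]) (use a(2)[of n] c(1)[of n] in auto)
    then have "continuous_on {real n..real n + 1} (\<lambda>t. br (k n) (g n t))"
      by (rule continuous_on_compose2) (auto simp: g_def intro!: continuous_intros)
    then show ?thesis using piece by (simp cong: continuous_on_cong_simp)
  qed
  have cont_fin: "continuous_on {0..real n} \<gamma>" for n
  proof (induction n)
    case (Suc n)
    have "{0..real (Suc n)} = {0..real n} \<union> {real n..real n + 1}" by auto
    then show ?case using Suc cont_piece[of n] by (simp add: continuous_on_closed_Un)
  qed simp
  have cont: "continuous_on {0..} \<gamma>"
    unfolding continuous_on_iff
  proof (intro ballI allI impI)
    fix t e :: real assume t: "t \<in> {0..}" and e: "0 < e"
    obtain n where n: "t + 1 < real n" using reals_Archimedean2 by blast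
    obtain d where d: "0 < d" "\<And>s. s \<in> {0..real n} \<Longrightarrow> dist s t < d \<Longrightarrow> dist (\<gamma> s) (\<gamma> t) < e"
      using cont_fin[of n, unfolded continuous_on_iff, rule_format, of t e] t e n by auto
    have "dist (\<gamma> s) (\<gamma> t) < e" if "s \<in> {0..}" "dist s t < min d 1" for s
      by (rule d(2)) (use that n in \<open>auto simp: dist_real_def\<close>)
    then show "\<exists>d>0. \<forall>s\<in>{0..}. dist s t < d \<longrightarrow> dist (\<gamma> s) (\<gamma> t) < e"
      using d(1) by (intro exI[of _ "min d 1"]) auto
  qed
  \<comment> \<open>The key invariant: up to time \<open>n + 1\<close> the whole path lies on the
    single route \<open>k n\<close> and runs along it monotonically. In the induction step the part
    already built is moved to the next route by reparametrization. Injectivity and the subroute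
    condition both follow from it.\<close>
  have param: "\<exists>\<phi>. strict_mono_on {0..real n + 1} \<phi> \<and> \<phi> ` {0..real n + 1} = {0..a n} \<and>
      (\<forall>t\<in>{0..real n + 1}. \<gamma> t = br (k n) (\<phi> t))" for n
  proof (induction n)
    case 0
    show ?case
      using g_img[of 0] piece[of _ 0] g_mono[of _ _ 0]
      by (intro exI[of _ "g 0"]) (auto simp: c_def strict_mono_on_def)
  next
    case (Suc n)
    then obtain \<phi> where \<phi>: "strict_mono_on {0..real n + 1} \<phi>" "\<phi> ` {0..real n + 1} = {0..a n}"
      "\<And>t. t \<in> {0..real n + 1} \<Longrightarrow> \<gamma> t = br (k n) (\<phi> t)" by blast
    have 1: "a n \<in> {0..1}" "c (Suc n) \<in> {0..1}" using a[of n] c[of "Suc n"] by auto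
    obtain h where h: "\<And>u. u \<in> {0..a n} \<Longrightarrow> br (k n) u = br (k (Suc n)) (h u)" "strict_mono_on {0..a n} h"
      "h ` {0..a n} = {0..c (Suc n)}"
      using route_tree_reparametrize[OF tree rangeI rangeI 1 ca[symmetric]] by blast
    define \<psi> where "\<psi> t = (if t \<le> real n + 1 then h (\<phi> t) else g (Suc n) t)" for t
    have \<phi>i: "\<phi> t \<in> {0..a n}" if "t \<in> {0..real n + 1}" for t using \<phi>(2) that by blast
    have \<psi>1: "\<psi> ` {0..real n + 1} = {0..c (Suc n)}"
    proof -
      have "\<psi> ` {0..real n + 1} = h ` \<phi> ` {0..real n + 1}"
        unfolding image_image by (intro image_cong refl) (simp add: \<psi>_def)
      then show ?thesis by (simp add: \<phi>(2) h(3))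
    qed
    have lo: "\<psi> t \<le> c (Suc n)" if "t \<in> {0..real n + 1}" for t using \<psi>1 that by auto
    have hi: "c (Suc n) < \<psi> t" if "real n + 1 < t" for t
      using that g_mono[of "real n + 1" t "Suc n"] by (simp add: \<psi>_def g_def)
    have "strict_mono_on {0..real (Suc n) + 1} \<psi>"
    proof (rule strict_mono_onI)
      fix s t assume st: "s \<in> {0..real (Suc n) + 1}" "t \<in> {0..real (Suc n) + 1}" "s < t"
      consider "t \<le> real n + 1" | "s \<le> real n + 1" "real n + 1 < t" | "real n + 1 < s" by linarith
      then show "\<psi> s < \<psi> t"
      proof cases
        case 1
        then have *: "s \<in> {0..real n + 1}" "t \<in> {0..real n + 1}" using st by auto
        have "\<phi> s < \<phi> t" by (rule strict_mono_onD[OF \<phi>(1) * st(3)])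
        then have "h (\<phi> s) < h (\<phi> t)" by (rule strict_mono_onD[OF h(2) \<phi>i[OF *(1)] \<phi>i[OF *(2)]])
        then show ?thesis using * by (simp add: \<psi>_def)
      next
        case 2
        then show ?thesis using lo[of s] hi[of t] st by auto
      next
        case 3
        then show ?thesis using g_mono[OF st(3)] st by (simp add: \<psi>_def)
      qed
    qed
    moreover have "\<psi> ` {0..real (Suc n) + 1} = {0..a (Suc n)}"
    proof -
      have e: "g (Suc n) (real n + 1) = c (Suc n)" by (simp add: g_def)
      have "\<psi> (real n + 1) = c (Suc n)"
      proof (rule antisym)
        obtain s where s: "s \<in> {0..real n + 1}" "\<psi> s = c (Suc n)" using \<psi>1 c(1)[of "Suc n"] by (metis atLeastAtMost_iff image_iff order.refl)
        show "c (Suc n) \<le> \<psi> (real n + 1)"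
        proof (cases "s = real n + 1")
          case False
          then have "\<psi> s < \<psi> (real n + 1)"
            using strict_mono_onD[OF \<open>strict_mono_on {0..real (Suc n) + 1} \<psi>\<close>, of s "real n + 1"] s by auto
          then show ?thesis using s by simp
        qed (use s in simp)
      qed (rule lo, simp)
      then have "\<psi> t = g (Suc n) t" if "t \<in> {real n + 1..real (Suc n) + 1}" for t
        using that e by (cases "t = real n + 1") (auto simp: \<psi>_def)
      then have "\<psi> ` {real n + 1..real (Suc n) + 1} = g (Suc n) ` {real (Suc n)..real (Suc n) + 1}"
        by (intro image_cong) auto
      then have 2: "\<psi> ` {real n + 1..real (Suc n) + 1} = {c (Suc n)..a (Suc n)}" by (simp only: g_img)
      have "{0..real (Suc n) + 1} = {0..real n + 1} \<union> {real n + 1..real (Suc n) + 1}" by auto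
      then have "\<psi> ` {0..real (Suc n) + 1} = {0..c (Suc n)} \<union> {c (Suc n)..a (Suc n)}"
        by (simp only: image_Un \<psi>1 2)
      also have "\<dots> = {0..a (Suc n)}" using c(1)[of "Suc n"] c_less_a[of "Suc n"] by auto
      finally show ?thesis .
    qed
    moreover have "\<gamma> t = br (k (Suc n)) (\<psi> t)" if t: "t \<in> {0..real (Suc n) + 1}" for t
    proof (cases "t \<le> real n + 1")
      case True
      then show ?thesis using \<phi>(3)[of t] h(1)[OF \<phi>i[of t]] t by (simp add: \<psi>_def)
    next
      case False
      then show ?thesis using piece[of t "Suc n"] t by (simp add: \<psi>_def)
    qed
    ultimately show ?case by blast
  qed
  have img: "\<gamma> ` {0..real n + 1} = initial (k n) (Suc n)" for n
  proof -
    obtain \<phi> where \<phi>: "\<phi> ` {0..real n + 1} = {0..a n}" "\<forall>t\<in>{0..real n + 1}. \<gamma> t = br (k n) (\<phi> t)"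
      using param[of n] by blast
    have "\<gamma> ` {0..real n + 1} = br (k n) ` \<phi> ` {0..real n + 1}"
      unfolding image_image using \<phi>(2) by (intro image_cong refl) blast
    then show ?thesis by (simp add: \<phi>(1) a_def)
  qed
  have bound: "\<exists>n. t \<le> real n + 1" for t :: real using real_arch_simple[of t] by (meson add_increasing2 zero_le_one)
  then have cover: "{0..} = (\<Union>n. {0..real n + 1})" by auto
  have whole: "\<gamma> ` {0..} = (\<Union>i. initial (k i) (Suc i))"
    unfolding cover image_UN img ..
  have unb: "\<not> bounded (\<gamma> ` {0..})"
  proof
    assume "bounded (\<gamma> ` {0..})"
    then obtain B where B: "\<And>z. z \<in> \<gamma> ` {0..} \<Longrightarrow> norm z \<le> B" unfolding bounded_iff by blast
    obtain n where n: "B < real n" using reals_Archimedean2 by blast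
    have "br (k n) (a n) \<in> initial (k n) (Suc n)" using a(1)[of n] by (intro imageI) (simp add: a_def)
    then have "br (k n) (a n) \<in> \<gamma> ` {0..}" unfolding whole by blast
    then have "norm (br (k n) (a n)) \<le> B" by (rule B)
    then show False using a(3)[of n] n by simp
  qed
  have "connected (\<gamma> ` {0..})" by (rule connected_continuous_image[OF cont]) simp
  then have len: "len (\<gamma> ` {0..}) = \<infinity>" using unb by (rule len_connected_unbounded)
  have sub: "\<exists>u v. 0 \<le> u \<and> u \<le> v \<and> v \<le> 1 \<and> \<gamma> ` {s..t} = br (k n) ` {u..v}"
    if st: "0 \<le> s" "s \<le> t" "t \<le> real n + 1" for s t n
  proof -
    obtain \<phi> where \<phi>: "strict_mono_on {0..real n + 1} \<phi>" "\<phi> ` {0..real n + 1} = {0..a n}" "\<forall>t\<in>{0..real n + 1}. \<gamma> t = br (k n) (\<phi> t)"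
      using param[of n] by blast
    have i: "s \<in> {0..real n + 1}" "t \<in> {0..real n + 1}" using st by auto
    have m: "\<phi> u \<le> \<phi> v \<longleftrightarrow> u \<le> v" if "u \<in> {0..real n + 1}" "v \<in> {0..real n + 1}" for u v
      using strict_mono_onD[OF \<phi>(1) that] strict_mono_onD[OF \<phi>(1) that(2,1)]
      by (cases u v rule: linorder_cases) auto
    have "\<phi> ` {s..t} = {\<phi> s..\<phi> t}"
    proof (intro subset_antisym subsetI)
      fix w assume w: "w \<in> {\<phi> s..\<phi> t}"
      have "\<phi> s \<in> {0..a n}" "\<phi> t \<in> {0..a n}" using \<phi>(2) i by blast+
      then have "w \<in> \<phi> ` {0..real n + 1}" unfolding \<phi>(2) using w by auto
      then obtain u where "u \<in> {0..real n + 1}" "w = \<phi> u" by blast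
      then show "w \<in> \<phi> ` {s..t}" using w m i by auto
    next
      fix w assume "w \<in> \<phi> ` {s..t}"
      then obtain u where "u \<in> {s..t}" "w = \<phi> u" by blast
      moreover have "u \<in> {0..real n + 1}" using calculation st by auto
      ultimately show "w \<in> {\<phi> s..\<phi> t}" using m i by auto
    qed
    moreover have "\<gamma> ` {s..t} = br (k n) ` \<phi> ` {s..t}"
      unfolding image_image using \<phi>(3) st by (intro image_cong refl) auto
    moreover have "\<phi> s \<in> {0..a n}" "\<phi> t \<in> {0..a n}" using \<phi>(2) i by blast+
    ultimately show ?thesis using m[OF i] st a(2)[of n]
      by (intro exI[of _ "\<phi> s"] exI[of _ "\<phi> t"]) auto
  qed
  have "inj_on \<gamma> {0..}"
  proof (rule linorder_inj_onI)
    fix s t :: real assume st: "s < t" "s \<in> {0..}" "t \<in> {0..}"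
    obtain n where n: "t \<le> real n + 1" using bound by blast
    obtain \<phi> where \<phi>: "strict_mono_on {0..real n + 1} \<phi>" "\<phi> ` {0..real n + 1} = {0..a n}" "\<forall>t\<in>{0..real n + 1}. \<gamma> t = br (k n) (\<phi> t)"
      using param[of n] by blast
    have i: "s \<in> {0..real n + 1}" "t \<in> {0..real n + 1}" using st n by auto
    then have "\<phi> s < \<phi> t" using strict_mono_onD[OF \<phi>(1)] st by blast
    moreover have "\<phi> s \<in> {0..1}" "\<phi> t \<in> {0..1}" using \<phi>(2) i a(2)[of n] by (fastforce)+
    ultimately have "br (k n) (\<phi> s) \<noteq> br (k n) (\<phi> t)" using inj_onD[OF br(4)] by fastforce
    then show "\<gamma> s \<noteq> \<gamma> t" using \<phi>(3) i by simp
  qed auto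
  moreover have "\<gamma> 0 = 0" using piece[of 0 0] br by (simp add: g_def c_def)
  moreover have "\<exists>\<xi>\<in>\<Xi> x l. \<exists>u\<in>{0..1}. \<exists>v\<in>{0..1}. \<gamma> ` {s..t} = path_image (subpath u v (\<rho> 0 \<xi>))"
    if st: "0 \<le> s" "s \<le> t" for s t
  proof -
    obtain n where n: "t \<le> real n + 1" using bound by blast
    obtain u v where "0 \<le> u" "u \<le> v" "v \<le> 1" "\<gamma> ` {s..t} = br (k n) ` {u..v}" using sub[OF st n] by blast
    moreover have "pos (k n) \<in> \<Xi> x l" using kl unfolding \<Xi>_def by blast
    ultimately show ?thesis
      by (intro bexI[of _ "pos (k n)"] bexI[of _ u] bexI[of _ v]) (auto simp: path_image_subpath)
  qed
  ultimately have "\<gamma> ` {0..} \<in> geodesics x \<rho> l"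
    unfolding geodesics_iff follows_routes_def using cont len by metis
  then show ?thesis by (simp only: whole)
qed


section \<open>Uniqueness of the geodesic for a fixed realization\<close>

lemma geodesics_mono:
  assumes "l \<le> l'"
  shows "geodesics x \<rho> l \<subseteq> geodesics x \<rho> l'"
proof -
  have "\<Xi> x l \<subseteq> \<Xi> x l'" using assms by (auto simp: \<Xi>_def intro: order.trans)
  then have "follows_routes l' \<gamma>" if "follows_routes l \<gamma>" for \<gamma>
    using that unfolding follows_routes_def by (meson subsetD)
  then show ?thesis unfolding geodesics_iff subset_iff by metis
qed

text \<open>By monotonicity in the time bound, the limit that defines \<open>G\<close> exists and is
  a supremum.\<close>

lemma G_ge:
  assumes "A \<subseteq> geodesics x \<rho> l"
  shows "emeasure (count_space UNIV) A \<le> G x \<rho>"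
proof -
  let ?f = "\<lambda>l. emeasure (count_space UNIV) (geodesics x \<rho> l)"
  have mono: "?f l \<le> ?f l'" if "l \<le> l'" for l l'
    using geodesics_mono[OF that] by (intro emeasure_mono) auto
  have "(?f \<longlongrightarrow> (SUP l. ?f l)) at_top"
  proof (rule order_tendstoI)
    fix a assume "a < (SUP l. ?f l)"
    then obtain l where "a < ?f l" by (auto simp: less_SUP_iff)
    then show "eventually (\<lambda>l. a < ?f l) at_top"
      by (intro eventually_mono[OF eventually_ge_at_top[of l]]) (rule order.strict_trans2[OF _ mono])
  next
    fix a assume a: "(SUP l. ?f l) < a"
    have "?f l < a" for l by (rule le_less_trans[OF SUP_upper a]) simp
    then show "eventually (\<lambda>l. ?f l < a) at_top" by simp
  qed
  then have "G x \<rho> = (SUP l. ?f l)" unfolding G_def by (intro tendsto_Lim) auto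
  moreover have "emeasure (count_space UNIV) A \<le> ?f l" using assms by (intro emeasure_mono) auto
  ultimately show ?thesis by (metis SUP_upper UNIV_I order.trans)
qed

lemma initial_subset:
  assumes "0 \<le> r" "r \<le> r'" "r' < norm (pos n)"
  shows "initial n r \<subseteq> initial n r'"
proof -
  have "exit_time r (br n) \<le> exit_time r' (br n)"
  proof (rule ccontr)
    assume *: "\<not> ?thesis"
    then have 1: "norm (br n (exit_time r' (br n))) \<le> r" using br_exit(1)[of r' n] assms by (intro br_exit(3)[of r n]) auto
    moreover have "norm (br n (exit_time r' (br n))) = r'" using br_exit(4)[of r' n] assms by (simp add: exit_point_def)
    ultimately show False using * assms by auto
  qed
  then show ?thesis by (intro image_mono) auto
qed

lemma len_subset_path: "S \<subseteq> path_image (br n) \<Longrightarrow> len S \<noteq> \<infinity>"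
  using len_mono[of S "path_image (br n)"] len_route_finite[OF br(1), of n] by (auto simp: top_unique)

text \<open>Pulled back to the parameters of the route, the path sweeps a connected set of times
  containing 0. Had it gone past the exit time, it would have passed through the exit point, whose
  modulus is \<open>r\<close>.\<close>

lemma initial_part_before_exit:
  fixes \<gamma> :: "real \<Rightarrow> complex"
  assumes cont: "continuous_on {0..s} \<gamma>" and 0: "\<gamma> 0 = 0" "0 \<le> s"
    and sub: "\<gamma> ` {0..s} \<subseteq> path_image (br n)" and small: "\<And>t. t \<in> {0..s} \<Longrightarrow> norm (\<gamma> t) < r" and r: "r < norm (pos n)"
  shows "\<gamma> s \<in> initial n r"
proof -
  have r0: "0 \<le> r" using small[of 0] 0 by simp
  note ex = br_exit[OF r0 r]
  let ?g = "the_inv_into {0..1} (br n)"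
  have cg: "continuous_on (br n ` {0..1}) ?g" by (rule continuous_on_inv_into[OF br(3) compact_Icc br(4)])
  have con: "connected ((?g \<circ> \<gamma>) ` {0..s})"
    by (intro connected_continuous_image continuous_on_compose cont continuous_on_subset[OF cg])
       (use sub in \<open>auto simp: path_image_def\<close>)
  have g0: "?g 0 = 0" using the_inv_into_f_f[OF br(4), of 0 n] br(2)[of n] by simp
  obtain w where w: "w \<in> {0..1}" "\<gamma> s = br n w" using sub 0(2) by (force simp: path_image_def)
  have gw: "?g (\<gamma> s) = w" unfolding w(2) by (rule the_inv_into_f_f[OF br(4) w(1)])
  have "w \<le> exit_time r (br n)"
  proof (rule ccontr)
    assume *: "\<not> ?thesis"
    have "{(?g \<circ> \<gamma>) 0..(?g \<circ> \<gamma>) s} \<subseteq> (?g \<circ> \<gamma>) ` {0..s}"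
      by (rule connected_contains_Icc[OF con]; rule imageI) (use 0 in simp_all)
    then have "{0..w} \<subseteq> (?g \<circ> \<gamma>) ` {0..s}" using g0 gw 0 by simp
    moreover have "exit_time r (br n) \<in> {0..w}" using * ex by auto
    ultimately have "exit_time r (br n) \<in> (?g \<circ> \<gamma>) ` {0..s}" by blast
    then obtain t where t: "t \<in> {0..s}" "exit_time r (br n) = ?g (\<gamma> t)" by auto
    have "br n (?g (\<gamma> t)) = \<gamma> t"
      by (rule f_the_inv_into_f[OF br(4)]) (use sub t in \<open>auto simp: path_image_def\<close>)
    then have "exit n r = \<gamma> t" using t by (simp add: exit_point_def)
    then show False using ex(4) small[OF t(1)] by simp
  qed
  then show ?thesis using w by auto
qed

lemma exists_far: "\<exists>n. snd (x n) \<le> 1 \<and> B < norm (pos n)"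
proof (rule ccontr)
  assume "\<not> ?thesis"
  then have "{n. snd (x n) \<le> 1} = {n. snd (x n) \<le> 1 \<and> norm (pos n) \<le> B}" by (auto simp: not_less)
  then show False using infinite locally_finite[of 1 B] by simp
qed

text \<open>Far routes share ever longer initial parts, and these chain up to one geodesic
  \<open>\<Gamma>\<close>. Any other geodesic has infinite length, so its portions cannot all lie on
  one route; by local finiteness they lie on routes to points arbitrarily far away, whose initial
  parts belong to \<open>\<Gamma>\<close>.\<close>

lemma unique_geodesic:
  assumes "\<And>R. \<exists>B. \<forall>n m. B < norm (pos n) \<longrightarrow> B < norm (pos m) \<longrightarrow> exit n (real (Suc R)) = exit m (real (Suc R))"
  shows "G x \<rho> = 1"
proof -
  obtain B where B: "\<And>R n m. B R < norm (pos n) \<Longrightarrow> B R < norm (pos m) \<Longrightarrow> exit n (real (Suc R)) = exit m (real (Suc R))"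
    using assms by metis
  \<comment> \<open>The sum makes one bound dominate all earlier ones; the second term lets the
    chosen points lie outside the disc under consideration.\<close>
  define B' where "B' i = (\<Sum>j\<le>i. \<bar>B j\<bar>) + real (Suc i)" for i
  have B': "B i \<le> B' j" "real (Suc i) \<le> B' j" if "i \<le> j" for i j
  proof -
    have "B i \<le> \<bar>B i\<bar>" by simp
    also have "\<dots> \<le> (\<Sum>j\<le>j. \<bar>B j\<bar>)" using that by (intro member_le_sum) auto
    finally show "B i \<le> B' j" by (simp add: B'_def)
    have "0 \<le> (\<Sum>j\<le>j. \<bar>B j\<bar>)" by (intro sum_nonneg) auto
    moreover have "real (Suc i) \<le> real (Suc j)" using that by simp
    ultimately show "real (Suc i) \<le> B' j" unfolding B'_def by linarith
  qed
  have "\<forall>i. \<exists>n. snd (x n) \<le> 1 \<and> B' i < norm (pos n)" using exists_far by blast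
  then obtain k where k: "\<And>i. snd (x (k i)) \<le> 1" "\<And>i. B' i < norm (pos (k i))" by metis
  have far: "B i < norm (pos (k j))" "real (Suc i) < norm (pos (k j))" if "i \<le> j" for i j
    using B'[OF that] k(2)[of j] by linarith+
  have ex: "exit (k j) (real (Suc i)) = exit (k i) (real (Suc i))" if "i \<le> j" for i j
    by (rule B) (use far that in auto)
  define \<Gamma> where "\<Gamma> = (\<Union>i. initial (k i) (real (Suc i)))"
  have \<Gamma>: "\<Gamma> \<in> geodesics x \<rho> 1"
    unfolding \<Gamma>_def
  proof (rule chain_geodesic)
    show "snd (x (k i)) \<le> 1" "real (Suc i) < norm (pos (k i))" for i using k far by simp_all
    show "exit (k (Suc i)) (real (Suc i)) = exit (k i) (real (Suc i))" for i by (rule ex) simp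
  qed
  have "S = \<Gamma>" if S: "S \<in> geodesics x \<rho> l" for S l
  proof -
    obtain \<gamma> where S': "S = \<gamma> ` {0..}" and \<gamma>: "continuous_on {0..} \<gamma>" "\<gamma> 0 = 0" "len (\<gamma> ` {0..}) = \<infinity>"
      and fr: "follows_routes l \<gamma>"
      using S unfolding geodesics_iff by metis
    have sub: "\<exists>\<xi>\<in>\<Xi> x l. \<exists>u\<in>{0..1}. \<exists>v\<in>{0..1}. \<gamma> ` {s..t} = path_image (subpath u v (\<rho> 0 \<xi>))"
      if "0 \<le> s" "s \<le> t" for s t using fr that unfolding follows_routes_def by metis
    have "\<exists>n v. snd (x n) \<le> l \<and> v \<in> {0..1} \<and> \<gamma> ` {0..t} = br n ` {0..v}" if t: "0 \<le> t" for t
    proof -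
      obtain n u v where n: "snd (x n) \<le> l" "u \<in> {0..1}" "v \<in> {0..1}" "\<gamma> ` {0..t} = path_image (subpath u v (br n))"
        using sub[of 0 t] t unfolding \<Xi>_def by blast
      define p q where "p = min u v" and "q = max u v"
      have pq: "p \<in> {0..1}" "q \<in> {0..1}" "p \<le> q" "\<gamma> ` {0..t} = br n ` {p..q}"
        using n by (auto simp: p_def q_def path_image_subpath min_def max_def)
      have "br n 0 \<in> \<gamma> ` {0..t}" using t br(2) \<gamma>(2) by (metis atLeastAtMost_iff imageI order.refl)
      then obtain w where w: "w \<in> {p..q}" "br n 0 = br n w" unfolding pq(4) by blast
      then have "0 = w" using inj_onD[OF br(4) w(2)] pq by auto
      then have "p = 0" using w pq by auto
      then show ?thesis using n pq by blast
    qed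
    then obtain N V where NV: "\<And>t. 0 \<le> t \<Longrightarrow> snd (x (N t)) \<le> l" "\<And>t. 0 \<le> t \<Longrightarrow> V t \<in> {0..1}"
      "\<And>t. 0 \<le> t \<Longrightarrow> \<gamma> ` {0..t} = br (N t) ` {0..V t}" by metis
    have img: "\<gamma> ` {0..t} \<subseteq> path_image (br (N t))" if "0 \<le> t" for t
      unfolding NV(3)[OF that] path_image_def using NV(2)[OF that] by (intro image_mono) auto
    have fin: "finite {t::nat. N (real t) = n}" for n
    proof (rule ccontr)
      assume inf: "infinite {t::nat. N (real t) = n}"
      have "\<gamma> ` {0..} \<subseteq> path_image (br n)"
      proof
        fix z assume "z \<in> \<gamma> ` {0..}"
        then obtain s where s: "0 \<le> s" "z = \<gamma> s" by auto
        obtain t where t: "N (real t) = n" "s \<le> real t"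
        proof -
          obtain m :: nat where m: "s \<le> real m" using real_arch_simple by blast
          obtain t where "t > m" "t \<in> {t. N (real t) = n}" using inf unfolding infinite_nat_iff_unbounded by blast
          then show thesis using m that by force
        qed
        have "z \<in> \<gamma> ` {0..real t}" using s t by auto
        then show "z \<in> path_image (br n)" using img[of "real t"] t by auto
      qed
      then show False using len_subset_path \<gamma>(3) by blast
    qed
    \<comment> \<open>Only finitely many routes end in a given disc, and by \<open>fin\<close> each
      of them carries only finitely many of the portions with integer end time.\<close>
    have large: "\<exists>t\<ge>s. 0 \<le> t \<and> C < norm (pos (N t))" for s C
    proof (rule ccontr)
      assume *: "\<not> ?thesis"
      obtain m :: nat where m: "s \<le> real m" using real_arch_simple by blast
      have "{m..} \<subseteq> (\<Union>n\<in>{n. snd (x n) \<le> l \<and> norm (pos n) \<le> C}. {t::nat. N (real t) = n})"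
        using * m NV(1) by (force simp: not_less)
      moreover have "finite (\<Union>n\<in>{n. snd (x n) \<le> l \<and> norm (pos n) \<le> C}. {t::nat. N (real t) = n})"
        using locally_finite fin by blast
      ultimately have "finite {m..}" by (rule finite_subset)
      then show False by (simp add: infinite_Ici)
    qed
    have "\<gamma> s \<in> \<Gamma>" if s: "0 \<le> s" for s
    proof -
      have cs: "continuous_on {0..s} \<gamma>" by (rule continuous_on_subset[OF \<gamma>(1)]) auto
      have "bounded (\<gamma> ` {0..s})" by (intro compact_imp_bounded compact_continuous_image cs) auto
      then obtain b where b: "\<And>t. t \<in> {0..s} \<Longrightarrow> norm (\<gamma> t) \<le> b" unfolding bounded_iff by blast
      obtain i where i: "b < real i" using reals_Archimedean2 by blast
      obtain T where T: "s \<le> T" "B' i < norm (pos (N T))" using large by blast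
      have "\<gamma> s \<in> initial (N T) (real (Suc i))"
      proof (rule initial_part_before_exit[OF cs \<gamma>(2) s])
        show "\<gamma> ` {0..s} \<subseteq> path_image (br (N T))" using img[of T] T(1) s by (auto simp: image_subset_iff)
        show "norm (\<gamma> t) < real (Suc i)" if "t \<in> {0..s}" for t using b[OF that] i by simp
        show "real (Suc i) < norm (pos (N T))" using T(2) B'(2)[of i i] by simp
      qed
      also have "initial (N T) (real (Suc i)) = initial (k i) (real (Suc i))"
      proof (rule initial_eq)
        show "real (Suc i) < norm (pos (N T))" using T(2) B'(2)[of i i] by simp
        show "real (Suc i) < norm (pos (k i))" by (rule far) simp
        show "exit (N T) (real (Suc i)) = exit (k i) (real (Suc i))"
          by (rule B) (use T(2) B'(1)[of i i] far(1)[of i i] in linarith)+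
      qed simp
      finally show ?thesis by (auto simp: \<Gamma>_def)
    qed
    \<comment> \<open>The initial part has finite length, so \<open>\<gamma>\<close> leaves it at
      some time \<open>s\<close>. The point reached lies on \<open>\<Gamma>\<close> further out, and
      by compatibility \<open>\<gamma>\<close> has run through everything on \<open>\<Gamma>\<close>
      before that point.\<close>
    moreover have "initial (k i) (real (Suc i)) \<subseteq> \<gamma> ` {0..}" for i
    proof -
      have "initial (k i) (real (Suc i)) \<subseteq> path_image (br (k i))"
        unfolding path_image_def using br_exit(2)[of "real (Suc i)" "k i"] far(2)[of i i] by (intro image_mono) auto
      then have "\<not> \<gamma> ` {0..} \<subseteq> initial (k i) (real (Suc i))"
        using len_subset_path \<gamma>(3) by (meson order.trans)
      then obtain s where s: "0 \<le> s" "\<gamma> s \<notin> initial (k i) (real (Suc i))" by auto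
      then obtain j where j: "\<gamma> s \<in> initial (k j) (real (Suc j))" using calculation[of s] by (auto simp: \<Gamma>_def)
      have init: "initial (k i) (real (Suc i)) = initial (k j) (real (Suc i))" if "i \<le> j"
        by (rule initial_eq[OF _ far(2) far(2) ex[OF that, symmetric]]) (use that in auto)
      have ij: "i < j"
      proof (rule ccontr)
        assume "\<not> i < j"
        then have ji: "j \<le> i" by simp
        have "initial (k j) (real (Suc j)) = initial (k i) (real (Suc j))"
          by (rule initial_eq[OF _ far(2) far(2) ex[OF ji, symmetric]]) (use ji in auto)
        also have "\<dots> \<subseteq> initial (k i) (real (Suc i))"
          by (rule initial_subset) (use far ji in auto)
        finally show False using j s by blast
      qed
      obtain w' where w': "0 \<le> w'" "w' \<le> exit_time (real (Suc j)) (br (k j))" "\<gamma> s = br (k j) w'" using j by auto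
      have w'1: "w' \<le> 1" using w' br_exit(2)[of "real (Suc j)" "k j"] far(2)[of j j] by auto
      have "exit_time (real (Suc i)) (br (k j)) < w'"
      proof (rule ccontr)
        assume "\<not> ?thesis"
        then have "\<gamma> s \<in> initial (k j) (real (Suc i))" using w' by auto
        then show False using init ij s by auto
      qed
      then have 1: "initial (k i) (real (Suc i)) \<subseteq> br (k j) ` {0..w'}"
        unfolding init[OF less_imp_le[OF ij]] by (intro image_mono) auto
      have "\<gamma> s \<in> br (N s) ` {0..V s}" unfolding NV(3)[OF s(1), symmetric] using s by auto
      then obtain w where w: "0 \<le> w" "w \<le> V s" "\<gamma> s = br (N s) w" by auto
      have "br (k j) ` {0..w'} = br (N s) ` {0..w}"
        by (rule route_tree_initial[OF tree rangeI rangeI]) (use w w' w'1 NV(2)[OF s(1)] in auto)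
      also have "\<dots> \<subseteq> br (N s) ` {0..V s}" using w by (intro image_mono) auto
      also have "\<dots> = \<gamma> ` {0..s}" by (rule NV(3)[OF s(1), symmetric])
      also have "\<dots> \<subseteq> \<gamma> ` {0..}" by (intro image_mono) auto
      finally show ?thesis using 1 by simp
    qed
    ultimately have "\<gamma> ` {0..} \<subseteq> \<Gamma>" "\<Gamma> \<subseteq> \<gamma> ` {0..}" unfolding \<Gamma>_def by (blast, blast)
    then show ?thesis unfolding S' by simp
  qed
  then have gl: "geodesics x \<rho> l = {\<Gamma>}" if "1 \<le> l" for l
    using geodesics_mono[OF that] \<Gamma> by blast
  have "eventually (\<lambda>l. emeasure (count_space UNIV) (geodesics x \<rho> l) = 1) at_top"
    by (rule eventually_mono[OF eventually_ge_at_top[of 1]]) (simp add: gl)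
  then have "((\<lambda>l. emeasure (count_space UNIV) (geodesics x \<rho> l)) \<longlongrightarrow> 1) at_top"
    by (rule tendsto_eventually)
  then show ?thesis unfolding G_def by (intro tendsto_Lim) auto
qed

text \<open>Koenig's lemma for the tree of routes.\<close>

lemma infinite_class_geodesic:
  assumes S: "infinite S" "S \<subseteq> {n. snd (x n) \<le> l}"
    and fin: "\<And>R. finite ((\<lambda>n. exit n (real (Suc R))) ` {n. 3 * real (Suc R) < norm (pos n)})"
  obtains k where "\<And>i. k i \<in> S" "\<And>i. real (Suc i) < norm (pos (k i))"
    "(\<Union>i. initial (k i) (real (Suc i))) \<in> geodesics x \<rho> l"
proof -
  \<comment> \<open>\<open>P i T\<close>: infinitely many routes leave the disc of radius
    \<open>i + 1\<close> at one and the same point. As there are finitely many exit points,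
    pigeonhole refines such a set at the next radius.\<close>
  define P where "P i T \<longleftrightarrow> infinite T \<and> T \<subseteq> S \<and>
    (\<forall>n\<in>T. 3 * real (Suc i) < norm (pos n)) \<and> (\<forall>n\<in>T. \<forall>m\<in>T. exit n (real (Suc i)) = exit m (real (Suc i)))" for i T
  have refine: "\<exists>T'. P i T' \<and> T' \<subseteq> T" if T: "infinite T" "T \<subseteq> S" for T i
  proof -
    let ?U = "{n\<in>T. 3 * real (Suc i) < norm (pos n)}"
    have "T - ?U \<subseteq> {n. snd (x n) \<le> l \<and> norm (pos n) \<le> 3 * real (Suc i)}" using T S by (auto simp: not_less)
    then have "finite (T - ?U)" using locally_finite by (rule finite_subset)
    then have "infinite ?U" using T(1) by (metis (no_types, lifting) Diff_infinite_finite finite_Diff2)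
    moreover have "finite ((\<lambda>n. exit n (real (Suc i))) ` ?U)" by (rule finite_subset[OF _ fin[of i]]) auto
    ultimately obtain n where "n \<in> ?U" "infinite {m \<in> ?U. exit m (real (Suc i)) = exit n (real (Suc i))}"
      using pigeonhole_infinite[of ?U "\<lambda>n. exit n (real (Suc i))"] by blast
    then show ?thesis unfolding P_def
      by (intro exI[of _ "{m \<in> ?U. exit m (real (Suc i)) = exit n (real (Suc i))}"]) (use T in auto)
  qed
  have 0: "\<exists>T. P 0 T" using refine[OF S(1), of 0] by blast
  have "\<exists>T'. P (Suc i) T' \<and> T' \<subseteq> T" if "P i T" for T i
    using refine[of T "Suc i"] that unfolding P_def by blast
  from dependent_nat_choice[of P "\<lambda>i T T'. T' \<subseteq> T", OF 0 this]
  have "\<exists>f. (\<forall>i. P i (f i)) \<and> (\<forall>i. f (Suc i) \<subseteq> f i)" by blast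
  then obtain f where f: "\<And>i. P i (f i)" "\<And>i. f (Suc i) \<subseteq> f i" by blast
  have "\<forall>i. \<exists>n. n \<in> f i" using f(1) unfolding P_def by (metis all_not_in_conv finite.emptyI)
  then obtain k where k: "\<And>i. k i \<in> f i" by metis
  have kS: "k i \<in> S" for i using k[of i] f(1)[of i] unfolding P_def by blast
  have far: "real (Suc i) < norm (pos (k i))" for i
  proof -
    have "3 * real (Suc i) < norm (pos (k i))" using k[of i] f(1)[of i] unfolding P_def by blast
    moreover have "0 \<le> real (Suc i)" by simp
    ultimately show ?thesis by argo
  qed
  have "(\<Union>i. initial (k i) (real (Suc i))) \<in> geodesics x \<rho> l"
  proof (rule chain_geodesic)
    show "snd (x (k i)) \<le> l" for i using kS S(2) by blast
    show "exit (k (Suc i)) (real (Suc i)) = exit (k i) (real (Suc i))" for i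
      using k[of i] k[of "Suc i"] f(2)[of i] f(1)[of i] unfolding P_def by blast
  qed (rule far)
  then show thesis using that[OF kS far] by blast
qed

text \<open>If two exit points from the unit disc were used by infinitely many routes each, both
  classes would carry a geodesic. So one exit point serves all but finitely many routes, and
  \<open>B\<close> is taken beyond the end points of the exceptions.\<close>

lemma unique_geodesic_imp_common_exit:
  assumes G: "G x \<rho> = 1"
    and fin: "\<And>R. finite ((\<lambda>n. exit n (real (Suc R))) ` {n. 3 * real (Suc R) < norm (pos n)})"
  shows "\<exists>B\<ge>1. \<forall>n m. snd (x n) \<le> 1 \<longrightarrow> snd (x m) \<le> 1 \<longrightarrow> B < norm (pos n) \<longrightarrow> B < norm (pos m) \<longrightarrow> exit n 1 = exit m 1"
proof -
  let ?N = "{n. snd (x n) \<le> 1 \<and> 3 < norm (pos n)}"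
  let ?C = "\<lambda>v. {n \<in> ?N. exit n 1 = v}"
  have at_most_one: "v = v'" if inf: "infinite (?C v)" "infinite (?C v')" for v v'
  proof (rule ccontr)
    assume ne: "v \<noteq> v'"
    obtain k where k: "\<And>i. k i \<in> ?C v" "\<And>i. real (Suc i) < norm (pos (k i))"
      "(\<Union>i. initial (k i) (real (Suc i))) \<in> geodesics x \<rho> 1"
      using infinite_class_geodesic[OF inf(1) _ fin, of 1] by auto
    obtain k' where k': "\<And>i. k' i \<in> ?C v'" "\<And>i. real (Suc i) < norm (pos (k' i))"
      "(\<Union>i. initial (k' i) (real (Suc i))) \<in> geodesics x \<rho> 1"
      using infinite_class_geodesic[OF inf(2) _ fin, of 1] by auto
    let ?\<Gamma> = "\<Union>i. initial (k i) (real (Suc i))" and ?\<Gamma>' = "\<Union>i. initial (k' i) (real (Suc i))"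
    \<comment> \<open>The witness that tells the two geodesics apart: being outside the unit disc,
      it would, if it lay on both, force equal exit points from that disc.\<close>
    let ?w = "exit (k 1) 2"
    have two: "2 < norm (pos (k 1))" using k(2)[of 1] by simp
    have "?w \<in> initial (k 1) (real (Suc 1))" using exit_in_initial[of 2 "k 1"] two by simp
    then have "?w \<in> ?\<Gamma>" by blast
    moreover have "?w \<notin> ?\<Gamma>'"
    proof
      assume "?w \<in> ?\<Gamma>'"
      then obtain i where "?w \<in> initial (k' i) (real (Suc i))" by blast
      then obtain t where t: "0 \<le> t" "t \<le> exit_time (real (Suc i)) (br (k' i))" "?w = br (k' i) t" by auto
      have t1: "t \<in> {0..1}" using t br_exit(2)[OF _ k'(2)[of i]] by auto
      have s: "exit_time 2 (br (k 1)) \<in> {0..1}" using br_exit(1,2)[of 2 "k 1"] two by auto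
      have w: "norm (br (k 1) (exit_time 2 (br (k 1)))) = 2" using br_exit(4)[of 2 "k 1"] two by (simp add: exit_point_def)
      have "exit (k 1) 1 = exit (k' i) 1"
        by (rule exit_point_eq_if_meet[OF tree rangeI rangeI s t1]) (use t(3) w in \<open>auto simp: exit_point_def\<close>)
      then show False using k(1)[of 1] k'(1)[of i] ne by auto
    qed
    ultimately have "?\<Gamma> \<noteq> ?\<Gamma>'" by blast
    then have "emeasure (count_space UNIV) {?\<Gamma>, ?\<Gamma>'} = 2" by simp
    moreover have "emeasure (count_space UNIV) {?\<Gamma>, ?\<Gamma>'} \<le> G x \<rho>"
      by (rule G_ge) (use k k' in blast)
    ultimately show False using G by simp
  qed
  have finV: "finite ((\<lambda>n. exit n 1) ` ?N)"
    by (rule finite_subset[OF _ fin[of 0]]) auto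
  have "infinite ?N"
  proof
    assume "finite ?N"
    moreover have "{n. snd (x n) \<le> 1} \<subseteq> ?N \<union> {n. snd (x n) \<le> 1 \<and> norm (pos n) \<le> 3}" by auto
    ultimately show False using infinite locally_finite[of 1 3] finite_subset by blast
  qed
  then obtain n0 where n0: "n0 \<in> ?N" "infinite (?C (exit n0 1))"
    using pigeonhole_infinite[OF _ finV] by blast
  have "?N - ?C (exit n0 1) \<subseteq> (\<Union>v\<in>(\<lambda>n. exit n 1) ` ?N - {exit n0 1}. ?C v)" by auto
  moreover have "finite (\<Union>v\<in>(\<lambda>n. exit n 1) ` ?N - {exit n0 1}. ?C v)"
    using finV at_most_one[OF _ n0(2)] by (intro finite_UN_I) auto
  ultimately have F: "finite (?N - ?C (exit n0 1))" by (rule finite_subset)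
  define B where "B = Max (insert 3 ((\<lambda>n. norm (pos n)) ` (?N - ?C (exit n0 1))))"
  have B: "3 \<le> B" "\<And>n. n \<in> ?N - ?C (exit n0 1) \<Longrightarrow> norm (pos n) \<le> B"
    using F by (auto simp: B_def intro!: Max_ge)
  have "exit n 1 = exit n0 1" if "snd (x n) \<le> 1" "B < norm (pos n)" for n
    using B(1) B(2)[of n] that by force
  then show ?thesis using B(1) by (intro exI[of _ B]) auto
qed

end

subsection \<open>Networks spanned by sample points\<close>

text \<open>Covers both kinds of networks with one definition: for \<open>J = {1..<k}\<close> the
  base point is the origin, for \<open>J = {..<k}\<close> it is one of the given points.\<close>

definition place :: "nat \<Rightarrow> nat set \<Rightarrow> (nat \<Rightarrow> complex) \<Rightarrow> nat \<Rightarrow> complex" where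
  "place k J y = (\<lambda>j\<in>{..<k}. if j \<in> J then y j else 0)"

lemma space_positions: "space (positions k) = {z \<in> {..<k} \<rightarrow>\<^sub>E UNIV. inj_on z {..<k}}"
  by (auto simp: positions_def space_restrict_space space_PiM)

lemma positions_set:
  fixes k :: nat
  shows "{z \<in> space (PiM {..<k} (\<lambda>_. borel :: complex measure)). inj_on z {..<k}} \<in> sets (PiM {..<k} (\<lambda>_. borel))"
proof -
  let ?P = "PiM {..<k} (\<lambda>_. borel :: complex measure)"
  have "{z \<in> space ?P. inj_on z {..<k}} = space ?P - (\<Union>x\<in>{..<k}. \<Union>y\<in>{..<k} - {x}. {z \<in> space ?P. z x = z y})"
    by (auto simp: inj_on_def)
  also have "\<dots> \<in> sets ?P"
    by (intro sets.Diff sets.top sets.finite_UN borel_measurable_eq measurable_component_singleton) auto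
  finally show ?thesis .
qed

lemma place_in_positions:
  assumes "J \<subseteq> {..<k}" "{..<k} \<subseteq> insert 0 J" "inj_on y J" "0 \<notin> J \<Longrightarrow> 0 \<notin> y ` J"
  shows "place k J y \<in> space (positions k)"
proof -
  have "inj_on (place k J y) {..<k}"
  proof (rule inj_onI)
    fix a b assume ab: "a \<in> {..<k}" "b \<in> {..<k}" "place k J y a = place k J y b"
    show "a = b"
    proof (cases "a \<in> J"; cases "b \<in> J")
      assume "a \<in> J" "b \<in> J"
      then show ?thesis using ab assms(3) by (auto simp: place_def inj_on_def)
    next
      assume "a \<in> J" "b \<notin> J"
      moreover from this have "b = 0" using ab assms(2) by auto
      ultimately show ?thesis using ab assms(4) by (auto simp: place_def image_iff)
    next
      assume "a \<notin> J" "b \<in> J"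
      moreover from this have "a = 0" using ab assms(2) by auto
      ultimately show ?thesis using ab assms(4) by (auto simp: place_def image_iff)
    next
      assume "a \<notin> J" "b \<notin> J"
      then show ?thesis using ab assms(2) by auto
    qed
  qed
  then show ?thesis by (auto simp: space_positions place_def)
qed

lemma place_measurable[measurable]: "place k J \<in> PiM J (\<lambda>_. borel) \<rightarrow>\<^sub>M PiM {..<k} (\<lambda>_. borel)"
  unfolding place_def
proof (rule measurable_restrict)
  fix j
  show "(\<lambda>y. if j \<in> J then y j else 0) \<in> PiM J (\<lambda>_. borel) \<rightarrow>\<^sub>M borel"
    by (cases "j \<in> J") (simp_all add: measurable_component_singleton)
qed

locale sirsn_sample = poisson_points M Z for M :: "'w measure" and Z +
  fixes \<mu> :: fdds and U V :: "'w \<Rightarrow> complex" and R :: "'w \<Rightarrow> complex \<Rightarrow> complex \<Rightarrow> real \<Rightarrow> complex"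
  assumes sampled: "sampled_routes \<mu> M U V Z R" and SIRSN: "SIRSN \<mu> M Z R"
begin

abbreviation arm :: "'w \<Rightarrow> nat \<Rightarrow> real \<Rightarrow> complex" where
  "arm \<omega> n \<equiv> R \<omega> 0 (fst (Z \<omega> n))"

lemma random_routes: "random_routes \<mu>"
  using SIRSN by (simp add: SIRSN_def)

lemma \<mu>_prob:
  assumes "z \<in> space (positions k)"
  shows "prob_space (\<mu> k z)" "sets (\<mu> k z) = sets (network_space k)" "space (\<mu> k z) = space (network_space k)"
proof -
  have "\<mu> k \<in> positions k \<rightarrow>\<^sub>M prob_algebra (network_space k)" using random_routes by (simp add: random_routes_def)
  from measurable_space[OF this assms] show "prob_space (\<mu> k z)" "sets (\<mu> k z) = sets (network_space k)"
    by (auto simp: space_prob_algebra)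
  then show "space (\<mu> k z) = space (network_space k)" using sets_eq_imp_space_eq by blast
qed

lemma \<mu>_measurable:
  assumes "C \<in> sets (network_space k)"
  shows "(\<lambda>z. emeasure (\<mu> k z) C) \<in> borel_measurable (positions k)"
proof -
  have "\<mu> k \<in> positions k \<rightarrow>\<^sub>M prob_algebra (network_space k)" using random_routes by (simp add: random_routes_def)
  then have "\<mu> k \<in> positions k \<rightarrow>\<^sub>M subprob_algebra (network_space k)" by (rule measurable_prob_algebraD)
  then show ?thesis using assms by (rule measurable_emeasure_kernel)
qed

lemma \<mu>_feasible: "z \<in> space (positions k) \<Longrightarrow> AE r in \<mu> k z. feasible_subnetwork k z r"
  using random_routes by (simp add: random_routes_def)

lemma \<mu>_le_1: "z \<in> space (positions k) \<Longrightarrow> emeasure (\<mu> k z) C \<le> 1"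
  using prob_space.emeasure_le_1 \<mu>_prob(1) by blast

text \<open>The laws depend measurably on the configuration only on the subspace of distinct points,
  so the level set is formed there and then seen as a measurable set of the full product.\<close>

lemma \<mu>_level_set:
  assumes "C \<in> sets (network_space k)" "Measurable.pred borel Pr"
  shows "{y \<in> space (PiM J (\<lambda>_. borel)). place k J y \<in> space (positions k) \<and> Pr (emeasure (\<mu> k (place k J y)) C)} \<in> sets (PiM J (\<lambda>_. borel))"
proof -
  let ?P = "PiM J (\<lambda>_. borel :: complex measure)"
  let ?S = "{y \<in> space ?P. place k J y \<in> space (positions k)}"
  have "?S = place k J -` {z \<in> space (PiM {..<k} (\<lambda>_. borel)). inj_on z {..<k}} \<inter> space ?P"
    by (auto simp: space_positions space_PiM)
  then have S: "?S \<in> sets ?P" using measurable_sets[OF place_measurable positions_set] by simp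
  have "place k J \<in> restrict_space ?P ?S \<rightarrow>\<^sub>M positions k"
    unfolding positions_def
    by (rule measurable_restrict_space2)
      (auto simp: space_restrict_space space_positions intro: measurable_restrict_space1)
  then have "(\<lambda>y. emeasure (\<mu> k (place k J y)) C) \<in> borel_measurable (restrict_space ?P ?S)"
    by (rule measurable_compose[OF _ \<mu>_measurable[OF assms(1)]])
  then have "Measurable.pred (restrict_space ?P ?S) (\<lambda>y. Pr (emeasure (\<mu> k (place k J y)) C))"
    by (rule measurable_compose[OF _ assms(2)])
  then have "{y \<in> space (restrict_space ?P ?S). Pr (emeasure (\<mu> k (place k J y)) C)} \<in> sets (restrict_space ?P ?S)"
    by (simp add: pred_def)
  moreover have "?S \<inter> space ?P \<in> sets ?P" using S by (intro sets.Int sets.top)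
  ultimately have "{y \<in> space (restrict_space ?P ?S). Pr (emeasure (\<mu> k (place k J y)) C)} \<in> sets ?P"
    by (simp only: sets_restrict_space_iff)
  also have "{y \<in> space (restrict_space ?P ?S). Pr (emeasure (\<mu> k (place k J y)) C)} =
     {y \<in> space ?P. place k J y \<in> space (positions k) \<and> Pr (emeasure (\<mu> k (place k J y)) C)}"
    by (auto simp: space_restrict_space)
  finally show ?thesis .
qed

definition span_of :: "nat \<Rightarrow> (nat \<Rightarrow> 'w \<Rightarrow> complex) \<Rightarrow> 'w \<Rightarrow> nat \<times> nat \<Rightarrow> real \<Rightarrow> complex" where
  "span_of k X \<omega> = (\<lambda>(i, j)\<in>index_pairs k. R \<omega> (X i \<omega>) (X j \<omega>))"

definition sample_points :: "nat \<Rightarrow> (nat \<Rightarrow> 'w \<Rightarrow> complex) \<Rightarrow> bool" where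
  "sample_points k X \<longleftrightarrow> inj_on X {..<k} \<and> X ` {..<k} \<subseteq> {\<lambda>_. 0, U, V} \<union> range (\<lambda>n \<omega>. fst (Z \<omega> n)) \<and>
    (AE \<omega> in M. (\<lambda>i\<in>{..<k}. X i \<omega>) \<in> space (positions k))"

lemma sampled_span:
  assumes "inj_on X {..<k}" "X ` {..<k} \<subseteq> {\<lambda>_. 0, U, V} \<union> range (\<lambda>n \<omega>. fst (Z \<omega> n))"
  shows "span_of k X \<in> M \<rightarrow>\<^sub>M network_space k \<and>
        (\<forall>A\<in>sets sample_data_space. \<forall>C\<in>sets (network_space k).
          emeasure M {\<omega>\<in>space M. (U \<omega>, V \<omega>, Z \<omega>) \<in> A \<and> span_of k X \<omega> \<in> C} =
          (\<integral>\<^sup>+ \<omega>. indicator A (U \<omega>, V \<omega>, Z \<omega>) * emeasure (\<mu> k (\<lambda>i\<in>{..<k}. X i \<omega>)) C \<partial>M))"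
proof -
  have "\<forall>k X. inj_on X {..<k} \<and>
        X ` {..<k} \<subseteq> {\<lambda>_. 0, U, V} \<union> range (\<lambda>n \<omega>. fst (Z \<omega> n)) \<longrightarrow>
      (let span = (\<lambda>\<omega>. \<lambda>(i, j)\<in>index_pairs k. R \<omega> (X i \<omega>) (X j \<omega>)) in
        span \<in> M \<rightarrow>\<^sub>M network_space k \<and>
        (\<forall>A\<in>sets sample_data_space. \<forall>C\<in>sets (network_space k).
          emeasure M {\<omega>\<in>space M. (U \<omega>, V \<omega>, Z \<omega>) \<in> A \<and> span \<omega> \<in> C} =
          (\<integral>\<^sup>+ \<omega>. indicator A (U \<omega>, V \<omega>, Z \<omega>) * emeasure (\<mu> k (\<lambda>i\<in>{..<k}. X i \<omega>)) C \<partial>M)))"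
    using sampled unfolding sampled_routes_def by (elim conjE)
  from mp[OF spec[OF spec[OF this, of k], of X] conjI[OF assms]]
  show ?thesis unfolding Let_def span_of_def[abs_def] .
qed

lemma span_measurable:
  assumes "sample_points k X"
  shows "span_of k X \<in> M \<rightarrow>\<^sub>M network_space k"
  using sampled_span[of X k] assms unfolding sample_points_def by (elim conjE) simp

lemma span_law:
  assumes "sample_points k X" "A \<in> sets sample_data_space" "C \<in> sets (network_space k)"
  shows "emeasure M {\<omega>\<in>space M. (U \<omega>, V \<omega>, Z \<omega>) \<in> A \<and> span_of k X \<omega> \<in> C} =
          (\<integral>\<^sup>+ \<omega>. indicator A (U \<omega>, V \<omega>, Z \<omega>) * emeasure (\<mu> k (\<lambda>i\<in>{..<k}. X i \<omega>)) C \<partial>M)"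
proof -
  note X = assms(1)[unfolded sample_points_def]
  from bspec[OF bspec[OF conjunct2[OF sampled_span[OF conjunct1[OF X] conjunct1[OF conjunct2[OF X]]]] assms(2)] assms(3)]
  show ?thesis .
qed

lemma Z_measurable[measurable]: "Z \<in> M \<rightarrow>\<^sub>M PiM UNIV (\<lambda>_. space_time)"
proof -
  have "(\<lambda>\<omega>. \<lambda>n. Z \<omega> n) \<in> M \<rightarrow>\<^sub>M PiM UNIV (\<lambda>_. space_time)"
    by (rule measurable_PiM_single') (auto simp: measurable_Z measurable_space[OF measurable_Z])
  then show ?thesis by simp
qed

lemma UV_measurable[measurable]: "U \<in> borel_measurable M" "V \<in> borel_measurable M"
  using sampled by (simp_all add: sampled_routes_def)

lemma data_measurable: "(\<lambda>\<omega>. (U \<omega>, V \<omega>, Z \<omega>)) \<in> M \<rightarrow>\<^sub>M sample_data_space"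
  unfolding sample_data_space_def by measurable

lemma span_AE:
  assumes X: "sample_points k X" and C: "C \<in> sets (network_space k)"
    and AE: "\<And>z. z \<in> space (positions k) \<Longrightarrow> AE r in \<mu> k z. r \<in> C"
  shows "AE \<omega> in M. span_of k X \<omega> \<in> C"
proof -
  let ?C = "space (network_space k) - C"
  have C': "?C \<in> sets (network_space k)" using C by auto
  have zero: "emeasure (\<mu> k z) ?C = 0" if z: "z \<in> space (positions k)" for z
  proof -
    have "AE r in \<mu> k z. r \<notin> ?C" using AE[OF z] by eventually_elim auto
    then show ?thesis using \<mu>_prob[OF z] C' by (subst (asm) AE_iff_measurable[of ?C]) auto
  qed
  have "emeasure M {\<omega>\<in>space M. (U \<omega>, V \<omega>, Z \<omega>) \<in> space sample_data_space \<and> span_of k X \<omega> \<in> ?C} =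
      (\<integral>\<^sup>+ \<omega>. indicator (space sample_data_space) (U \<omega>, V \<omega>, Z \<omega>) * emeasure (\<mu> k (\<lambda>i\<in>{..<k}. X i \<omega>)) ?C \<partial>M)"
    by (rule span_law[OF X _ C']) auto
  also have "\<dots> = (\<integral>\<^sup>+ \<omega>. 0 \<partial>M)"
  proof (rule nn_integral_cong_AE)
    show "AE \<omega> in M. indicator (space sample_data_space) (U \<omega>, V \<omega>, Z \<omega>) * emeasure (\<mu> k (\<lambda>i\<in>{..<k}. X i \<omega>)) ?C = 0"
      using X unfolding sample_points_def by (auto elim!: eventually_mono simp: zero)
  qed
  finally have "emeasure M {\<omega>\<in>space M. (U \<omega>, V \<omega>, Z \<omega>) \<in> space sample_data_space \<and> span_of k X \<omega> \<in> ?C} = 0" by simp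
  moreover have "{\<omega>\<in>space M. (U \<omega>, V \<omega>, Z \<omega>) \<in> space sample_data_space \<and> span_of k X \<omega> \<in> ?C} = {\<omega> \<in> space M. span_of k X \<omega> \<notin> C}"
    using measurable_space[OF data_measurable] measurable_space[OF span_measurable[OF X]] by auto
  moreover have "{\<omega> \<in> space M. span_of k X \<omega> \<notin> C} \<in> sets M"
    using measurable_sets[OF span_measurable[OF X] C'] measurable_space[OF span_measurable[OF X]]
    by (auto simp: vimage_def Int_def conj_commute cong: conj_cong)
  ultimately show ?thesis by (subst AE_iff_measurable[OF _ refl]) auto
qed

text \<open>A condition on a sample point becomes a measurable condition on the data
  \<open>(U, V, Z)\<close>, one side of the rectangles on which the joint law is prescribed.\<close>

lemma sample_point_data:
  assumes "sample_points k X" "c < k"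
  obtains h where "h \<in> borel_measurable sample_data_space" "\<And>\<omega>. X c \<omega> = h (U \<omega>, V \<omega>, Z \<omega>)"
proof -
  have fstm: "fst \<in> borel_measurable space_time"
    unfolding space_time_def by (rule measurable_restrict_space1) (simp add: borel_prod[symmetric] measurable_lborel1)
  have Zm: "(\<lambda>p. fst (snd (snd p) n)) \<in> borel_measurable sample_data_space" for n
  proof -
    have "(\<lambda>p. snd (snd p) n) \<in> sample_data_space \<rightarrow>\<^sub>M space_time"
      unfolding sample_data_space_def by measurable
    then show ?thesis by (rule measurable_compose[OF _ fstm])
  qed
  have "X c \<in> {\<lambda>_. 0, U, V} \<union> range (\<lambda>n \<omega>. fst (Z \<omega> n))" using assms unfolding sample_points_def by blast
  then consider "X c = (\<lambda>_. 0)" | "X c = U" | "X c = V" | n where "X c = (\<lambda>\<omega>. fst (Z \<omega> n))" by blast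
  then show thesis
  proof cases
    case 1 show thesis by (rule that[of "\<lambda>_. 0"]) (simp_all add: 1)
  next
    case 2 show thesis by (rule that[of fst]) (simp_all add: 2 sample_data_space_def)
  next
    case 3 show thesis by (rule that[of "\<lambda>p. fst (snd p)"]) (simp_all add: 3 sample_data_space_def)
  next
    case 4 show thesis by (rule that[of "\<lambda>p. fst (snd (snd p) n)"]) (simp_all add: 4 Zm)
  qed
qed

lemma network_component:
  "p \<in> index_pairs k \<Longrightarrow> (\<lambda>r. r p) \<in> network_space k \<rightarrow>\<^sub>M route_space"
  unfolding network_space_def by (rule measurable_component_singleton)

text \<open>Endpoints are identified through countably many half-planes, since the joint law of the
  sample points and the routes is only given on rectangles.\<close>

lemma span_endpoint_halfplanes:
  assumes X: "sample_points k X" and p: "p \<in> index_pairs k" "t \<in> {0..1}" "c < k"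
    and eq: "\<And>z. z \<in> space (positions k) \<Longrightarrow> AE r in \<mu> k z. r p t = z c"
    and g[measurable]: "(g :: complex \<Rightarrow> real) \<in> borel_measurable borel"
  shows "AE \<omega> in M. g (span_of k X \<omega> p t) = g (X c \<omega>)"
proof -
  obtain h where h[measurable]: "h \<in> borel_measurable sample_data_space" and hX: "\<And>\<omega>. X c \<omega> = h (U \<omega>, V \<omega>, Z \<omega>)"
    by (rule sample_point_data[OF X p(3)]) (rule that)
  have rm[measurable]: "(\<lambda>r. r p t) \<in> borel_measurable (network_space k)"
    by (rule measurable_route_eval[OF network_component[OF p(1)] p(2)])
  have spanm[measurable]: "(\<lambda>\<omega>. span_of k X \<omega> p t) \<in> borel_measurable M"
    by (rule measurable_compose[OF span_measurable[OF X] rm])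
  have Xm[measurable]: "X c \<in> borel_measurable M"
  proof -
    have "X c = (\<lambda>\<omega>. h (U \<omega>, V \<omega>, Z \<omega>))" by (rule ext) (rule hX)
    then show ?thesis using measurable_compose[OF data_measurable h] by (simp only:)
  qed
  \<comment> \<open>A rectangle with \<open>P\<close> true for the sample point and false for the
    end of the route has measure 0, as \<open>\<mu> k\<close> attaches the end of the route to the
    point. Rational thresholds then leave no room for two different values.\<close>
  have key: "AE \<omega> in M. \<not> (P (g (X c \<omega>)) \<and> \<not> P (g (span_of k X \<omega> p t)))"
    if P[measurable]: "Measurable.pred borel P" for P
  proof -
    let ?A = "{d \<in> space sample_data_space. P (g (h d))}" and ?C = "{r \<in> space (network_space k). \<not> P (g (r p t))}"
    have A: "?A \<in> sets sample_data_space" by measurable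
    have C: "?C \<in> sets (network_space k)" by measurable
    have "emeasure M {\<omega>\<in>space M. (U \<omega>, V \<omega>, Z \<omega>) \<in> ?A \<and> span_of k X \<omega> \<in> ?C} =
      (\<integral>\<^sup>+ \<omega>. indicator ?A (U \<omega>, V \<omega>, Z \<omega>) * emeasure (\<mu> k (\<lambda>i\<in>{..<k}. X i \<omega>)) ?C \<partial>M)"
      by (rule span_law[OF X A C])
    also have "\<dots> = (\<integral>\<^sup>+ \<omega>. 0 \<partial>M)"
    proof (rule nn_integral_cong_AE)
      have "AE \<omega> in M. (\<lambda>i\<in>{..<k}. X i \<omega>) \<in> space (positions k)" using X by (simp add: sample_points_def)
      then show "AE \<omega> in M. indicator ?A (U \<omega>, V \<omega>, Z \<omega>) * emeasure (\<mu> k (\<lambda>i\<in>{..<k}. X i \<omega>)) ?C = 0"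
      proof eventually_elim
        case (elim \<omega>)
        show ?case
        proof (cases "P (g (X c \<omega>))")
          case True
          have "AE r in \<mu> k (\<lambda>i\<in>{..<k}. X i \<omega>). r \<notin> ?C"
            using eq[OF elim] by eventually_elim (use True p(3) in auto)
          then have "emeasure (\<mu> k (\<lambda>i\<in>{..<k}. X i \<omega>)) ?C = 0"
            using \<mu>_prob[OF elim] C by (subst (asm) AE_iff_measurable[of ?C]) auto
          then show ?thesis by simp
        next
          case False
          then show ?thesis by (simp add: hX)
        qed
      qed
    qed
    finally have "emeasure M {\<omega>\<in>space M. (U \<omega>, V \<omega>, Z \<omega>) \<in> ?A \<and> span_of k X \<omega> \<in> ?C} = 0" by simp
    moreover have "{\<omega>\<in>space M. (U \<omega>, V \<omega>, Z \<omega>) \<in> ?A \<and> span_of k X \<omega> \<in> ?C} = {\<omega> \<in> space M. P (g (X c \<omega>)) \<and> \<not> P (g (span_of k X \<omega> p t))}"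
      using measurable_space[OF data_measurable] measurable_space[OF span_measurable[OF X]] by (auto simp: hX)
    ultimately have "emeasure M {\<omega> \<in> space M. P (g (X c \<omega>)) \<and> \<not> P (g (span_of k X \<omega> p t))} = 0" by simp
    moreover have "{\<omega> \<in> space M. P (g (X c \<omega>)) \<and> \<not> P (g (span_of k X \<omega> p t))} \<in> sets M" by measurable
    ultimately show ?thesis by (subst AE_iff_measurable[OF _ refl]) auto
  qed
  have "AE \<omega> in M. \<forall>q\<in>\<rat>. \<not> (g (X c \<omega>) < q \<and> \<not> g (span_of k X \<omega> p t) < q) \<and> \<not> (q < g (X c \<omega>) \<and> \<not> q < g (span_of k X \<omega> p t))"
    unfolding AE_ball_countable[OF countable_rat]
  proof (intro ballI AE_conjI)
    fix q :: real
    show "AE \<omega> in M. \<not> (g (X c \<omega>) < q \<and> \<not> g (span_of k X \<omega> p t) < q)" by (rule key) measurable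
    show "AE \<omega> in M. \<not> (q < g (X c \<omega>) \<and> \<not> q < g (span_of k X \<omega> p t))" by (rule key) measurable
  qed
  then show ?thesis
  proof eventually_elim
    case (elim \<omega>)
    show ?case
    proof (rule ccontr)
      assume "g (span_of k X \<omega> p t) \<noteq> g (X c \<omega>)"
      then consider "g (span_of k X \<omega> p t) < g (X c \<omega>)" | "g (X c \<omega>) < g (span_of k X \<omega> p t)" by linarith
      then show False
      proof cases
        case 1
        then obtain q where "q \<in> \<rat>" "g (span_of k X \<omega> p t) < q" "q < g (X c \<omega>)" using Rats_dense_in_real by blast
        then show False using elim by force
      next
        case 2
        then obtain q where "q \<in> \<rat>" "g (X c \<omega>) < q" "q < g (span_of k X \<omega> p t)" using Rats_dense_in_real by blast
        then show False using elim by force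
      qed
    qed
  qed
qed

lemma span_endpoint:
  assumes X: "sample_points k X" and p: "p \<in> index_pairs k" "t \<in> {0..1}" "c < k"
    and eq: "\<And>z. z \<in> space (positions k) \<Longrightarrow> AE r in \<mu> k z. r p t = z c"
  shows "AE \<omega> in M. span_of k X \<omega> p t = X c \<omega>"
proof -
  have "AE \<omega> in M. Re (span_of k X \<omega> p t) = Re (X c \<omega>)"
    by (rule span_endpoint_halfplanes[OF X p _ borel_measurable_Re]) (rule eq)
  moreover have "AE \<omega> in M. Im (span_of k X \<omega> p t) = Im (X c \<omega>)"
    by (rule span_endpoint_halfplanes[OF X p _ borel_measurable_Im]) (rule eq)
  ultimately show ?thesis by eventually_elim (simp add: complex_eq_iff)
qed

lemma span_tree:
  assumes X: "sample_points k X"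
  shows "AE \<omega> in M. \<forall>a\<in>{1..<k}. R \<omega> (X 0 \<omega>) (X a \<omega>) 0 = X 0 \<omega> \<and> R \<omega> (X 0 \<omega>) (X a \<omega>) 1 = X a \<omega> \<and>
     route (R \<omega> (X 0 \<omega>) (X a \<omega>)) \<and>
     (\<forall>b\<in>{1..<k}. initially_compatible (R \<omega> (X 0 \<omega>) (X a \<omega>)) (R \<omega> (X 0 \<omega>) (X b \<omega>)))"
proof -
  have pair: "(0, a) \<in> index_pairs k" if "a \<in> {1..<k}" for a using that by (auto simp: index_pairs_def)
  have sp: "span_of k X \<omega> (0, a) = R \<omega> (X 0 \<omega>) (X a \<omega>)" if "a \<in> {1..<k}" for a \<omega>
    using pair[OF that] by (simp add: span_of_def)
  have start: "AE r in \<mu> k z. r (0, a) 0 = z 0" if "a \<in> {1..<k}" "z \<in> space (positions k)" for a z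
    using \<mu>_feasible[OF that(2)] by eventually_elim (use pair[OF that(1)] in \<open>auto simp: feasible_subnetwork_def pathstart_def\<close>)
  have finish: "AE r in \<mu> k z. r (0, a) 1 = z a" if "a \<in> {1..<k}" "z \<in> space (positions k)" for a z
    using \<mu>_feasible[OF that(2)] by eventually_elim (use pair[OF that(1)] in \<open>auto simp: feasible_subnetwork_def pathfinish_def\<close>)
  have 1: "AE \<omega> in M. R \<omega> (X 0 \<omega>) (X a \<omega>) 0 = X 0 \<omega>" if a: "a \<in> {1..<k}" for a
  proof -
    have "AE \<omega> in M. span_of k X \<omega> (0, a) 0 = X 0 \<omega>"
      by (rule span_endpoint[OF X pair[OF a] _ _ start[OF a]]) (use a in auto)
    then show ?thesis by (simp add: sp[OF a])
  qed
  have 2: "AE \<omega> in M. R \<omega> (X 0 \<omega>) (X a \<omega>) 1 = X a \<omega>" if a: "a \<in> {1..<k}" for a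
  proof -
    have "AE \<omega> in M. span_of k X \<omega> (0, a) 1 = X a \<omega>"
      by (rule span_endpoint[OF X pair[OF a] _ _ finish[OF a]]) (use a in auto)
    then show ?thesis by (simp add: sp[OF a])
  qed
  have 3: "AE \<omega> in M. initially_compatible (R \<omega> (X 0 \<omega>) (X a \<omega>)) (R \<omega> (X 0 \<omega>) (X b \<omega>))" if a: "a \<in> {1..<k}" and b: "b \<in> {1..<k}" for a b
  proof -
    let ?C = "{r \<in> space (network_space k). initially_compatible (r (0, a)) (r (0, b))}"
    have "?C \<in> sets (network_space k)"
      using measurable_initially_compatible[OF network_component[OF pair[OF a]] network_component[OF pair[OF b]]] by (simp add: pred_def)
    then have "AE \<omega> in M. span_of k X \<omega> \<in> ?C"
    proof (rule span_AE[OF X])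
      fix z assume z: "z \<in> space (positions k)"
      show "AE r in \<mu> k z. r \<in> ?C"
        using \<mu>_feasible[OF z] start[OF a z] start[OF b z] AE_space
      proof eventually_elim
        case (elim r)
        have "compatible (r (0, a)) (r (0, b))"
          using elim(1) pair[OF a] pair[OF b] unfolding feasible_subnetwork_def by blast
        then have "initially_compatible (r (0, a)) (r (0, b))"
          using elim by (intro compatible_imp_initially_compatible) auto
        then show ?case using elim(4) \<mu>_prob(3)[OF z] by simp
      qed
    qed
    then show ?thesis by eventually_elim (simp add: sp[OF a] sp[OF b])
  qed
  have 4: "route (R \<omega> (X 0 \<omega>) (X a \<omega>))" if "a \<in> {1..<k}" "\<omega> \<in> space M" for a \<omega>
    using measurable_space[OF measurable_compose[OF span_measurable[OF X] network_component[OF pair[OF that(1)]]] that(2)]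
    by (simp add: space_route_space sp[OF that(1)])
  have "AE \<omega> in M. \<forall>a\<in>{1..<k}. R \<omega> (X 0 \<omega>) (X a \<omega>) 0 = X 0 \<omega>" by (intro AE_finite_allI 1) auto
  moreover have "AE \<omega> in M. \<forall>a\<in>{1..<k}. R \<omega> (X 0 \<omega>) (X a \<omega>) 1 = X a \<omega>" by (intro AE_finite_allI 2) auto
  moreover have "AE \<omega> in M. \<forall>a\<in>{1..<k}. \<forall>b\<in>{1..<k}. initially_compatible (R \<omega> (X 0 \<omega>) (X a \<omega>)) (R \<omega> (X 0 \<omega>) (X b \<omega>))"
    by (intro AE_finite_allI 3) auto
  ultimately show ?thesis using AE_space by eventually_elim (use 4 in blast)
qed

section \<open>Networks on tuples of Poisson points\<close>

definition pt :: "nat set \<Rightarrow> (nat \<Rightarrow> nat) \<Rightarrow> nat \<Rightarrow> 'w \<Rightarrow> complex" where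
  "pt J i j = (\<lambda>\<omega>. if j \<in> J then fst (Z \<omega> (i j)) else 0)"

definition net :: "nat \<Rightarrow> nat set \<Rightarrow> (nat \<Rightarrow> nat) \<Rightarrow> 'w \<Rightarrow> nat \<times> nat \<Rightarrow> real \<Rightarrow> complex" where
  "net k J i = span_of k (pt J i)"

lemma AE_nonzero: "AE \<omega> in M. \<forall>n. fst (Z \<omega> n) \<noteq> 0"
proof -
  have "AE \<omega> in M. fst (Z \<omega> n) \<noteq> 0" for n
  proof -
    have "emeasure (lborels {0}) (\<Pi>\<^sub>E j\<in>{0::nat}. {0}) = (\<Prod>j\<in>{0::nat}. emeasure lborel {0::complex})"
      by (rule lborels.emeasure_PiM) auto
    moreover have "(\<Pi>\<^sub>E j\<in>{0::nat}. {0}) \<in> sets (lborels {0})" by (rule sets_PiM_I_finite) auto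
    ultimately have "(\<Pi>\<^sub>E j\<in>{0::nat}. {0}) \<in> null_sets (lborels {0})" by (intro null_setsI) simp_all
    then have "AE y in lborels {0}. y 0 \<noteq> 0"
      by (rule AE_I') (auto simp: space_PiM PiE_def extensional_def fun_eq_iff)
    from AE_positions[OF _ _ this, of "\<lambda>_. n"] show ?thesis by simp
  qed
  then show ?thesis by (simp add: AE_all_countable)
qed

lemma sample_points_pt:
  assumes J: "J \<subseteq> {..<k}" "{..<k} \<subseteq> insert 0 J" and i: "inj_on i J"
  shows "sample_points k (pt J i)"
  unfolding sample_points_def
proof (intro conjI)
  have inj: "AE \<omega> in M. inj_on (\<lambda>j. fst (Z \<omega> (i j))) J \<and> 0 \<notin> (\<lambda>j. fst (Z \<omega> (i j))) ` J"
    using AE_distinct_Re AE_nonzero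
  proof eventually_elim
    case (elim \<omega>)
    have "inj_on (\<lambda>j. fst (Z \<omega> (i j))) J"
    proof (rule inj_onI)
      fix a b assume "a \<in> J" "b \<in> J" "fst (Z \<omega> (i a)) = fst (Z \<omega> (i b))"
      then show "a = b" using elim(1) i by (metis inj_onD)
    qed
    then show ?case using elim(2) by (metis (no_types, lifting) imageE)
  qed
  then have pos: "AE \<omega> in M. place k J (\<lambda>j. fst (Z \<omega> (i j))) \<in> space (positions k)"
    by eventually_elim (use place_in_positions[OF J] in blast)
  have pl: "place k J (\<lambda>j. fst (Z \<omega> (i j))) = (\<lambda>j\<in>{..<k}. pt J i j \<omega>)" for \<omega>
    by (auto simp: place_def pt_def)
  show "AE \<omega> in M. (\<lambda>j\<in>{..<k}. pt J i j \<omega>) \<in> space (positions k)" using pos by (simp add: pl)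
  show "inj_on (pt J i) {..<k}"
  proof (rule inj_onI, rule ccontr)
    fix a b assume ab: "a \<in> {..<k}" "b \<in> {..<k}" "pt J i a = pt J i b" "a \<noteq> b"
    \<comment> \<open>Injectivity concerns the random points as functions. If two of them were the
      same function, the points would coincide everywhere, although they are distinct with
      probability 1.\<close>
    have "AE \<omega> in M. False"
      using pos
    proof eventually_elim
      case (elim \<omega>)
      have "place k J (\<lambda>j. fst (Z \<omega> (i j))) a = place k J (\<lambda>j. fst (Z \<omega> (i j))) b"
        using ab fun_cong[OF ab(3), of \<omega>] by (simp add: pl)
      then show False using elim ab unfolding space_positions by (auto simp: inj_on_def)
    qed
    then show False by simp
  qed
  show "pt J i ` {..<k} \<subseteq> {\<lambda>_. 0, U, V} \<union> range (\<lambda>n \<omega>. fst (Z \<omega> n))"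
  proof
    fix f assume "f \<in> pt J i ` {..<k}"
    then obtain j where f: "f = pt J i j" by blast
    show "f \<in> {\<lambda>_. 0, U, V} \<union> range (\<lambda>n \<omega>. fst (Z \<omega> n))"
      by (cases "j \<in> J") (simp_all add: f pt_def)
  qed
qed

lemma net_law:
  assumes J: "J \<subseteq> {..<k}" "{..<k} \<subseteq> insert 0 J" and i: "inj_on i J"
    and A: "A \<in> sets (PiM UNIV (\<lambda>_. space_time))" and C: "C \<in> sets (network_space k)"
  shows "emeasure M {\<omega>\<in>space M. Z \<omega> \<in> A \<and> net k J i \<omega> \<in> C} =
      (\<integral>\<^sup>+ \<omega>. indicator A (Z \<omega>) * emeasure (\<mu> k (place k J (\<lambda>j. fst (Z \<omega> (i j))))) C \<partial>M)"
proof -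
  have A': "UNIV \<times> (UNIV \<times> A) \<in> sets sample_data_space"
    unfolding sample_data_space_def using A by (intro pair_measureI) auto
  have pl: "place k J (\<lambda>j. fst (Z \<omega> (i j))) = (\<lambda>j\<in>{..<k}. pt J i j \<omega>)" for \<omega>
    by (auto simp: place_def pt_def)
  show ?thesis
    using span_law[OF sample_points_pt[OF J i] A' C] by (simp add: net_def pl indicator_times)
qed

lemma net_measurable:
  assumes J: "J \<subseteq> {..<k}" "{..<k} \<subseteq> insert 0 J" and i: "inj_on i J"
  shows "net k J i \<in> M \<rightarrow>\<^sub>M network_space k"
  unfolding net_def by (rule span_measurable[OF sample_points_pt[OF assms]])

lemma AE_place_positions:
  assumes J: "J \<subseteq> {..<k}" "{..<k} \<subseteq> insert 0 J" and i: "inj_on i J"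
  shows "AE \<omega> in M. place k J (\<lambda>j. fst (Z \<omega> (i j))) \<in> space (positions k)"
proof -
  have pl: "place k J (\<lambda>j. fst (Z \<omega> (i j))) = (\<lambda>j\<in>{..<k}. pt J i j \<omega>)" for \<omega>
    by (auto simp: place_def pt_def)
  show ?thesis using sample_points_pt[OF assms] unfolding sample_points_def pl by blast
qed

text \<open>The first tuple of points that hits \<open>K\<close> depends on the points alone, so conditionally on the
  points its network has the law prescribed by \<open>\<mu>\<close>.\<close>

lemma hit_law:
  assumes J: "J \<subseteq> {..<k}" "{..<k} \<subseteq> insert 0 J" and C: "C \<in> sets (network_space k)"
    and K: "K \<in> sets (PiM J (\<lambda>_. borel))" and c: "0 < c"
    and q: "\<And>y. y \<in> K \<Longrightarrow> place k J (\<lambda>j\<in>J. c *\<^sub>R y j) \<in> space (positions k) \<Longrightarrow> q \<le> emeasure (\<mu> k (place k J (\<lambda>j\<in>J. c *\<^sub>R y j))) C"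
  shows "q * emeasure M (hit J K l c) \<le>
     emeasure M {\<omega>\<in>space M. \<exists>i\<in>J \<rightarrow>\<^sub>E UNIV. hit_tuple J K l c (Z \<omega>) i \<and> net k J i \<omega> \<in> C}"
proof -
  have finJ: "finite J" using J(1) finite_subset by blast
  let ?T = "J \<rightarrow>\<^sub>E (UNIV :: nat set)"
  let ?S = "PiM UNIV (\<lambda>_::nat. space_time)"
  define u where "u = from_nat_into ?T"
  have ne: "?T \<noteq> {}" by (simp add: PiE_eq_empty_iff)
  have u: "range u = ?T" unfolding u_def by (rule range_from_nat_into[OF ne countable_tuples[OF finJ]])
  let ?h = "\<lambda>x n. hit_tuple J K l c x (u n)"
  \<comment> \<open>\<open>A n\<close> says that the \<open>n\<close>-th index tuple is the first to
    hit. These events are disjoint and concern the points only, so the bounds for the individual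
    tuples may be added.\<close>
  define A where "A n = {x \<in> space ?S. ?h x n \<and> (\<forall>m<n. \<not> ?h x m)}" for n
  have fs[measurable]: "fst \<in> borel_measurable space_time" "snd \<in> borel_measurable space_time"
    unfolding space_time_def by (rule measurable_restrict_space1, simp add: borel_prod[symmetric] measurable_lborel1)+
  have xm[measurable]: "(\<lambda>x. fst (x n)) \<in> borel_measurable ?S" "(\<lambda>x. snd (x n)) \<in> borel_measurable ?S" for n
  proof -
    have c: "(\<lambda>x. x n) \<in> ?S \<rightarrow>\<^sub>M space_time" by (rule measurable_component_singleton) simp
    show "(\<lambda>x. fst (x n)) \<in> borel_measurable ?S" "(\<lambda>x. snd (x n)) \<in> borel_measurable ?S"
      by (rule measurable_compose[OF c fs(1)], rule measurable_compose[OF c fs(2)])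
  qed
  have hm: "Measurable.pred ?S (\<lambda>x. ?h x n)" for n
  proof -
    note [measurable] = K
    have [measurable]: "(\<lambda>x. \<lambda>j\<in>J. (1 / c) *\<^sub>R fst (x (u n j))) \<in> ?S \<rightarrow>\<^sub>M PiM J (\<lambda>_. borel)"
    proof (rule measurable_restrict)
      show "(\<lambda>x. (1 / c) *\<^sub>R fst (x (u n j))) \<in> borel_measurable ?S" for j
        using xm(1)[of "u n j"] by measurable
    qed
    have [measurable]: "Measurable.pred ?S (\<lambda>x. snd (x (u n j)) \<le> l)" for j
      using xm(2)[of "u n j"] by measurable
    show ?thesis unfolding hit_tuple_def using finJ by measurable
  qed
  have A: "A n \<in> sets ?S" for n unfolding A_def using hm by measurable
  have disjA: "disjoint_family A"
    unfolding disjoint_family_on_def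
  proof safe
    fix m n x assume "m \<noteq> n" "x \<in> A m" "x \<in> A n"
    then show "x \<in> {}" unfolding A_def by (cases m n rule: linorder_cases) auto
  qed
  define E where "E n = {\<omega> \<in> space M. Z \<omega> \<in> A n \<and> net k J (u n) \<omega> \<in> C}" for n
  define F where "F n = {\<omega> \<in> space M. Z \<omega> \<in> A n}" for n
  have F: "F n \<in> sets M" for n
    using measurable_sets[OF Z_measurable A[of n]] by (simp add: F_def vimage_def Int_def conj_commute)
  have E: "E n \<in> sets M" for n
  proof (cases "inj_on (u n) J")
    case True
    have "net k J (u n) -` C \<inter> space M \<in> sets M" by (rule measurable_sets[OF net_measurable[OF J True] C])
    moreover have "E n = F n \<inter> (net k J (u n) -` C \<inter> space M)" by (auto simp: E_def F_def)
    ultimately show ?thesis using F by simp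
  next
    case False
    then have "E n = {}" by (auto simp: E_def A_def hit_tuple_def)
    then show ?thesis by simp
  qed
  have le: "q * emeasure M (F n) \<le> emeasure M (E n)" for n
  proof (cases "inj_on (u n) J")
    case False
    then have "F n = {}" by (auto simp: F_def A_def hit_tuple_def)
    then show ?thesis by simp
  next
    case True
    have "q * emeasure M (F n) = (\<integral>\<^sup>+\<omega>. q * indicator (F n) \<omega> \<partial>M)"
      using F by (simp add: nn_integral_cmult_indicator)
    also have "\<dots> \<le> (\<integral>\<^sup>+ \<omega>. indicator (A n) (Z \<omega>) * emeasure (\<mu> k (place k J (\<lambda>j. fst (Z \<omega> (u n j))))) C \<partial>M)"
    proof (rule nn_integral_mono_AE)
      show "AE \<omega> in M. q * indicator (F n) \<omega> \<le> indicator (A n) (Z \<omega>) * emeasure (\<mu> k (place k J (\<lambda>j. fst (Z \<omega> (u n j))))) C"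
        using AE_place_positions[OF J True]
      proof eventually_elim
        case (elim \<omega>)
        show ?case
        proof (cases "\<omega> \<in> F n")
          case True
          let ?y = "\<lambda>j\<in>J. (1 / c) *\<^sub>R fst (Z \<omega> (u n j))"
          have "?y \<in> K" using True by (auto simp: F_def A_def hit_tuple_def)
          moreover have "place k J (\<lambda>j\<in>J. c *\<^sub>R ?y j) = place k J (\<lambda>j. fst (Z \<omega> (u n j)))"
            using c by (auto simp: place_def)
          ultimately have "q \<le> emeasure (\<mu> k (place k J (\<lambda>j. fst (Z \<omega> (u n j))))) C"
            using q[of ?y] elim by simp
          then show ?thesis using True by (simp add: F_def)
        qed simp
      qed
    qed
    also have "\<dots> = emeasure M (E n)" unfolding E_def by (rule net_law[OF J True A C, symmetric])
    finally show ?thesis .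
  qed
  have "{\<omega>\<in>space M. \<exists>i\<in>?T. hit_tuple J K l c (Z \<omega>) i} = (\<Union>n. F n)"
  proof (intro subset_antisym subsetI)
    fix \<omega> assume "\<omega> \<in> {\<omega>\<in>space M. \<exists>i\<in>?T. hit_tuple J K l c (Z \<omega>) i}"
    then obtain i where i: "\<omega> \<in> space M" "i \<in> ?T" "hit_tuple J K l c (Z \<omega>) i" by blast
    moreover from i(2) have "i \<in> range u" unfolding u .
    then obtain n where "i = u n" by (rule rangeE)
    ultimately have n: "\<omega> \<in> space M" "?h (Z \<omega>) n" by simp_all
    define n' where "n' = (LEAST n. ?h (Z \<omega>) n)"
    have "?h (Z \<omega>) n'" "\<forall>m<n'. \<not> ?h (Z \<omega>) m" unfolding n'_def using n(2) by (auto intro: LeastI dest: not_less_Least)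
    then have "\<omega> \<in> F n'" using n(1) measurable_space[OF Z_measurable n(1)] by (simp add: F_def A_def)
    then show "\<omega> \<in> (\<Union>n. F n)" by blast
  next
    fix \<omega> assume "\<omega> \<in> (\<Union>n. F n)"
    then obtain n where "\<omega> \<in> space M" "?h (Z \<omega>) n" by (auto simp: F_def A_def)
    moreover have "u n \<in> ?T" using u by blast
    ultimately show "\<omega> \<in> {\<omega>\<in>space M. \<exists>i\<in>?T. hit_tuple J K l c (Z \<omega>) i}" by blast
  qed
  moreover have disjF: "disjoint_family F" and disjE: "disjoint_family E"
  proof -
    have "A m \<inter> A n = {}" if "m \<noteq> n" for m n using disjA that by (simp add: disjoint_family_on_def)
    then show "disjoint_family F" "disjoint_family E"
      unfolding disjoint_family_on_def F_def E_def by blast+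
  qed
  moreover have "(\<Sum>n. emeasure M (F n)) = emeasure M (\<Union>n. F n)"
    by (rule suminf_emeasure[OF _ disjF]) (use F in blast)
  ultimately have "q * emeasure M {\<omega>\<in>space M. \<exists>i\<in>?T. hit_tuple J K l c (Z \<omega>) i} = q * (\<Sum>n. emeasure M (F n))"
    by (simp only:)
  also have "\<dots> = (\<Sum>n. q * emeasure M (F n))" by (rule ennreal_suminf_cmult[symmetric])
  also have "\<dots> \<le> (\<Sum>n. emeasure M (E n))" by (intro suminf_le le summableI)
  also have "\<dots> = emeasure M (\<Union>n. E n)"
    by (rule suminf_emeasure[OF _ disjE]) (use E in blast)
  also have "\<dots> \<le> emeasure M {\<omega>\<in>space M. \<exists>i\<in>?T. hit_tuple J K l c (Z \<omega>) i \<and> net k J i \<omega> \<in> C}"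
  proof (rule emeasure_mono)
    have uT: "u n \<in> ?T" for n using u by blast
    show "(\<Union>n. E n) \<subseteq> {\<omega>\<in>space M. \<exists>i\<in>?T. hit_tuple J K l c (Z \<omega>) i \<and> net k J i \<omega> \<in> C}"
    proof
      fix \<omega> assume "\<omega> \<in> (\<Union>n. E n)"
      then obtain n where "\<omega> \<in> E n" by blast
      then have "\<omega> \<in> space M" "?h (Z \<omega>) n" "net k J (u n) \<omega> \<in> C" by (simp_all add: E_def A_def)
      then show "\<omega> \<in> {\<omega>\<in>space M. \<exists>i\<in>?T. hit_tuple J K l c (Z \<omega>) i \<and> net k J i \<omega> \<in> C}" using uT[of n] by blast
    qed
    have "{\<omega>\<in>space M. \<exists>i\<in>?T. hit_tuple J K l c (Z \<omega>) i \<and> net k J i \<omega> \<in> C} =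
       (\<Union>i\<in>?T. {\<omega> \<in> space M. hit_tuple J K l c (Z \<omega>) i \<and> net k J i \<omega> \<in> C})" by blast
    also have "\<dots> \<in> sets M"
    proof (rule sets.countable_UN''[OF countable_tuples[OF finJ]])
      fix i
      show "{\<omega> \<in> space M. hit_tuple J K l c (Z \<omega>) i \<and> net k J i \<omega> \<in> C} \<in> sets M"
      proof (cases "inj_on i J")
        case True
        have "net k J i -` C \<inter> space M \<in> sets M" by (rule measurable_sets[OF net_measurable[OF J True] C])
        then have "{\<omega> \<in> space M. hit_tuple J K l c (Z \<omega>) i} \<inter> (net k J i -` C \<inter> space M) \<in> sets M"
          using hit_tuple_measurable[OF finJ K] by blast
        also have "{\<omega> \<in> space M. hit_tuple J K l c (Z \<omega>) i} \<inter> (net k J i -` C \<inter> space M) = {\<omega> \<in> space M. hit_tuple J K l c (Z \<omega>) i \<and> net k J i \<omega> \<in> C}" by auto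
        finally show ?thesis .
      next
        case False
        then show ?thesis by (simp add: hit_tuple_def)
      qed
    qed
    finally show "{\<omega>\<in>space M. \<exists>i\<in>?T. hit_tuple J K l c (Z \<omega>) i \<and> net k J i \<omega> \<in> C} \<in> sets M" .
  qed
  finally show ?thesis .
qed

text \<open>Transfer in the direction opposite to \<open>hit_law\<close>: a bound valid for almost
  all configurations holds for the random points, because a null set of configurations is a.s.
  avoided. \<open>D\<close> records what the event \<open>A\<close> guarantees about the
  positions.\<close>

lemma abs_law:
  assumes J: "J \<subseteq> {..<k}" "{..<k} \<subseteq> insert 0 J" and i: "inj_on i J" and C: "C \<in> sets (network_space k)"
    and A: "A \<in> sets (PiM UNIV (\<lambda>_. space_time))"
    and AE: "AE y in lborels J. D y \<longrightarrow> place k J y \<in> space (positions k) \<longrightarrow> emeasure (\<mu> k (place k J y)) C \<le> q"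
    and D: "\<And>\<omega>. \<omega> \<in> space M \<Longrightarrow> Z \<omega> \<in> A \<Longrightarrow> D (\<lambda>j\<in>J. fst (Z \<omega> (i j)))"
  shows "emeasure M {\<omega>\<in>space M. Z \<omega> \<in> A \<and> net k J i \<omega> \<in> C} \<le> q * emeasure M {\<omega>\<in>space M. Z \<omega> \<in> A}"
proof -
  have finJ: "finite J" using J(1) finite_subset by blast
  have pl: "place k J (\<lambda>j\<in>J. fst (Z \<omega> (i j))) = place k J (\<lambda>j. fst (Z \<omega> (i j)))" for \<omega> by (auto simp: place_def)
  have F: "{\<omega>\<in>space M. Z \<omega> \<in> A} \<in> sets M"
    using measurable_sets[OF Z_measurable A] by (simp add: vimage_def Int_def conj_commute)
  have "emeasure M {\<omega>\<in>space M. Z \<omega> \<in> A \<and> net k J i \<omega> \<in> C} =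
      (\<integral>\<^sup>+ \<omega>. indicator A (Z \<omega>) * emeasure (\<mu> k (place k J (\<lambda>j. fst (Z \<omega> (i j))))) C \<partial>M)"
    by (rule net_law[OF J i A C])
  also have "\<dots> \<le> (\<integral>\<^sup>+\<omega>. q * indicator {\<omega>\<in>space M. Z \<omega> \<in> A} \<omega> \<partial>M)"
  proof (rule nn_integral_mono_AE)
    show "AE \<omega> in M. indicator A (Z \<omega>) * emeasure (\<mu> k (place k J (\<lambda>j. fst (Z \<omega> (i j))))) C \<le> q * indicator {\<omega>\<in>space M. Z \<omega> \<in> A} \<omega>"
      using AE_positions[OF finJ i AE] AE_place_positions[OF J i] AE_space
      by eventually_elim (use D in \<open>auto simp: pl indicator_def\<close>)
  qed
  also have "\<dots> = q * emeasure M {\<omega>\<in>space M. Z \<omega> \<in> A}" using F by (simp add: nn_integral_cmult_indicator)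
  finally show ?thesis .
qed

text \<open>The tree conditions concern at most two routes from the origin, so networks on the
  origin and two Poisson points suffice; countably many pairs give one exceptional event.\<close>

lemma AE_sampled_tree: "AE \<omega> in M. sampled_tree (Z \<omega>) (R \<omega>)"
proof -
  have "AE \<omega> in M. route (arm \<omega> n) \<and> arm \<omega> n 0 = 0 \<and> arm \<omega> n 1 = fst (Z \<omega> n) \<and>
     initially_compatible (arm \<omega> n) (arm \<omega> m)" if "n \<noteq> m" for n m
  proof -
    define i where "i = (\<lambda>j::nat. if j = 1 then n else m)"
    have "sample_points 3 (pt {1..<3} i)"
    proof (rule sample_points_pt)
      show "inj_on i {1..<3}"
      proof (rule inj_onI)
        fix a b assume ab: "a \<in> {1..<3}" "b \<in> {1..<3}" "i a = i b"
        then have "(a = 1) = (b = 1)" using that unfolding i_def by metis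
        then show "a = b" using ab(1,2) by auto
      qed
    qed auto
    from span_tree[OF this] show ?thesis
    proof eventually_elim
      case (elim \<omega>)
      have p: "pt {1..<3} i 0 \<omega> = 0" "pt {1..<3} i 1 \<omega> = fst (Z \<omega> n)" "pt {1..<3} i 2 \<omega> = fst (Z \<omega> m)"
        by (auto simp: pt_def i_def)
      have "1 \<in> {1..<3::nat}" "2 \<in> {1..<3::nat}" by auto
      then show ?case using elim unfolding p[symmetric] by blast
    qed
  qed
  then have "AE \<omega> in M. \<forall>n m. n \<noteq> m \<longrightarrow> route (arm \<omega> n) \<and> arm \<omega> n 0 = 0 \<and> arm \<omega> n 1 = fst (Z \<omega> n) \<and>
     initially_compatible (arm \<omega> n) (arm \<omega> m)"
    unfolding AE_all_countable by (intro allI AE_impI)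
  then show ?thesis using AE_locally_finite AE_infinitely_many_points
  proof eventually_elim
    case (elim \<omega>)
    have one: "route (arm \<omega> n)" "arm \<omega> n 0 = 0" "arm \<omega> n 1 = fst (Z \<omega> n)" for n
      using elim(1)[rule_format, OF n_not_Suc_n, of n] by blast+
    have "initially_compatible (arm \<omega> n) (arm \<omega> m)" for n m
    proof (cases "n = m")
      case True
      have "inj_on (arm \<omega> n) {0..1}" using one(1)[of n] by (simp add: route_def arc_def)
      then show ?thesis unfolding True initially_compatible_def by (metis inj_onD order_refl)
    qed (use elim(1) in blast)
    then have "route_tree (range (\<lambda>n. arm \<omega> n))"
      by (simp add: route_tree_def one(1,2))
    then show ?case by (rule sampled_tree.intro) (use one(3) elim(2,3) in blast)+
  qed
qed

end

subsection \<open>The number of points at which the routes leave a disc\<close>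

lemma card_image_ge_iff:
  assumes "finite S"
  shows "j \<le> card (f ` S) \<longleftrightarrow> (\<exists>T\<subseteq>S. card T = j \<and> inj_on f T)"
proof
  assume "j \<le> card (f ` S)"
  from obtain_subset_with_card_n[OF this] obtain T0 where T0: "T0 \<subseteq> f ` S" "card T0 = j" by blast
  from T0(1) obtain T where T: "T \<subseteq> S" "inj_on f T" "T0 = f ` T" unfolding subset_image_inj by blast
  have "card T = j" using card_image[OF T(2)] T(3) T0(2) by simp
  then show "\<exists>T\<subseteq>S. card T = j \<and> inj_on f T" using T by blast
next
  assume "\<exists>T\<subseteq>S. card T = j \<and> inj_on f T"
  then obtain T where T: "T \<subseteq> S" "card T = j" "inj_on f T" by blast
  have "card (f ` T) \<le> card (f ` S)" using T(1) assms by (intro card_mono) auto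
  then show "j \<le> card (f ` S)" using card_image[OF T(3)] T(2) by simp
qed

lemma card_image_ge_measurable:
  fixes e :: "'b \<Rightarrow> 'a \<Rightarrow> complex"
  assumes S: "finite S" and e: "\<And>b. b \<in> S \<Longrightarrow> e b \<in> borel_measurable N"
  shows "{x \<in> space N. j \<le> card ((\<lambda>b. e b x) ` S)} \<in> sets N"
proof -
  have inj: "{x \<in> space N. inj_on (\<lambda>b. e b x) T} \<in> sets N" if T: "T \<subseteq> S" for T
  proof -
    have fT: "finite T" using T S by (rule finite_subset)
    have "{x \<in> space N. inj_on (\<lambda>b. e b x) T} = space N - (\<Union>a\<in>T. \<Union>b\<in>T - {a}. {x \<in> space N. e a x = e b x})"
      by (auto simp: inj_on_def)
    also have "\<dots> \<in> sets N"
    proof (intro sets.Diff sets.top sets.finite_UN)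
      fix a b assume "a \<in> T" "b \<in> T - {a}"
      then have [measurable]: "e a \<in> borel_measurable N" "e b \<in> borel_measurable N" using T by (auto intro: e)
      show "{x \<in> space N. e a x = e b x} \<in> sets N" by measurable
    qed (use fT in simp_all)
    finally show ?thesis .
  qed
  have "{x \<in> space N. j \<le> card ((\<lambda>b. e b x) ` S)} =
      (\<Union>T\<in>{T. T \<subseteq> S \<and> card T = j}. {x \<in> space N. inj_on (\<lambda>b. e b x) T})"
    unfolding card_image_ge_iff[OF S] by blast
  also have "\<dots> \<in> sets N"
    using S by (intro sets.finite_UN inj) auto
  finally show ?thesis .
qed

text \<open>Moves the starting point to 0, so that exits from discs around an arbitrary base point
  are expressed by \<open>exit_point\<close>.\<close>

definition centre :: "(real \<Rightarrow> complex) \<Rightarrow> real \<Rightarrow> complex" where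
  "centre \<gamma> = (\<lambda>t\<in>{0..1}. \<gamma> t - \<gamma> 0)"

lemma route_centre: "route \<gamma> \<Longrightarrow> route (centre \<gamma>)"
  using route_affine[of \<gamma> 1 "- \<gamma> 0"] by (simp add: centre_def)

lemma centre_id: "route \<gamma> \<Longrightarrow> \<gamma> 0 = 0 \<Longrightarrow> centre \<gamma> = \<gamma>"
  by (simp add: centre_def route_def extensional_restrict)

lemma centre_measurable:
  fixes f :: "'a \<Rightarrow> real \<Rightarrow> complex"
  assumes "f \<in> N \<rightarrow>\<^sub>M route_space"
  shows "(\<lambda>x. centre (f x)) \<in> N \<rightarrow>\<^sub>M route_space"
proof -
  have "(\<lambda>x. - f x 0) \<in> borel_measurable N"
    using measurable_route_eval[OF assms, of 0] by simp
  from measurable_route_affine[OF assms this, of 1] show ?thesis by (simp add: centre_def)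
qed

lemma route_continuous: "route \<gamma> \<Longrightarrow> continuous_on {0..1} \<gamma>"
  by (simp add: route_def arc_def path_def)

text \<open>The sets of times outside correspond, so the exit time does not change. That the route
  ends beyond \<open>r\<close> places the exit time in the unit interval, where the transformed
  route is given by the formula.\<close>

lemma exit_affine:
  assumes \<gamma>: "route \<gamma>" and c: "0 < c" and r: "0 \<le> r" "r < norm (\<gamma> 1 - \<gamma> 0)"
  shows "exit_point (c * r) (centre (\<lambda>t\<in>{0..1}. c *\<^sub>R \<gamma> t + a)) = c *\<^sub>R exit_point r (centre \<gamma>)"
proof -
  let ?\<delta> = "centre \<gamma>" and ?\<delta>' = "centre (\<lambda>t\<in>{0..1}. c *\<^sub>R \<gamma> t + a)"
  have eq: "?\<delta>' t = c *\<^sub>R ?\<delta> t" if "t \<in> {0..1}" for t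
    using that by (simp add: centre_def scaleR_diff_right)
  have mem: "?\<delta>' t \<notin> cball 0 (c * r) \<longleftrightarrow> ?\<delta> t \<notin> cball 0 r" if "t \<in> {0..1}" for t
    using c by (simp add: eq[OF that])
  have time: "exit_time (c * r) ?\<delta>' = exit_time r ?\<delta>"
    unfolding exit_time_def using mem by (intro arg_cong[where f = Inf] Collect_cong conj_cong) auto
  have "continuous_on {0..1} ?\<delta>" by (intro route_continuous route_centre \<gamma>)
  moreover have "norm (?\<delta> 0) \<le> r" "r < norm (?\<delta> 1)" using r by (simp_all add: centre_def)
  ultimately have "0 \<le> exit_time r ?\<delta>" "exit_time r ?\<delta> < 1" using exit_time_props(1,2)[of ?\<delta> r 1] by simp_all
  then show ?thesis unfolding exit_point_def time by (intro eq) simp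
qed

lemma initially_compatible_map:
  assumes \<gamma>\<eta>: "initially_compatible \<gamma> \<eta>" and f: "inj f"
  shows "initially_compatible (\<lambda>t\<in>{0..1}. f (\<gamma> t)) (\<lambda>t\<in>{0..1}. f (\<eta> t))"
  unfolding initially_compatible_def
proof (intro ballI impI)
  fix s t :: real assume st: "s \<in> {0..1}" "t \<in> {0..1}" "(\<lambda>t\<in>{0..1}. f (\<gamma> t)) s = (\<lambda>t\<in>{0..1}. f (\<eta> t)) t"
  have img: "(\<lambda>t\<in>{0..1}. f (\<zeta> t)) ` {0..u} = f ` \<zeta> ` {0..u}" if "u \<in> {0..1}" for \<zeta> and u :: real
    unfolding image_image using that by (intro image_cong) auto
  have "\<gamma> s = \<eta> t" using st f by (simp add: inj_eq)
  then have "\<gamma> ` {0..s} \<subseteq> \<eta> ` {0..t}" using \<gamma>\<eta> st by (simp add: initially_compatible_def)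
  then show "(\<lambda>t\<in>{0..1}. f (\<gamma> t)) ` {0..s} \<subseteq> (\<lambda>t\<in>{0..1}. f (\<eta> t)) ` {0..t}"
    unfolding img[OF st(1)] img[OF st(2)] by (rule image_mono)
qed

lemma initially_compatible_centre:
  assumes \<gamma>\<eta>: "initially_compatible \<gamma> \<eta>" "\<gamma> 0 = \<eta> 0"
  shows "initially_compatible (centre \<gamma>) (centre \<eta>)"
proof -
  have "inj (\<lambda>z. z - \<eta> 0)" by (simp add: inj_def)
  from initially_compatible_map[OF \<gamma>\<eta>(1) this] show ?thesis unfolding centre_def \<gamma>\<eta>(2) .
qed

text \<open>Routes that leave the unit disc around their common starting point at different points are
  disjoint from then on, and each crosses the annulus of radii \<open>5/4\<close> and \<open>7/4\<close>.\<close>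

lemma len_far_edges_ge:
  fixes x :: "nat \<Rightarrow> complex \<times> real" and i :: "nat \<Rightarrow> nat"
  defines "p \<equiv> \<lambda>b. fst (x (i b))"
  assumes k: "0 < k" and times: "\<And>a. a < k \<Longrightarrow> snd (x (i a)) \<le> l"
    and near: "norm (p 0) < 1" and far: "\<And>b. b \<in> {1..<k} \<Longrightarrow> 3 < norm (p b - p 0)"
    and routes: "\<And>b. b \<in> {1..<k} \<Longrightarrow> route (\<rho> (p 0) (p b))" "\<And>b. b \<in> {1..<k} \<Longrightarrow> \<rho> (p 0) (p b) 0 = p 0"
      "\<And>b. b \<in> {1..<k} \<Longrightarrow> \<rho> (p 0) (p b) 1 = p b"
    and compat: "\<And>a b. a \<in> {1..<k} \<Longrightarrow> b \<in> {1..<k} \<Longrightarrow> initially_compatible (\<rho> (p 0) (p a)) (\<rho> (p 0) (p b))"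
    and many: "j \<le> card ((\<lambda>b. exit_point 1 (centre (\<rho> (p 0) (p b)))) ` {1..<k})"
  shows "of_nat j * ennreal (1 / 2) \<le> len (far_edges x \<rho> l 1 \<inter> cball 0 3)"
proof -
  define g where "g b = \<rho> (p 0) (p b)" for b
  obtain T where T: "T \<subseteq> {1..<k}" "card T = j" "inj_on (\<lambda>b. exit_point 1 (centre (g b))) T"
    using many unfolding card_image_ge_iff[OF finite_atLeastLessThan] g_def[symmetric] by blast
  have tree: "route_tree ((\<lambda>b. centre (g b)) ` {1..<k})"
    unfolding route_tree_def g_def
  proof (intro conjI ballI)
    fix \<gamma> \<eta> assume "\<gamma> \<in> (\<lambda>b. centre (\<rho> (p 0) (p b))) ` {1..<k}" "\<eta> \<in> (\<lambda>b. centre (\<rho> (p 0) (p b))) ` {1..<k}"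
    then obtain a b where ab: "a \<in> {1..<k}" "\<gamma> = centre (\<rho> (p 0) (p a))" "b \<in> {1..<k}" "\<eta> = centre (\<rho> (p 0) (p b))" by blast
    show "route \<gamma>" using route_centre[OF routes(1)[OF ab(1)]] ab(2) by simp
    show "\<gamma> 0 = 0" using ab(2) by (simp add: centre_def)
    show "initially_compatible \<gamma> \<eta>"
      unfolding ab(2,4) by (rule initially_compatible_centre[OF compat[OF ab(1,3)]]) (simp only: routes(2)[OF ab(1)] routes(2)[OF ab(3)])
  qed
  \<comment> \<open>The annulus lies outside the unit disc around \<open>p 0\<close>, so distinct
    exit points make the pieces disjoint. Its outer radius is below 2, which keeps it out of the
    unit disc around \<open>p b\<close>, at distance more than 3 from \<open>p 0\<close>, and inside
    \<open>cball 0 3\<close>. Its width is the factor 1/2 in the claim.\<close>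
  define S where "S b = g b ` {0..1} \<inter> {w. 5 / 4 \<le> norm (w - p 0) \<and> norm (w - p 0) \<le> 7 / 4}" for b
  have cont: "continuous_on {0..1} (g b)" if "b \<in> {1..<k}" for b
    unfolding g_def by (rule route_continuous[OF routes(1)[OF that]])
  have "of_nat (card T) * ennreal (7 / 4 - 5 / 4) \<le> len (far_edges x \<rho> l 1 \<inter> cball 0 3)"
  proof (rule len_ge_disjoint[where S = S and c = "p 0"])
    show "finite T" using T(1) finite_subset by blast
    show "compact (S b)" if "b \<in> T" for b
      unfolding S_def
    proof (rule compact_Int_closed)
      show "compact (g b ` {0..1})" using cont that T(1) by (intro compact_continuous_image) auto
      show "closed {w. 5 / 4 \<le> norm (w - p 0) \<and> norm (w - p 0) \<le> 7 / 4}"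
        by (intro closed_Collect_conj closed_Collect_le continuous_intros)
    qed
    show "disjoint_family_on S T"
      unfolding disjoint_family_on_def
    proof (intro ballI impI, rule ccontr)
      fix a b assume ab: "a \<in> T" "b \<in> T" "a \<noteq> b" "S a \<inter> S b \<noteq> {}"
      then obtain w where "w \<in> S a" "w \<in> S b" by blast
      then obtain s t where st: "s \<in> {0..1}" "t \<in> {0..1}" "w = g a s" "w = g b t" and w: "5 / 4 \<le> norm (w - p 0)"
        unfolding S_def by blast
      have abk: "a \<in> {1..<k}" "b \<in> {1..<k}" using ab T(1) by auto
      have g0: "g a 0 = p 0" "g b 0 = p 0" unfolding g_def using routes(2) abk by auto
      have c: "centre (g a) s = w - p 0" "centre (g b) t = w - p 0"
        using st g0 by (simp_all add: centre_def)
      have "exit_point 1 (centre (g a)) = exit_point 1 (centre (g b))"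
        by (rule exit_point_eq_if_meet[OF tree imageI[OF abk(1)] imageI[OF abk(2)] st(1,2)]) (use c w in simp_all)
      then show False using T(3) ab by (simp add: inj_on_def)
    qed
    show "{5 / 4..7 / 4} \<subseteq> (\<lambda>z. norm (z - p 0)) ` S b" if "b \<in> T" for b
    proof
      fix u :: real assume u: "u \<in> {5 / 4..7 / 4}"
      have b: "b \<in> {1..<k}" using that T(1) by blast
      have "\<exists>t\<ge>0. t \<le> 1 \<and> norm (g b t - p 0) = u"
      proof (rule IVT')
        show "norm (g b 0 - p 0) \<le> u" "u \<le> norm (g b 1 - p 0)"
          using routes(2,3)[OF b] far[OF b] u by (simp_all add: g_def)
        show "continuous_on {0..1} (\<lambda>t. norm (g b t - p 0))" by (intro continuous_intros cont b)
      qed simp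
      then obtain t where t: "0 \<le> t" "t \<le> 1" "norm (g b t - p 0) = u" by blast
      then have "g b t \<in> S b" using u by (simp add: S_def)
      then show "u \<in> (\<lambda>z. norm (z - p 0)) ` S b" using t(3) by blast
    qed
    show "S b \<subseteq> far_edges x \<rho> l 1 \<inter> cball 0 3" if "b \<in> T" for b
    proof
      fix w assume "w \<in> S b"
      then have w: "w \<in> path_image (\<rho> (p 0) (p b))" "5 / 4 \<le> norm (w - p 0)" "norm (w - p 0) \<le> 7 / 4"
        by (simp_all add: S_def g_def path_image_def)
      have b: "b \<in> {1..<k}" using that T(1) by blast
      have "norm w \<le> norm (w - p 0) + norm (p 0)" using norm_triangle_ineq[of "w - p 0" "p 0"] by simp
      then have 1: "w \<in> cball 0 3" using w near by simp
      have "norm (p b - p 0) \<le> norm (p b - w) + norm (w - p 0)" using norm_triangle_ineq[of "p b - w" "w - p 0"] by simp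
      then have 2: "w \<notin> cball (p b) 1" using w far[OF b] by (simp add: dist_norm)
      have 3: "w \<notin> cball (p 0) 1" using w by (simp add: dist_norm norm_minus_commute)
      have 4: "p 0 \<in> \<Xi> x l" "p b \<in> \<Xi> x l - {p 0}"
        using times[of 0] times[of b] k b far[OF b] unfolding \<Xi>_def p_def by auto
      show "w \<in> far_edges x \<rho> l 1 \<inter> cball 0 3"
        unfolding far_edges_def using w(1) 1 2 3 4 by blast
    qed
  qed simp
  then show ?thesis using T(2) by simp
qed

context sirsn_sample
begin

section \<open>Scaling of the number of exit points\<close>

lemma network_affine_measurable:
  assumes "0 < c"
  shows "(\<lambda>r. \<lambda>p\<in>index_pairs k. \<lambda>t\<in>{0..1}. c *\<^sub>R r p t + a) \<in> network_space k \<rightarrow>\<^sub>M network_space k"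
  unfolding network_space_def
proof (rule measurable_restrict)
  fix p assume "p \<in> index_pairs k"
  then have "(\<lambda>r. r p) \<in> PiM (index_pairs k) (\<lambda>_. route_space) \<rightarrow>\<^sub>M route_space" by (rule measurable_component_singleton)
  from measurable_route_affine[OF this borel_measurable_const assms]
  show "(\<lambda>r. \<lambda>t\<in>{0..1}. c *\<^sub>R r p t + a) \<in> PiM (index_pairs k) (\<lambda>_. route_space) \<rightarrow>\<^sub>M route_space" .
qed

lemma positions_affine:
  fixes c :: real
  assumes "z \<in> space (positions k)" "0 < c"
  shows "(\<lambda>i\<in>{..<k}. c *\<^sub>R z i + a) \<in> space (positions k)"
  using assms unfolding space_positions by (auto simp: inj_on_def)

lemma \<mu>_affine:
  assumes z: "z \<in> space (positions k)" and c: "0 < c" and C: "C \<in> sets (network_space k)"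
  shows "emeasure (\<mu> k (\<lambda>i\<in>{..<k}. c *\<^sub>R z i + a)) C =
    emeasure (\<mu> k z) {r \<in> space (network_space k). (\<lambda>p\<in>index_pairs k. \<lambda>t\<in>{0..1}. c *\<^sub>R r p t + a) \<in> C}"
proof -
  let ?N = "network_space k"
  let ?S = "\<lambda>r. \<lambda>p\<in>index_pairs k. \<lambda>t\<in>{0..1}. c *\<^sub>R r p t"
  let ?T = "\<lambda>r. \<lambda>p\<in>index_pairs k. \<lambda>t\<in>{0..1}. r p t + a"
  let ?z = "\<lambda>i\<in>{..<k}. c *\<^sub>R z i"
  have S: "?S \<in> ?N \<rightarrow>\<^sub>M ?N" using network_affine_measurable[OF c, where k = k and a = 0] by simp
  have T: "?T \<in> ?N \<rightarrow>\<^sub>M ?N" using network_affine_measurable[where c = 1 and k = k and a = a] by simp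
  have z': "?z \<in> space (positions k)" using positions_affine[OF z c, of 0] by simp
  have inv: "invariant_fdds \<mu> (\<lambda>x. x + a)" "invariant_fdds \<mu> (\<lambda>x. c *\<^sub>R x)"
    using random_routes c unfolding random_routes_def by blast+
  have dS: "distr (\<mu> k z) ?N ?S = \<mu> k ?z"
    using inv(2) z unfolding invariant_fdds_def by blast
  have dT: "distr (\<mu> k ?z) ?N ?T = \<mu> k (\<lambda>i\<in>{..<k}. ?z i + a)"
    using inv(1) z' unfolding invariant_fdds_def by blast
  have "(\<lambda>i\<in>{..<k}. ?z i + a) = (\<lambda>i\<in>{..<k}. c *\<^sub>R z i + a)" by (rule restrict_ext) simp
  then have "emeasure (\<mu> k (\<lambda>i\<in>{..<k}. c *\<^sub>R z i + a)) C = emeasure (distr (\<mu> k ?z) ?N ?T) C" using dT by simp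
  also have "\<dots> = emeasure (\<mu> k ?z) (?T -` C \<inter> space ?N)"
    using emeasure_distr[of ?T "\<mu> k ?z" ?N C] T C \<mu>_prob(2,3)[OF z'] by (simp cong: measurable_cong_sets)
  also have "\<dots> = emeasure (distr (\<mu> k z) ?N ?S) (?T -` C \<inter> space ?N)" by (simp only: dS)
  also have "\<dots> = emeasure (\<mu> k z) (?S -` (?T -` C \<inter> space ?N) \<inter> space ?N)"
    using emeasure_distr[of ?S "\<mu> k z" ?N "?T -` C \<inter> space ?N"] S measurable_sets[OF T C] \<mu>_prob(2,3)[OF z]
    by (simp cong: measurable_cong_sets)
  also have "?S -` (?T -` C \<inter> space ?N) \<inter> space ?N =
      {r \<in> space ?N. (\<lambda>p\<in>index_pairs k. \<lambda>t\<in>{0..1}. c *\<^sub>R r p t + a) \<in> C}"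
  proof -
    have "?T (?S r) = (\<lambda>p\<in>index_pairs k. \<lambda>t\<in>{0..1}. c *\<^sub>R r p t + a)" for r :: "nat \<times> nat \<Rightarrow> real \<Rightarrow> complex"
      by (auto simp: restrict_def fun_eq_iff)
    then show ?thesis using measurable_space[OF S] by auto
  qed
  finally show ?thesis .
qed

lemma feasible_base:
  assumes "feasible_subnetwork k z s" "b \<in> {1..<k}"
  shows "route (s (0, b))" "s (0, b) 0 = z 0" "s (0, b) 1 = z b"
proof -
  have "(0, b) \<in> index_pairs k" using assms(2) by (auto simp: index_pairs_def)
  then show "route (s (0, b))" "s (0, b) 0 = z 0" "s (0, b) 1 = z b"
    using assms(1) by (auto simp: feasible_subnetwork_def pathstart_def pathfinish_def)
qed

lemma base_component: "b \<in> {1..<k} \<Longrightarrow> (\<lambda>s. s (0, b)) \<in> network_space k \<rightarrow>\<^sub>M route_space"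
  by (rule network_component) (auto simp: index_pairs_def)

definition many :: "nat \<Rightarrow> real \<Rightarrow> nat \<Rightarrow> (nat \<times> nat \<Rightarrow> real \<Rightarrow> complex) set" where
  "many k r j = {s \<in> space (network_space k). j \<le> card ((\<lambda>b. exit_point r (centre (s (0, b)))) ` {1..<k})}"

lemma many_measurable: "many k r j \<in> sets (network_space k)"
  unfolding many_def
proof (rule card_image_ge_measurable)
  fix b assume "b \<in> {1..<k}"
  then show "(\<lambda>s. exit_point r (centre (s (0, b)))) \<in> borel_measurable (network_space k)"
    by (rule measurable_exit_point[OF centre_measurable[OF base_component]])
qed simp

lemma many_affine:
  assumes z: "z \<in> space (positions k)" and c: "0 < c" and r: "0 \<le> r" "\<And>b. b \<in> {1..<k} \<Longrightarrow> r < norm (z b - z 0)"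
  shows "emeasure (\<mu> k (\<lambda>i\<in>{..<k}. c *\<^sub>R z i + a)) (many k (c * r) j) = emeasure (\<mu> k z) (many k r j)"
proof -
  let ?A = "\<lambda>s. \<lambda>p\<in>index_pairs k. \<lambda>t\<in>{0..1}. c *\<^sub>R s p t + a"
  have A: "?A \<in> network_space k \<rightarrow>\<^sub>M network_space k" by (rule network_affine_measurable[OF c])
  have "emeasure (\<mu> k (\<lambda>i\<in>{..<k}. c *\<^sub>R z i + a)) (many k (c * r) j) =
      emeasure (\<mu> k z) {s \<in> space (network_space k). ?A s \<in> many k (c * r) j}"
    by (rule \<mu>_affine[OF z c many_measurable])
  also have "\<dots> = emeasure (\<mu> k z) (many k r j)"
  proof (rule emeasure_eq_AE)
    show "{s \<in> space (network_space k). ?A s \<in> many k (c * r) j} \<in> sets (\<mu> k z)"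
      using measurable_sets[OF A many_measurable[of k "c * r" j]] unfolding \<mu>_prob(2)[OF z]
      by (simp add: vimage_def Int_def conj_commute)
    show "many k r j \<in> sets (\<mu> k z)" unfolding \<mu>_prob(2)[OF z] by (rule many_measurable)
    show "AE s in \<mu> k z. s \<in> {s \<in> space (network_space k). ?A s \<in> many k (c * r) j} \<longleftrightarrow> s \<in> many k r j"
      using \<mu>_feasible[OF z] AE_space
    proof eventually_elim
      case (elim s)
      have s: "s \<in> space (network_space k)" using elim(2) \<mu>_prob(3)[OF z] by simp
      have "exit_point (c * r) (centre (?A s (0, b))) = c *\<^sub>R exit_point r (centre (s (0, b)))" if b: "b \<in> {1..<k}" for b
      proof -
        have "(0, b) \<in> index_pairs k" using b by (auto simp: index_pairs_def)
        then have "?A s (0, b) = (\<lambda>t\<in>{0..1}. c *\<^sub>R s (0, b) t + a)" by simp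
        then show ?thesis
          using exit_affine[OF feasible_base(1)[OF elim(1) b] c r(1)] feasible_base[OF elim(1) b] r(2)[OF b] by simp
      qed
      then have "(\<lambda>b. exit_point (c * r) (centre (?A s (0, b)))) ` {1..<k} =
          (\<lambda>x. c *\<^sub>R x) ` (\<lambda>b. exit_point r (centre (s (0, b)))) ` {1..<k}"
        unfolding image_image by (intro image_cong refl)
      moreover have "inj_on (\<lambda>x. c *\<^sub>R x) X" for X :: "complex set" using c by (auto simp: inj_on_def)
      ultimately have "card ((\<lambda>b. exit_point (c * r) (centre (?A s (0, b)))) ` {1..<k}) =
          card ((\<lambda>b. exit_point r (centre (s (0, b)))) ` {1..<k})" by (simp only: card_image)
      moreover have "?A s \<in> space (network_space k)" by (rule measurable_space[OF A s])
      ultimately show ?case using s by (simp only: many_def mem_Collect_eq simp_thms)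
    qed
  qed
  finally show ?thesis .
qed

text \<open>\<open>ess j r B q\<close>: the routes from the origin to a fixed finite set of points outside
  \<open>disc(0, B)\<close>, generic in the sense of area, leave \<open>disc(0, r)\<close> at \<open>j\<close> or more points with probability
  at most \<open>q\<close>.\<close>

definition ess :: "nat \<Rightarrow> real \<Rightarrow> real \<Rightarrow> ennreal \<Rightarrow> bool" where
  "ess j r B q \<longleftrightarrow> (\<forall>k. AE y in lborels {1..<k}. (\<forall>b\<in>{1..<k}. B < norm (y b)) \<longrightarrow>
     place k {1..<k} y \<in> space (positions k) \<longrightarrow> emeasure (\<mu> k (place k {1..<k} y)) (many k r j) \<le> q)"

text \<open>Scaling carries the law at one configuration exactly to the law at the scaled
  configuration, and the exceptional null set to a null set. That the points lie beyond
  \<open>B\<close>, hence beyond \<open>r\<close>, ensures that all exit points are genuine and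
  scale along.\<close>

lemma ess_scale:
  assumes ess: "ess j r B q" and c: "0 < c" and r: "0 \<le> r" "r \<le> B"
  shows "ess j (c * r) (c * B) q"
  unfolding ess_def
proof
  fix k :: nat
  let ?J = "{1..<k}"
  have c': "0 < 1 / c" using c by simp
  have "AE y in lborels ?J. (\<forall>b\<in>?J. B < norm (y b)) \<longrightarrow>
     place k ?J y \<in> space (positions k) \<longrightarrow> emeasure (\<mu> k (place k ?J y)) (many k r j) \<le> q"
    using ess unfolding ess_def by blast
  from AE_lborels_affine[OF _ c' this, of 0]
  have "AE y in lborels ?J. (\<forall>b\<in>?J. B < norm ((\<lambda>j\<in>?J. (1 / c) *\<^sub>R y j + 0) b)) \<longrightarrow>
     place k ?J (\<lambda>j\<in>?J. (1 / c) *\<^sub>R y j + 0) \<in> space (positions k) \<longrightarrow>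
     emeasure (\<mu> k (place k ?J (\<lambda>j\<in>?J. (1 / c) *\<^sub>R y j + 0))) (many k r j) \<le> q" by simp
  then show "AE y in lborels ?J. (\<forall>b\<in>?J. c * B < norm (y b)) \<longrightarrow>
     place k ?J y \<in> space (positions k) \<longrightarrow> emeasure (\<mu> k (place k ?J y)) (many k (c * r) j) \<le> q"
  proof eventually_elim
    case (elim y)
    define y' where "y' = (\<lambda>j\<in>?J. (1 / c) *\<^sub>R y j + 0)"
    show ?case
    proof (intro impI)
      assume y: "\<forall>b\<in>?J. c * B < norm (y b)" "place k ?J y \<in> space (positions k)"
      have n: "B < norm (y' b)" if "b \<in> ?J" for b
        using y(1) that c by (simp add: y'_def field_simps)
      have pl: "place k ?J y' = (\<lambda>i\<in>{..<k}. (1 / c) *\<^sub>R place k ?J y i + 0)"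
        unfolding place_def y'_def by (intro restrict_ext) simp
      have pos: "place k ?J y' \<in> space (positions k)"
        unfolding pl by (rule positions_affine[OF y(2) c'])
      have pl': "(\<lambda>i\<in>{..<k}. c *\<^sub>R place k ?J y' i + 0) = place k ?J y"
        unfolding place_def y'_def using c by (intro restrict_ext) simp
      have "emeasure (\<mu> k (\<lambda>i\<in>{..<k}. c *\<^sub>R place k ?J y' i + 0)) (many k (c * r) j) = emeasure (\<mu> k (place k ?J y')) (many k r j)"
      proof (rule many_affine[OF pos c r(1)])
        fix b assume b: "b \<in> ?J"
        then have "place k ?J y' b = y' b" "place k ?J y' 0 = 0" by (auto simp: place_def)
        then show "r < norm (place k ?J y' b - place k ?J y' 0)" using n[OF b] r(2) by simp
      qed
      also have "\<dots> \<le> q" using elim n pos unfolding y'_def[symmetric] by blast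
      finally show "emeasure (\<mu> k (place k ?J y)) (many k (c * r) j) \<le> q" unfolding pl' .
    qed
  qed
qed

lemma net_apply:
  assumes "0 \<notin> J" "b \<in> J" "J \<subseteq> {..<k}"
  shows "net k J i \<omega> (0, b) = arm \<omega> (i b)"
proof -
  have "b \<noteq> 0" using assms(1,2) by metis
  moreover have "b < k" using assms(2,3) by auto
  ultimately have "(0, b) \<in> index_pairs k" by (auto simp: index_pairs_def)
  then show ?thesis using assms by (simp add: net_def span_of_def pt_def)
qed

lemma net_centre:
  assumes tree: "sampled_tree (Z \<omega>) (R \<omega>)" and b: "b \<in> {1..<k}"
  shows "centre (net k {1..<k} i \<omega> (0, b)) = arm \<omega> (i b)"
proof -
  interpret sampled_tree "Z \<omega>" "R \<omega>" by (rule tree)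
  have "net k {1..<k} i \<omega> (0, b) = arm \<omega> (i b)" by (rule net_apply[OF _ b]) auto
  then show ?thesis using centre_id[OF br(1,2), of "i b"] by simp
qed

lemma net_apply_all:
  assumes "b \<in> {1..<k}"
  shows "net k {..<k} i \<omega> (0, b) = R \<omega> (fst (Z \<omega> (i 0))) (fst (Z \<omega> (i b)))"
proof -
  have "(0, b) \<in> index_pairs k" using assms by (auto simp: index_pairs_def)
  then show ?thesis using assms by (simp add: net_def span_of_def pt_def)
qed

lemma emeasure_unit_ball_pos: "0 < emeasure lborel (ball 0 1 :: complex set)"
proof -
  have "0 < measure lborel (ball 0 1 :: complex set)" by (rule content_ball_pos) simp
  then have "emeasure lborel (ball 0 1 :: complex set) \<noteq> 0" by (auto simp: measure_def)
  then show ?thesis by (simp add: zero_less_iff_neq_zero)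
qed

lemma hit_half:
  assumes J: "finite J" and K: "K \<in> sets (PiM J (\<lambda>_. borel))" "emeasure (lborels J) K \<noteq> 0"
  shows "\<exists>m0>0. \<forall>l>0. \<forall>c>0. m0 \<le> l * c\<^sup>2 \<longrightarrow>
    1 / 2 \<le> prob (hit J K l c)"
proof (rule hit_probability[OF J K(1)])
  show "0 < emeasure (lborels J) K" using K(2) by (simp add: zero_less_iff_neq_zero)
  show "0 < (1 / 2 :: real)" by simp
  fix m0 :: real assume m0: "0 < m0" "\<And>l c. 0 < l \<Longrightarrow> 0 < c \<Longrightarrow> m0 \<le> l * c\<^sup>2 \<Longrightarrow>
    1 - 1 / 2 \<le> prob (hit J K l c)"
  show ?thesis
  proof (intro exI[of _ m0] conjI allI impI m0(1))
    fix l c :: real assume lc: "0 < l" "0 < c" "m0 \<le> l * c\<^sup>2"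
    from m0(2)[OF lc] show "1 / 2 \<le> prob (hit J K l c)" by simp
  qed
qed

lemma far_edges_mean_bound:
  "\<exists>K>0. \<exists>L>0. \<forall>l\<ge>L. (\<integral>\<^sup>+ \<omega>. len (far_edges (Z \<omega>) (R \<omega>) l 1 \<inter> cball 0 3) \<partial>M) \<le> ennreal K"
proof -
  obtain v p where v: "v < \<infinity>" and p: "\<And>l. 0 < l \<Longrightarrow> has_edge_intensity M (\<lambda>\<omega>. far_edges (Z \<omega>) (R \<omega>) l 1) (p l)"
    and lim: "(p \<longlongrightarrow> v) at_top"
    using SIRSN unfolding SIRSN_def limit_intensity_def by blast
  obtain v' where v': "v = ennreal v'" "0 \<le> v'" using v by (cases v) auto
  have "v < ennreal (v' + 1)" using v' by (simp add: ennreal_less_iff)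
  from order_tendstoD(2)[OF lim this] obtain L0 where L0: "\<And>l. L0 \<le> l \<Longrightarrow> p l < ennreal (v' + 1)"
    unfolding eventually_at_top_linorder by blast
  have "emeasure lborel (cball 0 3 :: complex set) < \<infinity>" by (rule emeasure_bounded_finite[OF bounded_cball])
  then obtain A where A: "emeasure lborel (cball 0 3 :: complex set) = ennreal A" "0 \<le> A"
    by (cases "emeasure lborel (cball 0 3 :: complex set)") auto
  have pos: "0 < (v' + 1) * A + 1" "0 < max L0 1" using v' A by (auto intro: add_nonneg_pos)
  have "(\<integral>\<^sup>+ \<omega>. len (far_edges (Z \<omega>) (R \<omega>) l 1 \<inter> cball 0 3) \<partial>M) \<le> ennreal ((v' + 1) * A + 1)" if l: "max L0 1 \<le> l" for l
  proof -
    have "(\<integral>\<^sup>+ \<omega>. len (far_edges (Z \<omega>) (R \<omega>) l 1 \<inter> cball 0 3) \<partial>M) = p l * ennreal A"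
      using p[of l] A(1) l unfolding has_edge_intensity_def by auto
    also have "\<dots> \<le> ennreal (v' + 1) * ennreal A" using L0[of l] l by (intro mult_right_mono) auto
    also have "\<dots> = ennreal ((v' + 1) * A)" using v' A by (simp add: ennreal_mult)
    also have "\<dots> \<le> ennreal ((v' + 1) * A + 1)" by (rule ennreal_leI) simp
    finally show ?thesis .
  qed
  then show ?thesis using pos by blast
qed

text \<open>The tuple that hits \<open>K\<close> is random, so the tree properties are needed for
  all of the countably many index tuples at once.\<close>

lemma AE_len_far_edges_ge:
  assumes k: "0 < k" and Kfar: "\<And>y. y \<in> K \<Longrightarrow> norm (y 0) < 1 \<and> (\<forall>b\<in>{1..<k}. 3 < norm (y b - y 0))"
  shows "AE \<omega> in M. (\<exists>i\<in>{..<k} \<rightarrow>\<^sub>E UNIV. hit_tuple {..<k} K l 1 (Z \<omega>) i \<and> net k {..<k} i \<omega> \<in> many k 1 j) \<longrightarrow>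
     of_nat j * ennreal (1 / 2) \<le> len (far_edges (Z \<omega>) (R \<omega>) l 1 \<inter> cball 0 3)"
proof -
  let ?T = "{..<k} \<rightarrow>\<^sub>E (UNIV :: nat set)"
  let ?tree = "\<lambda>i \<omega>. \<forall>a\<in>{1..<k}. R \<omega> (pt {..<k} i 0 \<omega>) (pt {..<k} i a \<omega>) 0 = pt {..<k} i 0 \<omega> \<and>
    R \<omega> (pt {..<k} i 0 \<omega>) (pt {..<k} i a \<omega>) 1 = pt {..<k} i a \<omega> \<and>
    route (R \<omega> (pt {..<k} i 0 \<omega>) (pt {..<k} i a \<omega>)) \<and>
     (\<forall>b\<in>{1..<k}. initially_compatible (R \<omega> (pt {..<k} i 0 \<omega>) (pt {..<k} i a \<omega>)) (R \<omega> (pt {..<k} i 0 \<omega>) (pt {..<k} i b \<omega>)))"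
  have cT: "countable ?T" by (rule countable_tuples) simp
  have "AE \<omega> in M. \<forall>i\<in>?T. inj_on i {..<k} \<longrightarrow>
     ?tree i \<omega>"
    unfolding AE_ball_countable[OF cT]
  proof
    fix i assume "i \<in> ?T"
    show "AE \<omega> in M. inj_on i {..<k} \<longrightarrow>
     ?tree i \<omega>"
    proof (cases "inj_on i {..<k}")
      case True
      have "sample_points k (pt {..<k} i)" by (rule sample_points_pt) (use True in auto)
      from span_tree[OF this] show ?thesis by (rule AE_mp) (rule AE_I2, blast)
    qed simp
  qed
  then show ?thesis
  proof (eventually_elim, intro impI)
    fix \<omega>
    assume tree: "\<forall>i\<in>?T. inj_on i {..<k} \<longrightarrow>
     ?tree i \<omega>"
    assume "\<exists>i\<in>?T. hit_tuple {..<k} K l 1 (Z \<omega>) i \<and> net k {..<k} i \<omega> \<in> many k 1 j"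
    then obtain i where i: "i \<in> ?T" "hit_tuple {..<k} K l 1 (Z \<omega>) i" "net k {..<k} i \<omega> \<in> many k 1 j" by blast
    have inj: "inj_on i {..<k}" and times: "\<And>a. a < k \<Longrightarrow> snd (Z \<omega> (i a)) \<le> l"
      and inK: "(\<lambda>j\<in>{..<k}. (1 / 1) *\<^sub>R fst (Z \<omega> (i j))) \<in> K"
      using i(2) by (auto simp: hit_tuple_def)
    have pt: "pt {..<k} i a \<omega> = fst (Z \<omega> (i a))" if "a < k" for a using that by (simp add: pt_def)
    note tr = bspec[OF mp[OF bspec[OF tree i(1)] inj]]
    show "of_nat j * ennreal (1 / 2) \<le> len (far_edges (Z \<omega>) (R \<omega>) l 1 \<inter> cball 0 3)"
    proof (rule len_far_edges_ge[OF k])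
      show "snd (Z \<omega> (i a)) \<le> l" if "a < k" for a using times that .
      show "norm (fst (Z \<omega> (i 0))) < 1" using Kfar[OF inK] k by simp
      show "3 < norm (fst (Z \<omega> (i b)) - fst (Z \<omega> (i 0)))" if "b \<in> {1..<k}" for b
        using bspec[OF conjunct2[OF Kfar[OF inK]] that] that k by simp
      show "route (R \<omega> (fst (Z \<omega> (i 0))) (fst (Z \<omega> (i b))))" "R \<omega> (fst (Z \<omega> (i 0))) (fst (Z \<omega> (i b))) 0 = fst (Z \<omega> (i 0))"
        "R \<omega> (fst (Z \<omega> (i 0))) (fst (Z \<omega> (i b))) 1 = fst (Z \<omega> (i b))" if "b \<in> {1..<k}" for b
        using tr[OF that] pt[OF k] pt[of b] that by simp_all
      show "initially_compatible (R \<omega> (fst (Z \<omega> (i 0))) (fst (Z \<omega> (i a)))) (R \<omega> (fst (Z \<omega> (i 0))) (fst (Z \<omega> (i b))))"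
        if "a \<in> {1..<k}" "b \<in> {1..<k}" for a b
      proof -
        have lt: "a < k" "b < k" using that by auto
        from bspec[OF conjunct2[OF conjunct2[OF conjunct2[OF tr[OF that(1)]]]] that(2)]
        show ?thesis unfolding pt[OF k] pt[OF lt(1)] pt[OF lt(2)] .
      qed
      have "(\<lambda>b. exit_point 1 (centre (net k {..<k} i \<omega> (0, b)))) ` {1..<k} =
          (\<lambda>b. exit_point 1 (centre (R \<omega> (fst (Z \<omega> (i 0))) (fst (Z \<omega> (i b)))))) ` {1..<k}"
        by (intro image_cong refl) (simp only: net_apply_all)
      then show "j \<le> card ((\<lambda>b. exit_point 1 (centre (R \<omega> (fst (Z \<omega> (i 0))) (fst (Z \<omega> (i b)))))) ` {1..<k})"
        using i(3) by (simp only: many_def mem_Collect_eq)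
    qed
  qed
qed

text \<open>Otherwise, for large \<open>l\<close>, some tuple of points falls into the bad set with
  probability at least 1/2, and its routes have \<open>j\<close> exit points with conditional
  probability at least \<open>5 * K / j\<close>. Each such event costs length \<open>j / 2\<close>,
  so the mean length would be at least \<open>5 * K / 4\<close>, more than the bound
  \<open>K\<close> supplied by \<open>p(1) < \<infinity>\<close>.\<close>

lemma ess_base: "\<exists>K>0. \<forall>j>0. ess j 1 3 (ennreal (5 * K / real j))"
proof -
  obtain K L :: real where KL: "0 < K" "0 < L" and mean: "\<And>l. L \<le> l \<Longrightarrow>
     (\<integral>\<^sup>+ \<omega>. len (far_edges (Z \<omega>) (R \<omega>) l 1 \<inter> cball 0 3) \<partial>M) \<le> ennreal K"
    using far_edges_mean_bound by blast
  have "ess j 1 3 (ennreal (5 * K / real j))" if j: "0 < j" for j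
    unfolding ess_def
  proof
    fix k :: nat
    let ?q = "5 * K / real j" and ?J = "{1..<k}"
    have q: "0 < ?q" using KL j by simp
    show "AE y in lborels ?J. (\<forall>b\<in>?J. 3 < norm (y b)) \<longrightarrow>
     place k ?J y \<in> space (positions k) \<longrightarrow> emeasure (\<mu> k (place k ?J y)) (many k 1 j) \<le> ennreal ?q"
    proof (cases "k = 0")
      case True
      then have "many k 1 j = {}" using j by (simp add: many_def)
      then show ?thesis by simp
    next
      case False
      then have k: "0 < k" by simp
      let ?P = "PiM {..<k} (\<lambda>_. borel :: complex measure)"
      \<comment> \<open>Here the base point is itself a Poisson point near the origin, because far
        edges join pairs of Poisson points.\<close>
      define D where "D = {y \<in> space ?P. (place k {..<k} y \<in> space (positions k) \<and>
           ennreal ?q < emeasure (\<mu> k (place k {..<k} y)) (many k 1 j))} \<inter>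
         ({y \<in> space ?P. norm (y 0) < 1} \<inter> {y \<in> space ?P. \<forall>b\<in>?J. 3 < norm (y b - y 0)})"
      have comp: "(\<lambda>y. y b) \<in> borel_measurable ?P" if "b < k" for b
        using that by (intro measurable_component_singleton) simp
      have D: "D \<in> sets ?P"
        unfolding D_def
      proof (intro sets.Int)
        show "{y \<in> space ?P. place k {..<k} y \<in> space (positions k) \<and>
           ennreal ?q < emeasure (\<mu> k (place k {..<k} y)) (many k 1 j)} \<in> sets ?P"
          by (rule \<mu>_level_set[OF many_measurable]) measurable
        show "{y \<in> space ?P. norm (y 0) < 1} \<in> sets ?P"
          using comp[OF k] by measurable
        show "{y \<in> space ?P. \<forall>b\<in>?J. 3 < norm (y b - y 0)} \<in> sets ?P"
        proof (rule sets.sets_Collect_finite_All)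
          fix b assume "b \<in> ?J"
          then have [measurable]: "(\<lambda>y. y b) \<in> borel_measurable ?P" "(\<lambda>y. y 0) \<in> borel_measurable ?P"
            using comp k by auto
          show "{y \<in> space ?P. 3 < norm (y b - y 0)} \<in> sets ?P" by measurable
        qed simp
      qed
      have "emeasure (lborels {..<k}) D = 0"
      proof (rule ccontr)
        assume "emeasure (lborels {..<k}) D \<noteq> 0"
        then obtain m0 where m0: "0 < m0" "\<And>l c. 0 < l \<Longrightarrow> 0 < c \<Longrightarrow> m0 \<le> l * c\<^sup>2 \<Longrightarrow>
            1 / 2 \<le> prob (hit {..<k} D l c)"
          using hit_half[OF finite_lessThan D] by blast
        define l where "l = max L m0"
        let ?H = "hit {..<k} D l 1"
        let ?E = "{\<omega> \<in> space M. \<exists>i \<in> {..<k} \<rightarrow>\<^sub>E UNIV. hit_tuple {..<k} D l 1 (Z \<omega>) i \<and> net k {..<k} i \<omega> \<in> many k 1 j}"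
        let ?len = "\<lambda>\<omega>. len (far_edges (Z \<omega>) (R \<omega>) l 1 \<inter> cball 0 3)"
        have l: "0 < l" "m0 \<le> l * 1\<^sup>2" "L \<le> l" using m0 by (auto simp: l_def)
        have half: "1 / 2 \<le> prob ?H" by (rule m0(2)[OF l(1) _ l(2)]) simp
        have le1: "ennreal ?q * emeasure M ?H \<le> emeasure M ?E"
        proof (rule hit_law[OF _ _ many_measurable D])
          fix y assume y: "y \<in> D" "place k {..<k} (\<lambda>j\<in>{..<k}. 1 *\<^sub>R y j) \<in> space (positions k)"
          have "place k {..<k} (\<lambda>j\<in>{..<k}. 1 *\<^sub>R y j) = place k {..<k} y"
            unfolding place_def by (intro restrict_ext) simp
          then show "ennreal ?q \<le> emeasure (\<mu> k (place k {..<k} (\<lambda>j\<in>{..<k}. 1 *\<^sub>R y j))) (many k 1 j)"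
            using y(1) by (auto simp: D_def intro: less_imp_le)
        qed auto
        have le2: "of_nat j * ennreal (1 / 2) * emeasure M ?E \<le> ennreal K"
        proof (cases "?E \<in> sets M")
          case True
          have "of_nat j * ennreal (1 / 2) * emeasure M ?E = (\<integral>\<^sup>+\<omega>. of_nat j * ennreal (1 / 2) * indicator ?E \<omega> \<partial>M)"
            using True by (simp add: nn_integral_cmult_indicator)
          also have "\<dots> \<le> (\<integral>\<^sup>+\<omega>. ?len \<omega> \<partial>M)"
          proof (rule nn_integral_mono_AE)
            have "AE \<omega> in M. (\<exists>i\<in>{..<k} \<rightarrow>\<^sub>E UNIV. hit_tuple {..<k} D l 1 (Z \<omega>) i \<and> net k {..<k} i \<omega> \<in> many k 1 j) \<longrightarrow>
                of_nat j * ennreal (1 / 2) \<le> ?len \<omega>"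
              by (rule AE_len_far_edges_ge[OF k]) (simp add: D_def)
            then show "AE \<omega> in M. of_nat j * ennreal (1 / 2) * indicator ?E \<omega> \<le> ?len \<omega>"
            proof eventually_elim
              case (elim \<omega>)
              show ?case
              proof (cases "\<omega> \<in> ?E")
                case True
                then have "of_nat j * ennreal (1 / 2) \<le> ?len \<omega>" using elim by blast
                then show ?thesis using True by simp
              next
                case False
                then have "indicator ?E \<omega> = (0 :: ennreal)" by (rule indicator_simps(2))
                then show ?thesis by (simp only: mult_zero_right) simp
              qed
            qed
          qed
          also have "\<dots> \<le> ennreal K" by (rule mean[OF l(3)])
          finally show ?thesis .
        qed (simp add: emeasure_notin_sets)
        have "of_nat j * ennreal (1 / 2) * (ennreal ?q * emeasure M ?H) \<le> ennreal K"
          by (rule order_trans[OF mult_left_mono[OF le1] le2]) simp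
        moreover have "ennreal (real j * (1 / 2) * (?q * (1 / 2))) \<le> of_nat j * ennreal (1 / 2) * (ennreal ?q * emeasure M ?H)"
        proof -
          have "ennreal (1 / 2) \<le> emeasure M ?H" using half unfolding emeasure_eq_measure by (rule ennreal_leI)
          moreover have "ennreal (real j * (1 / 2) * (?q * (1 / 2))) = of_nat j * ennreal (1 / 2) * (ennreal ?q * ennreal (1 / 2))"
          proof -
            have "ennreal (real j * (1 / 2) * (?q * (1 / 2))) = ennreal (real j * (1 / 2)) * ennreal (?q * (1 / 2))"
              by (rule ennreal_mult) (use q in \<open>simp_all add: less_imp_le\<close>)
            also have "ennreal (real j * (1 / 2)) = ennreal (real j) * ennreal (1 / 2)" by (rule ennreal_mult) simp_all
            also have "ennreal (?q * (1 / 2)) = ennreal ?q * ennreal (1 / 2)"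
              by (rule ennreal_mult) (use q in \<open>simp_all add: less_imp_le\<close>)
            finally show ?thesis by (simp only: ennreal_of_nat_eq_real_of_nat)
          qed
          ultimately show ?thesis by (simp only:) (intro mult_left_mono; simp)
        qed
        ultimately have "ennreal (real j * (1 / 2) * (?q * (1 / 2))) \<le> ennreal K" by (rule order_trans[rotated])
        then have "real j * (1 / 2) * (?q * (1 / 2)) \<le> K" using KL by (simp add: ennreal_le_iff)
        then show False using KL j by (simp add: field_simps)
      qed
      then have "D \<in> null_sets (lborels {..<k})" using D by (intro null_setsI) (simp_all add: sets_lborels)
      then have AE': "AE z in lborels {..<k}. z \<notin> D" by (rule AE_not_in)
      have ins: "{..<k} = insert 0 ?J" using k by auto
      have AE: "AE z in lborels (insert 0 ?J). z \<notin> D" using AE' unfolding ins .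
      \<comment> \<open>Fubini fixes a base point \<open>w\<close>; a translation by
        \<open>w\<close> then turns the statement into one about routes from the origin.\<close>
      have "\<exists>w\<in>ball 0 1. AE y in lborels ?J. y(0 := w) \<notin> D"
      proof (rule AE_lborels_section[OF _ _ AE _ emeasure_unit_ball_pos])
        fix w :: complex assume "w \<in> ball 0 1" "AE y in lborels ?J. y(0 := w) \<notin> D"
        then show ?thesis by blast
      qed simp_all
      then obtain w where w: "w \<in> ball 0 1" "AE y in lborels ?J. y(0 := w) \<notin> D" by blast
      have "AE y in lborels ?J. (\<lambda>j\<in>?J. 1 *\<^sub>R y j + w)(0 := w) \<notin> D"
        by (rule AE_lborels_affine[OF _ _ w(2)]) auto
      then show ?thesis
        using AE_space
      proof (eventually_elim, intro impI)
        fix y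
        assume y: "(\<lambda>j\<in>?J. 1 *\<^sub>R y j + w)(0 := w) \<notin> D" "\<forall>b\<in>?J. 3 < norm (y b)" "place k ?J y \<in> space (positions k)"
        let ?y = "(\<lambda>j\<in>?J. 1 *\<^sub>R y j + w)(0 := w)"
        have pl: "place k {..<k} ?y = (\<lambda>i\<in>{..<k}. 1 *\<^sub>R place k ?J y i + w)"
          unfolding place_def by (intro restrict_ext) auto
        have "place k {..<k} ?y \<in> space (positions k)" unfolding pl by (rule positions_affine[OF y(3)]) simp
        moreover have "?y \<in> space ?P" using ins by (auto simp: space_PiM PiE_def extensional_def)
        moreover have "norm (?y 0) < 1" "\<forall>b\<in>?J. 3 < norm (?y b - ?y 0)" using w(1) y(2) by auto
        ultimately have le: "emeasure (\<mu> k (place k {..<k} ?y)) (many k 1 j) \<le> ennreal ?q"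
          using y(1) unfolding D_def by (auto simp: not_less)
        have "emeasure (\<mu> k (\<lambda>i\<in>{..<k}. 1 *\<^sub>R place k ?J y i + w)) (many k (1 * 1) j) = emeasure (\<mu> k (place k ?J y)) (many k 1 j)"
        proof (rule many_affine[OF y(3)])
          fix b assume b: "b \<in> ?J"
          then have "place k ?J y b = y b" "place k ?J y 0 = 0" by (auto simp: place_def)
          then show "1 < norm (place k ?J y b - place k ?J y 0)" using y(2) b by force
        qed auto
        then show "emeasure (\<mu> k (place k ?J y)) (many k 1 j) \<le> ennreal ?q" using le unfolding pl by simp
      qed
    qed
  qed
  then show ?thesis using KL(1) by blast
qed

section \<open>Exit points of routes to Poisson points, and the passage back to the laws\<close>

text \<open>\<open>S\<close> ranges over points with any arrival times, so a bound for this event is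
  uniform in the intensity. Finite sets \<open>S\<close> keep it a countable union of events about
  finite networks.\<close>

definition fan :: "nat \<Rightarrow> real \<Rightarrow> real \<Rightarrow> 'w set" where
  "fan j r B = {\<omega> \<in> space M. \<exists>S. finite S \<and> (\<forall>n\<in>S. B < norm (fst (Z \<omega> n))) \<and>
     j \<le> card ((\<lambda>n. exit_point r (arm \<omega> n)) ` S)}"

lemma route_measurable: "(\<lambda>\<omega>. arm \<omega> n) \<in> M \<rightarrow>\<^sub>M route_space"
proof -
  have "net 2 {1} (\<lambda>_. n) \<in> M \<rightarrow>\<^sub>M network_space 2" by (rule net_measurable) auto
  then have "(\<lambda>\<omega>. net 2 {1} (\<lambda>_. n) \<omega> (0, 1)) \<in> M \<rightarrow>\<^sub>M route_space"
    by (rule measurable_compose[OF _ base_component]) simp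
  then show ?thesis by (simp add: net_apply)
qed

lemma exit_measurable[measurable]: "(\<lambda>\<omega>. exit_point r (arm \<omega> n)) \<in> borel_measurable M"
  by (rule measurable_exit_point[OF route_measurable])

text \<open>An event of the points alone that makes the random set of far points among the first
  \<open>N\<close> equal to a fixed \<open>S\<close>; given it, finite-dimensional laws can be
  applied.\<close>

definition select :: "real \<Rightarrow> nat \<Rightarrow> nat set \<Rightarrow> (nat \<Rightarrow> complex \<times> real) set" where
  "select B N S = {x \<in> space (PiM UNIV (\<lambda>_. space_time)). \<forall>n\<in>{..<N}. n \<in> S \<longleftrightarrow> B < norm (fst (x n))}"

lemma select_measurable: "select B N S \<in> sets (PiM UNIV (\<lambda>_. space_time))"
  unfolding select_def
proof (rule sets.sets_Collect_finite_All)
  fix n :: nat assume "n \<in> {..<N}"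
  have "fst \<in> borel_measurable space_time"
    unfolding space_time_def by (rule measurable_restrict_space1) (simp add: borel_prod[symmetric] measurable_lborel1)
  from measurable_compose[OF measurable_component_singleton[of n UNIV "\<lambda>_. space_time"] this]
  have [measurable]: "(\<lambda>x. fst (x n)) \<in> borel_measurable (PiM UNIV (\<lambda>_. space_time))" by simp
  show "{x \<in> space (PiM UNIV (\<lambda>_. space_time)). n \<in> S \<longleftrightarrow> B < norm (fst (x n))} \<in> sets (PiM UNIV (\<lambda>_. space_time))"
    by measurable
qed simp

lemma Z_select: "\<omega> \<in> space M \<Longrightarrow> S \<subseteq> {..<N} \<Longrightarrow> Z \<omega> \<in> select B N S \<longleftrightarrow> S = {n\<in>{..<N}. B < norm (fst (Z \<omega> n))}"
  using measurable_space[OF Z_measurable, of \<omega>] unfolding select_def by auto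

lemma fan_eq_Union:
  "fan j r B = (\<Union>N. \<Union>S\<in>Pow {..<N}. {\<omega> \<in> space M. Z \<omega> \<in> select B N S \<and>
     j \<le> card ((\<lambda>n. exit_point r (arm \<omega> n)) ` S)})" (is "_ = (\<Union>N. ?F N)")
proof (intro subset_antisym subsetI)
  fix \<omega> assume "\<omega> \<in> fan j r B"
  then obtain S where \<omega>: "\<omega> \<in> space M" and S: "finite S" "\<forall>n\<in>S. B < norm (fst (Z \<omega> n))"
     "j \<le> card ((\<lambda>n. exit_point r (arm \<omega> n)) ` S)" by (auto simp: fan_def)
  obtain N where N: "S \<subseteq> {..<N}" using finite_nat_bounded[OF S(1)] by blast
  let ?S = "{n\<in>{..<N}. B < norm (fst (Z \<omega> n))}"
  have "card ((\<lambda>n. exit_point r (arm \<omega> n)) ` S) \<le> card ((\<lambda>n. exit_point r (arm \<omega> n)) ` ?S)"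
    using N S(2) by (intro card_mono image_mono) auto
  moreover have "Z \<omega> \<in> select B N ?S" by (subst Z_select[OF \<omega>]) auto
  ultimately have "\<omega> \<in> ?F N" using \<omega> S(3) by (intro UN_I[of ?S]) auto
  then show "\<omega> \<in> (\<Union>N. ?F N)" by blast
next
  fix \<omega> assume "\<omega> \<in> (\<Union>N. ?F N)"
  then obtain N S where S: "S \<subseteq> {..<N}" "\<omega> \<in> space M" "Z \<omega> \<in> select B N S"
     "j \<le> card ((\<lambda>n. exit_point r (arm \<omega> n)) ` S)" by auto
  then have "\<forall>n\<in>S. B < norm (fst (Z \<omega> n))" "finite S"
    unfolding Z_select[OF S(2,1)] using finite_subset by auto
  then show "\<omega> \<in> fan j r B" using S by (auto simp: fan_def)
qed

lemma fan_part_measurable: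
  assumes "finite S"
  shows "{\<omega> \<in> space M. Z \<omega> \<in> select B N S \<and> j \<le> card ((\<lambda>n. exit_point r (arm \<omega> n)) ` S)} \<in> sets M"
proof -
  have "{\<omega> \<in> space M. j \<le> card ((\<lambda>n. exit_point r (arm \<omega> n)) ` S)} \<in> sets M"
    by (rule card_image_ge_measurable[OF assms]) (rule exit_measurable)
  then have "{\<omega> \<in> space M. j \<le> card ((\<lambda>n. exit_point r (arm \<omega> n)) ` S)} \<inter> (Z -` select B N S \<inter> space M) \<in> sets M"
    using measurable_sets[OF Z_measurable select_measurable] by (rule sets.Int)
  also have "{\<omega> \<in> space M. j \<le> card ((\<lambda>n. exit_point r (arm \<omega> n)) ` S)} \<inter> (Z -` select B N S \<inter> space M) =
     {\<omega> \<in> space M. Z \<omega> \<in> select B N S \<and> j \<le> card ((\<lambda>n. exit_point r (arm \<omega> n)) ` S)}" by auto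
  finally show ?thesis .
qed

lemma fan_measurable: "fan j r B \<in> sets M"
  unfolding fan_eq_Union
proof (intro sets.countable_nat_UN image_subsetI sets.finite_UN)
  fix N :: nat and S assume "S \<in> Pow {..<N}"
  then have "finite S" using finite_subset by blast
  then show "{\<omega> \<in> space M. Z \<omega> \<in> select B N S \<and> j \<le> card ((\<lambda>n. exit_point r (arm \<omega> n)) ` S)} \<in> events"
    by (rule fan_part_measurable)
qed simp

text \<open>For fixed \<open>N\<close> the event is split according to the set \<open>S\<close> of
  far points among the first \<open>N\<close>. Each part is bounded by \<open>q\<close> times the
  probability of its \<open>S\<close>, these probabilities sum to at most 1, and the events increase
  with \<open>N\<close>. Splitting by \<open>S\<close>, in place of a union bound over tuples, is
  what preserves the constant \<open>q\<close>.\<close>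

lemma fan_bound:
  assumes ess: "ess j r B q"
  shows "emeasure M (fan j r B) \<le> q"
proof -
  let ?e = "\<lambda>\<omega> n. exit_point r (arm \<omega> n)"
  define E where "E N S = {\<omega> \<in> space M. Z \<omega> \<in> select B N S \<and> j \<le> card (?e \<omega> ` S)}" for N S
  define F where "F N S = {\<omega> \<in> space M. Z \<omega> \<in> select B N S}" for N S
  have Em: "E N S \<in> sets M" if "S \<subseteq> {..<N}" for N S
    unfolding E_def by (rule fan_part_measurable) (rule finite_subset[OF that], simp)
  have Fm: "F N S \<in> sets M" for N S
    using measurable_sets[OF Z_measurable select_measurable[of B N S]] by (simp add: F_def vimage_def Int_def conj_commute)
  have fan: "fan j r B = (\<Union>N. \<Union>S\<in>Pow {..<N}. E N S)" unfolding fan_eq_Union E_def ..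
  have part: "emeasure M (E N S) \<le> q * emeasure M (F N S)" if S: "S \<subseteq> {..<N}" for N S
  proof -
    have finS: "finite S" using S finite_subset by blast
    \<comment> \<open>Index 0 is reserved for the origin.\<close>
    define k where "k = Suc (card S)"
    let ?J = "{1..<k}"
    obtain i where "bij_betw i {1..card S} S" using ex_bij_betw_nat_finite_1[OF finS] by blast
    then have i: "bij_betw i ?J S" unfolding k_def atLeastLessThanSuc_atLeastAtMost .
    then have inj: "inj_on i ?J" and img: "i ` ?J = S" by (auto simp: bij_betw_def)
    have J: "?J \<subseteq> {..<k}" "{..<k} \<subseteq> insert 0 ?J" by auto
    have ess': "AE y in lborels ?J. (\<forall>b\<in>?J. B < norm (y b)) \<longrightarrow>
       place k ?J y \<in> space (positions k) \<longrightarrow> emeasure (\<mu> k (place k ?J y)) (many k r j) \<le> q"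
      using ess unfolding ess_def by blast
    have "emeasure M (E N S) \<le> emeasure M {\<omega>\<in>space M. Z \<omega> \<in> select B N S \<and> net k ?J i \<omega> \<in> many k r j}"
    proof (rule emeasure_mono_AE)
      show "AE \<omega> in M. \<omega> \<in> E N S \<longrightarrow> \<omega> \<in> {\<omega>\<in>space M. Z \<omega> \<in> select B N S \<and> net k ?J i \<omega> \<in> many k r j}"
        using AE_sampled_tree
      proof (eventually_elim, intro impI)
        fix \<omega> assume tree: "sampled_tree (Z \<omega>) (R \<omega>)" and \<omega>: "\<omega> \<in> E N S"
        have "(\<lambda>b. exit_point r (centre (net k ?J i \<omega> (0, b)))) ` ?J = (\<lambda>b. ?e \<omega> (i b)) ` ?J"
          by (intro image_cong refl) (simp only: net_centre[OF tree])
        also have "\<dots> = ?e \<omega> ` S" unfolding img[symmetric] image_image ..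
        finally have eq: "(\<lambda>b. exit_point r (centre (net k ?J i \<omega> (0, b)))) ` ?J = ?e \<omega> ` S" .
        have *: "\<omega> \<in> space M" "Z \<omega> \<in> select B N S" "j \<le> card (?e \<omega> ` S)" using \<omega> unfolding E_def by blast+
        have "net k ?J i \<omega> \<in> many k r j"
          unfolding many_def mem_Collect_eq eq
          by (intro conjI *(3) measurable_space[OF net_measurable[OF J inj] *(1)])
        then show "\<omega> \<in> {\<omega>\<in>space M. Z \<omega> \<in> select B N S \<and> net k ?J i \<omega> \<in> many k r j}" using * by blast
      qed
      have "{\<omega>\<in>space M. Z \<omega> \<in> select B N S \<and> net k ?J i \<omega> \<in> many k r j} = F N S \<inter> (net k ?J i -` many k r j \<inter> space M)"
        by (auto simp: F_def)
      then show "{\<omega>\<in>space M. Z \<omega> \<in> select B N S \<and> net k ?J i \<omega> \<in> many k r j} \<in> sets M"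
        using Fm measurable_sets[OF net_measurable[OF J inj] many_measurable] by simp
    qed
    also have "\<dots> \<le> q * emeasure M {\<omega>\<in>space M. Z \<omega> \<in> select B N S}"
    proof (rule abs_law[OF J inj many_measurable select_measurable ess'])
      fix \<omega> assume \<omega>: "\<omega> \<in> space M" "Z \<omega> \<in> select B N S"
      have "S = {n\<in>{..<N}. B < norm (fst (Z \<omega> n))}" using Z_select[OF \<omega>(1) S] \<omega>(2) by blast
      then have "\<forall>n\<in>S. B < norm (fst (Z \<omega> n))" by blast
      then show "\<forall>b\<in>?J. B < norm ((\<lambda>j\<in>?J. fst (Z \<omega> (i j))) b)" using img by auto
    qed
    finally show ?thesis by (simp add: F_def)
  qed
  have upto: "emeasure M (\<Union>S\<in>Pow {..<N}. E N S) \<le> q" for N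
  proof -
    have "emeasure M (\<Union>S\<in>Pow {..<N}. E N S) \<le> (\<Sum>S\<in>Pow {..<N}. emeasure M (E N S))"
      using Em by (intro emeasure_subadditive_finite) auto
    also have "\<dots> \<le> (\<Sum>S\<in>Pow {..<N}. q * emeasure M (F N S))" using part by (intro sum_mono) auto
    also have "\<dots> = q * (\<Sum>S\<in>Pow {..<N}. emeasure M (F N S))" by (rule sum_distrib_left[symmetric])
    also have "(\<Sum>S\<in>Pow {..<N}. emeasure M (F N S)) = emeasure M (\<Union>S\<in>Pow {..<N}. F N S)"
    proof (rule sum_emeasure)
      show "disjoint_family_on (F N) (Pow {..<N})"
        unfolding disjoint_family_on_def
      proof (intro ballI impI, rule ccontr)
        fix S S' assume SS: "S \<in> Pow {..<N}" "S' \<in> Pow {..<N}" "S \<noteq> S'" "F N S \<inter> F N S' \<noteq> {}"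
        then obtain \<omega> where \<omega>: "\<omega> \<in> space M" "Z \<omega> \<in> select B N S" "Z \<omega> \<in> select B N S'" unfolding F_def by blast
        have "S = S'"
          using Z_select[OF \<omega>(1), of S N B] Z_select[OF \<omega>(1), of S' N B] \<omega>(2,3) SS(1,2) by simp
        then show False using SS(3) by simp
      qed
    qed (use Fm in auto)
    also have "q * \<dots> \<le> q * 1" by (intro mult_left_mono emeasure_le_1) simp
    finally show ?thesis by simp
  qed
  have "incseq (\<lambda>N. \<Union>S\<in>Pow {..<N}. E N S)"
  proof (rule monoI, rule subsetI)
    fix N N' :: nat and \<omega> assume N: "N \<le> N'" and "\<omega> \<in> (\<Union>S\<in>Pow {..<N}. E N S)"
    then obtain S where S: "S \<subseteq> {..<N}" "\<omega> \<in> space M" "Z \<omega> \<in> select B N S" "j \<le> card (?e \<omega> ` S)"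
      unfolding E_def by blast
    let ?S = "{n\<in>{..<N'}. B < norm (fst (Z \<omega> n))}"
    have "S \<subseteq> ?S" using S N unfolding Z_select[OF S(2,1)] by auto
    then have "card (?e \<omega> ` S) \<le> card (?e \<omega> ` ?S)" by (intro card_mono image_mono) auto
    moreover have "Z \<omega> \<in> select B N' ?S" by (subst Z_select[OF S(2)]) auto
    ultimately have "\<omega> \<in> E N' ?S" using S by (simp add: E_def)
    then show "\<omega> \<in> (\<Union>S\<in>Pow {..<N'}. E N' S)" by (intro UN_I[of ?S]) auto
  qed
  then have "(SUP N. emeasure M (\<Union>S\<in>Pow {..<N}. E N S)) = emeasure M (fan j r B)"
    unfolding fan
  proof (intro SUP_emeasure_incseq image_subsetI sets.finite_UN)
    show "E N S \<in> events" if "S \<in> Pow {..<N}" for N S using Em that by blast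
  qed simp_all
  moreover have "(SUP N. emeasure M (\<Union>S\<in>Pow {..<N}. E N S)) \<le> q" by (rule SUP_least) (rule upto)
  ultimately show ?thesis by simp
qed

text \<open>A set of configurations with probability above \<open>3 * q\<close> would, if not null,
  be hit with probability at least 1/2, giving \<open>fan\<close> probability at least
  \<open>3 * q / 2\<close>. Any factor above 2 would do.\<close>

lemma ess_of_fan:
  assumes fan: "emeasure M (fan j r B) \<le> ennreal q" and q: "0 < q"
  shows "ess j r B (ennreal (3 * q))"
  unfolding ess_def
proof
  fix k :: nat
  let ?J = "{1..<k}"
  let ?P = "PiM ?J (\<lambda>_. borel :: complex measure)"
  define D where "D = {y \<in> space ?P. (place k ?J y \<in> space (positions k) \<and>
       ennreal (3 * q) < emeasure (\<mu> k (place k ?J y)) (many k r j))} \<inter> {y \<in> space ?P. \<forall>b\<in>?J. B < norm (y b)}"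
  have D: "D \<in> sets ?P"
    unfolding D_def
  proof (intro sets.Int)
    show "{y \<in> space ?P. place k ?J y \<in> space (positions k) \<and>
       ennreal (3 * q) < emeasure (\<mu> k (place k ?J y)) (many k r j)} \<in> sets ?P"
      by (rule \<mu>_level_set[OF many_measurable]) measurable
    show "{y \<in> space ?P. \<forall>b\<in>?J. B < norm (y b)} \<in> sets ?P"
    proof (rule sets.sets_Collect_finite_All)
      fix b assume "b \<in> ?J"
      then have [measurable]: "(\<lambda>y. y b) \<in> borel_measurable ?P" by (intro measurable_component_singleton)
      show "{y \<in> space ?P. B < norm (y b)} \<in> sets ?P" by measurable
    qed simp
  qed
  have J: "?J \<subseteq> {..<k}" "{..<k} \<subseteq> insert 0 ?J" by auto
  have "emeasure (lborels ?J) D = 0"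
  proof (rule ccontr)
    assume "emeasure (lborels ?J) D \<noteq> 0"
    then obtain m0 where m0: "0 < m0" "\<And>l c. 0 < l \<Longrightarrow> 0 < c \<Longrightarrow> m0 \<le> l * c\<^sup>2 \<Longrightarrow>
        1 / 2 \<le> prob (hit ?J D l c)"
      using hit_half[OF finite_atLeastLessThan D] by blast
    let ?H = "hit ?J D m0 1"
    let ?E = "{\<omega> \<in> space M. \<exists>i \<in> ?J \<rightarrow>\<^sub>E UNIV. hit_tuple ?J D m0 1 (Z \<omega>) i \<and> net k ?J i \<omega> \<in> many k r j}"
    have "1 / 2 \<le> prob ?H" using m0(2)[of m0 1] m0(1) by simp
    then have "ennreal (1 / 2) \<le> emeasure M ?H" unfolding emeasure_eq_measure by (rule ennreal_leI)
    then have "ennreal (3 * q) * ennreal (1 / 2) \<le> ennreal (3 * q) * emeasure M ?H" by (intro mult_left_mono) simp_all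
    also have "\<dots> \<le> emeasure M ?E"
    proof (rule hit_law[OF J many_measurable D])
      fix y assume y: "y \<in> D" "place k ?J (\<lambda>j\<in>?J. 1 *\<^sub>R y j) \<in> space (positions k)"
      have "place k ?J (\<lambda>j\<in>?J. 1 *\<^sub>R y j) = place k ?J y"
        unfolding place_def by (intro restrict_ext) simp
      then show "ennreal (3 * q) \<le> emeasure (\<mu> k (place k ?J (\<lambda>j\<in>?J. 1 *\<^sub>R y j))) (many k r j)"
        using y(1) by (auto simp: D_def intro: less_imp_le)
    qed simp
    also have "\<dots> \<le> emeasure M (fan j r B)"
    proof (rule emeasure_mono_AE[OF _ fan_measurable])
      show "AE \<omega> in M. \<omega> \<in> ?E \<longrightarrow> \<omega> \<in> fan j r B"
        using AE_sampled_tree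
      proof (eventually_elim, intro impI)
        fix \<omega> assume tree: "sampled_tree (Z \<omega>) (R \<omega>)" and "\<omega> \<in> ?E"
        then obtain i where i: "\<omega> \<in> space M" "hit_tuple ?J D m0 1 (Z \<omega>) i" "net k ?J i \<omega> \<in> many k r j" by blast
        have "(\<lambda>j\<in>?J. (1 / 1) *\<^sub>R fst (Z \<omega> (i j))) \<in> D" using i(2) by (simp add: hit_tuple_def)
        then have far: "\<forall>n\<in>i ` ?J. B < norm (fst (Z \<omega> n))" by (auto simp: D_def)
        have "(\<lambda>b. exit_point r (centre (net k ?J i \<omega> (0, b)))) ` ?J = (\<lambda>b. exit_point r (arm \<omega> (i b))) ` ?J"
          by (intro image_cong refl) (simp only: net_centre[OF tree])
        also have "\<dots> = (\<lambda>n. exit_point r (arm \<omega> n)) ` i ` ?J" unfolding image_image ..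
        finally have "j \<le> card ((\<lambda>n. exit_point r (arm \<omega> n)) ` i ` ?J)"
          using i(3) unfolding many_def by simp
        then show "\<omega> \<in> fan j r B" unfolding fan_def using i(1) far by blast
      qed
    qed
    also have "\<dots> \<le> ennreal q" by (rule fan)
    finally have "ennreal (3 * q * (1 / 2)) \<le> ennreal q" using q by (simp only: ennreal_mult)
    then show False using q by (simp add: ennreal_le_iff)
  qed
  then have "D \<in> null_sets (lborels ?J)" using D by (intro null_setsI) (simp_all add: sets_lborels)
  then have "AE y in lborels ?J. y \<notin> D" by (rule AE_not_in)
  then show "AE y in lborels ?J. (\<forall>b\<in>?J. B < norm (y b)) \<longrightarrow>
     place k ?J y \<in> space (positions k) \<longrightarrow> emeasure (\<mu> k (place k ?J y)) (many k r j) \<le> ennreal (3 * q)"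
    using AE_space by eventually_elim (auto simp: D_def not_less sets_eq_imp_space_eq[OF sets_lborels])
qed

end

subsection \<open>Routes that separate at the origin\<close>

lemma small_radius:
  fixes e :: real
  assumes "0 < e"
  shows "\<forall>\<^sub>F n in sequentially. 1 / real (Suc n) < e"
proof -
  have "(\<lambda>n. 1 / real (Suc n)) \<longlonglongrightarrow> 0" by (rule LIMSEQ_Suc) (rule lim_1_over_n)
  from order_tendstoD(2)[OF this assms] show ?thesis .
qed

lemma small_radius_le_1: "0 \<le> 1 / real (Suc n)" "1 / real (Suc n) \<le> 1"
  by simp_all

text \<open>Exit points are meaningful only for radii below the distance of both end points, so the
  condition is asked for arbitrarily small radii. A sequence of radii keeps it a countable
  condition.\<close>

definition separate :: "(real \<Rightarrow> complex) \<Rightarrow> (real \<Rightarrow> complex) \<Rightarrow> bool" where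
  "separate \<gamma> \<eta> \<longleftrightarrow> (\<forall>N::nat. \<exists>n\<ge>N. exit_point (1 / real (Suc n)) \<gamma> \<noteq> exit_point (1 / real (Suc n)) \<eta>)"

lemma not_separate_iff:
  "\<not> separate \<gamma> \<eta> \<longleftrightarrow> (\<forall>\<^sub>F n in sequentially. exit_point (1 / real (Suc n)) \<gamma> = exit_point (1 / real (Suc n)) \<eta>)"
  unfolding separate_def eventually_sequentially by blast

lemma separate_measurable:
  assumes [measurable]: "\<And>r. (\<lambda>x. exit_point r (f x)) \<in> borel_measurable N" "\<And>r. (\<lambda>x. exit_point r (g x)) \<in> borel_measurable N"
  shows "Measurable.pred N (\<lambda>x. separate (f x) (g x))"
  unfolding separate_def by measurable

text \<open>A common point forces equal exit points from all discs not containing it; conversely, an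
  equal exit point at a radius below both end points is a common point other than the
  origin.\<close>

lemma separate_iff:
  assumes \<Gamma>: "route_tree \<Gamma>" "\<gamma> \<in> \<Gamma>" "\<eta> \<in> \<Gamma>" and ends: "\<gamma> 1 \<noteq> 0" "\<eta> 1 \<noteq> 0"
  shows "separate \<gamma> \<eta> \<longleftrightarrow> \<not> (\<exists>w. w \<noteq> 0 \<and> w \<in> path_image \<gamma> \<and> w \<in> path_image \<eta>)"
proof -
  have "\<not> separate \<gamma> \<eta>" if w: "w \<noteq> 0" "w \<in> path_image \<gamma>" "w \<in> path_image \<eta>" for w
  proof -
    from w(2) obtain s where s: "s \<in> {0..1}" "w = \<gamma> s" unfolding path_image_def by (rule imageE)
    from w(3) obtain t where t: "t \<in> {0..1}" "w = \<eta> t" unfolding path_image_def by (rule imageE)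
    have meet: "\<gamma> s = \<eta> t" using s(2) t(2) by (rule subst)
    have "0 < norm (\<gamma> s)" using w(1) unfolding s(2) by simp
    from small_radius[OF this] show ?thesis unfolding not_separate_iff
      by eventually_elim (rule exit_point_eq_if_meet[OF \<Gamma> s(1) t(1) meet small_radius_le_1(1)])
  qed
  moreover have "\<exists>w. w \<noteq> 0 \<and> w \<in> path_image \<gamma> \<and> w \<in> path_image \<eta>" if "\<not> separate \<gamma> \<eta>"
  proof -
    have "\<forall>\<^sub>F n in sequentially. exit_point (1 / real (Suc n)) \<gamma> = exit_point (1 / real (Suc n)) \<eta> \<and>
       1 / real (Suc n) < norm (\<gamma> 1) \<and> 1 / real (Suc n) < norm (\<eta> 1)"
      using that ends unfolding not_separate_iff by (intro eventually_conj small_radius) auto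
    from eventually_happens'[OF sequentially_bot this] obtain n where
      n: "exit_point (1 / real (Suc n)) \<gamma> = exit_point (1 / real (Suc n)) \<eta>"
        "1 / real (Suc n) < norm (\<gamma> 1)" "1 / real (Suc n) < norm (\<eta> 1)" by blast
    let ?r = "1 / real (Suc n)"
    note \<gamma> = route_treeD[OF \<Gamma>(1,2)] and \<eta> = route_treeD[OF \<Gamma>(1,3)]
    have "norm (exit_point ?r \<gamma>) = ?r"
      by (rule exit_time_props(4)[OF \<gamma>(3) _ _ n(2)]) (simp_all only: \<gamma>(2) norm_zero small_radius_le_1 atLeastAtMost_iff zero_le_one order_refl simp_thms)
    moreover have "exit_point ?r \<gamma> \<in> path_image \<gamma>" by (rule exit_point_in_image[OF \<gamma>(3) _ n(2)]) (simp only: \<gamma>(2) norm_zero small_radius_le_1)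
    moreover have "exit_point ?r \<eta> \<in> path_image \<eta>" by (rule exit_point_in_image[OF \<eta>(3) _ n(3)]) (simp only: \<eta>(2) norm_zero small_radius_le_1)
    ultimately show ?thesis using n(1) by (intro exI[of _ "exit_point ?r \<gamma>"] conjI) auto
  qed
  ultimately show ?thesis by blast
qed

lemma \<Xi>_image: "\<Xi> x l = (\<lambda>n. fst (x n)) ` {n. snd (x n) \<le> l}"
  by (auto simp: \<Xi>_def)

context sampled_tree
begin

lemma br_neq_0:
  assumes "I \<noteq> {}"
  shows "subroute_end (\<Inter>\<gamma>\<in>br ` I. path_image \<gamma>) \<noteq> 0 \<longleftrightarrow> (\<exists>w. w \<noteq> 0 \<and> (\<forall>n\<in>I. w \<in> path_image (br n)))"
proof -
  have "route_tree (br ` I)" using tree by (rule route_tree_mono) auto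
  from subroute_end_Inter_neq_0_iff[OF this] show ?thesis using assms by simp
qed

lemma common_point_not_separate:
  assumes "w \<noteq> 0" "w \<in> path_image (br n)" "w \<in> path_image (br m)" "pos n \<noteq> 0" "pos m \<noteq> 0"
  shows "\<not> separate (br n) (br m)"
proof -
  have "separate (br n) (br m) \<longleftrightarrow> \<not> (\<exists>w. w \<noteq> 0 \<and> w \<in> path_image (br n) \<and> w \<in> path_image (br m))"
    by (rule separate_iff[OF tree rangeI rangeI]) (simp_all only: ends assms(4,5) not_False_eq_True)
  then show ?thesis using assms(1-3) by blast
qed

lemma exit_smaller:
  assumes "exit n r = exit m r" "0 \<le> r'" "r' \<le> r" "r < norm (pos n)" "r < norm (pos m)"
  shows "exit n r' = exit m r'"
proof -
  have nm: "br n \<in> range (\<lambda>n. br n)" "br m \<in> range (\<lambda>n. br n)" by (rule rangeI)+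
  have "r < norm (br n 1)" "r < norm (br m 1)" using assms(4,5) by (simp_all only: ends)
  then show ?thesis by (rule exit_point_eq_smaller[OF tree nm assms(1-3)])
qed

lemma common_exit_not_separate:
  assumes "exit n 1 = exit m 1" "1 < norm (pos n)" "1 < norm (pos m)"
  shows "\<not> separate (br n) (br m)"
  unfolding separate_def
proof -
  have "exit n (1 / real (Suc k)) = exit m (1 / real (Suc k))" for k
    by (rule exit_smaller[OF assms(1) small_radius_le_1 assms(2,3)])
  then show "\<not> (\<forall>N::nat. \<exists>k\<ge>N. exit n (1 / real (Suc k)) \<noteq> exit m (1 / real (Suc k)))" by blast
qed

lemma common_exit_imp_common_point:
  assumes r: "0 < r" "\<And>n. n \<in> I \<Longrightarrow> r < norm (pos n)" and eq: "\<And>n m. n \<in> I \<Longrightarrow> m \<in> I \<Longrightarrow> exit n r = exit m r"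
    and I: "I \<noteq> {}"
  shows "\<exists>w. w \<noteq> 0 \<and> (\<forall>n\<in>I. w \<in> path_image (br n))"
proof -
  obtain m where m: "m \<in> I" using I by blast
  have r0: "0 \<le> r" using r(1) by simp
  have "norm (exit m r) = r" using br_exit(4)[OF r0 r(2)[OF m]] .
  then have "exit m r \<noteq> 0" using r(1) by auto
  moreover have "exit m r \<in> path_image (br n)" if n: "n \<in> I" for n
  proof -
    have "norm (br n 0) \<le> r" "r < norm (br n 1)" using r0 r(2)[OF n] by (simp_all only: br(2) ends norm_zero)
    then have "exit n r \<in> path_image (br n)" by (rule exit_point_in_image[OF br(3)])
    then show ?thesis using eq[OF n m] by simp
  qed
  ultimately show ?thesis by blast
qed

text \<open>Pairwise agreement near the origin becomes simultaneous agreement by reduction to a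
  finite set. Among points outside the unit disc, one representative per exit point from the disc of
  radius 1/3 is enough, as equal exits persist at smaller radii; early points inside the unit disc
  are finitely many. The radius 1/3 is the one for which finiteness is available beyond radius
  1.\<close>

lemma common_small_exit:
  assumes nonzero: "\<And>n. pos n \<noteq> 0" and nosep: "\<And>n m. \<not> separate (br n) (br m)"
    and fin: "finite ((\<lambda>n. exit n (1 / 3)) ` {n. 1 < norm (pos n)})"
  defines "W \<equiv> {n. snd (x n) \<le> 1 \<or> 1 < norm (pos n)}"
  shows "\<forall>\<^sub>F k in sequentially. \<forall>n\<in>W. 1 / real (Suc k) < norm (pos n) \<and>
     (\<forall>m\<in>W. exit n (1 / real (Suc k)) = exit m (1 / real (Suc k)))"
proof -
  let ?e = "\<lambda>n. exit n (1 / 3)"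
  let ?A = "{n. snd (x n) \<le> 1 \<and> norm (pos n) \<le> 1}"
  obtain S where S: "S \<subseteq> {n. 1 < norm (pos n)}" "finite S" "?e ` {n. 1 < norm (pos n)} = ?e ` S"
    using finite_subset_image[OF fin order_refl] by blast
  define T where "T = S \<union> ?A"
  have T: "finite T" using S(2) locally_finite[of 1 1] by (simp add: T_def)
  have "\<forall>\<^sub>F k in sequentially. \<forall>n\<in>T. \<forall>m\<in>T. exit n (1 / real (Suc k)) = exit m (1 / real (Suc k))"
    using nosep unfolding not_separate_iff by (intro eventually_ball_finite T ballI) blast
  moreover have "\<forall>\<^sub>F k in sequentially. \<forall>n\<in>T. 1 / real (Suc k) < norm (pos n)"
    using nonzero by (intro eventually_ball_finite T ballI small_radius) simp
  moreover have "\<forall>\<^sub>F k in sequentially. 1 / real (Suc k) < 1 / 3" by (rule small_radius) simp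
  ultimately show ?thesis
  proof eventually_elim
    case (elim k)
    let ?r = "1 / real (Suc k)"
    have rep: "?r < norm (pos n) \<and> (\<exists>s\<in>T. exit n ?r = exit s ?r)" if n: "n \<in> W" for n
    proof (cases "norm (pos n) \<le> 1")
      case True
      then have "n \<in> T" using n by (simp add: W_def T_def)
      then show ?thesis using elim(2) by blast
    next
      case False
      then have "?e n \<in> ?e ` S" using S(3) by force
      then obtain s where s: "s \<in> S" "?e n = ?e s" by blast
      have "1 / 3 < norm (pos n)" "1 / 3 < norm (pos s)" using False S(1) s(1) by auto
      then have "exit n ?r = exit s ?r"
        by (rule exit_smaller[OF s(2) small_radius_le_1(1) less_imp_le[OF elim(3)]])
      moreover have "s \<in> T" using s(1) by (simp add: T_def)
      moreover have "?r < norm (pos n)" using elim(3) False by linarith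
      ultimately show ?thesis by blast
    qed
    show ?case
    proof (intro ballI conjI)
      fix n m assume nm: "n \<in> W" "m \<in> W"
      show "?r < norm (pos n)" using rep[OF nm(1)] by blast
      obtain s t where "s \<in> T" "exit n ?r = exit s ?r" "t \<in> T" "exit m ?r = exit t ?r"
        using rep[OF nm(1)] rep[OF nm(2)] by blast
      moreover have "exit s ?r = exit t ?r" using elim(1) calculation(1,3) by blast
      ultimately show "exit n ?r = exit m ?r" by simp
    qed
  qed
qed

lemma branchpoint_neq_0_iff:
  "branchpoint (\<rho> 0 ` \<Xi> x 1) \<noteq> 0 \<longleftrightarrow> (\<exists>w. w \<noteq> 0 \<and> (\<forall>n\<in>{n. snd (x n) \<le> 1}. w \<in> path_image (br n)))"
proof -
  have "{n. snd (x n) \<le> 1} \<noteq> {}" using infinite by (metis finite.emptyI)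
  from br_neq_0[OF this] show ?thesis unfolding branchpoint_def \<Xi>_image image_image by simp
qed

lemma branchpoint_disc_neq_0_iff:
  "(\<Xi> x 1 \<inter> cball 0 r \<noteq> {} \<and> branchpoint (\<rho> 0 ` (\<Xi> x 1 \<inter> cball 0 r)) = 0) \<longleftrightarrow>
   {n. snd (x n) \<le> 1 \<and> norm (pos n) \<le> r} \<noteq> {} \<and>
   \<not> (\<exists>w. w \<noteq> 0 \<and> (\<forall>n\<in>{n. snd (x n) \<le> 1 \<and> norm (pos n) \<le> r}. w \<in> path_image (br n)))"
proof -
  let ?I = "{n. snd (x n) \<le> 1 \<and> norm (pos n) \<le> r}"
  have eq: "\<Xi> x 1 \<inter> cball 0 r = (\<lambda>n. pos n) ` ?I" by (auto simp: \<Xi>_def)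
  show ?thesis
  proof (cases "?I = {}")
    case False
    from br_neq_0[OF this] have "branchpoint (\<rho> 0 ` (\<Xi> x 1 \<inter> cball 0 r)) \<noteq> 0 \<longleftrightarrow>
      (\<exists>w. w \<noteq> 0 \<and> (\<forall>n\<in>?I. w \<in> path_image (br n)))" unfolding branchpoint_def eq image_image .
    moreover have "\<Xi> x 1 \<inter> cball 0 r \<noteq> {}" using False unfolding eq by blast
    ultimately show ?thesis using False by blast
  qed (simp add: eq)
qed

text \<open>Every point has arrived at some finite time, so the intersection over all times is one
  over all points outside the unit disc, whatever their arrival time.\<close>

lemma B_infty_neq_0_iff:
  "B_infty x \<rho> \<noteq> 0 \<longleftrightarrow> (\<exists>w. w \<noteq> 0 \<and> (\<forall>n\<in>{n. 1 < norm (pos n)}. w \<in> path_image (br n)))"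
proof -
  let ?I = "{n. 1 < norm (pos n)}"
  have ne: "?I \<noteq> {}"
  proof
    assume "?I = {}"
    then have "{n. snd (x n) \<le> 1} \<subseteq> {n. snd (x n) \<le> 1 \<and> norm (pos n) \<le> 1}" by (auto simp: not_less[symmetric])
    then show False using infinite locally_finite[of 1 1] finite_subset by blast
  qed
  have eq: "(\<Inter>l\<in>{0<..}. \<Inter>\<xi>\<in>\<Xi> x l - cball 0 1. path_image (\<rho> 0 \<xi>)) = (\<Inter>\<gamma>\<in>br ` ?I. path_image \<gamma>)"
  proof (intro subset_antisym subsetI)
    fix w assume w: "w \<in> (\<Inter>l\<in>{0<..}. \<Inter>\<xi>\<in>\<Xi> x l - cball 0 1. path_image (\<rho> 0 \<xi>))"
    show "w \<in> (\<Inter>\<gamma>\<in>br ` ?I. path_image \<gamma>)"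
    proof (clarify)
      fix n assume n: "1 < norm (pos n)"
      have "pos n \<in> \<Xi> x (max 1 (snd (x n))) - cball 0 1" using n by (auto simp: \<Xi>_def)
      moreover have "max 1 (snd (x n)) \<in> {0<..}" by simp
      ultimately show "w \<in> path_image (br n)" using w by blast
    qed
  next
    fix w assume w: "w \<in> (\<Inter>\<gamma>\<in>br ` ?I. path_image \<gamma>)"
    show "w \<in> (\<Inter>l\<in>{0<..}. \<Inter>\<xi>\<in>\<Xi> x l - cball 0 1. path_image (\<rho> 0 \<xi>))"
    proof (intro INT_I)
      fix l \<xi> assume "\<xi> \<in> \<Xi> x l - cball 0 1"
      then obtain n where "\<xi> = pos n" "1 < norm (pos n)" by (auto simp: \<Xi>_def)
      then show "w \<in> path_image (\<rho> 0 \<xi>)" using w by blast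
    qed
  qed
  from br_neq_0[OF ne] show ?thesis unfolding B_infty_def eq .
qed

end

text \<open>Dilation does not preserve the sequence of radii in \<open>separate\<close>. The
  invariance is therefore read off from common points.\<close>

lemma separate_scale:
  fixes c :: real
  assumes tree: "route_tree {\<gamma>, \<eta>}" and ends: "\<gamma> 1 \<noteq> 0" "\<eta> 1 \<noteq> 0" and c: "0 < c"
  shows "separate (\<lambda>t\<in>{0..1}. c *\<^sub>R \<gamma> t + 0) (\<lambda>t\<in>{0..1}. c *\<^sub>R \<eta> t + 0) \<longleftrightarrow> separate \<gamma> \<eta>"
proof -
  let ?f = "\<lambda>z::complex. c *\<^sub>R z + 0"
  let ?m = "\<lambda>\<gamma>. \<lambda>t\<in>{0..1::real}. ?f (\<gamma> t)"
  have f: "inj ?f" using c by (auto simp: inj_def)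
  have zero: "?f z = 0 \<longleftrightarrow> z = 0" for z using c by simp
  have img: "path_image (?m \<zeta>) = ?f ` path_image \<zeta>" for \<zeta>
    unfolding path_image_def image_image by (intro image_cong) auto
  have r: "route \<gamma>" "\<gamma> 0 = 0" "route \<eta>" "\<eta> 0 = 0" using tree by (simp_all add: route_tree_def)
  have tree': "route_tree {?m \<gamma>, ?m \<eta>}"
    unfolding route_tree_def
  proof (intro conjI ballI)
    fix \<zeta> \<xi> assume *: "\<zeta> \<in> {?m \<gamma>, ?m \<eta>}" "\<xi> \<in> {?m \<gamma>, ?m \<eta>}"
    then obtain \<zeta>' \<xi>' where z: "\<zeta>' \<in> {\<gamma>, \<eta>}" "\<zeta> = ?m \<zeta>'" "\<xi>' \<in> {\<gamma>, \<eta>}" "\<xi> = ?m \<xi>'" by blast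
    have \<zeta>': "route \<zeta>'" "\<zeta>' 0 = 0" using z(1) r by auto
    show "route \<zeta>" unfolding z(2) by (rule route_affine[OF \<zeta>'(1) c])
    show "\<zeta> 0 = 0" unfolding z(2) using \<zeta>'(2) by simp
    have "initially_compatible \<zeta>' \<xi>'" using tree z(1,3) unfolding route_tree_def by blast
    then show "initially_compatible \<zeta> \<xi>" unfolding z(2,4) by (rule initially_compatible_map[OF _ f])
  qed
  have "separate (?m \<gamma>) (?m \<eta>) \<longleftrightarrow> \<not> (\<exists>w. w \<noteq> 0 \<and> w \<in> path_image (?m \<gamma>) \<and> w \<in> path_image (?m \<eta>))"
    by (rule separate_iff[OF tree']) (use ends c in simp_all)
  also have "(\<exists>w. w \<noteq> 0 \<and> w \<in> path_image (?m \<gamma>) \<and> w \<in> path_image (?m \<eta>)) \<longleftrightarrow>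
      (\<exists>w. w \<noteq> 0 \<and> w \<in> path_image \<gamma> \<and> w \<in> path_image \<eta>)"
  proof
    assume "\<exists>w. w \<noteq> 0 \<and> w \<in> path_image (?m \<gamma>) \<and> w \<in> path_image (?m \<eta>)"
    then obtain w where w: "w \<noteq> 0" "w \<in> ?f ` path_image \<gamma>" "w \<in> ?f ` path_image \<eta>" unfolding img by blast
    from w(2) obtain u where u: "w = ?f u" "u \<in> path_image \<gamma>" by (rule imageE)
    from w(3) obtain v where v: "w = ?f v" "v \<in> path_image \<eta>" by (rule imageE)
    have "?f u = ?f v" using u(1) v(1) by (rule subst)
    then have uv: "u = v" by (rule injD[OF f])
    have "u \<noteq> 0" using w(1) unfolding u(1) by auto
    then show "\<exists>w. w \<noteq> 0 \<and> w \<in> path_image \<gamma> \<and> w \<in> path_image \<eta>" using u(2) v(2) unfolding uv by blast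
  next
    assume "\<exists>w. w \<noteq> 0 \<and> w \<in> path_image \<gamma> \<and> w \<in> path_image \<eta>"
    then obtain u where u: "u \<noteq> 0" "u \<in> path_image \<gamma>" "u \<in> path_image \<eta>" by blast
    have "?f u \<noteq> 0" using zero[of u] u(1) by blast
    then show "\<exists>w. w \<noteq> 0 \<and> w \<in> path_image (?m \<gamma>) \<and> w \<in> path_image (?m \<eta>)"
      unfolding img using imageI[OF u(2), of ?f] imageI[OF u(3), of ?f] by blast
  qed
  also have "\<not> (\<exists>w. w \<noteq> 0 \<and> w \<in> path_image \<gamma> \<and> w \<in> path_image \<eta>) \<longleftrightarrow> separate \<gamma> \<eta>"
    by (rule separate_iff[OF tree insertI1 insertI2[OF insertI1] ends, symmetric])
  finally show ?thesis .
qed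

lemma (in prob_space) prob_tendsto_0:
  fixes A :: "nat \<Rightarrow> 'a set"
  assumes A: "\<And>n. A n \<in> events" and AE: "AE \<omega> in M. \<forall>\<^sub>F n in sequentially. \<omega> \<notin> A n"
  shows "(\<lambda>n. prob (A n)) \<longlonglongrightarrow> 0"
proof -
  have "(\<lambda>n. LINT \<omega>|M. (indicator (A n) \<omega> :: real)) \<longlonglongrightarrow> (LINT \<omega>|M. 0)"
  proof (rule integral_dominated_convergence[where w = "\<lambda>_. 1"])
    show "AE \<omega> in M. (\<lambda>n. indicator (A n) \<omega> :: real) \<longlonglongrightarrow> 0"
      using AE
    proof eventually_elim
      case (elim \<omega>)
      then have "\<forall>\<^sub>F n in sequentially. (indicator (A n) \<omega> :: real) = 0" by eventually_elim simp
      then show ?case by (rule tendsto_eventually)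
    qed
  qed (use A in \<open>auto simp: indicator_def\<close>)
  moreover have "(LINT \<omega>|M. (indicator (A n) \<omega> :: real)) = prob (A n)" for n
    using A[of n] sets.sets_into_space[OF A[of n]] by (simp add: Int_absorb2)
  ultimately show ?thesis by simp
qed

lemma mono_tendsto_SUP:
  fixes f :: "real \<Rightarrow> real"
  assumes "mono f" "bdd_above (range f)"
  shows "(f \<longlongrightarrow> (SUP x. f x)) at_top"
proof (rule order_tendstoI)
  fix a assume "a < (SUP x. f x)"
  then obtain x where x: "a < f x" using less_cSUP_iff[OF _ assms(2)] by auto
  show "\<forall>\<^sub>F y in at_top. a < f y"
    using eventually_ge_at_top[of x]
  proof eventually_elim
    case (elim y)
    show ?case using monoD[OF assms(1) elim] x by simp
  qed
next
  fix a assume a: "(SUP x. f x) < a"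
  have "f y < a" for y using cSUP_upper[OF _ assms(2), of y] a by simp
  then show "\<forall>\<^sub>F y in at_top. f y < a" by simp
qed

context sirsn_sample
begin

section \<open>The probability that two routes separate at the origin\<close>

definition apart :: "(nat \<times> nat \<Rightarrow> real \<Rightarrow> complex) set" where
  "apart = {s \<in> space (network_space 3). separate (s (0, 1)) (s (0, 2))}"

lemma apart_measurable: "apart \<in> sets (network_space 3)"
proof -
  have m: "1 \<in> {1..<3::nat}" "2 \<in> {1..<3::nat}" by auto
  have "Measurable.pred (network_space 3) (\<lambda>s. separate (s (0, 1)) (s (0, 2)))"
    by (rule separate_measurable; rule measurable_exit_point[OF base_component]) (rule m)+
  then show ?thesis unfolding apart_def by (simp only: pred_def)
qed

lemma feasible_tree:
  assumes "feasible_subnetwork k z s" "z 0 = 0"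
  shows "route_tree ((\<lambda>b. s (0, b)) ` {1..<k})"
  unfolding route_tree_def
proof (intro conjI ballI)
  fix \<gamma> \<eta> assume "\<gamma> \<in> (\<lambda>b. s (0, b)) ` {1..<k}" "\<eta> \<in> (\<lambda>b. s (0, b)) ` {1..<k}"
  then obtain a b where ab: "a \<in> {1..<k}" "\<gamma> = s (0, a)" "b \<in> {1..<k}" "\<eta> = s (0, b)" by blast
  note a = feasible_base[OF assms(1) ab(1)] and b = feasible_base[OF assms(1) ab(3)]
  show "route \<gamma>" "\<gamma> 0 = 0" using a ab(2) assms(2) by simp_all
  have "(0, a) \<in> index_pairs k" "(0, b) \<in> index_pairs k" using ab by (auto simp: index_pairs_def)
  then have "compatible \<gamma> \<eta>" using assms(1) unfolding ab feasible_subnetwork_def by blast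
  then show "initially_compatible \<gamma> \<eta>" by (rule compatible_imp_initially_compatible) (simp add: ab a b)
qed

lemma apart_scale:
  assumes z: "z \<in> space (positions 3)" "z 0 = 0" and c: "0 < c"
  shows "emeasure (\<mu> 3 (\<lambda>i\<in>{..<3}. c *\<^sub>R z i + 0)) apart = emeasure (\<mu> 3 z) apart"
proof -
  let ?A = "\<lambda>s. \<lambda>p\<in>index_pairs 3. \<lambda>t\<in>{0..1}. c *\<^sub>R s p t + 0"
  have A: "?A \<in> network_space 3 \<rightarrow>\<^sub>M network_space 3" by (rule network_affine_measurable[OF c])
  have "emeasure (\<mu> 3 (\<lambda>i\<in>{..<3}. c *\<^sub>R z i + 0)) apart = emeasure (\<mu> 3 z) {s \<in> space (network_space 3). ?A s \<in> apart}"
    by (rule \<mu>_affine[OF z(1) c apart_measurable])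
  also have "\<dots> = emeasure (\<mu> 3 z) apart"
  proof (rule emeasure_eq_AE)
    show "{s \<in> space (network_space 3). ?A s \<in> apart} \<in> sets (\<mu> 3 z)"
      using measurable_sets[OF A apart_measurable] unfolding \<mu>_prob(2)[OF z(1)]
      by (simp add: vimage_def Int_def conj_commute)
    show "apart \<in> sets (\<mu> 3 z)" unfolding \<mu>_prob(2)[OF z(1)] by (rule apart_measurable)
    show "AE s in \<mu> 3 z. s \<in> {s \<in> space (network_space 3). ?A s \<in> apart} \<longleftrightarrow> s \<in> apart"
      using \<mu>_feasible[OF z(1)] AE_space
    proof eventually_elim
      case (elim s)
      have s: "s \<in> space (network_space 3)" using elim(2) \<mu>_prob(3)[OF z(1)] by simp
      have p: "(0, 1) \<in> index_pairs 3" "(0, 2) \<in> index_pairs 3" by (auto simp: index_pairs_def)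
      have tree: "route_tree {s (0, 1), s (0, 2)}"
        by (rule route_tree_mono[OF feasible_tree[OF elim(1) z(2)]]) auto
      have inj: "inj_on z {..<3}" using z(1) by (simp add: space_positions)
      have "z 1 \<noteq> z 0" "z 2 \<noteq> z 0" using inj_onD[OF inj, of 1 0] inj_onD[OF inj, of 2 0] by auto
      then have "s (0, 1) 1 \<noteq> 0" "s (0, 2) 1 \<noteq> 0"
        using feasible_base(3)[OF elim(1), of 1] feasible_base(3)[OF elim(1), of 2] z(2) by simp_all
      from separate_scale[OF tree this c] have "separate (?A s (0, 1)) (?A s (0, 2)) \<longleftrightarrow> separate (s (0, 1)) (s (0, 2))"
        unfolding restrict_apply'[OF p(1)] restrict_apply'[OF p(2)] .
      moreover have "?A s \<in> space (network_space 3)" by (rule measurable_space[OF A s])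
      ultimately show ?case using s by (simp only: apart_def mem_Collect_eq simp_thms)
    qed
  qed
  finally show ?thesis .
qed

lemma net3:
  "net 3 {1..<3} i \<omega> (0, 1) = arm \<omega> (i 1)" "net 3 {1..<3} i \<omega> (0, 2) = arm \<omega> (i 2)"
  by (rule net_apply; auto)+

definition generic_join :: bool where
  "generic_join \<longleftrightarrow> (AE y in lborels {1..<3}. place 3 {1..<3} y \<in> space (positions 3) \<longrightarrow>
     emeasure (\<mu> 3 (place 3 {1..<3} y)) apart = 0)"

text \<open>Only points arriving up to time 1 are considered. Going to far points replaces going to
  high intensities, by the scaling invariance of separation at the origin.\<close>

definition split :: "real \<Rightarrow> 'w set" where
  "split B = {\<omega> \<in> space M. \<exists>n m. snd (Z \<omega> n) \<le> 1 \<and> snd (Z \<omega> m) \<le> 1 \<and> B < norm (fst (Z \<omega> n)) \<and> B < norm (fst (Z \<omega> m)) \<and>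
     separate (arm \<omega> n) (arm \<omega> m)}"

lemma split_measurable: "split B \<in> events"
proof -
  have [measurable]: "Measurable.pred M (\<lambda>\<omega>. separate (arm \<omega> n) (arm \<omega> m))" for n m
    by (rule separate_measurable) (rule exit_measurable)+
  show ?thesis unfolding split_def by measurable
qed

lemma place_scale:
  fixes c :: real
  assumes "place 3 {1..<3} y \<in> space (positions 3)" "0 < c"
  shows "place 3 {1..<3} (\<lambda>j\<in>{1..<3}. c *\<^sub>R y j + 0) \<in> space (positions 3)"
    "emeasure (\<mu> 3 (place 3 {1..<3} (\<lambda>j\<in>{1..<3}. c *\<^sub>R y j + 0))) apart = emeasure (\<mu> 3 (place 3 {1..<3} y)) apart"
proof -
  have eq: "place 3 {1..<3} (\<lambda>j\<in>{1..<3}. c *\<^sub>R y j + 0) = (\<lambda>i\<in>{..<3}. c *\<^sub>R place 3 {1..<3} y i + 0)"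
    unfolding place_def by (intro restrict_ext) simp
  have 0: "place 3 {1..<3} y 0 = 0" by (simp add: place_def)
  show "place 3 {1..<3} (\<lambda>j\<in>{1..<3}. c *\<^sub>R y j + 0) \<in> space (positions 3)"
    "emeasure (\<mu> 3 (place 3 {1..<3} (\<lambda>j\<in>{1..<3}. c *\<^sub>R y j + 0))) apart = emeasure (\<mu> 3 (place 3 {1..<3} y)) apart"
    unfolding eq by (rule positions_affine[OF assms], rule apart_scale[OF assms(1) 0 assms(2)])
qed

text \<open>If separation had probability at least \<open>1 / Suc n\<close> on a non-null set of
  configurations, a suitable multiple of this set would be hit by early points beyond
  \<open>B\<close> with probability at least 1/2, whatever \<open>B\<close> is. This bounds the
  probability of \<open>split B\<close> from below by a constant independent of
  \<open>B\<close>.\<close>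

lemma generic_join_if_split_unlikely:
  assumes split: "\<And>\<delta>. 0 < \<delta> \<Longrightarrow> \<exists>B. prob (split B) \<le> \<delta>"
  shows generic_join
proof -
  let ?J = "{1..<3::nat}"
  let ?P = "PiM ?J (\<lambda>_. borel :: complex measure)"
  \<comment> \<open>The lower bound on the moduli makes large multiples of \<open>D n\<close> avoid
    any given disc.\<close>
  define D where "D n = {y \<in> space ?P. (place 3 ?J y \<in> space (positions 3) \<and>
       ennreal (1 / real (Suc n)) \<le> emeasure (\<mu> 3 (place 3 ?J y)) apart)} \<inter>
     {y \<in> space ?P. \<forall>b\<in>?J. 1 / real (Suc n) < norm (y b)}" for n
  have D: "D n \<in> sets ?P" for n
    unfolding D_def
  proof (intro sets.Int)
    show "{y \<in> space ?P. place 3 ?J y \<in> space (positions 3) \<and>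
       ennreal (1 / real (Suc n)) \<le> emeasure (\<mu> 3 (place 3 ?J y)) apart} \<in> sets ?P"
      by (rule \<mu>_level_set[OF apart_measurable]) measurable
    show "{y \<in> space ?P. \<forall>b\<in>?J. 1 / real (Suc n) < norm (y b)} \<in> sets ?P"
    proof (rule sets.sets_Collect_finite_All)
      fix b assume "b \<in> ?J"
      then have [measurable]: "(\<lambda>y. y b) \<in> borel_measurable ?P" by (intro measurable_component_singleton)
      show "{y \<in> space ?P. 1 / real (Suc n) < norm (y b)} \<in> sets ?P" by measurable
    qed simp
  qed
  have "emeasure (lborels ?J) (D n) = 0" for n
  proof (rule ccontr)
    let ?\<kappa> = "1 / real (Suc n)"
    assume "emeasure (lborels ?J) (D n) \<noteq> 0"
    then obtain m0 where m0: "0 < m0" "\<And>l c. 0 < l \<Longrightarrow> 0 < c \<Longrightarrow> m0 \<le> l * c\<^sup>2 \<Longrightarrow>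
        1 / 2 \<le> prob (hit ?J (D n) l c)"
      using hit_half[OF finite_atLeastLessThan D[of n]] by blast
    obtain B where B: "prob (split B) \<le> ?\<kappa> / 4" using split[of "?\<kappa> / 4"] by auto
    \<comment> \<open>The bounds 1 and \<open>m0\<close> give \<open>m0 \<le> c\<^sup>2\<close>, so
      that the multiple is hit; the third bound pushes it beyond \<open>B\<close>.\<close>
    define c where "c = max 1 (max m0 (\<bar>B\<bar> * real (Suc n)))"
    have c: "1 \<le> c" "m0 \<le> c" "\<bar>B\<bar> * real (Suc n) \<le> c" by (auto simp: c_def)
    have cB: "B \<le> c * ?\<kappa>"
    proof -
      have "B * real (Suc n) \<le> \<bar>B\<bar> * real (Suc n)" by (rule mult_right_mono) simp_all
      then have "B * real (Suc n) \<le> c" using c(3) by linarith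
      then have "B \<le> c / real (Suc n)" by (subst pos_le_divide_eq) simp_all
      then show ?thesis by simp
    qed
    have c0: "0 < c" using c(1) by simp
    have "c * 1 \<le> c * c" using c(1) by (intro mult_left_mono) auto
    then have "m0 \<le> c * c" using c(2) by linarith
    then have mc: "m0 \<le> 1 * c\<^sup>2" by (simp add: power2_eq_square)
    let ?H = "hit ?J (D n) 1 c"
    let ?E = "{\<omega> \<in> space M. \<exists>i \<in> ?J \<rightarrow>\<^sub>E UNIV. hit_tuple ?J (D n) 1 c (Z \<omega>) i \<and> net 3 ?J i \<omega> \<in> apart}"
    have "1 / 2 \<le> prob ?H" by (rule m0(2)[OF zero_less_one c0 mc])
    then have "ennreal (1 / 2) \<le> emeasure M ?H" unfolding emeasure_eq_measure by (rule ennreal_leI)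
    then have "ennreal ?\<kappa> * ennreal (1 / 2) \<le> ennreal ?\<kappa> * emeasure M ?H" by (intro mult_left_mono) simp_all
    also have "\<dots> \<le> emeasure M ?E"
    proof (rule hit_law[OF _ _ apart_measurable D])
      fix y assume y: "y \<in> D n"
      then have "place 3 ?J y \<in> space (positions 3)" unfolding D_def by blast
      from place_scale(2)[OF this c0] have
        eq: "emeasure (\<mu> 3 (place 3 ?J (\<lambda>j\<in>?J. c *\<^sub>R y j))) apart = emeasure (\<mu> 3 (place 3 ?J y)) apart" by simp
      show "ennreal ?\<kappa> \<le> emeasure (\<mu> 3 (place 3 ?J (\<lambda>j\<in>?J. c *\<^sub>R y j))) apart"
        unfolding eq using y unfolding D_def by blast
    qed (use c0 in auto)
    also have "\<dots> \<le> emeasure M (split B)"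
    proof (rule emeasure_mono[OF _ split_measurable], rule subsetI)
      fix \<omega> assume "\<omega> \<in> ?E"
      then obtain i where i: "\<omega> \<in> space M" "hit_tuple ?J (D n) 1 c (Z \<omega>) i" "net 3 ?J i \<omega> \<in> apart" by blast
      have "(\<lambda>j\<in>?J. (1 / c) *\<^sub>R fst (Z \<omega> (i j))) \<in> D n" and times: "\<And>b. b \<in> ?J \<Longrightarrow> snd (Z \<omega> (i b)) \<le> 1"
        using i(2) by (auto simp: hit_tuple_def)
      then have *: "\<forall>b\<in>?J. ?\<kappa> < norm ((\<lambda>j\<in>?J. (1 / c) *\<^sub>R fst (Z \<omega> (i j))) b)" unfolding D_def by blast
      have far: "B < norm (fst (Z \<omega> (i b)))" if b: "b \<in> ?J" for b
      proof -
        have n: "(\<lambda>j\<in>?J. (1 / c) *\<^sub>R fst (Z \<omega> (i j))) b = (1 / c) *\<^sub>R fst (Z \<omega> (i b))" using b by simp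
        have n': "norm ((1 / c) *\<^sub>R fst (Z \<omega> (i b))) = norm (fst (Z \<omega> (i b))) / c" using c0 by simp
        have "?\<kappa> < norm (fst (Z \<omega> (i b))) / c" using bspec[OF * b] unfolding n n' .
        then have "c * ?\<kappa> < norm (fst (Z \<omega> (i b)))" using c by (simp add: pos_less_divide_eq mult.commute)
        then show ?thesis using cB by simp
      qed
      have "separate (net 3 ?J i \<omega> (0, 1)) (net 3 ?J i \<omega> (0, 2))" using i(3) unfolding apart_def by blast
      then have "separate (arm \<omega> (i 1)) (arm \<omega> (i 2))" unfolding net3 .
      moreover have "1 \<in> ?J" "2 \<in> ?J" by auto
      ultimately show "\<omega> \<in> split B" unfolding split_def using i(1) far times by blast
    qed
    also have "\<dots> \<le> ennreal (?\<kappa> / 4)" using B by (simp add: emeasure_eq_measure ennreal_leI)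
    finally have "ennreal (?\<kappa> * (1 / 2)) \<le> ennreal (?\<kappa> / 4)" by (subst ennreal_mult) simp_all
    then have "?\<kappa> * (1 / 2) \<le> ?\<kappa> / 4" by (subst (asm) ennreal_le_iff) simp_all
    moreover have "\<not> x * (1 / 2) \<le> x / 4" if "0 < x" for x :: real using that by linarith
    moreover have "0 < ?\<kappa>" by simp
    ultimately show False by blast
  qed
  then have "D n \<in> null_sets (lborels ?J)" for n using D[of n] by (intro null_setsI) (simp_all add: sets_lborels)
  then have "AE y in lborels ?J. y \<notin> D n" for n by (rule AE_not_in)
  then have "AE y in lborels ?J. \<forall>n. y \<notin> D n" unfolding AE_all_countable by blast
  then show ?thesis
    unfolding generic_join_def using AE_space
  proof (eventually_elim, intro impI)
    fix y assume y: "\<forall>n. y \<notin> D n" "y \<in> space (lborels ?J)" "place 3 ?J y \<in> space (positions 3)"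
    have sp: "y \<in> space ?P" using y(2) sets_eq_imp_space_eq[OF sets_lborels] by blast
    have inj: "inj_on (place 3 ?J y) {..<3}" using y(3) by (simp add: space_positions)
    have nz: "y b \<noteq> 0" if "b \<in> ?J" for b
      using inj_onD[OF inj, of b 0] that by (auto simp: place_def)
    show "emeasure (\<mu> 3 (place 3 ?J y)) apart = 0"
    proof (rule ccontr)
      assume "emeasure (\<mu> 3 (place 3 ?J y)) apart \<noteq> 0"
      moreover have "emeasure (\<mu> 3 (place 3 ?J y)) apart \<le> 1" by (rule \<mu>_le_1[OF y(3)])
      ultimately obtain e where e: "emeasure (\<mu> 3 (place 3 ?J y)) apart = ennreal e" "0 < e"
        by (cases "emeasure (\<mu> 3 (place 3 ?J y)) apart") (auto simp: top_unique less_le)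
      have "\<forall>\<^sub>F n in sequentially. 1 / real (Suc n) < e \<and> (\<forall>b\<in>?J. 1 / real (Suc n) < norm (y b))"
        using nz e(2) by (intro eventually_conj eventually_ball_finite ballI small_radius) auto
      from eventually_happens'[OF sequentially_bot this] obtain n where
        "1 / real (Suc n) < e" "\<forall>b\<in>?J. 1 / real (Suc n) < norm (y b)" by blast
      then have "y \<in> D n" unfolding D_def using sp y(3) e by (auto intro!: ennreal_leI)
      then show False using y(1) by blast
    qed
  qed
qed

lemma AE_not_separate:
  assumes generic_join
  shows "AE \<omega> in M. \<forall>n m. \<not> separate (arm \<omega> n) (arm \<omega> m)"
proof -
  let ?J = "{1..<3::nat}"
  have "AE \<omega> in M. \<not> separate (arm \<omega> n) (arm \<omega> m)" for n m
  proof (cases "n = m")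
    case False
    define i where "i = (\<lambda>j::nat. if j = 1 then n else m)"
    have J: "?J \<subseteq> {..<3}" "{..<3} \<subseteq> insert 0 ?J" by auto
    have inj: "inj_on i ?J" using False by (auto simp: i_def inj_on_def)
    let ?S = "{\<omega>\<in>space M. Z \<omega> \<in> space (PiM UNIV (\<lambda>_. space_time)) \<and> net 3 ?J i \<omega> \<in> apart}"
    have "AE y in lborels ?J. True \<longrightarrow> place 3 ?J y \<in> space (positions 3) \<longrightarrow> emeasure (\<mu> 3 (place 3 ?J y)) apart \<le> 0"
      using assms unfolding generic_join_def by eventually_elim simp
    from abs_law[OF J inj apart_measurable sets.top this TrueI] have "emeasure M ?S = 0" by simp
    moreover have "?S = net 3 ?J i -` apart \<inter> space M" using measurable_space[OF Z_measurable] by auto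
    ultimately have "net 3 ?J i -` apart \<inter> space M \<in> null_sets M"
      using measurable_sets[OF net_measurable[OF J inj] apart_measurable] by (intro null_setsI) simp_all
    then have "AE \<omega> in M. \<omega> \<notin> net 3 ?J i -` apart \<inter> space M" by (rule AE_not_in)
    then show ?thesis using AE_space
    proof eventually_elim
      case (elim \<omega>)
      have "net 3 ?J i \<omega> \<in> space (network_space 3)" by (rule measurable_space[OF net_measurable[OF J inj] elim(2)])
      moreover have "net 3 ?J i \<omega> \<notin> apart" using elim by blast
      ultimately have ns: "\<not> separate (net 3 ?J i \<omega> (0, 1)) (net 3 ?J i \<omega> (0, 2))" unfolding apart_def by blast
      have i12: "i 1 = n" "i 2 = m" by (simp_all add: i_def)
      show ?case using ns unfolding net3 i12 .
    qed
  qed (simp add: separate_def)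
  then show ?thesis unfolding AE_all_countable by blast
qed

lemma fanI:
  assumes "\<omega> \<in> space M" "finite S" "\<And>n. n \<in> S \<Longrightarrow> B < norm (fst (Z \<omega> n))"
    "j \<le> card ((\<lambda>n. exit_point r (arm \<omega> n)) ` S)"
  shows "\<omega> \<in> fan j r B"
  unfolding fan_def by (intro CollectI conjI exI[of _ S] ballI assms)

lemma fanE:
  assumes "\<omega> \<in> fan j r B"
  obtains S where "\<omega> \<in> space M" "finite S" "\<And>n. n \<in> S \<Longrightarrow> B < norm (fst (Z \<omega> n))"
    "j \<le> card ((\<lambda>n. exit_point r (arm \<omega> n)) ` S)"
  using assms unfolding fan_def by (elim CollectE conjE exE) (rule that, auto)

text \<open>The bound from \<open>ess_base\<close>, scaled by \<open>r\<close>, makes the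
  probability of \<open>j\<close> or more exit points at most a constant over \<open>j\<close>, so
  infinitely many occur with probability 0. The 3 is the distance demanded in the base case.\<close>

lemma AE_finite_exits:
  assumes r: "0 < r"
  shows "AE \<omega> in M. finite ((\<lambda>n. exit_point r (arm \<omega> n)) ` {n. 3 * r < norm (fst (Z \<omega> n))})"
proof -
  obtain K :: real where K: "0 < K" "\<And>j. 0 < j \<Longrightarrow> ess j 1 3 (ennreal (5 * K / real j))" using ess_base by blast
  have fan: "prob (fan (Suc j) r (3 * r)) \<le> 5 * K / real (Suc j)" for j
  proof -
    have "ess (Suc j) (r * 1) (r * 3) (ennreal (5 * K / real (Suc j)))"
      by (rule ess_scale[OF K(2) r]) auto
    from fan_bound[OF this] have "emeasure M (fan (Suc j) r (3 * r)) \<le> ennreal (5 * K / real (Suc j))" by (simp add: mult.commute)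
    then show ?thesis using K(1) by (simp add: emeasure_eq_measure ennreal_le_iff)
  qed
  let ?N = "\<Inter>j. fan (Suc j) r (3 * r)"
  have N: "?N \<in> events" using fan_measurable by (intro sets.countable_INT) auto
  have "prob ?N = 0"
  proof (rule ccontr)
    assume "prob ?N \<noteq> 0"
    then have "0 < prob ?N / (5 * K)" using K(1) by (simp add: zero_less_measure_iff)
    from eventually_happens'[OF sequentially_bot small_radius[OF this]] obtain j where "1 / real (Suc j) < prob ?N / (5 * K)" by blast
    then have "5 * K * (1 / real (Suc j)) < 5 * K * (prob ?N / (5 * K))"
      using K(1) by (intro mult_strict_left_mono) auto
    moreover have "5 * K * (1 / real (Suc j)) = 5 * K / real (Suc j)" by simp
    moreover have "5 * K * (prob ?N / (5 * K)) = prob ?N" using K(1) by simp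
    moreover have "prob ?N \<le> prob (fan (Suc j) r (3 * r))" using fan_measurable by (intro finite_measure_mono) auto
    ultimately show False using fan[of j] by linarith
  qed
  then have "?N \<in> null_sets M" using N by (intro null_setsI) (simp_all add: emeasure_eq_measure)
  then have "AE \<omega> in M. \<omega> \<notin> ?N" by (rule AE_not_in)
  then show ?thesis using AE_space
  proof eventually_elim
    case (elim \<omega>)
    let ?e = "\<lambda>n. exit_point r (arm \<omega> n)" and ?X = "{n. 3 * r < norm (fst (Z \<omega> n))}"
    from elim(1) obtain j where j: "\<omega> \<notin> fan (Suc j) r (3 * r)" by blast
    show ?case
    proof (rule ccontr)
      assume "infinite (?e ` ?X)"
      from infinite_arbitrarily_large[OF this, of "Suc j"] obtain T where T: "finite T" "card T = Suc j" "T \<subseteq> ?e ` ?X" by blast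
      from finite_subset_image[OF T(1,3)] obtain S where S: "S \<subseteq> ?X" "finite S" "T = ?e ` S" by blast
      have "\<omega> \<in> fan (Suc j) r (3 * r)"
      proof (rule fanI[OF elim(2) S(2)])
        show "3 * r < norm (fst (Z \<omega> n))" if "n \<in> S" for n using S(1) that by auto
        show "Suc j \<le> card (?e ` S)" using T(2) unfolding S(3) by simp
      qed
      then show False using j by blast
    qed
  qed
qed

section \<open>Almost sure consequences and criteria\<close>

abbreviation joined_beyond :: "'w \<Rightarrow> real \<Rightarrow> bool" where
  "joined_beyond \<omega> B \<equiv> \<forall>n m. snd (Z \<omega> n) \<le> 1 \<longrightarrow> snd (Z \<omega> m) \<le> 1 \<longrightarrow> B < norm (fst (Z \<omega> n)) \<longrightarrow> B < norm (fst (Z \<omega> m)) \<longrightarrow>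
     \<not> separate (arm \<omega> n) (arm \<omega> m)"

text \<open>The bound beyond which routes are joined may be random. It is finite a.s., so the events
  \<open>split (real n)\<close> eventually fail and their probabilities tend to 0.\<close>

lemma split_unlikely:
  assumes "AE \<omega> in M. \<exists>B. joined_beyond \<omega> B"
  shows generic_join
proof (rule generic_join_if_split_unlikely)
  fix \<delta> :: real assume \<delta>: "0 < \<delta>"
  have "AE \<omega> in M. \<forall>\<^sub>F n in sequentially. \<omega> \<notin> split (real n)"
    using assms
  proof eventually_elim
    case (elim \<omega>)
    then obtain B where B: "joined_beyond \<omega> B" by blast
    have "\<omega> \<notin> split (real k)" if "nat \<lceil>B\<rceil> \<le> k" for k
    proof
      assume "\<omega> \<in> split (real k)"
      then obtain n m where nm: "snd (Z \<omega> n) \<le> 1" "snd (Z \<omega> m) \<le> 1" "real k < norm (fst (Z \<omega> n))" "real k < norm (fst (Z \<omega> m))"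
        "separate (arm \<omega> n) (arm \<omega> m)" unfolding split_def by blast
      have "B \<le> real k" using that by linarith
      then have "B < norm (fst (Z \<omega> n))" "B < norm (fst (Z \<omega> m))" using nm by linarith+
      then show False using B nm by blast
    qed
    then show ?case unfolding eventually_sequentially by blast
  qed
  from prob_tendsto_0[OF split_measurable this] have "(\<lambda>n. prob (split (real n))) \<longlonglongrightarrow> 0" .
  from eventually_happens'[OF sequentially_bot order_tendstoD(2)[OF this \<delta>]]
  show "\<exists>B. prob (split B) \<le> \<delta>" using less_imp_le by blast
qed

lemma AE_common_small_exit:
  assumes generic_join
  shows "AE \<omega> in M. \<forall>\<^sub>F k in sequentially. \<forall>n\<in>{n. snd (Z \<omega> n) \<le> 1 \<or> 1 < norm (fst (Z \<omega> n))}. 1 / real (Suc k) < norm (fst (Z \<omega> n)) \<and>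
     (\<forall>m\<in>{n. snd (Z \<omega> n) \<le> 1 \<or> 1 < norm (fst (Z \<omega> n))}.
       exit_point (1 / real (Suc k)) (arm \<omega> n) = exit_point (1 / real (Suc k)) (arm \<omega> m))"
proof -
  have "AE \<omega> in M. finite ((\<lambda>n. exit_point (1 / 3) (arm \<omega> n)) ` {n. 1 < norm (fst (Z \<omega> n))})"
    using AE_finite_exits[of "1 / 3"] by simp
  then show ?thesis
    using AE_not_separate[OF assms] AE_nonzero AE_sampled_tree
  proof eventually_elim
    case (elim \<omega>)
    interpret sampled_tree "Z \<omega>" "R \<omega>" by (rule elim(4))
    show ?case by (rule common_small_exit) (use elim in blast)+
  qed
qed

text \<open>The family \<open>I\<close> is left free in order to serve three properties at once: all
  early points for (b), those in a disc for (c), and all points outside the unit disc for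
  (d).\<close>

lemma AE_common_point:
  assumes generic_join
  shows "AE \<omega> in M. sampled_tree (Z \<omega>) (R \<omega>) \<and> (\<forall>I\<subseteq>{n. snd (Z \<omega> n) \<le> 1 \<or> 1 < norm (fst (Z \<omega> n))}. I \<noteq> {} \<longrightarrow>
     (\<exists>w. w \<noteq> 0 \<and> (\<forall>n\<in>I. w \<in> path_image (arm \<omega> n))))"
  using AE_common_small_exit[OF assms] AE_sampled_tree
proof eventually_elim
  case (elim \<omega>)
  interpret sampled_tree "Z \<omega>" "R \<omega>" by (rule elim(2))
  from eventually_happens'[OF sequentially_bot elim(1)] obtain k where
    k: "\<forall>n\<in>{n. snd (Z \<omega> n) \<le> 1 \<or> 1 < norm (fst (Z \<omega> n))}. 1 / real (Suc k) < norm (fst (Z \<omega> n)) \<and>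
     (\<forall>m\<in>{n. snd (Z \<omega> n) \<le> 1 \<or> 1 < norm (fst (Z \<omega> n))}.
       exit_point (1 / real (Suc k)) (arm \<omega> n) = exit_point (1 / real (Suc k)) (arm \<omega> m))" by blast
  have "\<exists>w. w \<noteq> 0 \<and> (\<forall>n\<in>I. w \<in> path_image (arm \<omega> n))"
    if I: "I \<subseteq> {n. snd (Z \<omega> n) \<le> 1 \<or> 1 < norm (fst (Z \<omega> n))}" "I \<noteq> {}" for I
  proof (rule common_exit_imp_common_point[OF _ _ _ I(2)])
    show "0 < 1 / real (Suc k)" by simp
    show "1 / real (Suc k) < norm (fst (Z \<omega> n))" if "n \<in> I" for n using bspec[OF k subsetD[OF I(1) that]] by blast
    show "exit_point (1 / real (Suc k)) (arm \<omega> n) = exit_point (1 / real (Suc k)) (arm \<omega> m)"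
      if "n \<in> I" "m \<in> I" for n m using bspec[OF k subsetD[OF I(1) that(1)]] subsetD[OF I(1) that(2)] by blast
  qed
  then show ?case using elim(2) by blast
qed

lemma fan_antimono:
  assumes "B \<le> B'"
  shows "fan j r B' \<subseteq> fan j r B"
proof
  fix \<omega> assume "\<omega> \<in> fan j r B'"
  then show "\<omega> \<in> fan j r B"
  proof (rule fanE)
    fix S assume S: "\<omega> \<in> space M" "finite S" "\<And>n. n \<in> S \<Longrightarrow> B' < norm (fst (Z \<omega> n))"
      "j \<le> card ((\<lambda>n. exit_point r (arm \<omega> n)) ` S)"
    show "\<omega> \<in> fan j r B" by (rule fanI[OF S(1,2) le_less_trans[OF assms S(3)] S(4)])
  qed
qed

lemma not_in_fan:
  assumes "\<omega> \<in> space M" "\<omega> \<notin> fan 2 r B" "B < norm (fst (Z \<omega> n))" "B < norm (fst (Z \<omega> m))"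
  shows "exit_point r (arm \<omega> n) = exit_point r (arm \<omega> m)"
proof (rule ccontr)
  let ?e = "\<lambda>n. exit_point r (arm \<omega> n)"
  assume "?e n \<noteq> ?e m"
  then have "2 \<le> card (?e ` {n, m})" by simp
  then have "\<omega> \<in> fan 2 r B" using assms(3,4) by (intro fanI[OF assms(1), of "{n, m}"]) auto
  then show False using assms(2) by blast
qed

text \<open>A.s. all routes beyond the unit disc agree at some random small radius, hence with
  probability near 1 at a fixed radius \<open>1 / Suc k\<close>. Passing to the laws, scaling by
  \<open>r * Suc k\<close> and passing back makes the radius \<open>r\<close> and moves the points
  outward. The passage to the laws costs the factor 3, whence \<delta>/3.\<close>

lemma fan_unlikely:
  assumes gj: generic_join and r: "0 < r" and \<delta>: "0 < \<delta>"
  shows "\<exists>B. prob (fan 2 r B) \<le> \<delta>"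
proof -
  have "AE \<omega> in M. \<forall>\<^sub>F k in sequentially. \<omega> \<notin> fan 2 (1 / real (Suc k)) 1"
    using AE_common_small_exit[OF gj]
  proof eventually_elim
    case (elim \<omega>)
    then show ?case
    proof eventually_elim
      case (elim k)
      let ?e = "\<lambda>n. exit_point (1 / real (Suc k)) (arm \<omega> n)"
      show ?case
      proof
        assume "\<omega> \<in> fan 2 (1 / real (Suc k)) 1"
        then show False
        proof (rule fanE)
        fix S assume S: "finite S" "\<And>n. n \<in> S \<Longrightarrow> 1 < norm (fst (Z \<omega> n))" "2 \<le> card (?e ` S)"
        have W: "n \<in> {n. snd (Z \<omega> n) \<le> 1 \<or> 1 < norm (fst (Z \<omega> n))}" if "n \<in> S" for n using S(2)[OF that] by simp
        have "?e n = ?e m" if "n \<in> S" "m \<in> S" for n m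
          by (rule bspec[OF conjunct2[OF bspec[OF elim W[OF that(1)]]] W[OF that(2)]])
        then have sub: "?e ` S \<subseteq> {?e n}" if "n \<in> S" for n using that by blast
        have "S \<noteq> {}" using S(3) by auto
        then obtain n where "n \<in> S" by blast
        from card_mono[OF _ sub[OF this]] have "card (?e ` S) \<le> 1" by simp
        then show False using S(3) by simp
        qed
      qed
    qed
  qed
  from prob_tendsto_0[OF fan_measurable this] have "(\<lambda>k. prob (fan 2 (1 / real (Suc k)) 1)) \<longlonglongrightarrow> 0" .
  moreover have "0 < \<delta> / 3" using \<delta> by simp
  ultimately have "\<forall>\<^sub>F k in sequentially. prob (fan 2 (1 / real (Suc k)) 1) < \<delta> / 3" by (rule order_tendstoD(2))
  from eventually_happens'[OF sequentially_bot this] obtain k where "prob (fan 2 (1 / real (Suc k)) 1) < \<delta> / 3" by blast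
  then have "emeasure M (fan 2 (1 / real (Suc k)) 1) \<le> ennreal (\<delta> / 3)" by (simp add: emeasure_eq_measure ennreal_leI)
  from ess_of_fan[OF this] have "ess 2 (1 / real (Suc k)) 1 (ennreal \<delta>)" using \<delta> by simp
  from ess_scale[OF this, of "r * real (Suc k)"] have "ess 2 r (r * real (Suc k)) (ennreal \<delta>)" using r by simp
  from fan_bound[OF this] have "prob (fan 2 r (r * real (Suc k))) \<le> \<delta>" using \<delta> by (simp add: emeasure_eq_measure ennreal_le_iff)
  then show ?thesis by blast
qed

lemma AE_unique_geodesic:
  assumes gj: generic_join
  shows "AE \<omega> in M. G (Z \<omega>) (R \<omega>) = 1"
proof -
  have "AE \<omega> in M. \<exists>B::nat. \<omega> \<notin> fan 2 (real (Suc k)) (real B)" for k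
  proof -
    let ?N = "\<Inter>B::nat. fan 2 (real (Suc k)) (real B)"
    have N: "?N \<in> events" using fan_measurable by (intro sets.countable_INT) auto
    have le: "prob ?N \<le> \<delta>" if "0 < \<delta>" for \<delta>
    proof -
      obtain B where B: "prob (fan 2 (real (Suc k)) B) \<le> \<delta>" using fan_unlikely[OF gj _ \<open>0 < \<delta>\<close>, of "real (Suc k)"] by auto
      have "B \<le> real (nat \<lceil>B\<rceil>)" by linarith
      from fan_antimono[OF this] have "?N \<subseteq> fan 2 (real (Suc k)) B" by blast
      then have "prob ?N \<le> prob (fan 2 (real (Suc k)) B)" by (intro finite_measure_mono fan_measurable)
      then show ?thesis using B by simp
    qed
    have "prob ?N \<le> 0" by (rule field_le_epsilon) (simp only: add_0_left le)
    then have "prob ?N = 0" using measure_nonneg[of M ?N] by linarith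
    then have "?N \<in> null_sets M" using N by (intro null_setsI) (simp_all add: emeasure_eq_measure)
    then have "AE \<omega> in M. \<omega> \<notin> ?N" by (rule AE_not_in)
    then show ?thesis by eventually_elim blast
  qed
  then have "AE \<omega> in M. \<forall>k. \<exists>B::nat. \<omega> \<notin> fan 2 (real (Suc k)) (real B)" unfolding AE_all_countable by blast
  then show ?thesis using AE_sampled_tree AE_space
  proof eventually_elim
    case (elim \<omega>)
    interpret sampled_tree "Z \<omega>" "R \<omega>" by (rule elim(2))
    show ?case
    proof (rule unique_geodesic)
      fix k
      obtain B :: nat where "\<omega> \<notin> fan 2 (real (Suc k)) (real B)" using elim(1) by blast
      then show "\<exists>B. \<forall>n m. B < norm (fst (Z \<omega> n)) \<longrightarrow> B < norm (fst (Z \<omega> m)) \<longrightarrow>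
         exit_point (real (Suc k)) (arm \<omega> n) = exit_point (real (Suc k)) (arm \<omega> m)"
        using not_in_fan[OF elim(3)] by blast
    qed
  qed
qed

text \<open>A unique geodesic forces a common exit from the unit disc for all early points beyond a
  random bound, and a common exit means a common initial segment.\<close>

lemma generic_join_if_unique_geodesic:
  assumes "AE \<omega> in M. G (Z \<omega>) (R \<omega>) = 1"
  shows generic_join
proof (rule split_unlikely)
  have "AE \<omega> in M. \<forall>k. finite ((\<lambda>n. exit_point (real (Suc k)) (arm \<omega> n)) ` {n. 3 * real (Suc k) < norm (fst (Z \<omega> n))})"
    unfolding AE_all_countable by (intro allI AE_finite_exits) simp
  then show "AE \<omega> in M. \<exists>B. joined_beyond \<omega> B"
    using assms AE_sampled_tree
  proof eventually_elim
    case (elim \<omega>)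
    interpret sampled_tree "Z \<omega>" "R \<omega>" by (rule elim(3))
    obtain B where B: "1 \<le> B" "\<forall>n m. snd (Z \<omega> n) \<le> 1 \<longrightarrow> snd (Z \<omega> m) \<le> 1 \<longrightarrow> B < norm (fst (Z \<omega> n)) \<longrightarrow> B < norm (fst (Z \<omega> m)) \<longrightarrow>
       exit_point 1 (arm \<omega> n) = exit_point 1 (arm \<omega> m)"
      using unique_geodesic_imp_common_exit[OF elim(2)] elim(1) by blast
    show ?case
    proof (intro exI[of _ B] allI impI)
      fix n m assume nm: "snd (Z \<omega> n) \<le> 1" "snd (Z \<omega> m) \<le> 1" "B < norm (fst (Z \<omega> n))" "B < norm (fst (Z \<omega> m))"
      have far: "1 < norm (fst (Z \<omega> n))" "1 < norm (fst (Z \<omega> m))" using B(1) nm by linarith+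
      show "\<not> separate (arm \<omega> n) (arm \<omega> m)"
        by (rule common_exit_not_separate[OF B(2)[rule_format, OF nm] far])
    qed
  qed
qed

text \<open>Each of (b), (c) and (d) provides this hypothesis.\<close>

lemma generic_join_if_common_point:
  assumes "AE \<omega> in M. \<forall>n m. snd (Z \<omega> n) \<le> 1 \<longrightarrow> snd (Z \<omega> m) \<le> 1 \<longrightarrow> 1 < norm (fst (Z \<omega> n)) \<longrightarrow> 1 < norm (fst (Z \<omega> m)) \<longrightarrow>
     (\<exists>w. w \<noteq> 0 \<and> w \<in> path_image (arm \<omega> n) \<and> w \<in> path_image (arm \<omega> m))"
  shows generic_join
proof (rule split_unlikely)
  show "AE \<omega> in M. \<exists>B. joined_beyond \<omega> B"
    using assms AE_sampled_tree AE_nonzero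
  proof eventually_elim
    case (elim \<omega>)
    interpret sampled_tree "Z \<omega>" "R \<omega>" by (rule elim(2))
    show ?case
      by (rule exI[of _ 1]) (use elim(1,3) common_point_not_separate in blast)
  qed
qed

section \<open>Each property compared with \<open>generic_join\<close>\<close>

lemma b_iff: "(AE \<omega> in M. branchpoint (R \<omega> 0 ` \<Xi> (Z \<omega>) 1) \<noteq> 0) \<longleftrightarrow> generic_join"
proof
  assume "AE \<omega> in M. branchpoint (R \<omega> 0 ` \<Xi> (Z \<omega>) 1) \<noteq> 0"
  note h = this
  show generic_join
  proof (rule generic_join_if_common_point, goal_cases)
    case 1
    show ?case using h AE_sampled_tree
    proof eventually_elim
    case (elim \<omega>)
    then show ?case unfolding sampled_tree.branchpoint_neq_0_iff[OF elim(2)] by blast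
    qed
  qed
next
  assume generic_join
  from AE_common_point[OF this] show "AE \<omega> in M. branchpoint (R \<omega> 0 ` \<Xi> (Z \<omega>) 1) \<noteq> 0"
  proof eventually_elim
    case (elim \<omega>)
    interpret sampled_tree "Z \<omega>" "R \<omega>" using elim by blast
    have "{n. snd (Z \<omega> n) \<le> 1} \<noteq> {}" using infinite by (metis finite.emptyI)
    then show ?case unfolding branchpoint_neq_0_iff using elim by blast
  qed
qed

lemma c_iff: "(\<forall>r>0. AE \<omega> in M. \<not> (\<Xi> (Z \<omega>) 1 \<inter> cball 0 r \<noteq> {} \<and> branchpoint (R \<omega> 0 ` (\<Xi> (Z \<omega>) 1 \<inter> cball 0 r)) = 0)) \<longleftrightarrow> generic_join"
proof
  assume *: "\<forall>r>0. AE \<omega> in M. \<not> (\<Xi> (Z \<omega>) 1 \<inter> cball 0 r \<noteq> {} \<and> branchpoint (R \<omega> 0 ` (\<Xi> (Z \<omega>) 1 \<inter> cball 0 r)) = 0)"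
  have "AE \<omega> in M. \<forall>k. \<not> (\<Xi> (Z \<omega>) 1 \<inter> cball 0 (real (Suc k)) \<noteq> {} \<and> branchpoint (R \<omega> 0 ` (\<Xi> (Z \<omega>) 1 \<inter> cball 0 (real (Suc k)))) = 0)"
    unfolding AE_all_countable by (intro allI *[rule_format]) simp
  note h = this
  show generic_join
  proof (rule generic_join_if_common_point, goal_cases)
    case 1
    show ?case using h AE_sampled_tree
    proof eventually_elim
    case (elim \<omega>)
    show ?case
    proof (intro allI impI)
      fix n m assume nm: "snd (Z \<omega> n) \<le> 1" "snd (Z \<omega> m) \<le> 1"
      define k where "k = nat \<lceil>max (norm (fst (Z \<omega> n))) (norm (fst (Z \<omega> m)))\<rceil>"
      have k: "norm (fst (Z \<omega> n)) \<le> real (Suc k)" "norm (fst (Z \<omega> m)) \<le> real (Suc k)" unfolding k_def by linarith+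
      let ?I = "{n. snd (Z \<omega> n) \<le> 1 \<and> norm (fst (Z \<omega> n)) \<le> real (Suc k)}"
      have I: "n \<in> ?I" "m \<in> ?I" using nm k by simp_all
      have "\<not> (?I \<noteq> {} \<and> \<not> (\<exists>w. w \<noteq> 0 \<and> (\<forall>n\<in>?I. w \<in> path_image (arm \<omega> n))))"
        using elim(1)[rule_format, of k] unfolding sampled_tree.branchpoint_disc_neq_0_iff[OF elim(2)] .
      then show "\<exists>w. w \<noteq> 0 \<and> w \<in> path_image (arm \<omega> n) \<and> w \<in> path_image (arm \<omega> m)"
        using I by blast
    qed
    qed
  qed
next
  assume gj: generic_join
  show "\<forall>r>0. AE \<omega> in M. \<not> (\<Xi> (Z \<omega>) 1 \<inter> cball 0 r \<noteq> {} \<and> branchpoint (R \<omega> 0 ` (\<Xi> (Z \<omega>) 1 \<inter> cball 0 r)) = 0)"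
  proof (intro allI impI)
    fix r :: real assume "0 < r"
    from AE_common_point[OF gj]
    show "AE \<omega> in M. \<not> (\<Xi> (Z \<omega>) 1 \<inter> cball 0 r \<noteq> {} \<and> branchpoint (R \<omega> 0 ` (\<Xi> (Z \<omega>) 1 \<inter> cball 0 r)) = 0)"
    proof eventually_elim
      case (elim \<omega>)
      let ?I = "{n. snd (Z \<omega> n) \<le> 1 \<and> norm (fst (Z \<omega> n)) \<le> r}"
      have "?I \<subseteq> {n. snd (Z \<omega> n) \<le> 1 \<or> 1 < norm (fst (Z \<omega> n))}" by blast
      then show ?case unfolding sampled_tree.branchpoint_disc_neq_0_iff[OF conjunct1[OF elim]] using elim by blast
    qed
  qed
qed

lemma d_iff: "(AE \<omega> in M. B_infty (Z \<omega>) (R \<omega>) \<noteq> 0) \<longleftrightarrow> generic_join"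
proof
  assume "AE \<omega> in M. B_infty (Z \<omega>) (R \<omega>) \<noteq> 0"
  note h = this
  show generic_join
  proof (rule generic_join_if_common_point, goal_cases)
    case 1
    show ?case using h AE_sampled_tree
    proof eventually_elim
    case (elim \<omega>)
    then show ?case unfolding sampled_tree.B_infty_neq_0_iff[OF elim(2)] by blast
    qed
  qed
next
  assume generic_join
  from AE_common_point[OF this] show "AE \<omega> in M. B_infty (Z \<omega>) (R \<omega>) \<noteq> 0"
  proof eventually_elim
    case (elim \<omega>)
    have tree: "sampled_tree (Z \<omega>) (R \<omega>)" using elim by blast
    have "{n. 1 < norm (fst (Z \<omega> n))} \<subseteq> {n. snd (Z \<omega> n) \<le> 1 \<or> 1 < norm (fst (Z \<omega> n))}" by blast
    moreover have "\<exists>w::complex. w \<noteq> 0" by (rule exI[of _ 1]) simp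
    ultimately show ?case
      unfolding sampled_tree.B_infty_neq_0_iff[OF tree] using elim by (cases "{n. 1 < norm (fst (Z \<omega> n))} = {}") blast+
  qed
qed

lemma Q_event:
  "{\<omega>\<in>space M. \<not> (\<exists>e. \<forall>\<xi>\<in>\<Xi> (Z \<omega>) l - cball 0 B. first_exit (R \<omega> 0 \<xi>) = e)} =
   {\<omega>\<in>space M. \<exists>n m. snd (Z \<omega> n) \<le> l \<and> snd (Z \<omega> m) \<le> l \<and> B < norm (fst (Z \<omega> n)) \<and> B < norm (fst (Z \<omega> m)) \<and>
     exit_point 1 (arm \<omega> n) \<noteq> exit_point 1 (arm \<omega> m)}" (is "_ = ?E l B")
proof -
  have X: "\<Xi> (Z \<omega>) l - cball 0 B = (\<lambda>n. fst (Z \<omega> n)) ` {n. snd (Z \<omega> n) \<le> l \<and> B < norm (fst (Z \<omega> n))}" for \<omega>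
    by (auto simp: \<Xi>_def)
  have const: "(\<exists>e. \<forall>i\<in>I. f i = e) \<longleftrightarrow> (\<forall>i\<in>I. \<forall>j\<in>I. f i = f j)" for f :: "nat \<Rightarrow> complex" and I
  proof
    assume "\<forall>i\<in>I. \<forall>j\<in>I. f i = f j"
    then have "\<forall>i\<in>I. f i = f i0" if "i0 \<in> I" for i0 using that by blast
    then show "\<exists>e. \<forall>i\<in>I. f i = e" by (cases "I = {}") blast+
  next
    assume "\<exists>e. \<forall>i\<in>I. f i = e"
    then obtain e where e: "\<forall>i\<in>I. f i = e" ..
    show "\<forall>i\<in>I. \<forall>j\<in>I. f i = f j" by (intro ballI) (simp only: bspec[OF e])
  qed
  have img: "(\<forall>\<xi>\<in>g ` I. P \<xi>) \<longleftrightarrow> (\<forall>n\<in>I. P (g n))" for g :: "nat \<Rightarrow> complex" and P I by blast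
  show ?thesis
    unfolding X first_exit_eq img const by auto
qed

lemma Q_event_measurable:
  "{\<omega>\<in>space M. \<not> (\<exists>e. \<forall>\<xi>\<in>\<Xi> (Z \<omega>) l - cball 0 B. first_exit (R \<omega> 0 \<xi>) = e)} \<in> events"
  unfolding Q_event by measurable

lemma Q_mono: "mono (\<lambda>l. Q M Z R l B)"
proof (rule monoI)
  fix l l' :: real assume l: "l \<le> l'"
  show "Q M Z R l B \<le> Q M Z R l' B"
    unfolding Q_def
  proof (rule finite_measure_mono[OF _ Q_event_measurable])
    have sub: "\<Xi> (Z \<omega>) l \<subseteq> \<Xi> (Z \<omega>) l'" for \<omega> using l by (force simp: \<Xi>_def)
    show "{\<omega>\<in>space M. \<not> (\<exists>e. \<forall>\<xi>\<in>\<Xi> (Z \<omega>) l - cball 0 B. first_exit (R \<omega> 0 \<xi>) = e)} \<subseteq>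
        {\<omega>\<in>space M. \<not> (\<exists>e. \<forall>\<xi>\<in>\<Xi> (Z \<omega>) l' - cball 0 B. first_exit (R \<omega> 0 \<xi>) = e)}"
    proof
      fix \<omega> assume \<omega>: "\<omega> \<in> {\<omega>\<in>space M. \<not> (\<exists>e. \<forall>\<xi>\<in>\<Xi> (Z \<omega>) l - cball 0 B. first_exit (R \<omega> 0 \<xi>) = e)}"
      have "\<Xi> (Z \<omega>) l - cball 0 B \<subseteq> \<Xi> (Z \<omega>) l' - cball 0 B" using sub by (rule Diff_mono) (rule order_refl)
      then have "\<exists>e. \<forall>\<xi>\<in>\<Xi> (Z \<omega>) l - cball 0 B. first_exit (R \<omega> 0 \<xi>) = e"
        if "\<exists>e. \<forall>\<xi>\<in>\<Xi> (Z \<omega>) l' - cball 0 B. first_exit (R \<omega> 0 \<xi>) = e" using that by (meson subsetD)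
      then show "\<omega> \<in> {\<omega>\<in>space M. \<not> (\<exists>e. \<forall>\<xi>\<in>\<Xi> (Z \<omega>) l' - cball 0 B. first_exit (R \<omega> 0 \<xi>) = e)}" using \<omega> by blast
    qed
  qed
qed

text \<open>The bound is uniform in the intensity, so it survives the inner limit of property
  (e).\<close>

lemma Q_le_fan: "Q M Z R l B \<le> prob (fan 2 1 B)"
  unfolding Q_def
proof (rule finite_measure_mono[OF _ fan_measurable])
  show "{\<omega>\<in>space M. \<not> (\<exists>e. \<forall>\<xi>\<in>\<Xi> (Z \<omega>) l - cball 0 B. first_exit (R \<omega> 0 \<xi>) = e)} \<subseteq> fan 2 1 B"
  proof
    fix \<omega> assume "\<omega> \<in> {\<omega>\<in>space M. \<not> (\<exists>e. \<forall>\<xi>\<in>\<Xi> (Z \<omega>) l - cball 0 B. first_exit (R \<omega> 0 \<xi>) = e)}"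
    then obtain n m where nm: "\<omega> \<in> space M" "B < norm (fst (Z \<omega> n))" "B < norm (fst (Z \<omega> m))"
      "exit_point 1 (arm \<omega> n) \<noteq> exit_point 1 (arm \<omega> m)"
      unfolding Q_event by auto
    show "\<omega> \<in> fan 2 1 B"
    proof (rule ccontr)
      assume "\<omega> \<notin> fan 2 1 B"
      from not_in_fan[OF nm(1) this nm(2,3)] nm(4) show False by contradiction
    qed
  qed
qed

text \<open>For points beyond radius 1 both routes leave the unit disc, so a common exit point would
  be a genuine common point.\<close>

lemma split_le_Q:
  assumes "1 \<le> B"
  shows "prob (split B) \<le> Q M Z R 1 B"
  unfolding Q_def
proof (rule finite_measure_mono_AE[OF _ Q_event_measurable])
  show "AE \<omega> in M. \<omega> \<in> split B \<longrightarrow> \<omega> \<in> {\<omega>\<in>space M. \<not> (\<exists>e. \<forall>\<xi>\<in>\<Xi> (Z \<omega>) 1 - cball 0 B. first_exit (R \<omega> 0 \<xi>) = e)}"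
    using AE_sampled_tree
  proof (eventually_elim, intro impI)
    fix \<omega> assume tree: "sampled_tree (Z \<omega>) (R \<omega>)" and "\<omega> \<in> split B"
    then obtain n m where nm: "\<omega> \<in> space M" "snd (Z \<omega> n) \<le> 1" "snd (Z \<omega> m) \<le> 1" "B < norm (fst (Z \<omega> n))" "B < norm (fst (Z \<omega> m))"
        "separate (arm \<omega> n) (arm \<omega> m)" unfolding split_def by blast
    have "1 < norm (fst (Z \<omega> n))" "1 < norm (fst (Z \<omega> m))" using nm assms by linarith+
    then have "exit_point 1 (arm \<omega> n) \<noteq> exit_point 1 (arm \<omega> m)"
      using sampled_tree.common_exit_not_separate[OF tree] nm(6) by blast
    then show "\<omega> \<in> {\<omega>\<in>space M. \<not> (\<exists>e. \<forall>\<xi>\<in>\<Xi> (Z \<omega>) 1 - cball 0 B. first_exit (R \<omega> 0 \<xi>) = e)}"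
      unfolding Q_event using nm by blast
  qed
qed

text \<open>The inner limit exists by monotonicity in the intensity. Towards
  \<open>generic_join\<close>, intensity 1 is enough, as its value of \<open>Q\<close> is below the
  limit; in the other direction the limit is at most the probability of \<open>fan\<close>.\<close>

lemma e_iff: "(\<exists>q :: real \<Rightarrow> real. (\<forall>B\<ge>1. ((\<lambda>l. Q M Z R l B) \<longlongrightarrow> q B) at_top) \<and> (q \<longlongrightarrow> 0) at_top) \<longleftrightarrow> generic_join"
proof
  assume "\<exists>q :: real \<Rightarrow> real. (\<forall>B\<ge>1. ((\<lambda>l. Q M Z R l B) \<longlongrightarrow> q B) at_top) \<and> (q \<longlongrightarrow> 0) at_top"
  then obtain q :: "real \<Rightarrow> real" where q: "\<And>B. 1 \<le> B \<Longrightarrow> ((\<lambda>l. Q M Z R l B) \<longlongrightarrow> q B) at_top" "(q \<longlongrightarrow> 0) at_top" by blast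
  show generic_join
  proof (rule generic_join_if_split_unlikely)
    fix \<delta> :: real assume "0 < \<delta>"
    have "\<forall>\<^sub>F B in at_top. q B < \<delta> \<and> 1 \<le> B"
      by (intro eventually_conj order_tendstoD(2)[OF q(2) \<open>0 < \<delta>\<close>] eventually_ge_at_top)
    then obtain B where B: "q B < \<delta>" "1 \<le> B" using eventually_happens'[OF trivial_limit_at_top_linorder] by blast
    have "\<forall>\<^sub>F l in at_top. prob (split B) \<le> Q M Z R l B"
      using eventually_ge_at_top[of 1]
    proof eventually_elim
      case (elim l)
      show ?case using split_le_Q[OF B(2)] monoD[OF Q_mono[of B] elim] by simp
    qed
    from tendsto_lowerbound[OF q(1)[OF B(2)] this] have "prob (split B) \<le> q B" by simp
    then show "\<exists>B. prob (split B) \<le> \<delta>" using B(1) by (intro exI[of _ B]) simp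
  qed
next
  assume gj: generic_join
  define q where "q B = (SUP l. Q M Z R l B)" for B
  have "bdd_above (range (\<lambda>l. Q M Z R l B))" for B
    using Q_le_fan by (intro bdd_aboveI2[of _ _ "prob (fan 2 1 B)"]) auto
  then have lim: "((\<lambda>l. Q M Z R l B) \<longlongrightarrow> q B) at_top" for B
    unfolding q_def by (rule mono_tendsto_SUP[OF Q_mono])
  have q0: "0 \<le> q B" for B
    by (rule tendsto_lowerbound[OF lim[of B]]) (simp_all add: Q_def)
  have q1: "q B \<le> prob (fan 2 1 B)" for B
    unfolding q_def by (rule cSUP_least) (simp_all add: Q_le_fan)
  have "(q \<longlongrightarrow> 0) at_top"
  proof (rule order_tendstoI)
    fix a :: real assume "a < 0"
    then have "a < q B" for B using q0[of B] by simp
    then show "\<forall>\<^sub>F B in at_top. a < q B" by simp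
  next
    fix a :: real assume a: "0 < a"
    then obtain B0 where B0: "prob (fan 2 1 B0) \<le> a / 2" using fan_unlikely[OF gj, of 1 "a / 2"] by auto
    have "q B < a" if "B0 \<le> B" for B
    proof -
      have "prob (fan 2 1 B) \<le> prob (fan 2 1 B0)" by (intro finite_measure_mono fan_antimono that fan_measurable)
      then show ?thesis using q1[of B] B0 a by linarith
    qed
    then show "\<forall>\<^sub>F B in at_top. q B < a" unfolding eventually_at_top_linorder by blast
  qed
  then show "\<exists>q :: real \<Rightarrow> real. (\<forall>B\<ge>1. ((\<lambda>l. Q M Z R l B) \<longlongrightarrow> q B) at_top) \<and> (q \<longlongrightarrow> 0) at_top"
    using lim by blast
qed

end

subsection \<open>The uniform points\<close>

lemma ennreal_eq_0I:
  fixes e :: ennreal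
  assumes "\<And>n::nat. \<not> ennreal (1 / real (Suc n)) \<le> e"
  shows "e = 0"
proof (cases e)
  case (real r)
  show ?thesis
  proof (rule ccontr)
    assume "e \<noteq> 0"
    then have "0 < r" using real by (cases "r = 0") auto
    from eventually_happens'[OF sequentially_bot small_radius[OF this]] obtain n where "1 / real (Suc n) < r" by blast
    then have "ennreal (1 / real (Suc n)) \<le> e" unfolding real(2) by (intro ennreal_leI) simp
    then show False using assms by blast
  qed
next
  case top
  then show ?thesis using assms[of 0] by simp
qed

context sirsn_sample
begin

text \<open>Coinciding points and points at the origin are negligible. The Poisson points, a.s.
  distinct and non-zero, are reused for this: a non-null set of degenerate configurations would be
  hit with probability at least 1/2.\<close>

lemma AE_lborels_positions: "AE y in lborels {1..<k}. place k {1..<k} y \<in> space (positions k)"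
proof -
  let ?J = "{1..<k}"
  let ?P = "PiM ?J (\<lambda>_. borel :: complex measure)"
  define D where "D = space ?P - {y \<in> space ?P. place k ?J y \<in> space (positions k) \<and> True}"
  have "{y \<in> space ?P. place k ?J y \<in> space (positions k) \<and> True} \<in> sets ?P"
    using \<mu>_level_set[of "{}" k "\<lambda>_. True" ?J] by simp
  then have D: "D \<in> sets ?P" unfolding D_def by (intro sets.Diff sets.top)
  have J: "?J \<subseteq> {..<k}" "{..<k} \<subseteq> insert 0 ?J" by auto
  have "emeasure (lborels ?J) D = 0"
  proof (rule ccontr)
    assume "emeasure (lborels ?J) D \<noteq> 0"
    then obtain m0 where m0: "0 < m0" "\<And>l c. 0 < l \<Longrightarrow> 0 < c \<Longrightarrow> m0 \<le> l * c\<^sup>2 \<Longrightarrow>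
        1 / 2 \<le> prob (hit ?J D l c)"
      using hit_half[OF finite_atLeastLessThan D] by blast
    let ?H = "hit ?J D m0 1"
    have "AE \<omega> in M. \<forall>i \<in> ?J \<rightarrow>\<^sub>E UNIV. inj_on i ?J \<longrightarrow> place k ?J (\<lambda>j. fst (Z \<omega> (i j))) \<in> space (positions k)"
      unfolding AE_ball_countable[OF countable_tuples[OF finite_atLeastLessThan]]
      by (intro ballI AE_impI AE_place_positions[OF J])
    then have "AE \<omega> in M. \<omega> \<notin> ?H"
    proof eventually_elim
      case (elim \<omega>)
      show ?case
      proof
        assume "\<omega> \<in> ?H"
        then obtain i where i: "i \<in> ?J \<rightarrow>\<^sub>E UNIV" "inj_on i ?J" "(\<lambda>j\<in>?J. (1 / 1) *\<^sub>R fst (Z \<omega> (i j))) \<in> D"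
          unfolding hit_tuple_def by blast
        have "place k ?J (\<lambda>j\<in>?J. (1 / 1) *\<^sub>R fst (Z \<omega> (i j))) = place k ?J (\<lambda>j. fst (Z \<omega> (i j)))"
          unfolding place_def by (intro restrict_ext) simp
        then show False using i elim unfolding D_def by auto
      qed
    qed
    then have "prob ?H = 0" using prob_eq_0[OF hit_event_measurable[OF _ D]] by simp
    then show False using m0(2)[of m0 1] m0(1) by simp
  qed
  then have "D \<in> null_sets (lborels ?J)" using D by (intro null_setsI) (simp_all add: sets_lborels)
  then have "AE y in lborels ?J. y \<notin> D" by (rule AE_not_in)
  then show ?thesis using AE_space
    by eventually_elim (simp add: D_def sets_eq_imp_space_eq[OF sets_lborels])
qed

definition UV :: "nat \<Rightarrow> 'w \<Rightarrow> complex" where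
  "UV j = (if j = 0 then (\<lambda>_. 0) else if j = 1 then U else V)"

lemma UV_simps: "UV 0 = (\<lambda>_. 0)" "UV 1 = U" "UV (Suc 0) = U" "UV 2 = V"
  by (simp_all add: UV_def)

text \<open>Independence and uniformity give the formula on boxes, with the constant the inverse
  square of the area of the disc. On the product of discs the null sets are therefore those of
  Lebesgue measure.\<close>

lemma UV_law:
  "\<exists>c>0. \<forall>S\<in>sets (PiM {1..<3} (\<lambda>_. borel)). emeasure M {\<omega> \<in> space M. (\<lambda>j\<in>{1..<3}. UV j \<omega>) \<in> S} =
       c * emeasure (lborels {1..<3}) (Pi\<^sub>E {1..<3} (\<lambda>_. cball 0 1) \<inter> S)"
proof -
  let ?J = "{1..<3::nat}" and ?A = "cball 0 1 :: complex set"
  let ?P = "PiM ?J (\<lambda>_. borel :: complex measure)"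
  let ?PZ = "distr M (PiM UNIV (\<lambda>_. space_time)) Z"
  define a where "a = emeasure lborel ?A"
  have a: "a < \<infinity>" unfolding a_def by (rule emeasure_bounded_finite[OF bounded_cball])
  have "emeasure lborel (ball 0 1 :: complex set) \<le> a" unfolding a_def by (intro emeasure_mono) auto
  then have a0: "a \<noteq> 0" using emeasure_unit_ball_pos by auto
  have u: "emeasure unit_disc_uniform B = emeasure lborel (?A \<inter> B) * inverse a" if "B \<in> sets borel" for B
    unfolding unit_disc_uniform_def a_def using that by (simp add: divide_ennreal_def)
  interpret u: prob_space unit_disc_uniform
    unfolding unit_disc_uniform_def by (rule prob_space_uniform_measure) (use a a0 in \<open>simp_all add: a_def\<close>)
  interpret z: prob_space ?PZ by (rule prob_space_distr[OF Z_measurable])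
  interpret uz: pair_prob_space unit_disc_uniform ?PZ ..
  let ?f = "\<lambda>\<omega>. \<lambda>j\<in>?J. UV j \<omega>"
  have UVm: "UV j \<in> borel_measurable M" for j by (simp add: UV_def)
  have f: "?f \<in> M \<rightarrow>\<^sub>M ?P" by (rule measurable_restrict[OF UVm])
  have J12: "?J = {1, 2}" by auto
  have box: "emeasure (distr M ?P ?f) (Pi\<^sub>E ?J B) = inverse a * inverse a * (\<Prod>j\<in>?J. emeasure lborel (?A \<inter> B j))"
    if B: "\<And>j. j \<in> ?J \<Longrightarrow> B j \<in> sets borel" for B
  proof -
    let ?S = "B 1 \<times> (B 2 \<times> space (PiM UNIV (\<lambda>_::nat. space_time)))"
    have B12: "B 1 \<in> sets borel" "B 2 \<in> sets borel" using B by auto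
    have S: "?S \<in> sets sample_data_space" unfolding sample_data_space_def using B12 by (intro pair_measureI) auto
    have us: "sets unit_disc_uniform = sets borel" by (simp add: unit_disc_uniform_def)
    have "emeasure (distr M ?P ?f) (Pi\<^sub>E ?J B) = emeasure M (?f -` Pi\<^sub>E ?J B \<inter> space M)"
      by (rule emeasure_distr[OF f]) (use B in \<open>intro sets_PiM_I_finite; simp\<close>)
    also have "?f -` Pi\<^sub>E ?J B \<inter> space M = (\<lambda>\<omega>. (U \<omega>, V \<omega>, Z \<omega>)) -` ?S \<inter> space M"
    proof -
      have "?f \<omega> \<in> Pi\<^sub>E ?J B \<longleftrightarrow> U \<omega> \<in> B 1 \<and> V \<omega> \<in> B 2" for \<omega>
        unfolding PiE_iff J12 by (simp add: UV_simps)
      then show ?thesis using measurable_space[OF Z_measurable] by auto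
    qed
    also have "emeasure M \<dots> = emeasure (distr M sample_data_space (\<lambda>\<omega>. (U \<omega>, V \<omega>, Z \<omega>))) ?S"
      by (rule emeasure_distr[OF data_measurable S, symmetric])
    also have "distr M sample_data_space (\<lambda>\<omega>. (U \<omega>, V \<omega>, Z \<omega>)) = unit_disc_uniform \<Otimes>\<^sub>M (unit_disc_uniform \<Otimes>\<^sub>M ?PZ)"
      using sampled unfolding sampled_routes_def by (elim conjE)
    also have "emeasure \<dots> ?S = emeasure unit_disc_uniform (B 1) *
        emeasure (unit_disc_uniform \<Otimes>\<^sub>M ?PZ) (B 2 \<times> space (PiM UNIV (\<lambda>_::nat. space_time)))"
      by (rule uz.P.emeasure_pair_measure_Times) (use B12 us in \<open>auto intro!: pair_measureI\<close>)
    also have "emeasure (unit_disc_uniform \<Otimes>\<^sub>M ?PZ) (B 2 \<times> space (PiM UNIV (\<lambda>_::nat. space_time))) =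
        emeasure unit_disc_uniform (B 2) * emeasure ?PZ (space (PiM UNIV (\<lambda>_::nat. space_time)))"
      by (rule z.emeasure_pair_measure_Times) (use B12 us in auto)
    also have "emeasure ?PZ (space (PiM UNIV (\<lambda>_::nat. space_time))) = 1"
      using z.emeasure_space_1 by simp
    finally have "emeasure (distr M ?P ?f) (Pi\<^sub>E ?J B) = emeasure unit_disc_uniform (B 1) * (emeasure unit_disc_uniform (B 2) * 1)" .
    moreover have "emeasure unit_disc_uniform (B 1) * (emeasure unit_disc_uniform (B 2) * 1) =
        inverse a * inverse a * (\<Prod>j\<in>?J. emeasure lborel (?A \<inter> B j))"
      unfolding J12 u[OF B12(1)] u[OF B12(2)] by (simp add: ac_simps)
    ultimately show ?thesis by (rule trans)
  qed
  show ?thesis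
  proof (intro exI[of _ "inverse a * inverse a"] conjI ballI)
    show "0 < inverse a * inverse a" using a by (simp add: ennreal_zero_less_mult_iff ennreal_inverse_positive)
    fix S assume S: "S \<in> sets ?P"
    have "emeasure (distr M ?P ?f) S = inverse a * inverse a * emeasure (lborels ?J) (Pi\<^sub>E ?J (\<lambda>_. ?A) \<inter> S)"
    proof (rule emeasure_unique_on_box[OF _ _ _ _ _ box S])
      obtain r where r: "a = ennreal r" "0 < r" using a a0 by (cases a) (auto simp: less_le)
      have "inverse a * inverse a = ennreal (inverse r * inverse r)" using r by (simp add: inverse_ennreal ennreal_mult)
      then show "inverse a * inverse a < \<infinity>" by simp
    qed (use a in \<open>auto simp: a_def\<close>)
    moreover have "emeasure (distr M ?P ?f) S = emeasure M {\<omega> \<in> space M. ?f \<omega> \<in> S}"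
      using emeasure_distr[OF f S] by (simp add: vimage_def Int_def conj_commute)
    ultimately show "emeasure M {\<omega> \<in> space M. ?f \<omega> \<in> S} = inverse a * inverse a * emeasure (lborels ?J) (Pi\<^sub>E ?J (\<lambda>_. ?A) \<inter> S)" by simp
  qed
qed

lemma UV_null_iff:
  assumes S: "S \<in> sets (PiM {1..<3} (\<lambda>_. borel))"
  shows "(AE \<omega> in M. (\<lambda>j\<in>{1..<3}. UV j \<omega>) \<notin> S) \<longleftrightarrow> (AE y in lborels {1..<3}. y \<in> Pi\<^sub>E {1..<3} (\<lambda>_. cball 0 1) \<longrightarrow> y \<notin> S)"
proof -
  let ?J = "{1..<3::nat}"
  let ?P = "PiM ?J (\<lambda>_. borel :: complex measure)"
  let ?B = "Pi\<^sub>E ?J (\<lambda>_. cball 0 1 :: complex set)"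
  obtain c where c: "0 < c" "\<And>S. S \<in> sets ?P \<Longrightarrow> emeasure M {\<omega> \<in> space M. (\<lambda>j\<in>?J. UV j \<omega>) \<in> S} =
       c * emeasure (lborels ?J) (?B \<inter> S)" using UV_law by blast
  have UVm: "UV j \<in> borel_measurable M" for j by (simp add: UV_def)
  have f: "(\<lambda>\<omega>. \<lambda>j\<in>?J. UV j \<omega>) \<in> M \<rightarrow>\<^sub>M ?P" by (rule measurable_restrict[OF UVm])
  have "{\<omega> \<in> space M. (\<lambda>j\<in>?J. UV j \<omega>) \<in> S} \<in> events"
    using measurable_sets[OF f S] by (simp add: vimage_def Int_def conj_commute)
  then have "(AE \<omega> in M. (\<lambda>j\<in>?J. UV j \<omega>) \<notin> S) \<longleftrightarrow> emeasure M {\<omega> \<in> space M. (\<lambda>j\<in>?J. UV j \<omega>) \<in> S} = 0"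
    by (subst AE_iff_measurable[of "{\<omega> \<in> space M. (\<lambda>j\<in>?J. UV j \<omega>) \<in> S}"]) simp_all
  also have "\<dots> \<longleftrightarrow> emeasure (lborels ?J) (?B \<inter> S) = 0"
  proof -
    have "c \<noteq> 0" using c(1) by auto
    then show ?thesis unfolding c(2)[OF S] by simp
  qed
  also have "\<dots> \<longleftrightarrow> (AE y in lborels ?J. y \<in> ?B \<longrightarrow> y \<notin> S)"
  proof (subst AE_iff_measurable[of "?B \<inter> S"])
    have "?B \<in> sets ?P" by (rule sets_PiM_I_finite) auto
    then show m: "?B \<inter> S \<in> sets (lborels ?J)" using S by (simp add: sets_lborels)
    show "{y \<in> space (lborels ?J). \<not> (y \<in> ?B \<longrightarrow> y \<notin> S)} = ?B \<inter> S" using sets.sets_into_space[OF m] by blast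
  qed simp
  finally show ?thesis .
qed

lemma AE_UV_positions: "AE \<omega> in M. (\<lambda>i\<in>{..<3}. UV i \<omega>) \<in> space (positions 3)"
proof -
  let ?J = "{1..<3::nat}"
  let ?P = "PiM ?J (\<lambda>_. borel :: complex measure)"
  define D where "D = space ?P - {y \<in> space ?P. place 3 ?J y \<in> space (positions 3) \<and> True}"
  have "{y \<in> space ?P. place 3 ?J y \<in> space (positions 3) \<and> True} \<in> sets ?P"
    using \<mu>_level_set[of "{}" 3 "\<lambda>_. True" ?J] by simp
  then have D: "D \<in> sets ?P" unfolding D_def by (intro sets.Diff sets.top)
  have "AE y in lborels ?J. y \<in> Pi\<^sub>E ?J (\<lambda>_. cball 0 1) \<longrightarrow> y \<notin> D"
    using AE_lborels_positions[of 3] by eventually_elim (simp add: D_def)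
  then have "AE \<omega> in M. (\<lambda>j\<in>?J. UV j \<omega>) \<notin> D" using UV_null_iff[OF D] by blast
  then show ?thesis
  proof eventually_elim
    case (elim \<omega>)
    have "(\<lambda>j\<in>?J. UV j \<omega>) \<in> space ?P" by (simp add: space_PiM)
    then have "place 3 ?J (\<lambda>j\<in>?J. UV j \<omega>) \<in> space (positions 3)" using elim by (simp add: D_def)
    moreover have "place 3 ?J (\<lambda>j\<in>?J. UV j \<omega>) = (\<lambda>i\<in>{..<3}. UV i \<omega>)"
      unfolding place_def by (intro restrict_ext) (auto simp: UV_def)
    ultimately show ?case by simp
  qed
qed

lemma sample_points_UV: "sample_points 3 UV"
  unfolding sample_points_def
proof (intro conjI AE_UV_positions)
  show "inj_on UV {..<3}"
  proof (rule inj_onI, rule ccontr)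
    fix a b :: nat assume ab: "a \<in> {..<3}" "b \<in> {..<3}" "UV a = UV b" "a \<noteq> b"
    have "AE \<omega> in M. False"
      using AE_UV_positions
    proof eventually_elim
      case (elim \<omega>)
      then have "inj_on (\<lambda>i\<in>{..<3}. UV i \<omega>) {..<3}" by (simp add: space_positions)
      from inj_onD[OF this, of a b] show False using ab by simp
    qed
    then show False by simp
  qed
  show "UV ` {..<3} \<subseteq> {\<lambda>_. 0, U, V} \<union> range (\<lambda>n \<omega>. fst (Z \<omega> n))" by (auto simp: UV_def)
qed

lemma AE_branchpoint_UV:
  "AE \<omega> in M. branchpoint {R \<omega> 0 (U \<omega>), R \<omega> 0 (V \<omega>)} \<noteq> 0 \<longleftrightarrow> span_of 3 UV \<omega> \<notin> apart"
  using span_tree[OF sample_points_UV] AE_UV_positions AE_space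
proof eventually_elim
  case (elim \<omega>)
  let ?\<gamma> = "R \<omega> 0 (U \<omega>)" and ?\<eta> = "R \<omega> 0 (V \<omega>)"
  have mem: "1 \<in> {1..<3::nat}" "2 \<in> {1..<3::nat}" by auto
  note 1 = bspec[OF elim(1) mem(1)] and 2 = bspec[OF elim(1) mem(2)]
  have props: "route ?\<gamma>" "?\<gamma> 0 = 0" "?\<gamma> 1 = U \<omega>" "route ?\<eta>" "?\<eta> 0 = 0" "?\<eta> 1 = V \<omega>"
    using 1 2 by (simp_all only: UV_simps)
  have ic: "initially_compatible ?\<gamma> ?\<gamma>" "initially_compatible ?\<gamma> ?\<eta>" "initially_compatible ?\<eta> ?\<gamma>" "initially_compatible ?\<eta> ?\<eta>"
    using bspec[OF conjunct2[OF conjunct2[OF conjunct2[OF 1]]] mem(1)] bspec[OF conjunct2[OF conjunct2[OF conjunct2[OF 1]]] mem(2)]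
      bspec[OF conjunct2[OF conjunct2[OF conjunct2[OF 2]]] mem(1)] bspec[OF conjunct2[OF conjunct2[OF conjunct2[OF 2]]] mem(2)]
    by (simp_all only: UV_simps)
  have tree: "route_tree {?\<gamma>, ?\<eta>}" unfolding route_tree_def using props ic by blast
  have inj: "inj_on (\<lambda>i\<in>{..<3}. UV i \<omega>) {..<3}" using elim(2) by (simp add: space_positions)
  have nz: "U \<omega> \<noteq> 0" "V \<omega> \<noteq> 0"
    using inj_onD[OF inj, of 1 0] inj_onD[OF inj, of 2 0] by (auto simp: UV_simps)
  have "branchpoint {?\<gamma>, ?\<eta>} \<noteq> 0 \<longleftrightarrow> (\<exists>w. w \<noteq> 0 \<and> (\<forall>\<gamma>\<in>{?\<gamma>, ?\<eta>}. w \<in> path_image \<gamma>))"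
    unfolding branchpoint_def by (rule subroute_end_Inter_neq_0_iff[OF tree]) simp
  also have "\<dots> \<longleftrightarrow> (\<exists>w. w \<noteq> 0 \<and> w \<in> path_image ?\<gamma> \<and> w \<in> path_image ?\<eta>)" by blast
  also have "\<dots> \<longleftrightarrow> \<not> separate ?\<gamma> ?\<eta>"
  proof -
    have "separate ?\<gamma> ?\<eta> \<longleftrightarrow> \<not> (\<exists>w. w \<noteq> 0 \<and> w \<in> path_image ?\<gamma> \<and> w \<in> path_image ?\<eta>)"
      by (rule separate_iff[OF tree insertI1 insertI2[OF insertI1]]) (simp_all only: props nz not_False_eq_True)
    then show ?thesis by blast
  qed
  also have "\<dots> \<longleftrightarrow> span_of 3 UV \<omega> \<notin> apart"
  proof -
    have "(0, 1) \<in> index_pairs 3" "(0, 2) \<in> index_pairs 3" by (auto simp: index_pairs_def)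
    then have "span_of 3 UV \<omega> (0, 1) = ?\<gamma>" "span_of 3 UV \<omega> (0, 2) = ?\<eta>"
      by (simp_all add: span_of_def UV_simps)
    then show ?thesis
      using measurable_space[OF span_measurable[OF sample_points_UV] elim(3)] by (simp add: apart_def)
  qed
  finally show ?case .
qed

text \<open>The probability of separation is the mean of its conditional probability given the
  points. It vanishes exactly if this conditional probability is 0 for almost all pairs in the unit
  disc, and by scaling then for almost all pairs in the plane.\<close>

lemma a_iff: "(AE \<omega> in M. branchpoint {R \<omega> 0 (U \<omega>), R \<omega> 0 (V \<omega>)} \<noteq> 0) \<longleftrightarrow> generic_join"
proof -
  let ?J = "{1..<3::nat}"
  let ?P = "PiM ?J (\<lambda>_. borel :: complex measure)"
  let ?f = "\<lambda>\<omega>. emeasure (\<mu> 3 (\<lambda>i\<in>{..<3}. UV i \<omega>)) apart"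
  let ?S = "{\<omega> \<in> space M. span_of 3 UV \<omega> \<in> apart}"
  define D where "D n = {y \<in> space ?P. place 3 ?J y \<in> space (positions 3) \<and>
       ennreal (1 / real (Suc n)) \<le> emeasure (\<mu> 3 (place 3 ?J y)) apart}" for n
  have D: "D n \<in> sets ?P" for n
    unfolding D_def by (rule \<mu>_level_set[OF apart_measurable]) measurable
  have pl: "place 3 ?J (\<lambda>j\<in>?J. UV j \<omega>) = (\<lambda>i\<in>{..<3}. UV i \<omega>)" for \<omega>
    unfolding place_def by (intro restrict_ext) (auto simp: UV_def)
  have S: "?S \<in> events"
    using measurable_sets[OF span_measurable[OF sample_points_UV] apart_measurable] by (simp add: vimage_def Int_def conj_commute)
  have "{\<omega> \<in> space M. (U \<omega>, V \<omega>, Z \<omega>) \<in> space sample_data_space \<and> span_of 3 UV \<omega> \<in> apart} = ?S"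
    using measurable_space[OF data_measurable] by blast
  then have "emeasure M ?S = (\<integral>\<^sup>+ \<omega>. indicator (space sample_data_space) (U \<omega>, V \<omega>, Z \<omega>) * ?f \<omega> \<partial>M)"
    using span_law[OF sample_points_UV sets.top apart_measurable] by simp
  also have "\<dots> = (\<integral>\<^sup>+ \<omega>. ?f \<omega> \<partial>M)"
    by (rule nn_integral_cong) (use measurable_space[OF data_measurable] in simp)
  finally have int: "emeasure M ?S = (\<integral>\<^sup>+ \<omega>. ?f \<omega> \<partial>M)" .
  have UVm: "(\<lambda>\<omega>. \<lambda>j\<in>?J. UV j \<omega>) \<in> M \<rightarrow>\<^sub>M ?P" by (rule measurable_restrict) (simp add: UV_def)
  have "(AE \<omega> in M. branchpoint {R \<omega> 0 (U \<omega>), R \<omega> 0 (V \<omega>)} \<noteq> 0) \<longleftrightarrow> (AE \<omega> in M. span_of 3 UV \<omega> \<notin> apart)"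
  proof
    assume "AE \<omega> in M. branchpoint {R \<omega> 0 (U \<omega>), R \<omega> 0 (V \<omega>)} \<noteq> 0"
    with AE_branchpoint_UV show "AE \<omega> in M. span_of 3 UV \<omega> \<notin> apart" by eventually_elim blast
  next
    assume "AE \<omega> in M. span_of 3 UV \<omega> \<notin> apart"
    with AE_branchpoint_UV show "AE \<omega> in M. branchpoint {R \<omega> 0 (U \<omega>), R \<omega> 0 (V \<omega>)} \<noteq> 0" by eventually_elim blast
  qed
  also have "\<dots> \<longleftrightarrow> emeasure M ?S = 0"
    by (subst AE_iff_measurable[OF S]) simp_all
  also have "\<dots> \<longleftrightarrow> (\<forall>n. AE \<omega> in M. (\<lambda>j\<in>?J. UV j \<omega>) \<notin> D n)"
  proof
    assume S0: "emeasure M ?S = 0"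
    show "\<forall>n. AE \<omega> in M. (\<lambda>j\<in>?J. UV j \<omega>) \<notin> D n"
    proof
      fix n
      let ?E = "{\<omega> \<in> space M. (\<lambda>j\<in>?J. UV j \<omega>) \<in> D n}"
      have E: "?E \<in> events" using measurable_sets[OF UVm D] by (simp add: vimage_def Int_def conj_commute)
      have "ennreal (1 / real (Suc n)) * emeasure M ?E = (\<integral>\<^sup>+\<omega>. ennreal (1 / real (Suc n)) * indicator ?E \<omega> \<partial>M)"
        using E by (simp add: nn_integral_cmult_indicator)
      also have "\<dots> \<le> (\<integral>\<^sup>+\<omega>. ?f \<omega> \<partial>M)"
      proof (rule nn_integral_mono)
        fix \<omega>
        show "ennreal (1 / real (Suc n)) * indicator ?E \<omega> \<le> ?f \<omega>"
        proof (cases "\<omega> \<in> ?E")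
          case True
          then have "ennreal (1 / real (Suc n)) \<le> ?f \<omega>" unfolding D_def by (simp only: mem_Collect_eq pl)
          then show ?thesis using True by simp
        next
          case False
          then have "indicator ?E \<omega> = (0 :: ennreal)" by (rule indicator_simps(2))
          then show ?thesis by (simp only: mult_zero_right) simp
        qed
      qed
      finally have "emeasure M ?E = 0" using int S0 by simp
      then show "AE \<omega> in M. (\<lambda>j\<in>?J. UV j \<omega>) \<notin> D n" by (subst AE_iff_measurable[OF E]) simp_all
    qed
  next
    assume "\<forall>n. AE \<omega> in M. (\<lambda>j\<in>?J. UV j \<omega>) \<notin> D n"
    then have "AE \<omega> in M. \<forall>n. (\<lambda>j\<in>?J. UV j \<omega>) \<notin> D n" unfolding AE_all_countable .
    then have "AE \<omega> in M. ?f \<omega> = 0"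
      using AE_UV_positions
    proof eventually_elim
      case (elim \<omega>)
      show ?case
      proof (rule ennreal_eq_0I)
        fix n
        have "(\<lambda>j\<in>?J. UV j \<omega>) \<notin> D n" using elim(1) by blast
        moreover have "(\<lambda>j\<in>?J. UV j \<omega>) \<in> space ?P" by (simp add: space_PiM)
        ultimately show "\<not> ennreal (1 / real (Suc n)) \<le> ?f \<omega>"
          using elim(2) unfolding D_def mem_Collect_eq pl by blast
      qed
    qed
    then have "(\<integral>\<^sup>+ \<omega>. ?f \<omega> \<partial>M) = (\<integral>\<^sup>+ \<omega>. 0 \<partial>M)" by (rule nn_integral_cong_AE)
    then show "emeasure M ?S = 0" using int by simp
  qed
  also have "\<dots> \<longleftrightarrow> (\<forall>n. AE y in lborels ?J. y \<in> Pi\<^sub>E ?J (\<lambda>_. cball 0 1) \<longrightarrow> y \<notin> D n)"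
    using UV_null_iff[OF D] by blast
  also have "\<dots> \<longleftrightarrow> generic_join"
  proof
    assume "\<forall>n. AE y in lborels ?J. y \<in> Pi\<^sub>E ?J (\<lambda>_. cball 0 1) \<longrightarrow> y \<notin> D n"
    then have *: "AE y in lborels ?J. \<forall>n. y \<in> Pi\<^sub>E ?J (\<lambda>_. cball 0 1) \<longrightarrow> y \<notin> D n" unfolding AE_all_countable .
    have "AE y in lborels ?J. \<forall>n. (\<lambda>j\<in>?J. (1 / real (Suc k)) *\<^sub>R y j + 0) \<in> Pi\<^sub>E ?J (\<lambda>_. cball 0 1) \<longrightarrow>
        (\<lambda>j\<in>?J. (1 / real (Suc k)) *\<^sub>R y j + 0) \<notin> D n" for k
      by (rule AE_lborels_affine[OF _ _ *]) simp_all
    then have "AE y in lborels ?J. \<forall>k n. (\<lambda>j\<in>?J. (1 / real (Suc k)) *\<^sub>R y j + 0) \<in> Pi\<^sub>E ?J (\<lambda>_. cball 0 1) \<longrightarrow>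
        (\<lambda>j\<in>?J. (1 / real (Suc k)) *\<^sub>R y j + 0) \<notin> D n" unfolding AE_all_countable by blast
    then show generic_join
      unfolding generic_join_def
    proof (eventually_elim, intro impI)
      fix y :: "nat \<Rightarrow> complex"
      assume y: "\<forall>k n. (\<lambda>j\<in>?J. (1 / real (Suc k)) *\<^sub>R y j + 0) \<in> Pi\<^sub>E ?J (\<lambda>_. cball 0 1) \<longrightarrow>
        (\<lambda>j\<in>?J. (1 / real (Suc k)) *\<^sub>R y j + 0) \<notin> D n" and pos: "place 3 ?J y \<in> space (positions 3)"
      \<comment> \<open>Division by \<open>Suc k\<close> brings both points into the unit disc;
        integer factors leave only countably many exceptional null sets.\<close>
      define k where "k = nat \<lceil>max (norm (y 1)) (norm (y 2))\<rceil>"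
      let ?y = "\<lambda>j\<in>?J. (1 / real (Suc k)) *\<^sub>R y j + 0"
      have le: "norm (y j) \<le> real (Suc k)" if "j \<in> ?J" for j
      proof -
        have "j = 1 \<or> j = 2" using that by auto
        then have "norm (y j) \<le> max (norm (y 1)) (norm (y 2))" by auto
        then show ?thesis unfolding k_def by linarith
      qed
      have box: "?y \<in> Pi\<^sub>E ?J (\<lambda>_. cball 0 1)"
      proof (rule PiE_I)
        fix j assume j: "j \<in> ?J"
        then show "?y j \<in> cball 0 1" using le[OF j] by (simp add: divide_simps)
      next
        fix j assume "j \<notin> ?J"
        then show "?y j = undefined" unfolding restrict_def by (rule if_not_P)
      qed
      have c: "0 < 1 / real (Suc k)" by simp
      have sp: "?y \<in> space ?P" by (simp add: space_PiM)
      have "emeasure (\<mu> 3 (place 3 ?J ?y)) apart = 0"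
      proof (rule ennreal_eq_0I)
        fix n
        have "?y \<notin> D n" using y box by blast
        then show "\<not> ennreal (1 / real (Suc n)) \<le> emeasure (\<mu> 3 (place 3 ?J ?y)) apart"
          using sp place_scale(1)[OF pos c] unfolding D_def by blast
      qed
      then show "emeasure (\<mu> 3 (place 3 ?J y)) apart = 0" unfolding place_scale(2)[OF pos c] .
    qed
  next
    assume gj: generic_join
    show "\<forall>n. AE y in lborels ?J. y \<in> Pi\<^sub>E ?J (\<lambda>_. cball 0 1) \<longrightarrow> y \<notin> D n"
    proof
      fix n
      show "AE y in lborels ?J. y \<in> Pi\<^sub>E ?J (\<lambda>_. cball 0 1) \<longrightarrow> y \<notin> D n"
        using gj unfolding generic_join_def
      proof eventually_elim
        case (elim y)
        have "\<not> ennreal (1 / real (Suc n)) \<le> 0" by simp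
        then show ?case using elim unfolding D_def by auto
      qed
    qed
  qed
  finally show ?thesis .
qed

lemma unique_geodesic_iff: "(AE \<omega> in M. G (Z \<omega>) (R \<omega>) = 1) \<longleftrightarrow> generic_join"
  using AE_unique_geodesic generic_join_if_unique_geodesic by blast

end

theorem proposition24:
  fixes \<mu> :: fdds
    and M :: "'w measure"
    and U V :: "'w \<Rightarrow> complex"
    and Z :: "'w \<Rightarrow> nat \<Rightarrow> complex \<times> real"
    and R :: "'w \<Rightarrow> complex \<Rightarrow> complex \<Rightarrow> real \<Rightarrow> complex"
  assumes "sampled_routes \<mu> M U V Z R"
    and "SIRSN \<mu> M Z R"
  shows "((AE \<omega> in M. G (Z \<omega>) (R \<omega>) = 1) \<longleftrightarrow>
           (AE \<omega> in M. branchpoint {R \<omega> 0 (U \<omega>), R \<omega> 0 (V \<omega>)} \<noteq> 0)) \<and>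
         ((AE \<omega> in M. G (Z \<omega>) (R \<omega>) = 1) \<longleftrightarrow>
           (AE \<omega> in M. branchpoint (R \<omega> 0 ` \<Xi> (Z \<omega>) 1) \<noteq> 0)) \<and>
         ((AE \<omega> in M. G (Z \<omega>) (R \<omega>) = 1) \<longleftrightarrow>
           (\<forall>r>0. AE \<omega> in M. \<not> (\<Xi> (Z \<omega>) 1 \<inter> cball 0 r \<noteq> {} \<and>
                                 branchpoint (R \<omega> 0 ` (\<Xi> (Z \<omega>) 1 \<inter> cball 0 r)) = 0))) \<and>
         ((AE \<omega> in M. G (Z \<omega>) (R \<omega>) = 1) \<longleftrightarrow>
           (AE \<omega> in M. B_infty (Z \<omega>) (R \<omega>) \<noteq> 0)) \<and>
         ((AE \<omega> in M. G (Z \<omega>) (R \<omega>) = 1) \<longleftrightarrow>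
           (\<exists>q :: real \<Rightarrow> real.
              (\<forall>B\<ge>1. ((\<lambda>l. Q M Z R l B) \<longlongrightarrow> q B) at_top) \<and> (q \<longlongrightarrow> 0) at_top))"
proof -
  interpret sirsn_sample M Z \<mu> U V R
  proof (intro sirsn_sample.intro poisson_points.intro)
    show "prob_space M" using assms(1) unfolding sampled_routes_def by (elim conjE)
    show "poisson_points_axioms M Z"
      by (rule poisson_points_axioms.intro) (use assms(1) in \<open>unfold sampled_routes_def, elim conjE\<close>)
    show "sirsn_sample_axioms M Z \<mu> U V R" using assms by (rule sirsn_sample_axioms.intro)
  qed
  show ?thesis by (intro conjI) (simp_all only: unique_geodesic_iff a_iff b_iff c_iff d_iff e_iff)
qed

end
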